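(* Let $\Omega\subset\mathbb R^n$ be a bounded domain, $n\ge 2$, $\partial\Omega\in C^3$, and let $\gamma$ be the inward unit normal to $\partial\Omega$. Suppose $u\in C^2(\overline\Omega)\cap C^3(\Omega)$ is a solution of $$\operatorname{div}\Big(\frac{Du}{\sqrt{1+|Du|^2}}\Big)=f(x,u)\ \text{ in }\Omega,\qquad v^{q-1}\frac{\partial u}{\partial\gamma}+\psi(x)=0\ \text{ on }\partial\Omega,\qquad v=\sqrt{1+|Du|^2},$$ with $q>1$, where $f(x,z)$ and $\psi(x)$ are given functions defined in $\overline\Omega\times[-M_0,M_0]$ and $\overline\Omega$ respectively. Assume furthermore that there exist positive constants $M_0,L_1,L_2$ such that $$|u|\le M_0\quad\text{in }\overline\Omega,$$ $$f_z(x,z)\ge 0\quad\text{in }\overline\Omega\times[-M_0,M_0],$$ $$|f(x,z)|+|f_x(x,z)|\le L_1\quad\text{in }\overline\Omega\times[-M_0,M_0],$$ $$|\psi(x)|_{C^1(\overline\Omega)}\le L_2 .$$ Then there exists a small positive constant $\mu_0$ such that $$\sup_{\overline\Omega_{\mu_0}}|Du|\le\max\{M_1,M_2\},$$ where $M_1$ is a positive constant depending only on $n,\mu_0,M_0,L_1$, which comes from the interior gradient estimates, and $M_2$ is a positive constant depending only on $n,\Omega,\mu_0,M_0,L_1,L_2$.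
   Context: Notation: $d(x)=\operatorname{dist}(x,\partial\Omega)$ and $\Omega_{\mu_0}=\{x\in\Omega: d(x)<\mu_0\}$. $f_x$ denotes the gradient of $f$ in the $x$ variable and $f_z$ the partial derivative in $z$. The exponent $q>1$ is a fixed number in the boundary condition. The interior gradient estimate referred to is the standard one: if $u\in C^3(\Omega)$ is a bounded solution of $\operatorname{div}(Du/\sqrt{1+|Du|^2})=f(x,u)$ in $\Omega$ with $|u|\le M_0$, and $f\in C^1(\overline\Omega\times[-M_0,M_0])$ satisfies $f_z\ge0$ and $|f|+|f_x|\le L_1$, then for any subdomain $\Omega'\subset\subset\Omega$ one has $\sup_{\Omega'}|Du|\le M_1$ with $M_1$ a positive constant depending only on $n,M_0,\operatorname{dist}(\Omega',\partial\Omega),L_1$. The paper restates this theorem from Lieberman's book on oblique derivative problems and gives a new proof of it. *)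

theory Defs
  imports "HOL-Analysis.Analysis"
begin

section \<open>Classical derivatives and the spaces $C^k(S)$, $C^k(\overline S)$\<close>

primrec partial_derivs :: "'a::euclidean_space list \<Rightarrow> ('a \<Rightarrow> real) \<Rightarrow> 'a \<Rightarrow> real" where
  "partial_derivs [] u = u"
| "partial_derivs (b # bs) u = (\<lambda>x. frechet_derivative (partial_derivs bs u) (at x) b)"

text \<open>The set \<open>S\<close> is meant to be open in the following two definitions.\<close>

definition C_on :: "nat \<Rightarrow> 'a::euclidean_space set \<Rightarrow> ('a \<Rightarrow> real) \<Rightarrow> bool" where
  "C_on k S u \<longleftrightarrow>
     (\<forall>bs\<in>lists Basis.
        (length bs < k \<longrightarrow> partial_derivs bs u differentiable_on S) \<and>
        (length bs \<le> k \<longrightarrow> continuous_on S (partial_derivs bs u)))"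

text \<open>\<open>C_closure k S\<close> is $C^k(\overline S)$ in the sense of Gilbarg and Trudinger: all partial
  derivatives of order at most \<open>k\<close> exist in \<open>S\<close> and extend continuously to the closure.\<close>

definition C_closure :: "nat \<Rightarrow> 'a::euclidean_space set \<Rightarrow> ('a \<Rightarrow> real) \<Rightarrow> bool" where
  "C_closure k S u \<longleftrightarrow>
     C_on k S u \<and> continuous_on (closure S) u \<and>
     (\<forall>bs\<in>lists Basis. length bs \<le> k \<longrightarrow>
        (\<exists>g. continuous_on (closure S) g \<and> (\<forall>x\<in>S. g x = partial_derivs bs u x)))"

definition grad :: "('a::euclidean_space \<Rightarrow> real) \<Rightarrow> 'a \<Rightarrow> 'a" where
  "grad u x = (\<Sum>b\<in>Basis. frechet_derivative u (at x) b *\<^sub>R b)"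

text \<open>The continuous extension of the gradient from the open set \<open>S\<close> to its closure; it agrees
  with \<open>grad u\<close> on \<open>S\<close> when \<open>u\<close> is $C^1$ there. Values of \<open>u\<close> outside \<open>S\<close> are irrelevant.\<close>

definition grad_cl :: "'a::euclidean_space set \<Rightarrow> ('a \<Rightarrow> real) \<Rightarrow> 'a \<Rightarrow> 'a" where
  "grad_cl S u x = Lim (at x within S) (grad u)"

definition divergence :: "('a::euclidean_space \<Rightarrow> 'a) \<Rightarrow> 'a \<Rightarrow> real" where
  "divergence F x = (\<Sum>b\<in>Basis. frechet_derivative F (at x) b \<bullet> b)"

text \<open>The suprema are finite for \<open>\<psi>\<close> in $C^1(\overline S)$ with \<open>S\<close> bounded and nonempty.\<close>

definition C1_norm :: "'a::euclidean_space set \<Rightarrow> ('a \<Rightarrow> real) \<Rightarrow> real" where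
  "C1_norm S \<psi> =
     (SUP x\<in>closure S. \<bar>\<psi> x\<bar>) + (SUP x\<in>closure S. norm (grad_cl S \<psi> x))"

section \<open>Domains, their boundary and the inward normal\<close>

definition bounded_domain :: "'a::euclidean_space set \<Rightarrow> bool" where
  "bounded_domain \<Omega> \<longleftrightarrow> open \<Omega> \<and> connected \<Omega> \<and> \<Omega> \<noteq> {} \<and> bounded \<Omega>"

text \<open>Near each boundary point, \<open>\<Omega>\<close> is the region above the graph of a $C^k$ function in some
  orthonormal system of axes. The unit vector \<open>e\<close> is the vertical axis, and the graph function of
  $n-1$ variables is represented by a function on the whole space that is only evaluated on the
  hyperplane orthogonal to \<open>e\<close>.\<close>

definition C_boundary :: "nat \<Rightarrow> 'a::euclidean_space set \<Rightarrow> bool" where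
  "C_boundary k \<Omega> \<longleftrightarrow>
     (\<forall>x0\<in>frontier \<Omega>. \<exists>r>0. \<exists>e g. norm e = 1 \<and> C_on k UNIV g \<and>
        \<Omega> \<inter> ball x0 r = {x \<in> ball x0 r. x \<bullet> e > g (x - (x \<bullet> e) *\<^sub>R e)})"

text \<open>Velocities at \<open>x\<close> of curves lying in the hypersurface \<open>M\<close>.\<close>

definition tangent_vectors :: "'a::euclidean_space set \<Rightarrow> 'a \<Rightarrow> 'a set" where
  "tangent_vectors M x =
     {w. \<exists>c :: real \<Rightarrow> 'a. c 0 = x \<and> (\<forall>\<^sub>F t in nhds 0. c t \<in> M) \<and>
           (c has_vector_derivative w) (at 0)}"

definition inward_unit_normal :: "'a::euclidean_space set \<Rightarrow> ('a \<Rightarrow> 'a) \<Rightarrow> bool" where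
  "inward_unit_normal \<Omega> \<gamma> \<longleftrightarrow>
     (\<forall>x\<in>frontier \<Omega>. norm (\<gamma> x) = 1 \<and>
        (\<forall>w\<in>tangent_vectors (frontier \<Omega>) x. \<gamma> x \<bullet> w = 0) \<and>
        (\<forall>\<^sub>F t in at_right 0. x + t *\<^sub>R \<gamma> x \<in> \<Omega>))"

definition boundary_strip :: "'a::euclidean_space set \<Rightarrow> real \<Rightarrow> 'a set" where
  "boundary_strip \<Omega> \<mu> = {x \<in> \<Omega>. infdist x (frontier \<Omega>) < \<mu>}"

section \<open>The mean curvature equation\<close>

definition slope :: "'a::real_inner \<Rightarrow> real" where
  "slope p = sqrt (1 + (norm p)\<^sup>2)"

definition mean_curvature_eq ::
  "'a::euclidean_space set \<Rightarrow> ('a \<times> real \<Rightarrow> real) \<Rightarrow> ('a \<Rightarrow> real) \<Rightarrow> bool" where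
  "mean_curvature_eq \<Omega> f u \<longleftrightarrow>
     (\<forall>x\<in>\<Omega>. divergence (\<lambda>y. grad u y /\<^sub>R slope (grad u y)) x = f (x, u x))"

definition oblique_bc ::
  "real \<Rightarrow> 'a::euclidean_space set \<Rightarrow> ('a \<Rightarrow> 'a) \<Rightarrow> ('a \<Rightarrow> real) \<Rightarrow> ('a \<Rightarrow> real) \<Rightarrow> bool" where
  "oblique_bc q \<Omega> \<gamma> \<psi> u \<longleftrightarrow>
     (\<forall>x\<in>frontier \<Omega>.
        slope (grad_cl \<Omega> u x) powr (q - 1) * (grad_cl \<Omega> u x \<bullet> \<gamma> x) + \<psi> x = 0)"

text \<open>The conditions on \<open>f\<close>. The gradient of \<open>f\<close> in all variables is the pair of $f_x$
  and $f_z$, so these are its two projections.\<close>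

definition rhs_conditions ::
  "'a::euclidean_space set \<Rightarrow> real \<Rightarrow> real \<Rightarrow> ('a \<times> real \<Rightarrow> real) \<Rightarrow> bool" where
  "rhs_conditions \<Omega> M0 L1 f \<longleftrightarrow>
     C_closure 1 (\<Omega> \<times> {-M0<..<M0}) f \<and>
     (\<forall>x\<in>closure \<Omega>. \<forall>z\<in>{-M0..M0}.
        snd (grad_cl (\<Omega> \<times> {-M0<..<M0}) f (x, z)) \<ge> 0 \<and>
        \<bar>f (x, z)\<bar> + norm (fst (grad_cl (\<Omega> \<times> {-M0<..<M0}) f (x, z))) \<le> L1)"

text \<open>\<open>M1 \<delta> M0 L1\<close> is a constant for which the interior gradient estimate in dimension
  \<open>CARD('n)\<close> holds, \<open>\<delta>\<close> being the distance of the subdomain to the boundary. Since \<open>\<Omega>\<close> is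
  bounded, the subdomain is compactly contained iff its closure lies in \<open>\<Omega>\<close>.\<close>

definition interior_gradient_bound ::
  "'n::finite itself \<Rightarrow> (real \<Rightarrow> real \<Rightarrow> real \<Rightarrow> real) \<Rightarrow> bool" where
  "interior_gradient_bound _ M1 \<longleftrightarrow>
     (\<forall>\<delta>>0. \<forall>M0>0. \<forall>L1>0. M1 \<delta> M0 L1 > 0) \<and>
     (\<forall>(\<Omega> :: (real ^ 'n) set) \<Omega>' f u. \<forall>M0>0. \<forall>L1>0.
        bounded_domain \<Omega> \<and> C_on 3 \<Omega> u \<and> (\<forall>x\<in>\<Omega>. \<bar>u x\<bar> \<le> M0) \<and>
        rhs_conditions \<Omega> M0 L1 f \<and> mean_curvature_eq \<Omega> f u \<and>
        bounded_domain \<Omega>' \<and> closure \<Omega>' \<subseteq> \<Omega>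
        \<longrightarrow> (\<forall>x\<in>\<Omega>'. norm (grad u x) \<le> M1 (setdist \<Omega>' (frontier \<Omega>)) M0 L1))"

end

theory Submission
  imports Defs
begin

text \<open>The gradient is bounded by a maximum principle for functions of several points, which avoids
  third derivatives of \<open>u\<close> and second derivatives at the boundary. Let \<open>\<phi>\<close> be a concave profile of
  large slope, let \<open>T\<close> be the distance to the set of centres of the balls of radius \<open>\<rho>\<close> in \<open>\<Omega>\<close>, so
  that \<open>T = \<rho>\<close> on the boundary, and let \<open>b\<close> be a Lipschitz field that on the boundary is
  the multiple of \<open>\<gamma>\<close> which solves the boundary condition for a gradient with a large tangential
  part. Then
    \<open>W x y z = u x - u y - \<phi> (norm (x - y)) * (1 + \<kappa> * (T x)\<^sup>2 + \<kappa> * (T y)\<^sup>2)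
      - b z \<bullet> (x - y) - Lb * (norm (x - z))\<^sup>2\<close>
  is nowhere positive when \<open>x\<close> and \<open>y\<close> are close, and \<open>z = x\<close>, \<open>y \<rightarrow> x\<close> gives a global gradient bound.

  At a positive maximum one may replace \<open>T\<close> by the distance to a fixed nearest centre, which is
  smooth and touches \<open>T\<close> from above. If \<open>x\<close> or \<open>y\<close> lies on the boundary, the term with \<open>T\<close>
  pushes the gradient against the normal strictly more than the boundary condition permits. If both
  are interior points, the second-order conditions, tested along square roots of the two coefficient
  matrices (reflected in the direction of \<open>x - y\<close>), compare \<open>\<phi>''\<close>, which is very negative, with the
  difference of the two right-hand sides, where \<open>f_z \<ge> 0\<close> and \<open>u y \<le> u x\<close> give the good sign.

  The interior estimate follows in the same way from \<open>u x - u y - \<phi> (norm (x - y)) - N * (norm (x - x0))\<^sup>2\<close>,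
  first with a power as the profile, which yields a Hoelder bound, and then with a profile of finite slope.\<close>

section \<open>Derivatives\<close>

text \<open>The main obstacle is the power of v in the boundary condition, which ties the normal
  derivative to the size of the whole gradient. So b is solved for the tangential size
  \<open>3 * P\<close>, \<open>P\<close> being the slope of the profile at 0. However large
  \<open>P\<close> is, the solution map is 1-Lipschitz, so the Lipschitz constant of b is free of
  \<open>P\<close> and the choice of constants is not circular. As b is merely Lipschitz, it is
  frozen at a third point z, which the penalty keeps within norm (x - y) of x. The number 3 comes
  from \<open>\<kappa> * \<rho>\<^sup>2 = 1\<close>, where the factor with \<open>T\<close> is about
  1 + 2. If this product were \<beta>, the factor would move the normal derivative by 2 \<beta>
  \<phi> / \<rho>, while the curvature of the boundary lets the axis x - y work against this by up
  to (1 + 2 \<beta>) \<phi> / (2 \<rho>); so \<beta> has to exceed 1/2. Along the axis the equation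
  divides \<phi>'' by the square of the slope. A profile with \<phi>'' = - C \<phi>'^2 therefore
  gains a multiple of C at every distance, whatever its steepness.\<close>

lemma slope_ge_1: "slope p \<ge> 1"
  unfolding slope_def by simp

lemma slope_minus [simp]: "slope (- p) = slope p"
  by (simp add: slope_def)

lemma slope_pos [simp]: "slope p > 0"
  using slope_ge_1[of p] by linarith

lemma slope_nonzero [simp]: "slope p \<noteq> 0"
  using slope_pos[of p] by linarith

lemma slope_sq: "(slope p)\<^sup>2 = 1 + (norm p)\<^sup>2"
  unfolding slope_def by simp

lemma norm_le_slope: "norm p \<le> slope p"
  unfolding slope_def by (rule real_le_rsqrt) simp

lemma slope_le: "slope p \<le> 1 + norm p"
proof (rule power2_le_imp_le)
  show "(slope p)\<^sup>2 \<le> (1 + norm p)\<^sup>2" unfolding slope_sq power2_sum by simp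
qed simp
text \<open>Read as a norm, the slope gets its Lipschitz bound from the triangle inequality.\<close>

lemma slope_eq_norm_Pair: "slope p = norm (1::real, p)"
  unfolding slope_def norm_Pair by simp

lemma slope_diff: "\<bar>slope p - slope q\<bar> \<le> norm (p - q)"
proof -
  have "\<bar>slope p - slope q\<bar> \<le> norm ((1::real, p) - (1, q))"
    unfolding slope_eq_norm_Pair by (rule norm_triangle_ineq3)
  also have "\<dots> = norm (p - q)" unfolding diff_Pair norm_Pair by simp
  finally show ?thesis .
qed
lemma has_derivative_grad:
  fixes u :: "'a::euclidean_space \<Rightarrow> real"
  assumes "u differentiable at x"
  shows "(u has_derivative (\<lambda>h. grad u x \<bullet> h)) (at x)"
proof -
  define D where "D = frechet_derivative u (at x)"
  have D: "(u has_derivative D) (at x)"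
    using assms frechet_derivative_works D_def by blast
  interpret D: bounded_linear D using D by (rule has_derivative_bounded_linear)
  have "D h = grad u x \<bullet> h" for h
  proof -
    have "D h = D (\<Sum>b\<in>Basis. (h \<bullet> b) *\<^sub>R b)" by (simp add: euclidean_representation)
    also have "\<dots> = (\<Sum>b\<in>Basis. (h \<bullet> b) * D b)" by (simp add: D.sum D.scale)
    also have "\<dots> = grad u x \<bullet> h"
      unfolding grad_def D_def[symmetric] inner_sum_left inner_scaleR_left
      by (intro sum.cong refl) (simp add: inner_commute)
    finally show ?thesis .
  qed
  then have "D = (\<lambda>h. grad u x \<bullet> h)" by auto
  then show ?thesis using D by simp
qed

lemma C_on_differentiable:
  fixes u :: "'a::euclidean_space \<Rightarrow> real"
  assumes "C_on k S u" "open S" "x \<in> S" "1 \<le> k"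
  shows "u differentiable at x"
proof -
  have "u differentiable_on S"
  proof -
    have "[] \<in> lists (Basis::'a set)" "length ([]::'a list) < k" using assms(4) by auto
    then have "partial_derivs [] u differentiable_on S" using assms(1) unfolding C_on_def by blast
    then show ?thesis by simp
  qed
  then show ?thesis using assms differentiable_on_eq_differentiable_at by blast
qed

lemma C_on_has_derivative:
  assumes "C_on k S u" "open S" "x \<in> S" "1 \<le> k"
  shows "(u has_derivative (\<lambda>h. grad u x \<bullet> h)) (at x)"
  by (rule has_derivative_grad[OF C_on_differentiable[OF assms]])

lemma C_on_mono: "C_on k S u \<Longrightarrow> l \<le> k \<Longrightarrow> C_on l S u"
  unfolding C_on_def by auto

lemma grad_partial: "grad u x = (\<Sum>b\<in>Basis. partial_derivs [b] u x *\<^sub>R b)"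
  by (simp add: grad_def)

lemma C_on_grad_continuous:
  assumes "C_on k S u" "1 \<le> k"
  shows "continuous_on S (grad u)"
proof -
  have "continuous_on S (partial_derivs [b] u)" if "b \<in> Basis" for b
  proof -
    have "[b] \<in> lists Basis" "length [b] \<le> k" using that assms(2) by auto
    then show ?thesis using assms(1) unfolding C_on_def by blast
  qed
  then show ?thesis
    unfolding grad_partial[abs_def] by (intro continuous_intros)
qed

lemma C_on_grad_differentiable:
  assumes "C_on k S u" "open S" "x \<in> S" "2 \<le> k"
  shows "grad u differentiable at x"
proof -
  have "partial_derivs [b] u differentiable at x" if "b \<in> Basis" for b
  proof -
    have "partial_derivs [b] u differentiable_on S"
    proof -
      have "[b] \<in> lists Basis" "length [b] < k" using that assms(4) by auto
      then show ?thesis using assms(1) unfolding C_on_def by blast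
    qed
    then show ?thesis using assms differentiable_on_eq_differentiable_at by blast
  qed
  then show ?thesis
    unfolding grad_partial[abs_def]
    by (intro differentiable_sum differentiable_scaleR) auto
qed

text \<open>A second derivative is asked for at 0 only, which is what \<open>two_point_max\<close>
  can supply. If it were positive, F' would be positive just to the right of 0, and the mean value
  theorem would lift F above F 0.\<close>

lemma second_derivative_test:
  fixes F :: "real \<Rightarrow> real"
  assumes der: "\<forall>\<^sub>F t in nhds 0. (F has_real_derivative F' t) (at t)"
    and der2: "(F' has_real_derivative c) (at 0)"
    and max: "\<forall>\<^sub>F t in nhds 0. F t \<le> F 0"
  shows "F' 0 = 0" "c \<le> 0"
proof -
  from eventually_conj[OF der max] obtain d where d: "d > 0"
    and dd: "\<And>t. \<bar>t\<bar> < d \<Longrightarrow> (F has_real_derivative F' t) (at t) \<and> F t \<le> F 0"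
    unfolding eventually_nhds_metric by (auto simp: dist_real_def)
  show F0: "F' 0 = 0"
    using DERIV_local_max[of F "F' 0" 0 d] dd d by auto
  show "c \<le> 0"
  proof (rule ccontr)
    assume "\<not> c \<le> 0"
    then obtain d' where d': "d' > 0" "\<And>h. h > 0 \<Longrightarrow> h < d' \<Longrightarrow> F' 0 < F' h"
      using DERIV_pos_inc_right[OF der2] by auto
    define t where "t = min d d' / 2"
    have t: "0 < t" "t < d" "t < d'" using d d' by (auto simp: t_def min_def)
    have "\<exists>z>0. z < t \<and> F t - F 0 = (t - 0) * F' z"
      by (rule MVT2) (use t dd in auto)
    then obtain z where z: "z > 0" "z < t" "F t - F 0 = t * F' z" by auto
    have "F' z > 0" using d'(2)[of z] z t F0 by auto
    then have "F t > F 0" using z t by (smt (verit) mult_pos_pos)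
    then show False using dd[of t] t by auto
  qed
qed

section \<open>The coupling\<close>

definition tang :: "'a::real_inner \<Rightarrow> 'a \<Rightarrow> 'a" where
  "tang e p = p - (p \<bullet> e) *\<^sub>R e"

text \<open>Its inverse square is the weight of the direction e in the equation at a gradient
  parallel to the unit vector e.\<close>

definition axial_slope :: "'a::real_inner \<Rightarrow> 'a \<Rightarrow> real" where
  "axial_slope e p = sqrt (1 + (p \<bullet> e)\<^sup>2)"

text \<open>With P = \<open>tang e p\<close>, r its squared norm and v = \<open>slope p\<close>,
  this is the root k of r k^2 - 2 k = - 1 / v^2 that stays bounded as r tends to 0; then 1 - k P P^T
  is a square root of 1 - P P^T / v^2.\<close>

definition tcoef :: "'a::real_inner \<Rightarrow> 'a \<Rightarrow> real" where
  "tcoef e p = 1 / (slope p * (slope p + axial_slope e p))"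

text \<open>The vectors \<open>e / axial_slope e p\<close> and \<open>coupling e p b\<close>, for \<open>b\<close> in the basis, form a square
  root of the coefficient matrix of the equation at the gradient \<open>p\<close>. It differs from
  the projection orthogonal to \<open>e\<close> only by terms containing the tangential part of \<open>p\<close>, which is
  small compared with the slope at the maxima below.\<close>

definition coupling :: "'a::real_inner \<Rightarrow> 'a \<Rightarrow> 'a \<Rightarrow> 'a" where
  "coupling e p b = tang e b
     - (tang e p \<bullet> b) *\<^sub>R (tcoef e p *\<^sub>R tang e p + ((p \<bullet> e) / (slope p * axial_slope e p)) *\<^sub>R e)"

lemma axial_slope_ge_1: "axial_slope e p \<ge> 1"
  by (simp add: axial_slope_def)

lemma axial_slope_pos [simp]: "axial_slope e p > 0"
  using axial_slope_ge_1[of e p] by linarith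

lemma axial_slope_nonzero [simp]: "axial_slope e p \<noteq> 0"
  using axial_slope_pos[of e p] by linarith

lemma axial_slope_sq: "(axial_slope e p)\<^sup>2 = 1 + (p \<bullet> e)\<^sup>2"
  by (simp add: axial_slope_def)

lemma norm_tang_sq:
  assumes "norm e = 1"
  shows "(norm (tang e p))\<^sup>2 = (norm p)\<^sup>2 - (p \<bullet> e)\<^sup>2"
proof -
  have "e \<bullet> e = 1" using assms by (simp add: dot_square_norm)
  then show ?thesis
    unfolding tang_def power2_norm_eq_inner inner_diff_left inner_diff_right
    by (simp add: inner_commute power2_eq_square)
qed

lemma slope_axial_slope:
  assumes "norm e = 1"
  shows "(slope p)\<^sup>2 = (axial_slope e p)\<^sup>2 + (norm (tang e p))\<^sup>2"
  using norm_tang_sq[OF assms, of p] by (simp add: slope_sq axial_slope_sq)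

text \<open>Coefficient matching for \<open>coupling_identity\<close>: with p = P + c e, these are
  the coefficients of \<open>H P \<bullet> P\<close>, of the mixed terms and of
  \<open>H e \<bullet> e\<close> on its two sides.\<close>

lemma coupling_coefficients:
  fixes v S r k m c :: real
  assumes "v > 0" "S > 0" "v\<^sup>2 = S\<^sup>2 + r" "S\<^sup>2 = 1 + c\<^sup>2" "k = 1 / (v * (v + S))" "m = c / (v * S)"
  shows "r * k\<^sup>2 - 2 * k = - 1 / v\<^sup>2" "r * k * m - m = - c / v\<^sup>2" "r * m\<^sup>2 - 1 + 1 / S\<^sup>2 = - c\<^sup>2 / v\<^sup>2"
proof -
  have r: "r = (v - S) * (v + S)" using assms(3) by (simp add: algebra_simps power2_eq_square)
  have rk: "r * k = 1 - S / v"
  proof -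
    have "v + S \<noteq> 0" using assms(1,2) by linarith
    then have "r * k = (v - S) / v" unfolding assms(5) r by simp
    then show ?thesis using assms(1) by (simp add: diff_divide_distrib)
  qed
  show "r * k\<^sup>2 - 2 * k = - 1 / v\<^sup>2"
  proof -
    have "r * k\<^sup>2 - 2 * k = (r * k - 2) * k" by (simp add: power2_eq_square algebra_simps)
    also have "\<dots> = - ((v + S) / v) * k" unfolding rk using assms(1) by (simp add: field_simps)
    also have "\<dots> = - 1 / v\<^sup>2"
    proof -
      have "v + S \<noteq> 0" using assms(1,2) by linarith
      then show ?thesis unfolding assms(5) by (simp add: power2_eq_square)
    qed
    finally show ?thesis .
  qed
  have "r * k * m - m = - (S / v) * m" unfolding rk by (simp add: algebra_simps)
  then show "r * k * m - m = - c / v\<^sup>2" unfolding assms(6) using assms(1,2) by (simp add: power2_eq_square)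
  have c: "c\<^sup>2 = S\<^sup>2 - 1" and rr: "r = v\<^sup>2 - S\<^sup>2" using assms(3,4) by auto
  show "r * m\<^sup>2 - 1 + 1 / S\<^sup>2 = - c\<^sup>2 / v\<^sup>2"
    unfolding assms(6) power_divide power_mult_distrib c rr using assms(1,2)
    by (simp add: field_simps power2_eq_square)
qed

text \<open>Both sides are the trace of H against the coefficient matrix 1 - p p^T / v^2, of which
  the coupling is a square root. An arbitrary linear H covers the Hessians as well as the identity,
  which gives the bound on norms in \<open>coupling_norm_sum\<close>.\<close>

lemma coupling_identity:
  fixes H :: "'a::euclidean_space \<Rightarrow> 'a"
  assumes lin: "linear H" and e: "norm e = 1"
  shows "H e \<bullet> e / (axial_slope e p)\<^sup>2 + (\<Sum>b\<in>Basis. H (coupling e p b) \<bullet> coupling e p b)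
       = (\<Sum>b\<in>Basis. H b \<bullet> b) - H p \<bullet> p / (slope p)\<^sup>2"
proof -
  interpret H: linear H by (rule lin)
  define P c v S r k m where "P = tang e p" and "c = p \<bullet> e" and "v = slope p" and "S = axial_slope e p"
    and "r = (norm P)\<^sup>2" and "k = tcoef e p" and "m = c / (v * S)"
  define g where "g = k *\<^sub>R P + m *\<^sub>R e"
  have ee: "e \<bullet> e = 1" using e by (simp add: dot_square_norm)
  have Pe: "P \<bullet> e = 0" by (simp add: P_def tang_def inner_diff_left ee)
  have p: "p = P + c *\<^sub>R e" by (simp add: P_def tang_def c_def)
  have rep: "(\<Sum>b\<in>Basis. (x \<bullet> b) * (H b \<bullet> y)) = H x \<bullet> y" for x y
  proof -
    have "H x = H (\<Sum>b\<in>Basis. (x \<bullet> b) *\<^sub>R b)" by (simp add: euclidean_representation)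
    then have "H x = (\<Sum>b\<in>Basis. (x \<bullet> b) *\<^sub>R H b)" by (simp only: H.sum H.scale)
    then show ?thesis by (simp add: inner_sum_left)
  qed
  have rep2: "(\<Sum>b\<in>Basis. (x \<bullet> b) * (y \<bullet> b)) = x \<bullet> y" for x y :: 'a
    by (rule euclidean_inner[symmetric])
  \<comment> \<open>With everything multiplied by \<open>P \<bullet> b\<close> collected in g, the
    quadratic form splits into nine products, each of which sums to an inner product by
    \<open>rep\<close> and \<open>rep2\<close>.\<close>
  have cpl: "coupling e p b = b - (e \<bullet> b) *\<^sub>R e - (P \<bullet> b) *\<^sub>R g" for b
    by (simp add: coupling_def P_def g_def k_def m_def c_def v_def S_def tang_def inner_commute)
  have "H (coupling e p b) \<bullet> coupling e p b =
      H b \<bullet> b - (e \<bullet> b) * (H b \<bullet> e) - (P \<bullet> b) * (H b \<bullet> g) - (e \<bullet> b) * (H e \<bullet> b)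
      + (H e \<bullet> e) * ((e \<bullet> b) * (e \<bullet> b)) + (H e \<bullet> g) * ((e \<bullet> b) * (P \<bullet> b))
      - (P \<bullet> b) * (H g \<bullet> b) + (H g \<bullet> e) * ((e \<bullet> b) * (P \<bullet> b))
      + (H g \<bullet> g) * ((P \<bullet> b) * (P \<bullet> b))" for b
    unfolding cpl H.diff H.scale
    by (simp add: inner_diff_left inner_diff_right algebra_simps)
  then have "(\<Sum>b\<in>Basis. H (coupling e p b) \<bullet> coupling e p b) =
      (\<Sum>b\<in>Basis. H b \<bullet> b) - H e \<bullet> e - H P \<bullet> g - e \<bullet> H e + (H e \<bullet> e) * (e \<bullet> e)
      + (H e \<bullet> g) * (e \<bullet> P) - P \<bullet> H g + (H g \<bullet> e) * (e \<bullet> P) + (H g \<bullet> g) * (P \<bullet> P)"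
    by (simp only: sum.distrib sum_subtractf sum_distrib_left[symmetric] rep rep2)
  also have "\<dots> = (\<Sum>b\<in>Basis. H b \<bullet> b) - H e \<bullet> e - H P \<bullet> g - H g \<bullet> P + r * (H g \<bullet> g)"
    using ee Pe by (simp add: inner_commute r_def power2_norm_eq_inner)
  also have "\<dots> = (\<Sum>b\<in>Basis. H b \<bullet> b) + (r * k\<^sup>2 - 2 * k) * (H P \<bullet> P)
      + (r * k * m - m) * (H P \<bullet> e + H e \<bullet> P) + (r * m\<^sup>2 - 1) * (H e \<bullet> e)"
    unfolding g_def H.add H.scale
    by (simp add: inner_add_left inner_add_right algebra_simps power2_eq_square)
  finally have sum: "H e \<bullet> e / S\<^sup>2 + (\<Sum>b\<in>Basis. H (coupling e p b) \<bullet> coupling e p b) =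
      (\<Sum>b\<in>Basis. H b \<bullet> b) + (r * k\<^sup>2 - 2 * k) * (H P \<bullet> P)
      + (r * k * m - m) * (H P \<bullet> e + H e \<bullet> P) + (r * m\<^sup>2 - 1 + 1 / S\<^sup>2) * (H e \<bullet> e)"
    by (simp add: algebra_simps)
  have "v > 0" "S > 0" "v\<^sup>2 = S\<^sup>2 + r" "S\<^sup>2 = 1 + c\<^sup>2" "k = 1 / (v * (v + S))"
    using slope_axial_slope[OF e, of p]
    by (auto simp: v_def S_def r_def P_def c_def k_def tcoef_def axial_slope_sq)
  note co = coupling_coefficients[OF this m_def]
  have "H p \<bullet> p = H P \<bullet> P + c * (H P \<bullet> e + H e \<bullet> P) + c\<^sup>2 * (H e \<bullet> e)"
    unfolding p H.add H.scale
    by (simp add: inner_add_left inner_add_right algebra_simps power2_eq_square)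
  then have "H p \<bullet> p / v\<^sup>2 = (H P \<bullet> P + c * (H P \<bullet> e + H e \<bullet> P) + c\<^sup>2 * (H e \<bullet> e)) / v\<^sup>2"
    by (rule arg_cong)
  also have "\<dots> = - ((- 1 / v\<^sup>2) * (H P \<bullet> P) + (- c / v\<^sup>2) * (H P \<bullet> e + H e \<bullet> P)
      + (- c\<^sup>2 / v\<^sup>2) * (H e \<bullet> e))"
    by (simp add: add_divide_distrib)
  finally have "(\<Sum>b\<in>Basis. H b \<bullet> b) - H p \<bullet> p / v\<^sup>2 =
     (\<Sum>b\<in>Basis. H b \<bullet> b) + (- 1 / v\<^sup>2) * (H P \<bullet> P)
      + (- c / v\<^sup>2) * (H P \<bullet> e + H e \<bullet> P) + (- c\<^sup>2 / v\<^sup>2) * (H e \<bullet> e)"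
    by linarith
  then show ?thesis using sum[unfolded co] unfolding v_def S_def by (rule trans[OF _ sym, rotated])
qed

text \<open>The case of the identity map: the trace of the coefficient matrix is at most the
  dimension.\<close>

lemma coupling_norm_sum:
  fixes e p :: "'a::euclidean_space"
  assumes "norm e = 1"
  shows "1 / (axial_slope e p)\<^sup>2 + (\<Sum>b\<in>Basis. (norm (coupling e p b))\<^sup>2) \<le> DIM('a)"
proof -
  have "e \<bullet> e = 1" using assms by (simp add: dot_square_norm)
  then have "1 / (axial_slope e p)\<^sup>2 + (\<Sum>b\<in>Basis. (norm (coupling e p b))\<^sup>2)
      = (\<Sum>b\<in>Basis. (b::'a) \<bullet> b) - (p \<bullet> p) / (slope p)\<^sup>2"
    using coupling_identity[OF linear_ident assms, of p]
    unfolding power2_norm_eq_inner by simp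
  also have "\<dots> \<le> (\<Sum>b\<in>Basis. (b::'a) \<bullet> b)" by simp
  also have "\<dots> = DIM('a)" by (simp add: inner_same_Basis)
  finally show ?thesis .
qed

text \<open>Multiplied by the slope, the equation has a coefficient matrix bounded by the identity.
  The price is the factor on the right, which is why differences of f times slope have to be
  estimated later.\<close>

lemma mean_curvature_eq_expanded:
  fixes u :: "'a::euclidean_space \<Rightarrow> real"
  assumes H: "(grad u has_derivative H) (at x)" and mc: "mean_curvature_eq \<Omega> f u" and x: "x \<in> \<Omega>"
  shows "(\<Sum>b\<in>Basis. H b \<bullet> b) - H (grad u x) \<bullet> grad u x / (slope (grad u x))\<^sup>2
    = f (x, u x) * slope (grad u x)"
proof -
  define p v where "p = grad u x" and "v = slope (grad u x)"
  interpret H: linear H using H has_derivative_linear by blast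
  have v: "v > 0" by (simp add: v_def)
  have vsq: "1 + p \<bullet> p = v\<^sup>2" unfolding v_def p_def slope_sq by (simp add: power2_norm_eq_inner)
  have sl: "((\<lambda>y. slope (grad u y)) has_derivative (\<lambda>h. (p \<bullet> H h) / v)) (at x)"
    unfolding slope_def power2_norm_eq_inner
    using v
    by (auto intro!: derivative_eq_intros H simp: p_def[symmetric] vsq inner_commute fun_eq_iff add_pos_nonneg)
       (simp add: field_simps)
  have "((\<lambda>y. grad u y /\<^sub>R slope (grad u y)) has_derivative
        (\<lambda>h. inverse v *\<^sub>R H h + (- (inverse v * (p \<bullet> H h / v) * inverse v)) *\<^sub>R p)) (at x)"
    using has_derivative_scaleR[OF Deriv.has_derivative_inverse[OF _ sl] H]
    by (simp add: p_def v_def)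
  then have "frechet_derivative (\<lambda>y. grad u y /\<^sub>R slope (grad u y)) (at x)
      = (\<lambda>h. inverse v *\<^sub>R H h + (- (inverse v * (p \<bullet> H h / v) * inverse v)) *\<^sub>R p)"
    by (rule frechet_derivative_at[symmetric])
  then have "divergence (\<lambda>y. grad u y /\<^sub>R slope (grad u y)) x
      = (\<Sum>b\<in>Basis. (H b \<bullet> b) / v - ((p \<bullet> b) * (H b \<bullet> p)) / v ^ 3)"
    unfolding divergence_def
    by (intro sum.cong refl, simp only: inner_add_left inner_scaleR_left)
      (simp add: inner_commute divide_simps power3_eq_cube)
  also have "\<dots> = (\<Sum>b\<in>Basis. H b \<bullet> b) / v - (\<Sum>b\<in>Basis. (p \<bullet> b) * (H b \<bullet> p)) / v ^ 3"
    by (simp add: sum_subtractf sum_divide_distrib)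
  also have "(\<Sum>b\<in>Basis. (p \<bullet> b) * (H b \<bullet> p)) = H p \<bullet> p"
  proof -
    have "H p = H (\<Sum>b\<in>Basis. (p \<bullet> b) *\<^sub>R b)" by (simp add: euclidean_representation)
    then have "H p = (\<Sum>b\<in>Basis. (p \<bullet> b) *\<^sub>R H b)" by (simp only: H.sum H.scale)
    then show ?thesis by (metis (no_types, lifting) inner_scaleR_left inner_sum_left sum.cong)
  qed
  finally have "(\<Sum>b\<in>Basis. H b \<bullet> b) / v - H p \<bullet> p / v ^ 3 = f (x, u x)"
    using mc x unfolding mean_curvature_eq_def by simp
  then have "((\<Sum>b\<in>Basis. H b \<bullet> b) / v - H p \<bullet> p / v ^ 3) * v = f (x, u x) * v" by simp
  moreover have "((\<Sum>b\<in>Basis. H b \<bullet> b) / v - H p \<bullet> p / v ^ 3) * v = (\<Sum>b\<in>Basis. H b \<bullet> b) - H p \<bullet> p / v\<^sup>2"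
    using v by (simp add: field_simps power3_eq_cube power2_eq_square)
  ultimately show ?thesis by (simp add: p_def v_def)
qed

section \<open>The two-point function\<close>

lemma eventually_line_in_open:
  fixes x \<xi> :: "'a::real_normed_vector"
  assumes "open S" "x \<in> S"
  shows "\<forall>\<^sub>F t in nhds 0. x + t *\<^sub>R \<xi> \<in> S"
proof -
  have "((\<lambda>t. x + t *\<^sub>R \<xi>) \<longlongrightarrow> x + 0 *\<^sub>R \<xi>) (nhds 0)"
    by (intro tendsto_intros filterlim_ident)
  then show ?thesis using topological_tendstoD[of _ x _ S] assms by simp
qed

lemma line_has_derivative:
  fixes u :: "'a::euclidean_space \<Rightarrow> real"
  assumes "(u has_derivative (\<lambda>h. p \<bullet> h)) (at (x + t *\<^sub>R \<xi>))"
  shows "((\<lambda>t. u (x + t *\<^sub>R \<xi>)) has_real_derivative p \<bullet> \<xi>) (at t)"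
proof -
  have "((\<lambda>t. x + t *\<^sub>R \<xi>) has_derivative (\<lambda>t. t *\<^sub>R \<xi>)) (at t)"
    by (auto intro!: derivative_eq_intros)
  from has_derivative_compose[OF this assms]
  show ?thesis by (simp add: has_field_derivative_def mult.commute[of _ "p \<bullet> \<xi>"] fun_eq_iff)
qed

lemma line_has_second_derivative:
  fixes u :: "'a::euclidean_space \<Rightarrow> real"
  assumes "(grad u has_derivative H) (at x)"
  shows "((\<lambda>t. grad u (x + t *\<^sub>R \<xi>) \<bullet> \<xi>) has_real_derivative H \<xi> \<bullet> \<xi>) (at 0)"
proof -
  interpret H: linear H using assms has_derivative_linear by blast
  have "((\<lambda>t. x + t *\<^sub>R \<xi>) has_derivative (\<lambda>t. t *\<^sub>R \<xi>)) (at (0::real))"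
    by (auto intro!: derivative_eq_intros)
  moreover have "(grad u has_derivative H) (at (x + 0 *\<^sub>R \<xi>))" using assms by simp
  ultimately have "((\<lambda>t. grad u (x + t *\<^sub>R \<xi>)) has_derivative (\<lambda>t. H (t *\<^sub>R \<xi>))) (at (0::real))"
    by (rule has_derivative_compose)
  then have "((\<lambda>t. grad u (x + t *\<^sub>R \<xi>) \<bullet> \<xi>) has_derivative (\<lambda>t. H (t *\<^sub>R \<xi>) \<bullet> \<xi>)) (at 0)"
    by (intro has_derivative_inner_left)
  then show ?thesis
    by (simp add: has_field_derivative_def H.scale mult.commute[of _ "H \<xi> \<bullet> \<xi>"] fun_eq_iff)
qed

lemma norm_line_has_derivative:
  fixes d \<zeta> :: "'a::real_inner"
  assumes "d + t *\<^sub>R \<zeta> \<noteq> 0"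
  shows "((\<lambda>t. norm (d + t *\<^sub>R \<zeta>)) has_real_derivative ((d + t *\<^sub>R \<zeta>) \<bullet> \<zeta>) / norm (d + t *\<^sub>R \<zeta>)) (at t)"
proof -
  have "((\<lambda>t. d + t *\<^sub>R \<zeta>) has_derivative (\<lambda>t. t *\<^sub>R \<zeta>)) (at t)"
    by (auto intro!: derivative_eq_intros)
  from has_derivative_compose[OF this has_derivative_norm[OF assms]]
  show ?thesis
    unfolding has_field_derivative_def
    by (rule has_derivative_eq_rhs) (simp add: sgn_div_norm fun_eq_iff inner_commute divide_inverse ac_simps)
qed

lemma dist_sq_line_has_derivative:
  fixes x c \<xi> :: "'a::real_inner"
  shows "((\<lambda>t. (norm (x + t *\<^sub>R \<xi> - c))\<^sup>2) has_real_derivative 2 * ((x + t *\<^sub>R \<xi> - c) \<bullet> \<xi>)) (at t)"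
  unfolding power2_norm_eq_inner has_field_derivative_def
  by (auto intro!: derivative_eq_intros simp: fun_eq_iff inner_commute algebra_simps)

text \<open>The part subtracted from \<open>u x - u y\<close>, built from smooth ingredients: the
  centres \<open>c1\<close>, \<open>c2\<close>, the vector \<open>b\<close> and the point
  \<open>z\<close> are frozen parameters. The interior estimate is the case
  \<open>\<kappa> = 0\<close>, \<open>b = 0\<close>, with \<open>z\<close> the centre of
  localization.\<close>

definition two_point_fun ::
  "(real \<Rightarrow> real) \<Rightarrow> real \<Rightarrow> real \<Rightarrow> 'a \<Rightarrow> 'a \<Rightarrow> 'a \<Rightarrow> real \<Rightarrow> 'a \<Rightarrow> 'a \<Rightarrow> 'a::real_inner \<Rightarrow> real" where
  "two_point_fun \<phi> E0 \<kappa> c1 c2 b N z x y =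
     \<phi> (norm (x - y)) * (E0 + \<kappa> * (norm (x - c1))\<^sup>2 + \<kappa> * (norm (y - c2))\<^sup>2) + b \<bullet> (x - y) + N * (norm (x - z))\<^sup>2"

lemma two_point_line_derivative:
  fixes x y \<xi> \<eta> :: "'a::real_inner"
  assumes ne: "x + t *\<^sub>R \<xi> \<noteq> y + t *\<^sub>R \<eta>"
    and \<phi>: "(\<phi> has_real_derivative \<phi>1 (norm (x - y + t *\<^sub>R (\<xi> - \<eta>)))) (at (norm (x - y + t *\<^sub>R (\<xi> - \<eta>))))"
  shows "((\<lambda>t. two_point_fun \<phi> E0 \<kappa> c1 c2 b N z (x + t *\<^sub>R \<xi>) (y + t *\<^sub>R \<eta>)) has_real_derivative
     \<phi>1 (norm (x - y + t *\<^sub>R (\<xi> - \<eta>)))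
         * (((x - y + t *\<^sub>R (\<xi> - \<eta>)) \<bullet> (\<xi> - \<eta>)) / norm (x - y + t *\<^sub>R (\<xi> - \<eta>)))
         * (E0 + \<kappa> * (norm (x + t *\<^sub>R \<xi> - c1))\<^sup>2 + \<kappa> * (norm (y + t *\<^sub>R \<eta> - c2))\<^sup>2)
     + \<phi> (norm (x - y + t *\<^sub>R (\<xi> - \<eta>))) * (2 * \<kappa> * ((x + t *\<^sub>R \<xi> - c1) \<bullet> \<xi> + (y + t *\<^sub>R \<eta> - c2) \<bullet> \<eta>))
     + b \<bullet> (\<xi> - \<eta>) + 2 * N * ((x + t *\<^sub>R \<xi> - z) \<bullet> \<xi>)) (at t)"
proof -
  have eq: "x + t *\<^sub>R \<xi> - (y + t *\<^sub>R \<eta>) = x - y + t *\<^sub>R (\<xi> - \<eta>)" for t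
    by (simp add: algebra_simps)
  have ne': "x - y + t *\<^sub>R (\<xi> - \<eta>) \<noteq> 0" using ne eq[of t] by (metis right_minus_eq)
  have b: "((\<lambda>t. b \<bullet> (x - y + t *\<^sub>R (\<xi> - \<eta>))) has_real_derivative b \<bullet> (\<xi> - \<eta>)) (at t)"
    unfolding has_field_derivative_def
    by (auto intro!: derivative_eq_intros simp: fun_eq_iff)
  show ?thesis
    unfolding two_point_fun_def eq
    by (rule derivative_eq_intros DERIV_chain2[OF \<phi> norm_line_has_derivative[OF ne']]
        dist_sq_line_has_derivative b refl)+
      (simp add: algebra_simps)
qed

lemma two_point_line_second_derivative:
  fixes x y \<xi> \<eta> :: "'a::real_inner"
  assumes ne: "x \<noteq> y" and s: "s = norm (x - y)" and e: "e = (x - y) /\<^sub>R s"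
    and \<phi>: "(\<phi> has_real_derivative \<phi>1 s) (at s)" and \<phi>1: "(\<phi>1 has_real_derivative \<phi>2) (at s)"
  shows "((\<lambda>t. \<phi>1 (norm (x - y + t *\<^sub>R (\<xi> - \<eta>)))
         * (((x - y + t *\<^sub>R (\<xi> - \<eta>)) \<bullet> (\<xi> - \<eta>)) / norm (x - y + t *\<^sub>R (\<xi> - \<eta>)))
         * (E0 + \<kappa> * (norm (x + t *\<^sub>R \<xi> - c1))\<^sup>2 + \<kappa> * (norm (y + t *\<^sub>R \<eta> - c2))\<^sup>2)
     + \<phi> (norm (x - y + t *\<^sub>R (\<xi> - \<eta>))) * (2 * \<kappa> * ((x + t *\<^sub>R \<xi> - c1) \<bullet> \<xi> + (y + t *\<^sub>R \<eta> - c2) \<bullet> \<eta>))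
     + b \<bullet> (\<xi> - \<eta>) + 2 * N * ((x + t *\<^sub>R \<xi> - z) \<bullet> \<xi>)) has_real_derivative
     (\<phi>2 * (e \<bullet> (\<xi> - \<eta>))\<^sup>2 + \<phi>1 s / s * ((norm (\<xi> - \<eta>))\<^sup>2 - (e \<bullet> (\<xi> - \<eta>))\<^sup>2))
         * (E0 + \<kappa> * (norm (x - c1))\<^sup>2 + \<kappa> * (norm (y - c2))\<^sup>2)
     + 4 * \<kappa> * \<phi>1 s * (e \<bullet> (\<xi> - \<eta>)) * ((x - c1) \<bullet> \<xi> + (y - c2) \<bullet> \<eta>)
     + 2 * \<kappa> * \<phi> s * ((norm \<xi>)\<^sup>2 + (norm \<eta>)\<^sup>2) + 2 * N * (norm \<xi>)\<^sup>2) (at 0)"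
proof -
  define d \<zeta> where "d = x - y" and "\<zeta> = \<xi> - \<eta>"
  have d: "d \<noteq> 0" and s0: "s > 0" using ne by (auto simp: d_def s)
  have de: "d = s *\<^sub>R e" using s0 by (simp add: e d_def)
  have n0: "norm (d + 0 *\<^sub>R \<zeta>) = s" by (simp add: s d_def)
  have rho: "((\<lambda>t. norm (d + t *\<^sub>R \<zeta>)) has_real_derivative e \<bullet> \<zeta>) (at 0)"
    using norm_line_has_derivative[of d 0 \<zeta>] d s0 by (simp add: s[folded d_def, symmetric] e[folded d_def] divide_inverse mult.commute)
  have lin: "((\<lambda>t. (a + t *\<^sub>R v - c) \<bullet> v) has_real_derivative (norm v)\<^sup>2) (at 0)" for a v c :: 'a
    unfolding has_field_derivative_def power2_norm_eq_inner
    by (auto intro!: derivative_eq_intros simp: fun_eq_iff)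
  have lin': "((\<lambda>t. (d + t *\<^sub>R \<zeta>) \<bullet> \<zeta>) has_real_derivative (norm \<zeta>)\<^sup>2) (at 0)"
    using lin[of d \<zeta> 0] by simp
  have p: "((\<lambda>t. \<phi> (norm (d + t *\<^sub>R \<zeta>))) has_real_derivative \<phi>1 s * (e \<bullet> \<zeta>)) (at 0)"
    using DERIV_chain2[OF _ rho, of \<phi> "\<phi>1 s"] \<phi> n0 by simp
  have p1: "((\<lambda>t. \<phi>1 (norm (d + t *\<^sub>R \<zeta>))) has_real_derivative \<phi>2 * (e \<bullet> \<zeta>)) (at 0)"
    using DERIV_chain2[OF _ rho, of \<phi>1 \<phi>2] \<phi>1 n0 by simp
  have quot: "((\<lambda>t. ((d + t *\<^sub>R \<zeta>) \<bullet> \<zeta>) / norm (d + t *\<^sub>R \<zeta>)) has_real_derivative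
        ((norm \<zeta>)\<^sup>2 - (e \<bullet> \<zeta>)\<^sup>2) / s) (at 0)"
  proof -
    have "((\<lambda>t. ((d + t *\<^sub>R \<zeta>) \<bullet> \<zeta>) / norm (d + t *\<^sub>R \<zeta>)) has_real_derivative
        ((norm \<zeta>)\<^sup>2 * norm (d + 0 *\<^sub>R \<zeta>) - (d + 0 *\<^sub>R \<zeta>) \<bullet> \<zeta> * (e \<bullet> \<zeta>))
         / (norm (d + 0 *\<^sub>R \<zeta>) * norm (d + 0 *\<^sub>R \<zeta>))) (at 0)"
      by (rule DERIV_divide[OF lin' rho]) (use d in simp)
    moreover have "((norm \<zeta>)\<^sup>2 * norm (d + 0 *\<^sub>R \<zeta>) - (d + 0 *\<^sub>R \<zeta>) \<bullet> \<zeta> * (e \<bullet> \<zeta>))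
         / (norm (d + 0 *\<^sub>R \<zeta>) * norm (d + 0 *\<^sub>R \<zeta>)) = ((norm \<zeta>)\<^sup>2 - (e \<bullet> \<zeta>)\<^sup>2) / s"
      unfolding n0 using s0 by (simp add: de power2_eq_square field_simps)
    ultimately show ?thesis by (rule DERIV_cong)
  qed
  have E': "((\<lambda>t. E0 + \<kappa> * (norm (x + t *\<^sub>R \<xi> - c1))\<^sup>2 + \<kappa> * (norm (y + t *\<^sub>R \<eta> - c2))\<^sup>2)
      has_real_derivative 2 * \<kappa> * ((x - c1) \<bullet> \<xi> + (y - c2) \<bullet> \<eta>)) (at 0)"
    by (rule DERIV_cong, (rule derivative_eq_intros dist_sq_line_has_derivative refl)+)
      (simp add: algebra_simps)
  have L': "((\<lambda>t. 2 * \<kappa> * ((x + t *\<^sub>R \<xi> - c1) \<bullet> \<xi> + (y + t *\<^sub>R \<eta> - c2) \<bullet> \<eta>))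
      has_real_derivative 2 * \<kappa> * ((norm \<xi>)\<^sup>2 + (norm \<eta>)\<^sup>2)) (at 0)"
    by (rule DERIV_cmult[OF DERIV_add[OF lin lin]])
  have N': "((\<lambda>t. 2 * N * ((x + t *\<^sub>R \<xi> - z) \<bullet> \<xi>)) has_real_derivative 2 * N * (norm \<xi>)\<^sup>2) (at 0)"
    by (rule DERIV_cmult[OF lin])
  have dn: "d \<bullet> \<zeta> = s * (e \<bullet> \<zeta>)" using s0 by (simp add: de)
  show ?thesis
    unfolding d_def[symmetric] \<zeta>_def[symmetric]
    by (rule DERIV_cong[OF DERIV_add[OF DERIV_add[OF DERIV_add[OF
        DERIV_mult[OF DERIV_mult[OF p1 quot] E'] DERIV_mult[OF p L']] DERIV_const] N']])
      (use s0 n0 in \<open>simp add: dn field_simps power2_eq_square\<close>)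
qed

text \<open>Moving x along \<xi> and y along \<eta> reduces everything to functions of one variable.
  The two directions stay independent, because the later gain comes from combining different
  directions at x and at y.\<close>

lemma two_point_max:
  fixes u :: "'a::euclidean_space \<Rightarrow> real"
  assumes u: "C_on 2 S u" "open S" "x \<in> S" "y \<in> S"
    and ne: "x \<noteq> y" and s: "s = norm (x - y)" and e: "e = (x - y) /\<^sub>R s"
    and \<phi>: "\<forall>\<^sub>F r in nhds s. (\<phi> has_real_derivative \<phi>1 r) (at r)" and \<phi>1: "(\<phi>1 has_real_derivative \<phi>2) (at s)"
    and max: "\<forall>\<^sub>F w in nhds (x, y). u (fst w) - u (snd w) - two_point_fun \<phi> E0 \<kappa> c1 c2 b N z (fst w) (snd w)
        \<le> u x - u y - two_point_fun \<phi> E0 \<kappa> c1 c2 b N z x y"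
    and Hx: "(grad u has_derivative Hx) (at x)" and Hy: "(grad u has_derivative Hy) (at y)"
    and E: "E = E0 + \<kappa> * (norm (x - c1))\<^sup>2 + \<kappa> * (norm (y - c2))\<^sup>2"
  shows "grad u x = (E * \<phi>1 s) *\<^sub>R e + (2 * \<kappa> * \<phi> s) *\<^sub>R (x - c1) + b + (2 * N) *\<^sub>R (x - z)"
    and "grad u y = (E * \<phi>1 s) *\<^sub>R e - (2 * \<kappa> * \<phi> s) *\<^sub>R (y - c2) + b"
    and "Hx \<xi> \<bullet> \<xi> - Hy \<eta> \<bullet> \<eta> \<le>
        (\<phi>2 * (e \<bullet> (\<xi> - \<eta>))\<^sup>2 + \<phi>1 s / s * ((norm (\<xi> - \<eta>))\<^sup>2 - (e \<bullet> (\<xi> - \<eta>))\<^sup>2)) * E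
        + 4 * \<kappa> * \<phi>1 s * (e \<bullet> (\<xi> - \<eta>)) * ((x - c1) \<bullet> \<xi> + (y - c2) \<bullet> \<eta>)
        + 2 * \<kappa> * \<phi> s * ((norm \<xi>)\<^sup>2 + (norm \<eta>)\<^sup>2) + 2 * N * (norm \<xi>)\<^sup>2"
proof -
  have s0: "s > 0" using ne by (simp add: s)
  have *: "grad u x \<bullet> \<xi> - grad u y \<bullet> \<eta> = \<phi>1 s * (e \<bullet> (\<xi> - \<eta>)) * E
        + \<phi> s * (2 * \<kappa> * ((x - c1) \<bullet> \<xi> + (y - c2) \<bullet> \<eta>)) + b \<bullet> (\<xi> - \<eta>) + 2 * N * ((x - z) \<bullet> \<xi>)
     \<and> Hx \<xi> \<bullet> \<xi> - Hy \<eta> \<bullet> \<eta> \<le>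
        (\<phi>2 * (e \<bullet> (\<xi> - \<eta>))\<^sup>2 + \<phi>1 s / s * ((norm (\<xi> - \<eta>))\<^sup>2 - (e \<bullet> (\<xi> - \<eta>))\<^sup>2)) * E
        + 4 * \<kappa> * \<phi>1 s * (e \<bullet> (\<xi> - \<eta>)) * ((x - c1) \<bullet> \<xi> + (y - c2) \<bullet> \<eta>)
        + 2 * \<kappa> * \<phi> s * ((norm \<xi>)\<^sup>2 + (norm \<eta>)\<^sup>2) + 2 * N * (norm \<xi>)\<^sup>2" (is "?L \<and> ?M \<le> ?R") for \<xi> \<eta>
  proof -
    define X Y where "X t = x + t *\<^sub>R \<xi>" and "Y t = y + t *\<^sub>R \<eta>" for t
    define G where "G t = \<phi>1 (norm (x - y + t *\<^sub>R (\<xi> - \<eta>)))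
         * (((x - y + t *\<^sub>R (\<xi> - \<eta>)) \<bullet> (\<xi> - \<eta>)) / norm (x - y + t *\<^sub>R (\<xi> - \<eta>)))
         * (E0 + \<kappa> * (norm (x + t *\<^sub>R \<xi> - c1))\<^sup>2 + \<kappa> * (norm (y + t *\<^sub>R \<eta> - c2))\<^sup>2)
     + \<phi> (norm (x - y + t *\<^sub>R (\<xi> - \<eta>))) * (2 * \<kappa> * ((x + t *\<^sub>R \<xi> - c1) \<bullet> \<xi> + (y + t *\<^sub>R \<eta> - c2) \<bullet> \<eta>))
     + b \<bullet> (\<xi> - \<eta>) + 2 * N * ((x + t *\<^sub>R \<xi> - z) \<bullet> \<xi>)" for t
    have cX: "(X \<longlongrightarrow> x) (nhds 0)" and cY: "(Y \<longlongrightarrow> y) (nhds 0)"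
    proof -
      have "(X \<longlongrightarrow> x + 0 *\<^sub>R \<xi>) (nhds 0)" "(Y \<longlongrightarrow> y + 0 *\<^sub>R \<eta>) (nhds 0)" unfolding X_def Y_def
        by (intro tendsto_intros filterlim_ident)+
      then show "(X \<longlongrightarrow> x) (nhds 0)" "(Y \<longlongrightarrow> y) (nhds 0)" by simp_all
    qed
    have cn: "((\<lambda>t. norm (x - y + t *\<^sub>R (\<xi> - \<eta>))) \<longlongrightarrow> s) (nhds 0)"
    proof -
      have "((\<lambda>t. norm (x - y + t *\<^sub>R (\<xi> - \<eta>))) \<longlongrightarrow> norm (x - y + 0 *\<^sub>R (\<xi> - \<eta>))) (nhds 0)"
        by (intro tendsto_intros filterlim_ident)
      then show ?thesis by (simp add: s)
    qed
    have evS: "\<forall>\<^sub>F t in nhds 0. X t \<in> S \<and> Y t \<in> S"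
      using eventually_line_in_open[OF u(2,3)] eventually_line_in_open[OF u(2,4)]
      by (auto simp: X_def Y_def intro: eventually_conj)
    have ev\<phi>: "\<forall>\<^sub>F t in nhds 0. (\<phi> has_real_derivative \<phi>1 (norm (x - y + t *\<^sub>R (\<xi> - \<eta>)))) (at (norm (x - y + t *\<^sub>R (\<xi> - \<eta>))))"
      using \<phi> cn unfolding filterlim_iff by blast
    have evn: "\<forall>\<^sub>F t in nhds 0. norm (x - y + t *\<^sub>R (\<xi> - \<eta>)) > 0"
      using cn s0 order_tendstoD(1) by blast
    have "\<forall>\<^sub>F t in nhds 0. ((\<lambda>t. u (X t) - u (Y t) - two_point_fun \<phi> E0 \<kappa> c1 c2 b N z (X t) (Y t))
       has_real_derivative grad u (X t) \<bullet> \<xi> - grad u (Y t) \<bullet> \<eta> - G t) (at t)"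
      using evS ev\<phi> evn
    proof eventually_elim
      case (elim t)
      have "x + t *\<^sub>R \<xi> - (y + t *\<^sub>R \<eta>) = x - y + t *\<^sub>R (\<xi> - \<eta>)" by (simp add: algebra_simps)
      then have n: "x + t *\<^sub>R \<xi> \<noteq> y + t *\<^sub>R \<eta>" using elim(3) by (metis norm_zero order_less_irrefl right_minus_eq)
      show ?case unfolding X_def Y_def G_def
        by (intro DERIV_diff line_has_derivative two_point_line_derivative n elim
            C_on_has_derivative[OF u(1,2)]) (use elim in \<open>auto simp: X_def Y_def\<close>)
    qed
    moreover have "((\<lambda>t. grad u (X t) \<bullet> \<xi> - grad u (Y t) \<bullet> \<eta> - G t) has_real_derivative ?M - ?R) (at 0)"
      unfolding X_def Y_def G_def E
      by (intro DERIV_diff line_has_second_derivative Hx Hy two_point_line_second_derivative[OF ne s e _ \<phi>1])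
         (use \<phi> eventually_nhds_x_imp_x in blast)
    moreover have "\<forall>\<^sub>F t in nhds 0. u (X t) - u (Y t) - two_point_fun \<phi> E0 \<kappa> c1 c2 b N z (X t) (Y t)
        \<le> u (X 0) - u (Y 0) - two_point_fun \<phi> E0 \<kappa> c1 c2 b N z (X 0) (Y 0)"
    proof -
      have "((\<lambda>t. (X t, Y t)) \<longlongrightarrow> (x, y)) (nhds 0)" by (intro tendsto_Pair cX cY)
      from this[unfolded filterlim_iff, rule_format, OF max] show ?thesis by (simp add: X_def Y_def)
    qed
    ultimately have "grad u (X 0) \<bullet> \<xi> - grad u (Y 0) \<bullet> \<eta> - G 0 = 0" "?M - ?R \<le> 0"
      by (rule second_derivative_test)+
    then show ?thesis using s0
      by (auto simp: X_def Y_def G_def E e s[symmetric] divide_inverse mult.commute)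
  qed
  \<comment> \<open>Holding y fixed isolates the gradient at x, holding x fixed the gradient at
    y.\<close>
  show "grad u x = (E * \<phi>1 s) *\<^sub>R e + (2 * \<kappa> * \<phi> s) *\<^sub>R (x - c1) + b + (2 * N) *\<^sub>R (x - z)"
    by (rule euclidean_eqI) (use *[of _ 0] in \<open>simp add: inner_add_left inner_diff_left algebra_simps\<close>)
  show "grad u y = (E * \<phi>1 s) *\<^sub>R e - (2 * \<kappa> * \<phi> s) *\<^sub>R (y - c2) + b"
    by (rule euclidean_eqI) (use *[of 0] in \<open>simp add: inner_add_left inner_diff_left algebra_simps\<close>)
  show "Hx \<xi> \<bullet> \<xi> - Hy \<eta> \<bullet> \<eta> \<le>
        (\<phi>2 * (e \<bullet> (\<xi> - \<eta>))\<^sup>2 + \<phi>1 s / s * ((norm (\<xi> - \<eta>))\<^sup>2 - (e \<bullet> (\<xi> - \<eta>))\<^sup>2)) * E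
        + 4 * \<kappa> * \<phi>1 s * (e \<bullet> (\<xi> - \<eta>)) * ((x - c1) \<bullet> \<xi> + (y - c2) \<bullet> \<eta>)
        + 2 * \<kappa> * \<phi> s * ((norm \<xi>)\<^sup>2 + (norm \<eta>)\<^sup>2) + 2 * N * (norm \<xi>)\<^sup>2"
    using * by blast
qed

section \<open>Components along and orthogonal to the axis\<close>

lemma inner_tang:
  assumes "norm e = 1"
  shows "e \<bullet> tang e p = 0"
proof -
  have "e \<bullet> e = 1" using assms by (simp add: dot_square_norm)
  then show ?thesis unfolding tang_def inner_diff_right inner_scaleR_right inner_commute[of p e] by simp
qed

lemma tang_tang:
  assumes "norm e = 1"
  shows "tang e (tang e p) = tang e p"
  unfolding tang_def[of e "tang e p"] inner_commute[of "tang e p" e] inner_tang[OF assms] by simp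

lemma tang_diff: "tang e (p - q) = tang e p - tang e q"
  unfolding tang_def inner_diff_left scaleR_left_diff_distrib by simp

lemma tang_add: "tang e (p + q) = tang e p + tang e q"
  unfolding tang_def inner_add_left scaleR_left_distrib by simp

lemma tang_scaleR: "tang e (c *\<^sub>R p) = c *\<^sub>R tang e p"
  unfolding tang_def inner_scaleR_left scaleR_right_diff_distrib by simp

lemma tang_self:
  assumes "norm e = 1"
  shows "tang e e = 0"
proof -
  have "e \<bullet> e = 1" using assms by (simp add: dot_square_norm)
  then show ?thesis unfolding tang_def by simp
qed

lemma norm_tang_le:
  assumes "norm e = 1"
  shows "norm (tang e p) \<le> norm p"
proof (rule power2_le_imp_le)
  show "(norm (tang e p))\<^sup>2 \<le> (norm p)\<^sup>2" unfolding norm_tang_sq[OF assms] by simp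
qed simp

lemma inner_axial_le: "\<bar>p \<bullet> e\<bar> \<le> axial_slope e p"
  unfolding axial_slope_def by (rule real_le_rsqrt) simp

text \<open>The axial component is a product of the tangential part of p with
  \<open>(p \<bullet> e) / axial_slope e p\<close>, which is at most 1 in modulus, divided by the
  slope.\<close>

lemma inner_coupling_le:
  assumes e: "norm e = 1" and b: "norm b \<le> 1" and C: "norm (tang e p) \<le> C"
  shows "\<bar>e \<bullet> coupling e p b\<bar> \<le> C / slope p"
proof -
  have "e \<bullet> e = 1" using e by (simp add: dot_square_norm)
  then have "e \<bullet> coupling e p b = - ((tang e p \<bullet> b) * ((p \<bullet> e) / axial_slope e p)) / slope p"
    by (simp add: coupling_def inner_diff_right inner_add_right inner_tang[OF e])
  moreover have "\<bar>(tang e p \<bullet> b) * ((p \<bullet> e) / axial_slope e p)\<bar> \<le> C * 1"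
    unfolding abs_mult
  proof (rule mult_mono)
    have "\<bar>tang e p \<bullet> b\<bar> \<le> norm (tang e p) * norm b" by (rule Cauchy_Schwarz_ineq2)
    also have "\<dots> \<le> norm (tang e p)" using b by (simp add: mult_left_le)
    finally show "\<bar>tang e p \<bullet> b\<bar> \<le> C" using C by simp
    show "\<bar>(p \<bullet> e) / axial_slope e p\<bar> \<le> 1" using inner_axial_le[of p e] by simp
    show "0 \<le> C" by (rule order_trans[OF norm_ge_zero C])
  qed auto
  ultimately have "\<bar>e \<bullet> coupling e p b\<bar> \<le> (C * 1) / \<bar>slope p\<bar>"
    unfolding abs_divide abs_minus_cancel by (simp only: abs_divide abs_minus_cancel divide_right_mono abs_ge_zero)
  then show ?thesis by (simp add: abs_of_pos)
qed

text \<open>The correction along e disappears, so the images of one b under two gradients differ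
  only by the expressions that \<open>Z\<close> bounds in
  \<open>two_point_inequality\<close>.\<close>

lemma tang_coupling:
  assumes "norm e = 1"
  shows "tang e (coupling e p b) = tang e b - (tcoef e p * (tang e p \<bullet> b)) *\<^sub>R tang e p"
  by (simp add: coupling_def tang_diff tang_add tang_scaleR tang_tang[OF assms] tang_self[OF assms] mult.commute)

text \<open>Adding up the second-order conditions along the vectors of the coupling turns the two
  Hessian terms into the two sides of the equation. The pair \<open>e / axial_slope e p\<close>,
  \<open>- e / axial_slope e q\<close> yields the good term \<open>\<phi>2\<close>; the remaining pairs only differ by the
  tangential parts of \<open>p\<close> and \<open>q\<close>.\<close>

lemma two_point_inequality:
  fixes u :: "'a::euclidean_space \<Rightarrow> real" and \<phi> :: "real \<Rightarrow> real" and \<kappa> N C0 D E Z :: real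
  assumes u: "C_on 2 \<Omega> u" "open \<Omega>" "x \<in> \<Omega>" "y \<in> \<Omega>" and mc: "mean_curvature_eq \<Omega> f u"
    and ne: "x \<noteq> y" and s: "s = norm (x - y)" and e: "e = (x - y) /\<^sub>R s"
    and \<phi>: "\<forall>\<^sub>F r in nhds s. (\<phi> has_real_derivative \<phi>1 r) (at r)" and \<phi>1: "(\<phi>1 has_real_derivative \<phi>2) (at s)"
    and max: "\<forall>\<^sub>F w in nhds (x, y). u (fst w) - u (snd w) - two_point_fun \<phi> E0 \<kappa> c1 c2 b N z (fst w) (snd w)
        \<le> u x - u y - two_point_fun \<phi> E0 \<kappa> c1 c2 b N z x y"
    and E: "E = E0 + \<kappa> * (norm (x - c1))\<^sup>2 + \<kappa> * (norm (y - c2))\<^sup>2"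
    and nonneg: "0 \<le> \<kappa>" "0 \<le> N" "0 \<le> \<phi> s" "0 \<le> \<phi>1 s" "\<phi>2 \<le> 0" "0 \<le> E"
    and D: "norm (x - c1) \<le> D" "norm (y - c2) \<le> D"
    and p: "p = grad u x" and q: "q = grad u y"
    and C0: "norm (tang e p) \<le> C0" "norm (tang e q) \<le> C0"
    and Z: "\<And>b. b \<in> Basis \<Longrightarrow>
       norm ((tcoef e p * (tang e p \<bullet> b)) *\<^sub>R tang e p - (tcoef e q * (tang e q \<bullet> b)) *\<^sub>R tang e q) \<le> Z"
  shows "f (x, u x) * slope p - f (y, u y) * slope q \<le>
      E * \<phi>2 * (1 / axial_slope e p + 1 / axial_slope e q)\<^sup>2 + real DIM('a) * (E * \<phi>1 s / s * Z\<^sup>2)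
      + 4 * \<kappa> * D * \<phi>1 s * ((1 / axial_slope e p + 1 / axial_slope e q)\<^sup>2
          + 2 * (real DIM('a))\<^sup>2 * C0 * (1 / slope p + 1 / slope q))
      + 4 * real DIM('a) * \<kappa> * \<phi> s + 2 * real DIM('a) * N"
proof -
  obtain Hx where Hx: "(grad u has_derivative Hx) (at x)"
    using C_on_grad_differentiable[OF u(1,2,3) order_refl] unfolding differentiable_def by blast
  obtain Hy where Hy: "(grad u has_derivative Hy) (at y)"
    using C_on_grad_differentiable[OF u(1,2,4) order_refl] unfolding differentiable_def by blast
  note tp = two_point_max(3)[of \<Omega> u x y s e \<phi> \<phi>1 \<phi>2 E0 \<kappa> c1 c2 b N z Hx Hy E, OF u ne s e \<phi> \<phi>1 max Hx Hy E]
  have lx: "linear Hx" and ly: "linear Hy" by (rule has_derivative_linear[OF Hx] has_derivative_linear[OF Hy])+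
  interpret Hx: linear Hx by (rule lx)
  interpret Hy: linear Hy by (rule ly)
  have s0: "s > 0" unfolding s using ne by simp
  have e1: "norm e = 1" unfolding e norm_scaleR s[symmetric] using s0 by simp
  have ee: "e \<bullet> e = 1" using e1 by (simp add: dot_square_norm)
  have D0: "D \<ge> 0" by (rule order_trans[OF norm_ge_zero D(1)])
  have C00: "C0 \<ge> 0" by (rule order_trans[OF norm_ge_zero C0(1)])
  define n where "n = real DIM('a)"
  have "DIM('a) \<ge> 1" using DIM_positive[where 'a = 'a] by linarith
  then have n1: "n \<ge> 1" unfolding n_def by simp
  define Sp Sq vp vq a where "Sp = axial_slope e p" and "Sq = axial_slope e q"
    and "vp = slope p" and "vq = slope q" and "a = 1 / Sp + 1 / Sq"
  have Sp: "Sp > 0" and Sq: "Sq > 0" and vp: "vp > 0" and vq: "vq > 0"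
    by (simp_all add: Sp_def Sq_def vp_def vq_def)
  have a0: "a > 0" using Sp Sq by (simp add: a_def add_pos_pos)
  have tang_sq: "(norm \<zeta>)\<^sup>2 - (e \<bullet> \<zeta>)\<^sup>2 = (norm (tang e \<zeta>))\<^sup>2" for \<zeta>
    using norm_tang_sq[OF e1, of \<zeta>] by (simp add: inner_commute)
  \<comment> \<open>The mixed term keeps the factor \<open>e \<bullet> (\<xi> - \<eta>)\<close>,
    which for every pair used below is of the order of an inverse slope.\<close>
  have cross: "4 * \<kappa> * \<phi>1 s * (e \<bullet> (\<xi> - \<eta>)) * ((x - c1) \<bullet> \<xi> + (y - c2) \<bullet> \<eta>)
      \<le> 4 * \<kappa> * D * \<phi>1 s * (\<bar>e \<bullet> (\<xi> - \<eta>)\<bar> * (norm \<xi> + norm \<eta>))" for \<xi> \<eta>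
  proof -
    have "\<bar>(x - c1) \<bullet> \<xi>\<bar> \<le> D * norm \<xi>"
      by (rule order_trans[OF Cauchy_Schwarz_ineq2 mult_right_mono[OF D(1)]]) simp
    moreover have "\<bar>(y - c2) \<bullet> \<eta>\<bar> \<le> D * norm \<eta>"
      by (rule order_trans[OF Cauchy_Schwarz_ineq2 mult_right_mono[OF D(2)]]) simp
    ultimately have "\<bar>(x - c1) \<bullet> \<xi> + (y - c2) \<bullet> \<eta>\<bar> \<le> D * (norm \<xi> + norm \<eta>)"
      by (simp add: distrib_left)
    then have "\<bar>e \<bullet> (\<xi> - \<eta>)\<bar> * \<bar>(x - c1) \<bullet> \<xi> + (y - c2) \<bullet> \<eta>\<bar> \<le> \<bar>e \<bullet> (\<xi> - \<eta>)\<bar> * (D * (norm \<xi> + norm \<eta>))"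
      by (intro mult_left_mono) auto
    then have "(e \<bullet> (\<xi> - \<eta>)) * ((x - c1) \<bullet> \<xi> + (y - c2) \<bullet> \<eta>) \<le> \<bar>e \<bullet> (\<xi> - \<eta>)\<bar> * (D * (norm \<xi> + norm \<eta>))"
      unfolding abs_mult[symmetric] by linarith
    then have "(4 * \<kappa> * \<phi>1 s) * ((e \<bullet> (\<xi> - \<eta>)) * ((x - c1) \<bullet> \<xi> + (y - c2) \<bullet> \<eta>))
      \<le> (4 * \<kappa> * \<phi>1 s) * (\<bar>e \<bullet> (\<xi> - \<eta>)\<bar> * (D * (norm \<xi> + norm \<eta>)))"
      using nonneg by (intro mult_left_mono) auto
    then show ?thesis by (simp only: mult_ac)
  qed
  have axial: "Hx e \<bullet> e / Sp\<^sup>2 - Hy e \<bullet> e / Sq\<^sup>2 \<le> E * \<phi>2 * a\<^sup>2 + 4 * \<kappa> * D * \<phi>1 s * a\<^sup>2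
      + 2 * \<kappa> * \<phi> s * (1 / Sp\<^sup>2 + 1 / Sq\<^sup>2) + 2 * N * (1 / Sp\<^sup>2)"
  proof -
    define \<xi> \<eta> where "\<xi> = (1 / Sp) *\<^sub>R e" and "\<eta> = (- 1 / Sq) *\<^sub>R e"
    \<comment> \<open>Opposite signs make the difference purely axial, so the term with
      \<open>\<phi>1 s / s\<close> vanishes.\<close>
    have \<zeta>: "\<xi> - \<eta> = a *\<^sub>R e" by (simp add: \<xi>_def \<eta>_def a_def scaleR_add_left)
    have n: "norm \<xi> = 1 / Sp" "norm \<eta> = 1 / Sq" using Sp Sq by (auto simp: \<xi>_def \<eta>_def e1)
    have t: "(norm (tang e (\<xi> - \<eta>)))\<^sup>2 = 0" by (simp add: \<zeta> tang_scaleR tang_self[OF e1])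
    have ez: "e \<bullet> (\<xi> - \<eta>) = a" by (simp add: \<zeta> ee)
    have h: "Hx \<xi> \<bullet> \<xi> = Hx e \<bullet> e / Sp\<^sup>2" "Hy \<eta> \<bullet> \<eta> = Hy e \<bullet> e / Sq\<^sup>2"
      unfolding \<xi>_def \<eta>_def Hx.scale Hy.scale by (simp_all add: power2_eq_square)
    have c: "4 * \<kappa> * D * \<phi>1 s * (\<bar>e \<bullet> (\<xi> - \<eta>)\<bar> * (norm \<xi> + norm \<eta>)) = 4 * \<kappa> * D * \<phi>1 s * a\<^sup>2"
      unfolding ez n a_def[symmetric] using a0 by (simp add: power2_eq_square)
    have g: "(\<phi>2 * (e \<bullet> (\<xi> - \<eta>))\<^sup>2 + \<phi>1 s / s * (norm (tang e (\<xi> - \<eta>)))\<^sup>2) * E = E * \<phi>2 * a\<^sup>2"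
      unfolding t ez by simp
    have n2: "(norm \<xi>)\<^sup>2 = 1 / Sp\<^sup>2" "(norm \<eta>)\<^sup>2 = 1 / Sq\<^sup>2"
      unfolding n by (simp_all add: power_divide)
    show ?thesis using tp[of \<xi> \<eta>] cross[of \<xi> \<eta>] unfolding tang_sq g c n2 h by linarith
  qed
  have sync: "Hx (coupling e p b) \<bullet> coupling e p b - Hy (coupling e q b) \<bullet> coupling e q b
      \<le> E * \<phi>1 s / s * Z\<^sup>2 + 4 * \<kappa> * D * \<phi>1 s * (2 * n * C0 * (1 / vp + 1 / vq))
      + 2 * \<kappa> * \<phi> s * ((norm (coupling e p b))\<^sup>2 + (norm (coupling e q b))\<^sup>2) + 2 * N * (norm (coupling e p b))\<^sup>2"
    if b: "b \<in> Basis" for b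
  proof -
    define \<xi> \<eta> where "\<xi> = coupling e p b" and "\<eta> = coupling e q b"
    have b1: "norm b \<le> 1" using b by simp
    have small: "norm (coupling e r b) \<le> n" for r
    proof -
      have "(norm (coupling e r b))\<^sup>2 \<le> (\<Sum>b\<in>Basis. (norm (coupling e r b))\<^sup>2)"
        by (rule member_le_sum[where f = "\<lambda>b. (norm (coupling e r b))\<^sup>2", OF b]) simp_all
      also have "\<dots> \<le> 1 / (axial_slope e r)\<^sup>2 + (\<Sum>b\<in>Basis. (norm (coupling e r b))\<^sup>2)" by simp
      also have "\<dots> \<le> n" unfolding n_def by (rule coupling_norm_sum[OF e1])
      also have "n \<le> n\<^sup>2" using n1 by (intro self_le_power) simp_all
      finally show ?thesis by (rule power2_le_imp_le) (use n1 in linarith)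
    qed
    have "tang e (\<xi> - \<eta>) = - ((tcoef e p * (tang e p \<bullet> b)) *\<^sub>R tang e p - (tcoef e q * (tang e q \<bullet> b)) *\<^sub>R tang e q)"
      by (simp add: \<xi>_def \<eta>_def tang_diff tang_coupling[OF e1])
    then have "norm (tang e (\<xi> - \<eta>)) \<le> Z" using Z[OF b] by (simp add: norm_minus_commute)
    then have t: "(norm (tang e (\<xi> - \<eta>)))\<^sup>2 \<le> Z\<^sup>2" by (intro power_mono) auto
    have "\<phi>1 s / s * (norm (tang e (\<xi> - \<eta>)))\<^sup>2 \<le> \<phi>1 s / s * Z\<^sup>2"
      using t nonneg s0 by (intro mult_left_mono) auto
    \<comment> \<open>The axial part of the difference only helps, as
      \<open>\<phi>2 \<le> 0\<close>.\<close>
    then have "\<phi>2 * (e \<bullet> (\<xi> - \<eta>))\<^sup>2 + \<phi>1 s / s * (norm (tang e (\<xi> - \<eta>)))\<^sup>2 \<le> \<phi>1 s / s * Z\<^sup>2"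
      using nonneg by (smt (verit) mult_nonpos_nonneg zero_le_power2)
    then have 1: "(\<phi>2 * (e \<bullet> (\<xi> - \<eta>))\<^sup>2 + \<phi>1 s / s * (norm (tang e (\<xi> - \<eta>)))\<^sup>2) * E \<le> \<phi>1 s / s * Z\<^sup>2 * E"
      using nonneg by (intro mult_right_mono) auto
    have "\<bar>e \<bullet> \<xi>\<bar> \<le> C0 / vp" "\<bar>e \<bullet> \<eta>\<bar> \<le> C0 / vq"
      unfolding \<xi>_def \<eta>_def vp_def vq_def by (rule inner_coupling_le[OF e1 b1 C0(1)] inner_coupling_le[OF e1 b1 C0(2)])+
    then have "\<bar>e \<bullet> (\<xi> - \<eta>)\<bar> \<le> C0 * (1 / vp + 1 / vq)"
      by (simp add: inner_diff_right distrib_left)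
    then have "\<bar>e \<bullet> (\<xi> - \<eta>)\<bar> * (norm \<xi> + norm \<eta>) \<le> C0 * (1 / vp + 1 / vq) * (n + n)"
      using small[of p] small[of q] vp vq C00 unfolding \<xi>_def[symmetric] \<eta>_def[symmetric]
      by (intro mult_mono add_mono) auto
    then have "4 * \<kappa> * D * \<phi>1 s * (\<bar>e \<bullet> (\<xi> - \<eta>)\<bar> * (norm \<xi> + norm \<eta>))
        \<le> 4 * \<kappa> * D * \<phi>1 s * (2 * n * C0 * (1 / vp + 1 / vq))"
      using nonneg D0 by (intro mult_left_mono) (auto simp: algebra_simps)
    moreover have "\<phi>1 s / s * Z\<^sup>2 * E = E * \<phi>1 s / s * Z\<^sup>2" by simp
    ultimately show ?thesis using tp[of \<xi> \<eta>, unfolded tang_sq] cross[of \<xi> \<eta>] 1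
      unfolding \<xi>_def[symmetric] \<eta>_def[symmetric] by linarith
  qed
  let ?\<Sigma>p = "\<Sum>b\<in>Basis. (norm (coupling e p b))\<^sup>2" and ?\<Sigma>q = "\<Sum>b\<in>Basis. (norm (coupling e q b))\<^sup>2"
  define K c d where "K = E * \<phi>1 s / s * Z\<^sup>2 + 4 * \<kappa> * D * \<phi>1 s * (2 * n * C0 * (1 / vp + 1 / vq))"
    and "c = 2 * \<kappa> * \<phi> s" and "d = 2 * N"
  have "f (x, u x) * vp - f (y, u y) * vq =
     (Hx e \<bullet> e / Sp\<^sup>2 - Hy e \<bullet> e / Sq\<^sup>2)
     + (\<Sum>b\<in>Basis. Hx (coupling e p b) \<bullet> coupling e p b - Hy (coupling e q b) \<bullet> coupling e q b)"
    using coupling_identity[OF lx e1, of p] coupling_identity[OF ly e1, of q]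
      mean_curvature_eq_expanded[OF Hx mc u(3)] mean_curvature_eq_expanded[OF Hy mc u(4)]
    unfolding vp_def vq_def Sp_def Sq_def p q sum_subtractf by linarith
  also have "\<dots> \<le> (E * \<phi>2 * a\<^sup>2 + 4 * \<kappa> * D * \<phi>1 s * a\<^sup>2
      + c * (1 / Sp\<^sup>2 + 1 / Sq\<^sup>2) + d * (1 / Sp\<^sup>2))
      + (\<Sum>b\<in>(Basis::'a set). K + c * ((norm (coupling e p b))\<^sup>2 + (norm (coupling e q b))\<^sup>2) + d * (norm (coupling e p b))\<^sup>2)"
    unfolding c_def d_def K_def by (rule add_mono[OF axial sum_mono[OF sync]])
  also have "\<dots> = E * \<phi>2 * a\<^sup>2 + 4 * \<kappa> * D * \<phi>1 s * a\<^sup>2 + n * K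
      + c * ((1 / Sp\<^sup>2 + ?\<Sigma>p) + (1 / Sq\<^sup>2 + ?\<Sigma>q)) + d * (1 / Sp\<^sup>2 + ?\<Sigma>p)"
    unfolding sum.distrib sum_distrib_left[symmetric] sum_constant n_def distrib_left by linarith
  \<comment> \<open>The remaining terms with \<kappa> and N carry the traces of the two coefficient
    matrices.\<close>
  also have "\<dots> \<le> E * \<phi>2 * a\<^sup>2 + 4 * \<kappa> * D * \<phi>1 s * a\<^sup>2 + n * K + c * (n + n) + d * n"
  proof -
    have sp: "1 / Sp\<^sup>2 + ?\<Sigma>p \<le> n" and sq: "1 / Sq\<^sup>2 + ?\<Sigma>q \<le> n"
      unfolding n_def Sp_def Sq_def by (rule coupling_norm_sum[OF e1])+
    have "c \<ge> 0" "d \<ge> 0" unfolding c_def d_def using nonneg by simp_all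
    then show ?thesis
      by (intro add_mono[OF add_mono[OF order_refl mult_left_mono[OF add_mono[OF sp sq]]] mult_left_mono[OF sp]])
  qed
  also have "\<dots> = E * \<phi>2 * a\<^sup>2 + n * (E * \<phi>1 s / s * Z\<^sup>2)
      + 4 * \<kappa> * D * \<phi>1 s * (a\<^sup>2 + 2 * n\<^sup>2 * C0 * (1 / vp + 1 / vq)) + 4 * n * \<kappa> * \<phi> s + 2 * n * N"
    unfolding K_def c_def d_def by (simp add: distrib_left power2_eq_square mult_ac)
  finally show ?thesis unfolding a_def Sp_def Sq_def vp_def vq_def n_def .
qed

section \<open>The right-hand side\<close>

text \<open>A substitute for the existence of a path of length at most \<open>\<Lambda> * norm (x - y)\<close> from \<open>x\<close> to \<open>y\<close> in \<open>\<Omega>\<close>.\<close>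

definition grad_lip :: "real \<Rightarrow> 'a::euclidean_space set \<Rightarrow> 'a \<Rightarrow> 'a \<Rightarrow> bool" where
  "grad_lip \<Lambda> \<Omega> x y \<longleftrightarrow> (\<forall>(h :: 'a \<Rightarrow> real) L. 0 \<le> L \<longrightarrow>
     (\<forall>w\<in>\<Omega>. \<bar>h w\<bar> \<le> L \<and> (\<exists>h'. (h has_derivative h') (at w) \<and> (\<forall>v. \<bar>h' v\<bar> \<le> L * norm v))) \<longrightarrow>
     \<bar>h x - h y\<bar> \<le> \<Lambda> * L * norm (x - y))"

lemma grad_lipD:
  assumes "grad_lip \<Lambda> \<Omega> x y" "0 \<le> L" and "\<And>w. w \<in> \<Omega> \<Longrightarrow> \<bar>h w\<bar> \<le> L"
    and "\<And>w. w \<in> \<Omega> \<Longrightarrow> (h has_derivative h' w) (at w)"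
    and "\<And>w v. w \<in> \<Omega> \<Longrightarrow> \<bar>h' w v\<bar> \<le> L * norm v"
  shows "\<bar>h x - h y\<bar> \<le> \<Lambda> * L * norm (x - y)"
  using assms unfolding grad_lip_def by blast

lemma grad_lip_segment:
  assumes "closed_segment x y \<subseteq> \<Omega>"
  shows "grad_lip 1 \<Omega> x y"
  unfolding grad_lip_def
proof (intro allI impI)
  fix h :: "'a \<Rightarrow> real" and L :: real
  assume L: "0 \<le> L" and "\<forall>w\<in>\<Omega>. \<bar>h w\<bar> \<le> L \<and> (\<exists>h'. (h has_derivative h') (at w) \<and> (\<forall>v. \<bar>h' v\<bar> \<le> L * norm v))"
  then obtain h' where h': "\<And>w. w \<in> \<Omega> \<Longrightarrow> (h has_derivative h' w) (at w)"
    "\<And>w v. w \<in> \<Omega> \<Longrightarrow> \<bar>h' w v\<bar> \<le> L * norm v" by metis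
  have "norm (h x - h y) \<le> L * norm (x - y)"
  proof (rule differentiable_bound[where S = "closed_segment x y" and f = h and f' = h'])
    show "(h has_derivative h' w) (at w within closed_segment x y)" if "w \<in> closed_segment x y" for w
      using h'(1)[of w] that assms by (meson has_derivative_at_withinI subsetD)
    show "onorm (h' w) \<le> L" if "w \<in> closed_segment x y" for w
    proof (rule onorm_le)
      show "norm (h' w v) \<le> L * norm v" for v
        using h'(2)[of w v] that assms by (metis real_norm_def subsetD)
    qed
  qed auto
  then show "\<bar>h x - h y\<bar> \<le> 1 * L * norm (x - y)" by simp
qed

lemma grad_cl_interior:
  fixes g :: "'a::euclidean_space \<Rightarrow> real"
  assumes "C_on k S g" "1 \<le> k" "open S" "x \<in> S"
  shows "grad_cl S g x = grad g x"
proof -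
  have "(grad g \<longlongrightarrow> grad g x) (at x within S)"
    using C_on_grad_continuous[OF assms(1,2)] assms(4) by (simp add: continuous_on_def)
  moreover have "at x within S \<noteq> bot" unfolding at_within_open[OF assms(4,3)] by simp
  ultimately show ?thesis unfolding grad_cl_def by (intro tendsto_Lim)
qed

lemma rhs_derivative:
  assumes rhs: "rhs_conditions \<Omega> M0 L1 f" and \<Omega>: "open \<Omega>" and x: "x \<in> \<Omega>" and z: "\<bar>z\<bar> < M0"
  shows "(f has_derivative (\<lambda>h. grad f (x, z) \<bullet> h)) (at (x, z))"
    and "norm (fst (grad f (x, z))) \<le> L1" and "0 \<le> snd (grad f (x, z))"
proof -
  let ?S = "\<Omega> \<times> {-M0<..<M0}"
  have S: "open ?S" "(x, z) \<in> ?S" using \<Omega> x z by (auto intro: open_Times)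
  have C: "C_on 1 ?S f" using rhs by (simp add: rhs_conditions_def C_closure_def)
  show "(f has_derivative (\<lambda>h. grad f (x, z) \<bullet> h)) (at (x, z))"
    by (rule C_on_has_derivative[OF C S]) simp
  have eq: "grad_cl ?S f (x, z) = grad f (x, z)" by (rule grad_cl_interior[OF C _ S]) simp
  have "x \<in> closure \<Omega>" "z \<in> {-M0..M0}" using x z closure_subset by auto
  then have "snd (grad_cl ?S f (x, z)) \<ge> 0 \<and> \<bar>f (x, z)\<bar> + norm (fst (grad_cl ?S f (x, z))) \<le> L1"
    using rhs unfolding rhs_conditions_def by blast
  then show "norm (fst (grad f (x, z))) \<le> L1" "0 \<le> snd (grad f (x, z))" unfolding eq by auto
qed

lemma rhs_bound:
  assumes rhs: "rhs_conditions \<Omega> M0 L1 f" and x: "x \<in> \<Omega>" and z: "\<bar>z\<bar> \<le> M0"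
  shows "\<bar>f (x, z)\<bar> \<le> L1"
proof -
  have "x \<in> closure \<Omega>" "z \<in> {-M0..M0}" using x z closure_subset by auto
  then have "\<bar>f (x, z)\<bar> + norm (fst (grad_cl (\<Omega> \<times> {-M0<..<M0}) f (x, z))) \<le> L1"
    using rhs unfolding rhs_conditions_def by blast
  then show ?thesis using norm_ge_zero[of "fst (grad_cl (\<Omega> \<times> {-M0<..<M0}) f (x, z))"] by linarith
qed

lemma rhs_continuous:
  assumes rhs: "rhs_conditions \<Omega> M0 L1 f" and x: "x \<in> \<Omega>" and M0: "0 < M0"
  shows "continuous_on {-M0..M0} (\<lambda>z. f (x, z))"
proof -
  have "continuous_on (closure (\<Omega> \<times> {-M0<..<M0})) f"
    using rhs by (simp add: rhs_conditions_def C_closure_def)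
  then have "continuous_on (closure \<Omega> \<times> {-M0..M0}) f" using M0 by (simp add: closure_Times)
  moreover have "(\<lambda>z. (x, z)) ` {-M0..M0} \<subseteq> closure \<Omega> \<times> {-M0..M0}" using x closure_subset by auto
  ultimately show ?thesis
    by (intro continuous_on_compose2[of _ f _ "\<lambda>z. (x, z)"] continuous_intros)
qed

lemma rhs_mono:
  assumes rhs: "rhs_conditions \<Omega> M0 L1 f" and \<Omega>: "open \<Omega>" and x: "x \<in> \<Omega>" and M0: "0 < M0"
    and z: "-M0 \<le> z'" "z' \<le> z" "z \<le> M0"
  shows "f (x, z') \<le> f (x, z)"
proof (rule DERIV_nonneg_imp_increasing_open[where f = "\<lambda>z. f (x, z)"])
  show "continuous_on {z'..z} (\<lambda>z. f (x, z))"
    by (rule continuous_on_subset[OF rhs_continuous[OF rhs x M0]]) (use z in auto)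
  show "\<exists>y. ((\<lambda>z. f (x, z)) has_real_derivative y) (at t) \<and> 0 \<le> y" if t: "z' < t" "t < z" for t
  proof -
    have "\<bar>t\<bar> < M0" using t z by auto
    note d = rhs_derivative[OF rhs \<Omega> x this]
    have "((\<lambda>z. (x, z)) has_derivative (\<lambda>h. (0, h))) (at t)" by (auto intro!: derivative_eq_intros)
    from has_derivative_compose[OF this d(1)]
    have "((\<lambda>z. f (x, z)) has_derivative (\<lambda>h. h * snd (grad f (x, t)))) (at t)"
      by (rule has_derivative_eq_rhs) (simp add: inner_prod_def fun_eq_iff)
    then have "((\<lambda>z. f (x, z)) has_real_derivative snd (grad f (x, t))) (at t)"
      unfolding has_field_derivative_def by (rule has_derivative_eq_rhs) (simp add: fun_eq_iff)
    then show ?thesis using d(3) by blast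
  qed
qed (use z in auto)

text \<open>Lowering the value from z to z' at the fixed point x cannot increase f, by
  \<open>rhs_mono\<close>. What remains is a change of the point at a fixed value, which
  \<open>grad_lip\<close> controls.\<close>

lemma rhs_difference:
  assumes rhs: "rhs_conditions \<Omega> M0 L1 f" and \<Omega>: "open \<Omega>" and x: "x \<in> \<Omega>" and y: "y \<in> \<Omega>" and M0: "0 < M0"
    and L1: "0 < L1" and lip: "grad_lip \<Lambda> \<Omega> x y"
    and z: "\<bar>z\<bar> \<le> M0" "\<bar>z'\<bar> \<le> M0" "z' \<le> z"
  shows "- (\<Lambda> * L1 * norm (x - y)) \<le> f (x, z) - f (y, z')"
proof -
  have *: "\<bar>f (x, t) - f (y, t)\<bar> \<le> \<Lambda> * L1 * norm (x - y)" if t: "t \<in> {-M0<..<M0}" for t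
  proof (rule grad_lipD[OF lip, where h = "\<lambda>x. f (x, t)" and h' = "\<lambda>w v. grad f (w, t) \<bullet> (v, 0)"])
    fix w v assume w: "w \<in> \<Omega>"
    have "\<bar>t\<bar> < M0" using t by auto
    note d = rhs_derivative[OF rhs \<Omega> w this]
    have "((\<lambda>w. (w, t)) has_derivative (\<lambda>h. (h, 0))) (at w)" by (auto intro!: derivative_eq_intros)
    from has_derivative_compose[OF this d(1)]
    show "((\<lambda>x. f (x, t)) has_derivative (\<lambda>v. grad f (w, t) \<bullet> (v, 0))) (at w)" .
    have "\<bar>grad f (w, t) \<bullet> (v, 0)\<bar> = \<bar>fst (grad f (w, t)) \<bullet> v\<bar>" by (simp add: inner_prod_def)
    also have "\<dots> \<le> norm (fst (grad f (w, t))) * norm v" by (rule Cauchy_Schwarz_ineq2)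
    also have "\<dots> \<le> L1 * norm v" by (rule mult_right_mono[OF d(2)]) simp
    finally show "\<bar>grad f (w, t) \<bullet> (v, 0)\<bar> \<le> L1 * norm v" .
    show "\<bar>f (w, t)\<bar> \<le> L1" by (rule rhs_bound[OF rhs w]) (use t in auto)
  qed (use L1 in auto)
  have cl: "closure {-M0<..<M0} = {-M0..M0}" using M0 by simp
  \<comment> \<open>The end values - M0 and M0, at which f is not differentiated, are reached by
    continuity.\<close>
  have "\<bar>f (x, z') - f (y, z')\<bar> \<le> \<Lambda> * L1 * norm (x - y)"
  proof (rule continuous_le_on_closure[where S = "{-M0<..<M0}" and f = "\<lambda>t. \<bar>f (x, t) - f (y, t)\<bar>"])
    show "continuous_on (closure {-M0<..<M0}) (\<lambda>t. \<bar>f (x, t) - f (y, t)\<bar>)"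
      unfolding cl by (intro continuous_intros rhs_continuous[OF rhs _ M0] x y)
  qed (use z * cl in auto)
  moreover have "f (x, z') \<le> f (x, z)" by (rule rhs_mono[OF rhs \<Omega> x M0]) (use z in auto)
  ultimately show ?thesis by linarith
qed

text \<open>\<open>v\<close> and \<open>w\<close> are slopes at the two points; the factor \<open>v - w\<close> is controlled by the difference of
  the gradients.\<close>

lemma rhs_slope_difference:
  assumes fx: "\<bar>fx\<bar> \<le> L1" and fd: "- A \<le> fx - fy" and v: "\<bar>slope p - slope q\<bar> \<le> B"
  shows "- (L1 * B + A * slope q) \<le> fx * slope p - fy * slope q"
proof -
  have "fx * slope p - fy * slope q = fx * (slope p - slope q) + (fx - fy) * slope q" by (simp add: algebra_simps)
  moreover have "\<bar>fx * (slope p - slope q)\<bar> \<le> L1 * B"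
    unfolding abs_mult by (intro mult_mono fx v) (use fx in linarith)+
  moreover have "- A * slope q \<le> (fx - fy) * slope q"
    by (rule mult_right_mono[OF fd]) (simp add: less_imp_le)
  ultimately show ?thesis by linarith
qed

text \<open>A one-sided estimate suffices: leaving x in the direction - g, u falls at the rate norm
  g per unit length.\<close>

lemma gradient_bound_from_difference:
  fixes u :: "'a::euclidean_space \<Rightarrow> real"
  assumes der: "(u has_derivative (\<lambda>h. g \<bullet> h)) (at x)" and r: "r > 0" and P: "0 \<le> P"
    and bound: "\<And>y. norm (x - y) \<le> r \<Longrightarrow> u x - u y \<le> P * norm (x - y)"
  shows "norm g \<le> P"
proof (rule ccontr)
  assume "\<not> norm g \<le> P"
  then have g: "norm g > P" "norm g > 0" using P by auto
  have "(u has_derivative (\<lambda>h. g \<bullet> h)) (at (x + 0 *\<^sub>R (- g)))" using der by simp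
  from line_has_derivative[OF this]
  have "((\<lambda>t. u (x + t *\<^sub>R (- g))) has_real_derivative - (norm g)\<^sup>2) (at 0)"
    by (simp add: power2_norm_eq_inner)
  then have "((\<lambda>t. - u (x + t *\<^sub>R (- g)) - P * norm g * t) has_real_derivative (norm g)\<^sup>2 - P * norm g) (at 0)"
    by (auto intro!: derivative_eq_intros)
  moreover have "(norm g)\<^sup>2 - P * norm g > 0"
    using mult_strict_right_mono[OF g] by (simp only: power2_eq_square diff_gt_0_iff_gt)
  ultimately have "\<exists>d>0. \<forall>t>0. t < d \<longrightarrow> - u (x + 0 *\<^sub>R (- g)) - P * norm g * 0
      < - u (x + (0 + t) *\<^sub>R (- g)) - P * norm g * (0 + t)"
    by (rule DERIV_pos_inc_right)
  then obtain d where d: "d > 0"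
    "\<And>t. 0 < t \<Longrightarrow> t < d \<Longrightarrow> - u x < - u (x + t *\<^sub>R (- g)) - P * norm g * t"
    by auto
  define t where "t = min (d / 2) (r / norm g)"
  have t: "0 < t" "t < d" using d(1) r g by (auto simp: t_def)
  have "t \<le> r / norm g" by (simp add: t_def)
  then have tr: "t * norm g \<le> r" using g(2) by (simp only: pos_le_divide_eq)
  have "norm (x - (x + t *\<^sub>R (- g))) = t * norm g" using t by simp
  then have "u x - u (x + t *\<^sub>R (- g)) \<le> P * (t * norm g)" using bound[of "x + t *\<^sub>R (- g)"] tr by metis
  moreover have "P * (t * norm g) = P * norm g * t" by simp
  ultimately show False using d(2)[OF t] by linarith
qed

section \<open>The interior gradient estimate\<close>

lemma tcoef_le: "tcoef e p \<le> 1 / (slope p)\<^sup>2"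
  unfolding tcoef_def power2_eq_square
  by (intro divide_left_mono mult_left_mono mult_pos_pos) (simp_all add: less_imp_le add_pos_pos)

lemma tcoef_nonneg: "0 \<le> tcoef e p"
  unfolding tcoef_def by (intro divide_nonneg_pos mult_pos_pos add_pos_pos) simp_all

text \<open>Only x is localized, so the gradient at y is exactly axial, and w bounds both the
  tangential part at x and the difference of the gradients. The term with \<open>w ^ 4\<close> is
  \<open>\<phi>1 s / s\<close> times the square of a tangential form of order (w / \<phi>1 s)^2; its
  factor 1 / s is the difficulty of the estimate.\<close>

lemma interior_two_point:
  fixes u :: "'a::euclidean_space \<Rightarrow> real" and \<phi> :: "real \<Rightarrow> real"
  assumes u: "C_on 2 \<Omega> u" "open \<Omega>" "x \<in> \<Omega>" "y \<in> \<Omega>" and mc: "mean_curvature_eq \<Omega> f u"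
    and rhs: "rhs_conditions \<Omega> M0 L1 f" and M0: "0 < M0" and L1: "0 < L1"
    and seg: "closed_segment x y \<subseteq> \<Omega>"
    and uM: "\<bar>u x\<bar> \<le> M0" "\<bar>u y\<bar> \<le> M0" "u y \<le> u x"
    and ne: "x \<noteq> y" and s: "s = norm (x - y)"
    and \<phi>: "\<forall>\<^sub>F r in nhds s. (\<phi> has_real_derivative \<phi>1 r) (at r)" and \<phi>1: "(\<phi>1 has_real_derivative \<phi>2) (at s)"
    and max: "\<forall>\<^sub>F w in nhds (x, y). u (fst w) - u (snd w) - \<phi> (norm (fst w - snd w)) - N * (norm (fst w - x0))\<^sup>2
        \<le> u x - u y - \<phi> (norm (x - y)) - N * (norm (x - x0))\<^sup>2"
    and nonneg: "0 \<le> N" "0 \<le> \<phi> s" "\<phi>2 \<le> 0"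
    and w: "w = 2 * N * norm (x - x0)" and big: "1 \<le> \<phi>1 s" "2 * w \<le> \<phi>1 s"
  shows "- (L1 * (w + s * (1 + \<phi>1 s))) \<le>
      \<phi>2 / (2 * (\<phi>1 s)\<^sup>2) + 16 * real DIM('a) * w ^ 4 / ((\<phi>1 s) ^ 3 * s) + 2 * real DIM('a) * N"
proof -
  define e where "e = (x - y) /\<^sub>R s"
  have s0: "s > 0" unfolding s using ne by simp
  have e1: "norm e = 1" unfolding e_def norm_scaleR s[symmetric] using s0 by simp
  have ee: "e \<bullet> e = 1" using e1 by (simp add: dot_square_norm)
  have w0: "w \<ge> 0" using nonneg w by simp
  define p where "p = grad u x"
  define q where "q = grad u y"
  obtain Hx where Hx: "(grad u has_derivative Hx) (at x)"
    using C_on_grad_differentiable[OF u(1,2,3) order_refl] unfolding differentiable_def by blast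
  obtain Hy where Hy: "(grad u has_derivative Hy) (at y)"
    using C_on_grad_differentiable[OF u(1,2,4) order_refl] unfolding differentiable_def by blast
  have tpf: "two_point_fun \<phi> 1 0 0 0 0 N x0 x' y' = \<phi> (norm (x' - y')) + N * (norm (x' - x0))\<^sup>2" for x' y'
    by (simp add: two_point_fun_def)
  have max': "\<forall>\<^sub>F w in nhds (x, y). u (fst w) - u (snd w) - two_point_fun \<phi> 1 0 0 0 0 N x0 (fst w) (snd w)
        \<le> u x - u y - two_point_fun \<phi> 1 0 0 0 0 N x0 x y"
    using max unfolding tpf diff_diff_eq add.assoc .
  have E: "(1::real) = 1 + 0 * (norm (x - 0))\<^sup>2 + 0 * (norm (y - 0))\<^sup>2" by simp
  note grads = two_point_max(1,2)[of \<Omega> u x y s e \<phi> \<phi>1 \<phi>2 1 0 0 0 0 N x0 Hx Hy 1, OF u ne s e_def \<phi> \<phi>1 max' Hx Hy E]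
  have p: "p = \<phi>1 s *\<^sub>R e + (2 * N) *\<^sub>R (x - x0)" and q: "q = \<phi>1 s *\<^sub>R e"
    using grads by (simp_all add: p_def q_def)
  have pq: "norm (p - q) = w" unfolding p q using nonneg by (simp add: w)
  have nq: "norm q = \<phi>1 s" unfolding q using big by (simp add: e1)
  have np: "\<phi>1 s / 2 \<le> slope p"
  proof -
    have "norm q \<le> norm p + norm (p - q)" using norm_triangle_ineq4[of p "p - q"] by simp
    then show ?thesis using nq pq big norm_le_slope[of p] by linarith
  qed
  have tq: "tang e q = 0" unfolding q tang_scaleR tang_self[OF e1] by simp
  have tp: "norm (tang e p) \<le> w"
  proof -
    have "tang e p = tang e (p - q)" unfolding tang_diff tq by simp
    then show ?thesis using norm_tang_le[OF e1, of "p - q"] pq by simp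
  qed
  have Z: "norm ((tcoef e p * (tang e p \<bullet> b)) *\<^sub>R tang e p - (tcoef e q * (tang e q \<bullet> b)) *\<^sub>R tang e q)
      \<le> 4 * w\<^sup>2 / (\<phi>1 s)\<^sup>2" if "b \<in> Basis" for b
  proof -
    have 1: "tcoef e p \<le> 4 / (\<phi>1 s)\<^sup>2"
    proof -
      have "(\<phi>1 s / 2)\<^sup>2 \<le> (slope p)\<^sup>2" using np big by (intro power_mono) auto
      then have "1 / (slope p)\<^sup>2 \<le> 1 / (\<phi>1 s / 2)\<^sup>2" using big by (intro divide_left_mono) auto
      then show ?thesis using tcoef_le[of e p] by (simp add: power_divide)
    qed
    have 2: "\<bar>tang e p \<bullet> b\<bar> \<le> w"
      using Cauchy_Schwarz_ineq2[of "tang e p" b] tp that by simp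
    have "norm ((tcoef e p * (tang e p \<bullet> b)) *\<^sub>R tang e p) = tcoef e p * \<bar>tang e p \<bullet> b\<bar> * norm (tang e p)"
      by (simp add: abs_mult tcoef_nonneg)
    also have "\<dots> \<le> 4 / (\<phi>1 s)\<^sup>2 * w * w"
      by (intro mult_mono 1 2 tp mult_nonneg_nonneg tcoef_nonneg w0) auto
    finally show ?thesis unfolding tq by (simp add: power2_eq_square)
  qed
  have ineq: "f (x, u x) * slope p - f (y, u y) * slope q \<le>
      1 * \<phi>2 * (1 / axial_slope e p + 1 / axial_slope e q)\<^sup>2 + real DIM('a) * (1 * \<phi>1 s / s * (4 * w\<^sup>2 / (\<phi>1 s)\<^sup>2)\<^sup>2)
      + 4 * 0 * (norm x + norm y) * \<phi>1 s * ((1 / axial_slope e p + 1 / axial_slope e q)\<^sup>2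
          + 2 * (real DIM('a))\<^sup>2 * w * (1 / slope p + 1 / slope q))
      + 4 * real DIM('a) * 0 * \<phi> s + 2 * real DIM('a) * N"
    by (rule two_point_inequality[of \<Omega> u x y f s e \<phi> \<phi>1 \<phi>2 1 0 0 0 0 N x0 1,
          OF u mc ne s e_def \<phi> \<phi>1 max' E _ nonneg(1,2) _ nonneg(3) _ _ _ p_def q_def tp _ Z])
       (use tq w0 big in simp_all)
  \<comment> \<open>Only the contribution of q is kept; as q is axial, the square of its axial slope
    is \<open>1 + (\<phi>1 s)\<^sup>2\<close>.\<close>
  have good: "\<phi>2 * (1 / axial_slope e p + 1 / axial_slope e q)\<^sup>2 \<le> \<phi>2 / (2 * (\<phi>1 s)\<^sup>2)"
  proof -
    have "q \<bullet> e = \<phi>1 s" by (simp add: q ee)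
    then have "(axial_slope e q)\<^sup>2 = 1 + (\<phi>1 s)\<^sup>2" by (simp add: axial_slope_sq)
    moreover have "1 \<le> (\<phi>1 s)\<^sup>2" using big(1) by simp
    ultimately have "(axial_slope e q)\<^sup>2 \<le> 2 * (\<phi>1 s)\<^sup>2" by linarith
    then have "1 / (2 * (\<phi>1 s)\<^sup>2) \<le> 1 / (axial_slope e q)\<^sup>2" using big by (intro divide_left_mono mult_pos_pos) auto
    also have "\<dots> = (1 / axial_slope e q)\<^sup>2" by (simp add: power_divide)
    also have "\<dots> \<le> (1 / axial_slope e p + 1 / axial_slope e q)\<^sup>2"
      by (rule power_mono) (simp_all add: less_imp_le)
    finally have "\<phi>2 * (1 / axial_slope e p + 1 / axial_slope e q)\<^sup>2 \<le> \<phi>2 * (1 / (2 * (\<phi>1 s)\<^sup>2))"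
      by (rule mult_left_mono_neg) (rule nonneg(3))
    then show ?thesis by simp
  qed
  have cost: "\<phi>1 s / s * (4 * w\<^sup>2 / (\<phi>1 s)\<^sup>2)\<^sup>2 = 16 * w ^ 4 / ((\<phi>1 s) ^ 3 * s)"
  proof -
    have "(4 * w\<^sup>2 / (\<phi>1 s)\<^sup>2)\<^sup>2 = 16 * w ^ 4 / (\<phi>1 s * (\<phi>1 s) ^ 3)"
      unfolding power_divide power_mult_distrib power_mult[symmetric] by (simp flip: power_Suc)
    then show ?thesis using big s0 by (simp add: mult.commute)
  qed
  have "- (L1 * w + (1 * L1 * norm (x - y)) * slope q) \<le> f (x, u x) * slope p - f (y, u y) * slope q"
    using slope_diff[of p q] unfolding pq
    by (intro rhs_slope_difference rhs_bound[OF rhs u(3) uM(1)]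
        rhs_difference[OF rhs u(2,3,4) M0 L1 grad_lip_segment[OF seg] uM])
  moreover have "L1 * s * slope q \<le> L1 * s * (1 + \<phi>1 s)"
    using slope_le[of q] L1 s0 unfolding nq by (intro mult_left_mono) auto
  ultimately have "- (L1 * (w + s * (1 + \<phi>1 s))) \<le> f (x, u x) * slope p - f (y, u y) * slope q"
    unfolding s[symmetric] by (simp add: distrib_left mult.assoc)
  moreover have "real DIM('a) * (1 * \<phi>1 s / s * (4 * w\<^sup>2 / (\<phi>1 s)\<^sup>2)\<^sup>2)
      = 16 * real DIM('a) * w ^ 4 / ((\<phi>1 s) ^ 3 * s)"
    unfolding mult_1 cost by simp
  ultimately show ?thesis using ineq good by simp
qed

text \<open>The compactness argument common to both profiles. A positive maximum over K stays away
  from the border: \<open>2 * M0 \<le> N * R\<^sup>2\<close> keeps x inside the ball,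
  \<open>far\<close> keeps the distance of the points below \<open>s1\<close>, and
  \<open>\<phi> 0 = 0\<close> keeps them apart. The equation enters only through
  \<open>no_max\<close>.\<close>

lemma interior_localized:
  fixes u :: "'a::euclidean_space \<Rightarrow> real" and \<phi> :: "real \<Rightarrow> real"
  assumes cont: "continuous_on \<Omega> u" and ball: "cball x0 (2 * R) \<subseteq> \<Omega>" and R: "0 < R" and s1: "0 < s1" "s1 \<le> R"
    and \<phi>: "continuous_on {0..s1} \<phi>" "\<phi> 0 = 0" "\<And>s. 0 \<le> s \<Longrightarrow> s \<le> s1 \<Longrightarrow> 0 \<le> \<phi> s"
    and M0: "\<And>x. x \<in> \<Omega> \<Longrightarrow> \<bar>u x\<bar> \<le> M0" and N: "2 * M0 \<le> N * R\<^sup>2" "0 \<le> N"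
    and far: "\<And>x y. norm (x - x0) \<le> R \<Longrightarrow> norm (x - y) = s1 \<Longrightarrow> u x - u y \<le> \<phi> s1"
    and no_max: "\<And>x y. norm (x - x0) < R \<Longrightarrow> x \<noteq> y \<Longrightarrow> norm (x - y) < s1 \<Longrightarrow>
        \<phi> (norm (x - y)) + N * (norm (x - x0))\<^sup>2 < u x - u y \<Longrightarrow>
        \<forall>\<^sub>F w in nhds (x, y). u (fst w) - u (snd w) - \<phi> (norm (fst w - snd w)) - N * (norm (fst w - x0))\<^sup>2
        \<le> u x - u y - \<phi> (norm (x - y)) - N * (norm (x - x0))\<^sup>2 \<Longrightarrow> False"
    and y: "norm (x0 - y) \<le> s1"
  shows "u x0 - u y \<le> \<phi> (norm (x0 - y))"
proof (rule ccontr)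
  assume neg: "\<not> u x0 - u y \<le> \<phi> (norm (x0 - y))"
  define K where "K = {w. norm (fst w - x0) \<le> R \<and> norm (fst w - snd w) \<le> s1}"
  define W where "W w = u (fst w) - u (snd w) - \<phi> (norm (fst w - snd w)) - N * (norm (fst w - x0))\<^sup>2" for w
  have in\<Omega>: "fst w \<in> \<Omega>" "snd w \<in> \<Omega>" if "w \<in> K" for w
  proof -
    have "norm (snd w - x0) \<le> norm (fst w - x0) + norm (fst w - snd w)"
      using norm_triangle_ineq4[of "fst w - x0" "fst w - snd w"] by simp
    then have "norm (fst w - x0) \<le> 2 * R" "norm (snd w - x0) \<le> 2 * R" using that s1 R by (auto simp: K_def)
    then show "fst w \<in> \<Omega>" "snd w \<in> \<Omega>" using ball by (auto simp: dist_norm norm_minus_commute subset_iff)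
  qed
  have "compact K"
  proof -
    have "closed K" unfolding K_def by (intro closed_Collect_conj closed_Collect_le continuous_intros)
    moreover have "K \<subseteq> cball x0 (2 * R) \<times> cball x0 (2 * R)"
    proof
      fix w assume "w \<in> K"
      have "norm (snd w - x0) \<le> norm (fst w - x0) + norm (fst w - snd w)"
        using norm_triangle_ineq4[of "fst w - x0" "fst w - snd w"] by simp
      then have "norm (fst w - x0) \<le> 2 * R" "norm (snd w - x0) \<le> 2 * R" using \<open>w \<in> K\<close> s1 R by (auto simp: K_def)
      then show "w \<in> cball x0 (2 * R) \<times> cball x0 (2 * R)"
        by (auto simp: mem_Times_iff dist_norm norm_minus_commute)
    qed
    moreover have "compact (cball x0 (2 * R) \<times> cball x0 (2 * R))" by (intro compact_Times compact_cball)
    ultimately show ?thesis by (metis compact_Int_closed inf.absorb_iff2)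
  qed
  moreover have "(x0, y) \<in> K" using y R by (simp add: K_def)
  moreover have "continuous_on K W" unfolding W_def
  proof (intro continuous_on_diff continuous_on_compose2[OF cont] continuous_on_compose2[OF \<phi>(1)] continuous_intros)
    show "(\<lambda>w. norm (fst w - snd w)) ` K \<subseteq> {0..s1}" by (auto simp: K_def)
  qed (use in\<Omega> in auto)
  ultimately obtain w where wK: "w \<in> K" and wmax: "\<And>w'. w' \<in> K \<Longrightarrow> W w' \<le> W w"
    using continuous_attains_sup[of K W] by blast
  define x' y' where "x' = fst w" and "y' = snd w"
  have pos: "0 < W w" using wmax[OF \<open>(x0, y) \<in> K\<close>] neg by (simp add: W_def)
  have \<phi>0: "0 \<le> \<phi> (norm (x' - y'))" using wK by (intro \<phi>(3)) (auto simp: K_def x'_def y'_def)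
  have W: "W w = u x' - u y' - \<phi> (norm (x' - y')) - N * (norm (x' - x0))\<^sup>2" by (simp add: W_def x'_def y'_def)
  have uu: "u x' - u y' \<le> 2 * M0" using M0[of x'] M0[of y'] in\<Omega>[OF wK] unfolding x'_def y'_def by linarith
  have N0: "0 \<le> N * (norm (x' - x0))\<^sup>2" using N(2) by simp
  have 1: "norm (x' - x0) < R"
  proof (rule ccontr)
    assume "\<not> norm (x' - x0) < R"
    then have "R\<^sup>2 \<le> (norm (x' - x0))\<^sup>2" using R by (intro power_mono) auto
    then have "N * R\<^sup>2 \<le> N * (norm (x' - x0))\<^sup>2" using N(2) by (rule mult_left_mono)
    then show False using pos W uu \<phi>0 N(1) by linarith
  qed
  have 2: "norm (x' - y') < s1"
  proof (rule ccontr)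
    assume "\<not> norm (x' - y') < s1"
    then have eq: "norm (x' - y') = s1" using wK by (auto simp: K_def x'_def y'_def)
    have "u x' - u y' \<le> \<phi> s1" by (rule far[OF less_imp_le[OF 1] eq])
    then show False using pos W N0 eq by simp
  qed
  have 3: "x' \<noteq> y'" using pos W N0 \<phi>(2) by auto
  have nb: "\<forall>\<^sub>F w' in nhds (x', y'). w' \<in> K"
  proof -
    have "open {w'. norm (fst w' - x0) < R \<and> norm (fst w' - snd w') < s1}"
      by (intro open_Collect_conj open_Collect_less continuous_intros)
    moreover have "(x', y') \<in> {w'. norm (fst w' - x0) < R \<and> norm (fst w' - snd w') < s1}" using 1 2 by simp
    ultimately have "\<forall>\<^sub>F w' in nhds (x', y'). w' \<in> {w'. norm (fst w' - x0) < R \<and> norm (fst w' - snd w') < s1}"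
      by (rule eventually_nhds_in_open)
    then show ?thesis by eventually_elim (auto simp: K_def)
  qed
  show False
  proof (rule no_max[OF 1 3 2])
    show "\<phi> (norm (x' - y')) + N * (norm (x' - x0))\<^sup>2 < u x' - u y'" using pos W by linarith
    show "\<forall>\<^sub>F w in nhds (x', y'). u (fst w) - u (snd w) - \<phi> (norm (fst w - snd w)) - N * (norm (fst w - x0))\<^sup>2
        \<le> u x' - u y' - \<phi> (norm (x' - y')) - N * (norm (x' - x0))\<^sup>2"
      using nb by eventually_elim (use wmax in \<open>simp add: W_def[symmetric] W[symmetric]\<close>)
  qed
qed

definition bounded_solution :: "'a::euclidean_space set \<Rightarrow> ('a \<times> real \<Rightarrow> real) \<Rightarrow> ('a \<Rightarrow> real) \<Rightarrow> real \<Rightarrow> real \<Rightarrow> bool" where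
  "bounded_solution \<Omega> f u M0 L1 \<longleftrightarrow> open \<Omega> \<and> C_on 2 \<Omega> u \<and> mean_curvature_eq \<Omega> f u
     \<and> rhs_conditions \<Omega> M0 L1 f \<and> (\<forall>x\<in>\<Omega>. \<bar>u x\<bar> \<le> M0)"

lemma bounded_solution_continuous: "bounded_solution \<Omega> f u M0 L1 \<Longrightarrow> continuous_on \<Omega> u"
  unfolding bounded_solution_def
  by (metis C_on_has_derivative continuous_at_imp_continuous_on has_derivative_continuous one_le_numeral)

lemma segment_in_ball:
  fixes x0 :: "'a::euclidean_space"
  assumes "cball x0 (2 * R) \<subseteq> \<Omega>" "norm (x - x0) \<le> R" "norm (x - y) \<le> R"
  shows "x \<in> \<Omega>" "y \<in> \<Omega>" "closed_segment x y \<subseteq> \<Omega>"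
proof -
  have "norm (y - x0) \<le> norm (x - x0) + norm (x - y)"
    using norm_triangle_ineq4[of "x - x0" "x - y"] by simp
  moreover have "0 \<le> norm (x - y)" by simp
  ultimately have "norm (x - x0) \<le> 2 * R" "norm (y - x0) \<le> 2 * R" using assms(2,3) by linarith+
  then have *: "x \<in> cball x0 (2 * R)" "y \<in> cball x0 (2 * R)" by (auto simp: dist_norm norm_minus_commute)
  then have "closed_segment x y \<subseteq> cball x0 (2 * R)" by (simp add: closed_segment_subset)
  then show "x \<in> \<Omega>" "y \<in> \<Omega>" "closed_segment x y \<subseteq> \<Omega>" using * assms(1) by auto
qed

lemma powr_has_derivative_nhds:
  assumes "0 < (s::real)"
  shows "\<forall>\<^sub>F r in nhds s. ((\<lambda>r. r powr a) has_real_derivative a * r powr (a - 1)) (at r)"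
proof -
  have "\<forall>\<^sub>F r in nhds s. r \<in> {0<..}" by (rule eventually_nhds_in_open) (use assms in auto)
  then show ?thesis by eventually_elim (simp add: has_real_derivative_powr)
qed

text \<open>For a power, s \<phi>'(s) = \<alpha> \<phi>(s), and \<phi>(s) is at most 2 M0 at a
  positive maximum. The gain \<phi>'' / \<phi>'^2 is of order - 1 / (s \<phi>'(s)) and hence beats
  any constant once \<alpha> is small. It also absorbs the term with \<open>w ^ 4\<close>, because
  \<phi>' is at least m, a large number.\<close>

lemma interior_holder:
  fixes R M0 L1 :: real
  assumes R: "0 < R" and M0: "0 < M0" and L1: "0 < L1"
  shows "\<exists>\<alpha> A s0. 0 < \<alpha> \<and> \<alpha> \<le> 1 / 2 \<and> 0 < A \<and> 0 < s0 \<and> s0 \<le> R \<and>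
    (\<forall>\<Omega> f (u :: 'a::euclidean_space \<Rightarrow> real) x0 y. bounded_solution \<Omega> f u M0 L1 \<longrightarrow>
       cball x0 (2 * R) \<subseteq> \<Omega> \<longrightarrow> norm (x0 - y) \<le> s0 \<longrightarrow> u x0 - u y \<le> A * norm (x0 - y) powr \<alpha>)"
proof -
  define n where "n = real DIM('a)"
  have "DIM('a) \<ge> 1" using DIM_positive[where 'a = 'a] by linarith
  then have n1: "n \<ge> 1" unfolding n_def by simp
  define N where "N = 2 * M0 / R\<^sup>2"
  define C0 where "C0 = 2 * N * R"
  have N0: "N > 0" using M0 R by (simp add: N_def)
  have C00: "C0 > 0" using N0 R by (simp add: C0_def)
  \<comment> \<open>Bounds all the terms without a factor 1 / s, by means of
    \<open>s * \<phi>1 s \<le> 2 * M0\<close>.\<close>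
  define C where "C = L1 * (C0 + R + 2 * M0) + 2 * n * N"
  have C: "C > 0" using L1 C00 R M0 N0 n1 by (simp add: C_def add_pos_pos)
  \<comment> \<open>The final inequality is \<open>1 \<le> 16 * \<alpha> * M0 * C\<close>; the 17
    makes it contradictory.\<close>
  define \<alpha> where "\<alpha> = min (1 / 2) (1 / (17 * M0 * C))"
  have \<alpha>: "0 < \<alpha>" "\<alpha> \<le> 1 / 2" using C M0 by (simp_all add: \<alpha>_def)
  have "\<alpha> \<le> 1 / (17 * M0 * C)" by (simp add: \<alpha>_def)
  then have \<alpha>C: "\<alpha> * (17 * M0 * C) \<le> 1" using C M0 by (simp only: pos_le_divide_eq mult_pos_pos zero_less_numeral)
  define m where "m = 1 + 2 * C0 + 128 * n * C0 ^ 4"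
  have m: "m \<ge> 1" "m \<ge> 2 * C0" "m \<ge> 128 * n * C0 ^ 4" using C00 n1 by (simp_all add: m_def)
  \<comment> \<open>Makes the slope of the profile at least m at \<open>s0\<close>; towards 0 the
    slope only grows.\<close>
  define s0 where "s0 = min R (2 * M0 * \<alpha> / m)"
  have s0: "0 < s0" "s0 \<le> R" using R M0 \<alpha> m by (simp_all add: s0_def)
  have "s0 \<le> 2 * M0 * \<alpha> / m" by (simp add: s0_def)
  then have s0m: "s0 * m \<le> 2 * M0 * \<alpha>" using m by (simp add: pos_le_divide_eq)
  \<comment> \<open>Normalizes the profile to \<open>\<phi> s0 = 2 * M0\<close>, so that pairs at
    distance \<open>s0\<close> satisfy the estimate trivially.\<close>
  define A where "A = 2 * M0 / s0 powr \<alpha>"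
  have A: "A > 0" using M0 s0 by (simp add: A_def)
  define \<phi> \<phi>1 where "\<phi> r = A * r powr \<alpha>" and "\<phi>1 r = A * (\<alpha> * r powr (\<alpha> - 1))" for r
  have \<phi>s0: "\<phi> s0 = 2 * M0" using s0 by (simp add: \<phi>_def A_def)
  have "u x0 - u y \<le> A * norm (x0 - y) powr \<alpha>"
    if sol: "bounded_solution \<Omega> f u M0 L1" and ball: "cball x0 (2 * R) \<subseteq> \<Omega>" and y: "norm (x0 - y) \<le> s0"
    for \<Omega> f and u :: "'a \<Rightarrow> real" and x0 y
  proof -
    have u: "open \<Omega>" "C_on 2 \<Omega> u" "mean_curvature_eq \<Omega> f u" "rhs_conditions \<Omega> M0 L1 f"
      and uM: "\<And>x. x \<in> \<Omega> \<Longrightarrow> \<bar>u x\<bar> \<le> M0" using sol by (auto simp: bounded_solution_def)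
    have "u x0 - u y \<le> \<phi> (norm (x0 - y))"
    proof (rule interior_localized[OF bounded_solution_continuous[OF sol] ball R s0 _ _ _ uM _ _ _ _ y])
      show "continuous_on {0..s0} \<phi>" unfolding \<phi>_def
        using \<alpha> by (intro continuous_intros continuous_on_powr') auto
      show "\<phi> 0 = 0" by (simp add: \<phi>_def)
      show "0 \<le> \<phi> s" if "0 \<le> s" "s \<le> s0" for s using A by (simp add: \<phi>_def)
      show "2 * M0 \<le> N * R\<^sup>2" using R by (simp add: N_def)
      show "0 \<le> N" using N0 by simp
      show "u x - u y \<le> \<phi> s0" if "norm (x - x0) \<le> R" "norm (x - y) = s0" for x y
        using uM[OF segment_in_ball(1)[OF ball that(1)]] uM[OF segment_in_ball(2)[OF ball that(1)]] that(2) s0(2)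
        unfolding \<phi>s0 by fastforce
    next
      fix x y assume x: "norm (x - x0) < R" and ne: "x \<noteq> y" and xy: "norm (x - y) < s0"
        and pos: "\<phi> (norm (x - y)) + N * (norm (x - x0))\<^sup>2 < u x - u y"
        and max: "\<forall>\<^sub>F w in nhds (x, y). u (fst w) - u (snd w) - \<phi> (norm (fst w - snd w)) - N * (norm (fst w - x0))\<^sup>2
          \<le> u x - u y - \<phi> (norm (x - y)) - N * (norm (x - x0))\<^sup>2"
      define s where "s = norm (x - y)"
      have s: "0 < s" "s < s0" using ne xy by (simp_all add: s_def)
      have "norm (x - y) \<le> R" using xy s0 by simp
      note in\<Omega> = segment_in_ball[OF ball less_imp_le[OF x] this]
      have \<phi>0: "0 \<le> \<phi> s" using A by (simp add: \<phi>_def)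
      have N0': "0 \<le> N * (norm (x - x0))\<^sup>2" using N0 by simp
      have \<phi>le: "\<phi> s \<le> 2 * M0" using pos N0' uM[OF in\<Omega>(1)] uM[OF in\<Omega>(2)] unfolding s_def by linarith
      have s\<phi>: "s * \<phi>1 s = \<alpha> * \<phi> s" using s by (simp add: \<phi>1_def \<phi>_def powr_diff)
      have \<phi>1m: "m \<le> \<phi>1 s"
      proof -
        have "m \<le> 2 * M0 * \<alpha> / s0" using s0m s0 by (simp add: pos_le_divide_eq mult.commute)
        also have "\<dots> = \<phi>1 s0" using s0 by (simp add: \<phi>1_def A_def powr_diff)
        also have "\<dots> \<le> \<phi>1 s" unfolding \<phi>1_def
          using \<alpha> A s by (intro mult_left_mono powr_mono2') auto
        finally show ?thesis .
      qed
      define \<phi>2 where "\<phi>2 = A * (\<alpha> * ((\<alpha> - 1) * s powr (\<alpha> - 1 - 1)))"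
      have "s powr (\<alpha> - 1 - 1) = s powr (\<alpha> - 1) / s"
        unfolding powr_diff[of s "\<alpha> - 1" 1] using s by simp
      then have \<phi>2: "\<phi>2 = - ((1 - \<alpha>) * \<phi>1 s / s)"
        unfolding \<phi>2_def \<phi>1_def using s by (simp add: field_simps)
      have d1: "\<forall>\<^sub>F r in nhds s. (\<phi> has_real_derivative \<phi>1 r) (at r)"
        using powr_has_derivative_nhds[OF s(1), of \<alpha>] unfolding \<phi>_def \<phi>1_def
        by eventually_elim (rule DERIV_cmult)
      have d2: "(\<phi>1 has_real_derivative \<phi>2) (at s)"
        unfolding \<phi>1_def \<phi>2_def
        by (intro DERIV_cmult has_real_derivative_powr s(1))
      define w where "w = 2 * N * norm (x - x0)"
      have w: "0 \<le> w" "w \<le> C0" using N0 x by (simp_all add: w_def C0_def)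
      have \<phi>1pos: "\<phi>1 s > 0" using \<phi>1m m by linarith
      have \<phi>20: "\<phi>2 \<le> 0" unfolding \<phi>2 using \<alpha> \<phi>1pos s by simp
      have "u y \<le> u x" using pos \<phi>0 N0' unfolding s_def by linarith
      then have ineq: "- (L1 * (w + s * (1 + \<phi>1 s))) \<le>
        \<phi>2 / (2 * (\<phi>1 s)\<^sup>2) + 16 * n * w ^ 4 / ((\<phi>1 s) ^ 3 * s) + 2 * n * N"
        unfolding n_def
        using \<phi>1m m w N0 \<phi>0 \<phi>20
        by (intro interior_two_point[OF u(2,1) in\<Omega>(1,2) u(3,4) M0 L1 in\<Omega>(3) uM[OF in\<Omega>(1)] uM[OF in\<Omega>(2)] _ ne s_def
              d1 d2 max _ _ _ w_def]) auto
      have "L1 * (w + s * (1 + \<phi>1 s)) + 2 * n * N \<le> C"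
      proof -
        have "s * \<phi>1 s \<le> 1 * (2 * M0)" unfolding s\<phi> using \<alpha> \<phi>le \<phi>0 by (intro mult_mono) auto
        then have "w + s * (1 + \<phi>1 s) \<le> C0 + R + 2 * M0" using w s s0 by (simp add: distrib_left)
        then show ?thesis unfolding C_def using L1 by simp
      qed
      moreover have "\<phi>2 / (2 * (\<phi>1 s)\<^sup>2) + 16 * n * w ^ 4 / ((\<phi>1 s) ^ 3 * s) \<le> - 1 / (8 * (s * \<phi>1 s))"
      proof -
        have "16 * n * w ^ 4 \<le> 16 * n * C0 ^ 4"
          using w n1 by (intro mult_left_mono power_mono) auto
        also have "\<dots> \<le> \<phi>1 s / 8" using m(3) \<phi>1m by linarith
        also have "\<dots> \<le> \<phi>1 s * \<phi>1 s / 8" using \<phi>1m m by simp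
        finally have "16 * n * w ^ 4 / ((\<phi>1 s) ^ 3 * s) \<le> (\<phi>1 s * \<phi>1 s / 8) / ((\<phi>1 s) ^ 3 * s)"
          using \<phi>1pos s by (intro divide_right_mono) auto
        also have "\<dots> = 1 / (8 * (s * \<phi>1 s))" using \<phi>1pos s by (simp add: power3_eq_cube)
        finally have 1: "16 * n * w ^ 4 / ((\<phi>1 s) ^ 3 * s) \<le> 1 / (8 * (s * \<phi>1 s))" .
        have "\<phi>2 / (2 * (\<phi>1 s)\<^sup>2) = - ((1 - \<alpha>) / (2 * (s * \<phi>1 s)))"
          unfolding \<phi>2 using \<phi>1pos s by (simp add: power2_eq_square)
        also have "\<dots> \<le> - ((1 / 2) / (2 * (s * \<phi>1 s)))"
          unfolding neg_le_iff_le using \<alpha> \<phi>1pos s by (intro divide_right_mono) auto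
        finally have 2: "\<phi>2 / (2 * (\<phi>1 s)\<^sup>2) \<le> - (1 / (4 * (s * \<phi>1 s)))" by simp
        have "1 / (4 * (s * \<phi>1 s)) = 2 * (1 / (8 * (s * \<phi>1 s)))" by simp
        then show ?thesis using 1 2 by simp
      qed
      ultimately have "1 / (8 * (s * \<phi>1 s)) \<le> C" using ineq by simp
      moreover have "s * \<phi>1 s > 0" using s \<phi>1pos by simp
      ultimately have "1 \<le> C * (8 * (s * \<phi>1 s))" by (simp add: pos_divide_le_eq)
      also have "\<dots> \<le> C * (8 * (\<alpha> * (2 * M0)))"
        unfolding s\<phi> using \<alpha> C \<phi>le by (intro mult_left_mono) auto
      also have "\<dots> < \<alpha> * (17 * M0 * C)" using \<alpha> C M0 by simp
      finally show False using \<alpha>C by simp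
    qed
    then show ?thesis by (simp add: \<phi>_def)
  qed
  then show ?thesis using \<alpha> A s0 by blast
qed

text \<open>With a bounded slope the gain no longer absorbs the cost w^4 / s by itself. At a
  positive maximum, however, the Hoelder bound gives
  \<open>N * (norm (x - x0))\<^sup>2 \<le> A * s powr \<alpha>\<close>, so that w^4 is of order s
  powr (2 \<alpha>). The exponent \<open>1 + 2 * \<alpha>\<close> of the profile makes \<phi>'' of
  the matching order s powr (2 \<alpha> - 1).\<close>

lemma interior_gradient_estimate:
  fixes R M0 L1 :: real
  assumes R: "0 < R" and M0: "0 < M0" and L1: "0 < L1"
  shows "\<exists>P>0. \<forall>\<Omega> f (u :: 'a::euclidean_space \<Rightarrow> real) x0. bounded_solution \<Omega> f u M0 L1 \<longrightarrow>
       cball x0 (3 * R) \<subseteq> \<Omega> \<longrightarrow> norm (grad u x0) \<le> P"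
proof -
  obtain \<alpha> A s0 where \<alpha>: "0 < \<alpha>" "\<alpha> \<le> 1 / 2" and A: "0 < A" and s0: "0 < s0" "s0 \<le> R"
    and holder: "\<And>\<Omega> f (u :: 'a \<Rightarrow> real) x0 y. bounded_solution \<Omega> f u M0 L1 \<Longrightarrow>
       cball x0 (2 * R) \<subseteq> \<Omega> \<Longrightarrow> norm (x0 - y) \<le> s0 \<Longrightarrow> u x0 - u y \<le> A * norm (x0 - y) powr \<alpha>"
    using interior_holder[OF assms, where 'a = 'a] by blast
  define n where "n = real DIM('a)"
  have "DIM('a) \<ge> 1" using DIM_positive[where 'a = 'a] by linarith
  then have n1: "n \<ge> 1" unfolding n_def by simp
  define N where "N = 2 * M0 / R\<^sup>2"
  define C0 where "C0 = 2 * N * R"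
  have N0: "N > 0" using M0 R by (simp add: N_def)
  have C00: "C0 > 0" using N0 R by (simp add: C0_def)
  define C where "C = L1 * (C0 + 2) + 2 * n * N"
  have C: "C > 0" using L1 C00 N0 n1 by (simp add: C_def add_pos_pos)
  \<comment> \<open>The net gain below is at least \<open>\<alpha> / (4 * c)\<close>, which for this
    c exceeds C.\<close>
  define c where "c = \<alpha> / (8 * C + 8)"
  have c: "0 < c" "c \<le> 1" using \<alpha> C by (simp_all add: c_def)
  have cC: "C * (4 * c) < \<alpha>" using \<alpha> C by (simp add: c_def divide_less_eq)
  define K where "K = 2048 * n * N\<^sup>2 * A\<^sup>2 / \<alpha>"
  have K0: "K \<ge> 0" using n1 \<alpha> by (simp add: K_def)
  \<comment> \<open>The summands serve in turn for \<open>1 \<le> \<phi>1 s\<close>,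
    \<open>2 * w \<le> \<phi>1 s\<close>, \<open>s1 \<le> s0\<close>, \<open>s1 \<le> 1\<close>, the
    singular cost, and the comparison with the Hoelder bound at \<open>s1\<close>.\<close>
  define P where "P = 2 + 4 * C0 + c / s0 + c + K + (2 * A / c powr (1 - \<alpha>)) powr (1 / \<alpha>)"
  have P: "2 \<le> P" "4 * C0 \<le> P" "c / s0 \<le> P" "c \<le> P" "K \<le> P" "(2 * A / c powr (1 - \<alpha>)) powr (1 / \<alpha>) \<le> P"
    using C00 c s0 K0 by (simp_all add: P_def add_nonneg_nonneg)
  \<comment> \<open>Since \<open>P * s1 = c\<close> is fixed, the slope times the distance stays
    bounded however large P is.\<close>
  define s1 where "s1 = c / P"
  have s1: "0 < s1" "s1 \<le> s0" "s1 \<le> 1" using c P s0 by (simp_all add: s1_def divide_le_eq mult.commute)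
  have Ps1: "P * s1 = c" using P by (simp add: s1_def)
  \<comment> \<open>Lets the slope of the profile fall from P at 0 to exactly \<open>P / 2\<close>
    at \<open>s1\<close>.\<close>
  define D where "D = P / (2 * s1 powr (2 * \<alpha>))"
  have Ds1: "D * s1 powr (2 * \<alpha>) = P / 2" using s1 by (simp add: D_def)
  have "s1 powr (2 * \<alpha>) \<le> 1" using s1 \<alpha> by (intro powr_le1) auto
  then have DP: "P / 2 \<le> D" using P s1 unfolding D_def by (intro divide_left_mono) auto
  then have D: "D > 0" using P by simp
  define \<phi> \<phi>1 where "\<phi> r = P * r - D / (1 + 2 * \<alpha>) * r powr (1 + 2 * \<alpha>)" and "\<phi>1 r = P - D * r powr (2 * \<alpha>)" for r
  have \<phi>1P: "P / 2 \<le> \<phi>1 r" if "0 \<le> r" "r \<le> s1" for r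
  proof -
    have "D * r powr (2 * \<alpha>) \<le> D * s1 powr (2 * \<alpha>)" using D \<alpha> that by (intro mult_left_mono powr_mono2) auto
    then show ?thesis unfolding \<phi>1_def Ds1 by simp
  qed
  have \<phi>lower: "P / 2 * r \<le> \<phi> r" if "0 \<le> r" "r \<le> s1" for r
  proof -
    have "D / (1 + 2 * \<alpha>) * r powr (1 + 2 * \<alpha>) \<le> D * r powr (1 + 2 * \<alpha>)"
      using D \<alpha> by (intro mult_right_mono) (auto simp: divide_le_eq)
    also have "\<dots> = r * (D * r powr (2 * \<alpha>))" using that by (cases "r = 0") (auto simp: powr_add)
    also have "\<dots> \<le> r * (P / 2)" using \<phi>1P[OF that] that unfolding \<phi>1_def by (intro mult_left_mono) auto
    finally have "D / (1 + 2 * \<alpha>) * r powr (1 + 2 * \<alpha>) \<le> r * (P / 2)" .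
    moreover have "P / 2 * r + r * (P / 2) = P * r" by simp
    ultimately show ?thesis unfolding \<phi>_def by linarith
  qed
  have \<phi>upper: "\<phi> r \<le> P * r" for r unfolding \<phi>_def using D \<alpha> by simp
  have reach: "A * s1 powr \<alpha> \<le> \<phi> s1"
  proof -
    have "2 * A / c powr (1 - \<alpha>) = ((2 * A / c powr (1 - \<alpha>)) powr (1 / \<alpha>)) powr \<alpha>"
      using \<alpha> A c by (simp add: powr_powr)
    also have "\<dots> \<le> P powr \<alpha>" using P(6) \<alpha> by (intro powr_mono2) auto
    finally have "2 * A \<le> P powr \<alpha> * c powr (1 - \<alpha>)" using c by (simp add: divide_le_eq)
    then have "2 * A * c powr \<alpha> \<le> P powr \<alpha> * c powr (1 - \<alpha>) * c powr \<alpha>" by (rule mult_right_mono) simp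
    also have "\<dots> = P powr \<alpha> * c" using c by (simp add: mult.assoc flip: powr_add)
    finally have "A * (c powr \<alpha> / P powr \<alpha>) \<le> c / 2" using P by (simp add: divide_le_eq mult_ac)
    then have "A * s1 powr \<alpha> \<le> c / 2" unfolding s1_def using c P by (simp add: powr_divide)
    also have "\<dots> = P / 2 * s1" using Ps1 by simp
    also have "\<dots> \<le> \<phi> s1" by (rule \<phi>lower) (use s1 in auto)
    finally show ?thesis .
  qed
  have "norm (grad u x0) \<le> P"
    if sol: "bounded_solution \<Omega> f u M0 L1" and ball: "cball x0 (3 * R) \<subseteq> \<Omega>"
    for \<Omega> f and u :: "'a \<Rightarrow> real" and x0
  proof -
    have u: "open \<Omega>" "C_on 2 \<Omega> u" "mean_curvature_eq \<Omega> f u" "rhs_conditions \<Omega> M0 L1 f"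
      and uM: "\<And>x. x \<in> \<Omega> \<Longrightarrow> \<bar>u x\<bar> \<le> M0" using sol by (auto simp: bounded_solution_def)
    have ball2: "cball x0 (2 * R) \<subseteq> \<Omega>" 
    proof (rule order_trans[OF subset_cball ball])
      show "2 * R \<le> 3 * R" using R by simp
    qed
    \<comment> \<open>The Hoelder bound is applied around x instead of x0, which takes up the third
      R.\<close>
    have hold: "u x - u y \<le> A * norm (x - y) powr \<alpha>" if "norm (x - x0) \<le> R" "norm (x - y) \<le> s0" for x y
    proof (rule holder[OF sol _ that(2)])
      have "cball x (2 * R) \<subseteq> cball x0 (3 * R)"
        using that(1) by (intro subsetI) (smt (verit) dist_norm dist_triangle mem_cball norm_minus_commute)
      then show "cball x (2 * R) \<subseteq> \<Omega>" using ball by blast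
    qed
    have diff: "u x0 - u y \<le> \<phi> (norm (x0 - y))" if y: "norm (x0 - y) \<le> s1" for y
    proof (rule interior_localized[OF bounded_solution_continuous[OF sol] ball2 R s1(1) _ _ _ _ uM _ _ _ _ y])
      show "s1 \<le> R" using s1 s0 by simp
      show "continuous_on {0..s1} \<phi>" unfolding \<phi>_def
        using \<alpha> by (intro continuous_intros continuous_on_powr') auto
      show "\<phi> 0 = 0" by (simp add: \<phi>_def)
      show "0 \<le> \<phi> s" if "0 \<le> s" "s \<le> s1" for s
        using \<phi>lower[OF that] P that by (smt (verit) divide_nonneg_nonneg mult_nonneg_nonneg)
      show "2 * M0 \<le> N * R\<^sup>2" using R by (simp add: N_def)
      show "0 \<le> N" using N0 by simp
      show "u x - u y \<le> \<phi> s1" if "norm (x - x0) \<le> R" "norm (x - y) = s1" for x y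
        using hold[OF that(1), of y] that(2) s1 reach by simp
    next
      fix x y assume x: "norm (x - x0) < R" and ne: "x \<noteq> y" and xy: "norm (x - y) < s1"
        and pos: "\<phi> (norm (x - y)) + N * (norm (x - x0))\<^sup>2 < u x - u y"
        and max: "\<forall>\<^sub>F w in nhds (x, y). u (fst w) - u (snd w) - \<phi> (norm (fst w - snd w)) - N * (norm (fst w - x0))\<^sup>2
          \<le> u x - u y - \<phi> (norm (x - y)) - N * (norm (x - x0))\<^sup>2"
      define s where "s = norm (x - y)"
      have s: "0 < s" "s < s1" "s \<le> s1" using ne xy by (simp_all add: s_def)
      have "norm (x - y) \<le> R" using xy s0 s1 by simp
      note in\<Omega> = segment_in_ball[OF ball2 less_imp_le[OF x] this]
      have \<phi>0: "0 \<le> \<phi> s" using \<phi>lower[OF less_imp_le[OF s(1)] s(3)] P s by (smt (verit) divide_nonneg_nonneg mult_nonneg_nonneg)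
      have N0': "0 \<le> N * (norm (x - x0))\<^sup>2" using N0 by simp
      have \<phi>1m: "P / 2 \<le> \<phi>1 s" by (rule \<phi>1P) (use s in auto)
      have \<phi>1le: "\<phi>1 s \<le> P" unfolding \<phi>1_def using D by simp
      have \<phi>1pos: "\<phi>1 s > 0" using \<phi>1m P by linarith
      define \<sigma> where "\<sigma> = s powr (2 * \<alpha> - 1)"
      have \<sigma>: "\<sigma> > 0" using s by (simp add: \<sigma>_def)
      define \<phi>2 where "\<phi>2 = - (2 * \<alpha> * D * \<sigma>)"
      have d1: "\<forall>\<^sub>F r in nhds s. (\<phi> has_real_derivative \<phi>1 r) (at r)"
        using powr_has_derivative_nhds[OF s(1), of "1 + 2 * \<alpha>"] unfolding \<phi>_def \<phi>1_def
      proof eventually_elim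
        case (elim r)
        have "((\<lambda>r. P * r - D / (1 + 2 * \<alpha>) * r powr (1 + 2 * \<alpha>)) has_real_derivative
           P * 1 - D / (1 + 2 * \<alpha>) * ((1 + 2 * \<alpha>) * r powr (1 + 2 * \<alpha> - 1))) (at r)"
          by (intro DERIV_diff DERIV_cmult elim DERIV_ident)
        then show ?case using \<alpha> by simp
      qed
      have d2: "(\<phi>1 has_real_derivative \<phi>2) (at s)"
      proof -
        have "(\<phi>1 has_real_derivative 0 - D * (2 * \<alpha> * s powr (2 * \<alpha> - 1))) (at s)"
          unfolding \<phi>1_def by (intro DERIV_diff DERIV_cmult has_real_derivative_powr s(1) DERIV_const)
        then show ?thesis by (simp add: \<phi>2_def \<sigma>_def mult_ac)
      qed
      define w where "w = 2 * N * norm (x - x0)"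
      have w: "0 \<le> w" "w \<le> C0" using N0 x by (simp_all add: w_def C0_def)
      \<comment> \<open>Positivity of the maximum together with the Hoelder bound makes the
        localization gradient small with s.\<close>
      have w4: "w ^ 4 \<le> 16 * N\<^sup>2 * A\<^sup>2 * (s * \<sigma>)"
      proof -
        have "N * (norm (x - x0))\<^sup>2 \<le> A * s powr \<alpha>"
          using pos \<phi>0 hold[OF less_imp_le[OF x], of y] xy s1 unfolding s_def by linarith
        then have "(4 * N) * (N * (norm (x - x0))\<^sup>2) \<le> (4 * N) * (A * s powr \<alpha>)"
          using N0 by (intro mult_left_mono) auto
        then have "w\<^sup>2 \<le> 4 * N * A * s powr \<alpha>" unfolding w_def power_mult_distrib by (simp add: power2_eq_square mult_ac)
        then have "(w\<^sup>2)\<^sup>2 \<le> (4 * N * A * s powr \<alpha>)\<^sup>2" by (intro power_mono) auto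
        moreover have "(s powr \<alpha>)\<^sup>2 = s * \<sigma>"
          unfolding \<sigma>_def using s by (simp add: power2_eq_square powr_diff flip: powr_add)
        ultimately show ?thesis unfolding power_mult_distrib by (simp flip: power_mult)
      qed
      have \<phi>20: "\<phi>2 \<le> 0" unfolding \<phi>2_def using \<alpha> D \<sigma> by simp
      have "u y \<le> u x" using pos \<phi>0 N0' unfolding s_def by linarith
      then have ineq: "- (L1 * (w + s * (1 + \<phi>1 s))) \<le>
        \<phi>2 / (2 * (\<phi>1 s)\<^sup>2) + 16 * n * w ^ 4 / ((\<phi>1 s) ^ 3 * s) + 2 * n * N"
        unfolding n_def
        using \<phi>1m w N0 \<phi>0 \<phi>20 P
        by (intro interior_two_point[OF u(2,1) in\<Omega>(1,2) u(3,4) M0 L1 in\<Omega>(3) uM[OF in\<Omega>(1)] uM[OF in\<Omega>(2)] _ ne s_def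
              d1 d2 max _ _ _ w_def]) auto
      have "L1 * (w + s * (1 + \<phi>1 s)) + 2 * n * N \<le> C"
      proof -
        have "s * (1 + \<phi>1 s) \<le> s1 * (1 + P)" using s \<phi>1le \<phi>1pos by (intro mult_mono) auto
        also have "\<dots> \<le> 2" using Ps1 s1 c by (simp add: distrib_left mult.commute)
        finally show ?thesis unfolding C_def using L1 w by simp
      qed
      moreover have "\<phi>2 / (2 * (\<phi>1 s)\<^sup>2) + 16 * n * w ^ 4 / ((\<phi>1 s) ^ 3 * s) \<le> - (\<alpha> / (4 * c))"
      proof -
        have "16 * n * w ^ 4 / ((\<phi>1 s) ^ 3 * s) \<le> 16 * n * (16 * N\<^sup>2 * A\<^sup>2 * (s * \<sigma>)) / ((\<phi>1 s) ^ 3 * s)"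
          using w4 n1 \<phi>1pos s by (intro divide_right_mono mult_left_mono) auto
        also have "\<dots> = (256 * n * N\<^sup>2 * A\<^sup>2 / \<phi>1 s) * (\<sigma> / (\<phi>1 s)\<^sup>2)"
          using s \<phi>1pos by (simp add: power3_eq_cube power2_eq_square)
        also have "\<dots> \<le> (\<alpha> * D / 2) * (\<sigma> / (\<phi>1 s)\<^sup>2)"
        proof (rule mult_right_mono)
          have "256 * n * N\<^sup>2 * A\<^sup>2 = \<alpha> / 8 * K" using \<alpha> by (simp add: K_def)
          also have "\<dots> \<le> \<alpha> / 8 * P" using P \<alpha> by (intro mult_left_mono) auto
          also have "\<dots> \<le> \<alpha> / 8 * (P * P)" using P \<alpha> by (intro mult_left_mono) auto
          also have "\<dots> \<le> \<alpha> / 8 * ((2 * D) * (2 * \<phi>1 s))"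
            using DP \<phi>1m P \<alpha> by (intro mult_left_mono mult_mono) auto
          also have "\<dots> = \<alpha> * D / 2 * \<phi>1 s" by simp
          finally show "256 * n * N\<^sup>2 * A\<^sup>2 / \<phi>1 s \<le> \<alpha> * D / 2" using \<phi>1pos by (simp only: pos_divide_le_eq)
          show "0 \<le> \<sigma> / (\<phi>1 s)\<^sup>2" using \<sigma> by simp
        qed
        finally have 1: "16 * n * w ^ 4 / ((\<phi>1 s) ^ 3 * s) \<le> (\<alpha> * D / 2) * (\<sigma> / (\<phi>1 s)\<^sup>2)" .
        have 2: "\<phi>2 / (2 * (\<phi>1 s)\<^sup>2) = - (\<alpha> * D * (\<sigma> / (\<phi>1 s)\<^sup>2))" unfolding \<phi>2_def by simp
        \<comment> \<open>As \<open>2 * \<alpha> - 1 \<le> 0\<close>, the factor \<sigma> is at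
          least its value for \<open>s1\<close>, where the gain is a multiple of
          \<open>1 / (P * s1) = 1 / c\<close>.\<close>
        have "\<alpha> / (4 * c) = \<alpha> / 2 * ((P / (2 * s1)) / P\<^sup>2)"
          using P s1 by (simp add: s1_def power2_eq_square)
        also have "P / (2 * s1) = D * s1 powr (2 * \<alpha> - 1)"
          using s1 by (simp add: D_def powr_diff)
        also have "\<alpha> / 2 * (D * s1 powr (2 * \<alpha> - 1) / P\<^sup>2) \<le> \<alpha> / 2 * (D * \<sigma> / (\<phi>1 s)\<^sup>2)"
        proof (intro mult_left_mono frac_le power_mono)
          show "s1 powr (2 * \<alpha> - 1) \<le> \<sigma>" unfolding \<sigma>_def using s \<alpha> by (intro powr_mono2') auto
        qed (use D \<sigma> \<phi>1le \<phi>1pos \<alpha> in auto)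
        finally have "\<alpha> / (4 * c) \<le> (\<alpha> * D / 2) * (\<sigma> / (\<phi>1 s)\<^sup>2)" by simp
        then show ?thesis using 1 2 by simp
      qed
      ultimately have "\<alpha> / (4 * c) \<le> C" using ineq by simp
      then have "\<alpha> \<le> C * (4 * c)" using c by (simp add: pos_divide_le_eq)
      then show False using cC by simp
    qed
    have "x0 \<in> \<Omega>" using ball R by auto
    show ?thesis
    proof (rule gradient_bound_from_difference[OF C_on_has_derivative[OF u(2,1) \<open>x0 \<in> \<Omega>\<close>] s1(1)])
      show "u x0 - u y \<le> P * norm (x0 - y)" if "norm (x0 - y) \<le> s1" for y
        using diff[OF that] \<phi>upper order_trans by blast
    qed (use P in auto)
  qed
  moreover have "P > 0" using P by simp
  ultimately show ?thesis by blast
qed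

text \<open>A ball around a point of \<open>\<Omega>\<close> that leaves \<open>\<Omega>\<close> is
  connected and hence meets the boundary.\<close>

lemma ball_subset_of_frontier_distance:
  fixes \<Omega> :: "'a::euclidean_space set"
  assumes "open \<Omega>" "x \<in> \<Omega>" "\<And>y. y \<in> frontier \<Omega> \<Longrightarrow> d \<le> dist x y"
  shows "ball x d \<subseteq> \<Omega>"
proof (rule ccontr)
  assume "\<not> ball x d \<subseteq> \<Omega>"
  then have "ball x d \<inter> - \<Omega> \<noteq> {}" by auto
  moreover have "d > 0"
    using \<open>\<not> ball x d \<subseteq> \<Omega>\<close> by (metis ball_empty empty_subsetI not_le)
  then have "x \<in> ball x d \<inter> \<Omega>" using assms(2) by simp
  then have "ball x d \<inter> \<Omega> \<noteq> {}" by blast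
  ultimately have "ball x d \<inter> frontier \<Omega> \<noteq> {}"
    by (metis Diff_eq connected_Int_frontier connected_ball)
  then obtain y where "y \<in> frontier \<Omega>" "dist x y < d" by auto
  then show False using assms(3) by fastforce
qed

text \<open>The constant is chosen for each \<delta>, M0, L1 before the domain appears. With radius
  \<delta> / 4 the interior estimate needs the closed ball of radius 3 \<delta> / 4, which lies in
  the open ball of radius \<delta>.\<close>

lemma interior_gradient_bound_exists:
  "\<exists>M1. interior_gradient_bound TYPE('n::finite) M1"
proof -
  have "\<exists>P>0. \<forall>\<Omega> f (u :: real ^ 'n \<Rightarrow> real) x0. bounded_solution \<Omega> f u M0 L1 \<longrightarrow>
       cball x0 (3 * (\<delta> / 4)) \<subseteq> \<Omega> \<longrightarrow> norm (grad u x0) \<le> P" if "0 < \<delta>" "0 < M0" "0 < L1" for \<delta> M0 L1 :: real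
    by (rule interior_gradient_estimate) (use that in auto)
  then obtain M1 where M1: "\<And>\<delta> M0 L1 :: real. 0 < \<delta> \<Longrightarrow> 0 < M0 \<Longrightarrow> 0 < L1 \<Longrightarrow> 0 < M1 \<delta> M0 L1 \<and>
      (\<forall>\<Omega> f (u :: real ^ 'n \<Rightarrow> real) x0. bounded_solution \<Omega> f u M0 L1 \<longrightarrow>
       cball x0 (3 * (\<delta> / 4)) \<subseteq> \<Omega> \<longrightarrow> norm (grad u x0) \<le> M1 \<delta> M0 L1)" by metis
  have "norm (grad u x) \<le> M1 (setdist \<Omega>' (frontier \<Omega>)) M0 L1"
    if M0: "0 < M0" and L1: "0 < L1" and \<Omega>: "bounded_domain \<Omega>" and u: "C_on 3 \<Omega> u" "\<forall>x\<in>\<Omega>. \<bar>u x\<bar> \<le> M0"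
      and rhs: "rhs_conditions \<Omega> M0 L1 f" and mc: "mean_curvature_eq \<Omega> f u"
      and \<Omega>': "bounded_domain \<Omega>'" "closure \<Omega>' \<subseteq> \<Omega>" and x: "x \<in> \<Omega>'"
    for M0 L1 and \<Omega> \<Omega>' :: "(real ^ 'n) set" and f u x
  proof -
    define \<delta> where "\<delta> = setdist \<Omega>' (frontier \<Omega>)"
    have o: "open \<Omega>" using \<Omega> by (simp add: bounded_domain_def)
    have ne: "frontier \<Omega> \<noteq> {}"
      using \<Omega> by (auto simp: bounded_domain_def frontier_eq_empty)
    have cpt: "compact (closure \<Omega>')" using \<Omega>' by (simp add: bounded_domain_def compact_closure)
    have "closure \<Omega>' \<inter> frontier \<Omega> = {}" using \<Omega>'(2) o by (auto simp: frontier_def interior_open)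
    then have "0 < setdist (closure \<Omega>') (frontier \<Omega>)"
      using cpt ne x setdist_gt_0_compact_closed[OF cpt frontier_closed] by (auto simp: closure_subset)
    then have \<delta>: "0 < \<delta>" by (simp add: \<delta>_def)
    have x\<Omega>: "x \<in> \<Omega>" using x \<Omega>'(2) closure_subset by blast
    have "ball x \<delta> \<subseteq> \<Omega>"
      by (rule ball_subset_of_frontier_distance[OF o x\<Omega>]) (use x in \<open>simp add: \<delta>_def setdist_le_dist\<close>)
    moreover have "cball x (3 * (\<delta> / 4)) \<subseteq> ball x \<delta>" using \<delta> by (simp add: cball_subset_ball_iff)
    ultimately have "cball x (3 * (\<delta> / 4)) \<subseteq> \<Omega>" by blast
    moreover have "bounded_solution \<Omega> f u M0 L1"
      unfolding bounded_solution_def using o mc rhs u C_on_mono[OF u(1), of 2] by simp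
    ultimately show ?thesis using M1[OF \<delta> M0 L1] unfolding \<delta>_def by blast
  qed
  then have "interior_gradient_bound TYPE('n) M1"
    unfolding interior_gradient_bound_def using M1 by blast
  then show ?thesis by blast
qed

section \<open>Geometry of the boundary\<close>

lemma partial_derivs_append: "partial_derivs (bs @ cs) u = partial_derivs bs (partial_derivs cs u)"
  by (induction bs) auto

lemma C_on_partial:
  assumes "C_on (Suc k) S u" "b \<in> Basis"
  shows "C_on k S (partial_derivs [b] u)"
  unfolding C_on_def
proof (intro ballI)
  fix bs :: "'a list" assume "bs \<in> lists Basis"
  then have "bs @ [b] \<in> lists Basis" using assms(2) by simp
  then have "(length (bs @ [b]) < Suc k \<longrightarrow> partial_derivs (bs @ [b]) u differentiable_on S) \<and>
        (length (bs @ [b]) \<le> Suc k \<longrightarrow> continuous_on S (partial_derivs (bs @ [b]) u))"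
    using assms(1) unfolding C_on_def by blast
  then show "(length bs < k \<longrightarrow> partial_derivs bs (partial_derivs [b] u) differentiable_on S) \<and>
        (length bs \<le> k \<longrightarrow> continuous_on S (partial_derivs bs (partial_derivs [b] u)))"
    unfolding partial_derivs_append by simp
qed

lemma norm_bounded_on_cball:
  fixes F :: "'a::euclidean_space \<Rightarrow> 'b::real_normed_vector"
  assumes "continuous_on UNIV F"
  obtains B where "0 \<le> B" "\<And>w. w \<in> cball x r \<Longrightarrow> norm (F w) \<le> B"
proof -
  have "compact (F ` cball x r)"
    by (rule compact_continuous_image[OF continuous_on_subset[OF assms] compact_cball]) simp
  then have "bounded (F ` cball x r)" by (rule compact_imp_bounded)
  then obtain B where "B > 0" "\<And>w. w \<in> cball x r \<Longrightarrow> norm (F w) \<le> B"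
    unfolding bounded_pos by auto
  then show ?thesis using that[of B] by auto
qed

lemma C1_lipschitz_on_cball:
  fixes h :: "'a::euclidean_space \<Rightarrow> real"
  assumes "C_on 1 UNIV h"
  obtains B where "0 \<le> B" "\<And>v w. v \<in> cball x r \<Longrightarrow> w \<in> cball x r \<Longrightarrow> \<bar>h v - h w\<bar> \<le> B * norm (v - w)"
proof -
  obtain B where B: "0 \<le> B" "\<And>w. w \<in> cball x r \<Longrightarrow> norm (grad h w) \<le> B"
    using norm_bounded_on_cball[OF C_on_grad_continuous[OF assms order_refl], of x r] by blast
  have "\<bar>h v - h w\<bar> \<le> B * norm (v - w)" if vw: "v \<in> cball x r" "w \<in> cball x r" for v w
  proof -
    have "norm (h v - h w) \<le> B * norm (v - w)"
    proof (rule differentiable_bound[where S = "cball x r" and f = h and f' = "\<lambda>y v. grad h y \<bullet> v"])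
      show "(h has_derivative (\<lambda>v. grad h y \<bullet> v)) (at y within cball x r)" for y
        by (rule has_derivative_at_withinI[OF C_on_has_derivative[OF assms open_UNIV UNIV_I order_refl]])
      show "onorm (\<lambda>v. grad h y \<bullet> v) \<le> B" if y: "y \<in> cball x r" for y
      proof (rule onorm_le)
        show "norm (grad h y \<bullet> v) \<le> B * norm v" for v
          using Cauchy_Schwarz_ineq2[of "grad h y" v] mult_right_mono[OF B(2)[OF y] norm_ge_zero[of v]]
          unfolding real_norm_def by linarith
      qed
    qed (use vw in auto)
    then show ?thesis by simp
  qed
  then show ?thesis using that[OF B(1)] by blast
qed

lemma C2_grad_lipschitz_on_cball:
  fixes g :: "'a::euclidean_space \<Rightarrow> real"
  assumes "C_on 2 UNIV g"
  obtains B where "0 \<le> B" "\<And>v w. v \<in> cball x r \<Longrightarrow> w \<in> cball x r \<Longrightarrow> norm (grad g v - grad g w) \<le> B * norm (v - w)"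
proof -
  have "\<exists>B\<ge>0. \<forall>v\<in>cball x r. \<forall>w\<in>cball x r. \<bar>partial_derivs [b] g v - partial_derivs [b] g w\<bar> \<le> B * norm (v - w)"
    if b: "b \<in> Basis" for b
  proof -
    have "C_on 1 UNIV (partial_derivs [b] g)"
      by (rule C_on_partial[OF _ b]) (use assms in \<open>simp add: numeral_2_eq_2\<close>)
    then show ?thesis using C1_lipschitz_on_cball[of "partial_derivs [b] g" x r] by metis
  qed
  then obtain B where B: "\<And>b. b \<in> Basis \<Longrightarrow> 0 \<le> B b"
    "\<And>b v w. b \<in> Basis \<Longrightarrow> v \<in> cball x r \<Longrightarrow> w \<in> cball x r \<Longrightarrow>
       \<bar>partial_derivs [b] g v - partial_derivs [b] g w\<bar> \<le> B b * norm (v - w)" by metis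
  show ?thesis
  proof (rule that[of "sum B Basis"])
    show "0 \<le> sum B Basis" by (intro sum_nonneg B(1))
    show "norm (grad g v - grad g w) \<le> sum B Basis * norm (v - w)" if vw: "v \<in> cball x r" "w \<in> cball x r" for v w
    proof -
      have "grad g v - grad g w = (\<Sum>b\<in>Basis. (partial_derivs [b] g v - partial_derivs [b] g w) *\<^sub>R b)"
        unfolding grad_partial by (simp add: sum_subtractf scaleR_left_diff_distrib)
      also have "norm \<dots> \<le> (\<Sum>b\<in>Basis. norm ((partial_derivs [b] g v - partial_derivs [b] g w) *\<^sub>R b))"
        by (rule norm_sum)
      also have "\<dots> \<le> (\<Sum>b\<in>Basis. B b * norm (v - w))"
        by (intro sum_mono) (use B(2)[OF _ vw] in \<open>simp del: partial_derivs.simps\<close>)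
      finally show ?thesis by (simp add: sum_distrib_right)
    qed
  qed
qed

lemma C2_taylor_on_cball:
  fixes g :: "'a::euclidean_space \<Rightarrow> real"
  assumes "C_on 2 UNIV g"
  obtains B where "0 \<le> B" "\<And>v w. v \<in> cball x r \<Longrightarrow> w \<in> cball x r \<Longrightarrow>
     \<bar>g w - g v - grad g v \<bullet> (w - v)\<bar> \<le> B * (norm (w - v))\<^sup>2"
proof -
  obtain B where B: "0 \<le> B" "\<And>v w. v \<in> cball x r \<Longrightarrow> w \<in> cball x r \<Longrightarrow> norm (grad g v - grad g w) \<le> B * norm (v - w)"
    using C2_grad_lipschitz_on_cball[OF assms, of x r] by blast
  have "\<bar>g w - g v - grad g v \<bullet> (w - v)\<bar> \<le> B * (norm (w - v))\<^sup>2" if vw: "v \<in> cball x r" "w \<in> cball x r" for v w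
  proof -
    have seg: "closed_segment v w \<subseteq> cball x r" using vw by (simp add: closed_segment_subset)
    let ?f = "\<lambda>y. g y - grad g v \<bullet> y"
    have "norm (?f w - ?f v) \<le> (B * norm (w - v)) * norm (w - v)"
    proof (rule differentiable_bound[where S = "closed_segment v w" and f' = "\<lambda>y h. grad g y \<bullet> h - grad g v \<bullet> h"])
      show "(?f has_derivative (\<lambda>h. grad g y \<bullet> h - grad g v \<bullet> h)) (at y within closed_segment v w)" for y
      proof -
        have "(g has_derivative (\<lambda>h. grad g y \<bullet> h)) (at y)"
          by (rule C_on_has_derivative[OF assms open_UNIV UNIV_I]) simp
        from has_derivative_diff[OF this bounded_linear_imp_has_derivative[OF bounded_linear_inner_right]]
        show ?thesis by (rule has_derivative_at_withinI)
      qed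
      show "onorm (\<lambda>h. grad g y \<bullet> h - grad g v \<bullet> h) \<le> B * norm (w - v)" if y: "y \<in> closed_segment v w" for y
      proof (rule onorm_le)
        fix h :: 'a
        have "norm (y - v) \<le> norm (w - v)" using segment_bound(1)[OF y] by simp
        then have "B * norm (y - v) \<le> B * norm (w - v)" using B(1) by (rule mult_left_mono)
        then have "norm (grad g y - grad g v) \<le> B * norm (w - v)"
          using B(2)[of y v] y seg vw by (meson order_trans subsetD)
        then have "norm (grad g y - grad g v) * norm h \<le> B * norm (w - v) * norm h" by (rule mult_right_mono) simp
        then show "norm (grad g y \<bullet> h - grad g v \<bullet> h) \<le> B * norm (w - v) * norm h"
          unfolding inner_diff_left[symmetric] real_norm_def
          by (rule order_trans[OF Cauchy_Schwarz_ineq2])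
      qed
    qed auto
    then show ?thesis by (simp add: inner_diff_right power2_eq_square algebra_simps)
  qed
  then show ?thesis using that[OF B(1)] by blast
qed

text \<open>A defining function of the epigraph of \<open>g\<close> over the hyperplane orthogonal to \<open>e\<close>.\<close>

definition height :: "'a::euclidean_space \<Rightarrow> ('a \<Rightarrow> real) \<Rightarrow> 'a \<Rightarrow> real" where
  "height e g x = x \<bullet> e - g (tang e x)"

definition height_grad :: "'a::euclidean_space \<Rightarrow> ('a \<Rightarrow> real) \<Rightarrow> 'a \<Rightarrow> 'a" where
  "height_grad e g x = e - tang e (grad g (tang e x))"

lemma height_add_axis:
  assumes "norm e = 1"
  shows "height e g (x + t *\<^sub>R e) = height e g x + t"
proof -
  have "e \<bullet> e = 1" using assms by (simp add: dot_square_norm)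
  then show ?thesis unfolding height_def tang_add tang_scaleR tang_self[OF assms] by (simp add: inner_add_left)
qed

lemma tang_inner_left: "tang e v \<bullet> w = v \<bullet> tang e w"
  unfolding tang_def inner_diff_left inner_diff_right inner_scaleR_left inner_scaleR_right
  by (simp add: inner_commute)

lemma height_grad_axis:
  assumes "norm e = 1"
  shows "height_grad e g x \<bullet> e = 1" "1 \<le> norm (height_grad e g x)"
proof -
  have ee: "e \<bullet> e = 1" using assms by (simp add: dot_square_norm)
  show *: "height_grad e g x \<bullet> e = 1"
    unfolding height_grad_def inner_diff_left tang_inner_left tang_self[OF assms] ee by simp
  show "1 \<le> norm (height_grad e g x)"
    using norm_cauchy_schwarz[of "height_grad e g x" e] * assms by simp
qed

lemma height_continuous:
  assumes "C_on 1 UNIV g"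
  shows "continuous_on UNIV (height e g)"
proof -
  have g: "continuous_on UNIV g"
  proof (rule continuous_at_imp_continuous_on, rule ballI)
    show "isCont g x" for x
      by (rule has_derivative_continuous[OF C_on_has_derivative[OF assms open_UNIV UNIV_I order_refl]])
  qed
  have "continuous_on UNIV (\<lambda>x. x \<bullet> e - g (x - (x \<bullet> e) *\<^sub>R e))"
    by (rule continuous_on_diff[OF _ continuous_on_compose2[OF g]]) (intro continuous_intros subset_UNIV)+
  then show ?thesis unfolding height_def[abs_def] tang_def .
qed

text \<open>One constant serves all base points in the ball; this is what makes the radius of the
  touching balls locally uniform.\<close>

lemma height_taylor:
  assumes "C_on 2 UNIV g" "norm e = 1"
  obtains B where "0 \<le> B" "\<And>v w. v \<in> ball x r \<Longrightarrow> w \<in> ball x r \<Longrightarrow>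
     \<bar>height e g w - height e g v - height_grad e g v \<bullet> (w - v)\<bar> \<le> B * (norm (w - v))\<^sup>2"
proof -
  obtain B where B: "0 \<le> B" "\<And>v w. v \<in> cball (tang e x) r \<Longrightarrow> w \<in> cball (tang e x) r \<Longrightarrow>
     \<bar>g w - g v - grad g v \<bullet> (w - v)\<bar> \<le> B * (norm (w - v))\<^sup>2"
    using C2_taylor_on_cball[OF assms(1), of "tang e x" r] by blast
  have tb: "tang e v \<in> cball (tang e x) r" if "v \<in> ball x r" for v
    using that norm_tang_le[OF assms(2), of "x - v"] by (simp add: dist_norm tang_diff)
  show ?thesis
  proof (rule that[OF B(1)])
    fix v w assume vw: "v \<in> ball x r" "w \<in> ball x r"
    have "height e g w - height e g v - height_grad e g v \<bullet> (w - v)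
        = - (g (tang e w) - g (tang e v) - grad g (tang e v) \<bullet> (tang e w - tang e v))"
      unfolding height_def height_grad_def inner_diff_left tang_inner_left tang_diff
      by (simp add: inner_diff_right inner_commute)
    then have "\<bar>height e g w - height e g v - height_grad e g v \<bullet> (w - v)\<bar>
      \<le> B * (norm (tang e w - tang e v))\<^sup>2" using B(2)[OF tb[OF vw(1)] tb[OF vw(2)]] by simp
    also have "\<dots> \<le> B * (norm (w - v))\<^sup>2"
      unfolding tang_diff[symmetric] by (intro mult_left_mono power_mono norm_tang_le assms B(1)) simp
    finally show "\<bar>height e g w - height e g v - height_grad e g v \<bullet> (w - v)\<bar> \<le> B * (norm (w - v))\<^sup>2" .
  qed
qed

text \<open>By continuity a point of negative height is not in the closure of
  \<open>\<Omega>\<close>; from height 0, moving up along e enters \<open>\<Omega>\<close> at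
  once.\<close>

lemma height_frontier_iff:
  assumes \<Omega>: "open \<Omega>" and g: "C_on 1 UNIV g" and e: "norm e = 1"
    and loc: "\<And>x. x \<in> ball x0 r \<Longrightarrow> x \<in> \<Omega> \<longleftrightarrow> 0 < height e g x" and x: "x \<in> ball x0 r"
  shows "x \<in> frontier \<Omega> \<longleftrightarrow> height e g x = 0"
proof
  assume fr: "x \<in> frontier \<Omega>"
  then have "x \<notin> \<Omega>" using \<Omega> by (auto simp: frontier_def interior_open)
  then have le: "height e g x \<le> 0" using loc[OF x] by simp
  show "height e g x = 0"
  proof (rule ccontr)
    assume "height e g x \<noteq> 0"
    then have neg: "height e g x < 0" using le by simp
    have "open ({y. height e g y < 0} \<inter> ball x0 r)"
      by (intro open_Int open_ball open_Collect_less height_continuous g continuous_on_const)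
    moreover have "x \<in> {y. height e g y < 0} \<inter> ball x0 r" using neg x by simp
    moreover have "x \<in> closure \<Omega>" using fr by (simp add: frontier_def)
    ultimately have "({y. height e g y < 0} \<inter> ball x0 r) \<inter> \<Omega> \<noteq> {}"
      using open_Int_closure_eq_empty by blast
    then show False using loc by fastforce
  qed
next
  assume h: "height e g x = 0"
  then have "x \<notin> \<Omega>" using loc[OF x] by simp
  moreover have "x \<in> closure \<Omega>"
    unfolding closure_approachable
  proof (intro allI impI)
    fix \<epsilon> :: real assume \<epsilon>: "0 < \<epsilon>"
    have dr: "0 < r - dist x0 x" using x by simp
    define t where "t = min \<epsilon> (r - dist x0 x) / 2"
    have t: "0 < t" "t < \<epsilon>" "t < r - dist x0 x" using \<epsilon> dr by (auto simp: t_def min_def)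
    have d: "dist (x + t *\<^sub>R e) x = t" using t e by (simp add: dist_norm)
    have "dist x0 (x + t *\<^sub>R e) \<le> dist x0 x + dist (x + t *\<^sub>R e) x" by (metis dist_commute dist_triangle)
    then have "x + t *\<^sub>R e \<in> ball x0 r" using d t by simp
    then have "x + t *\<^sub>R e \<in> \<Omega>" using loc height_add_axis[OF e, of g x t] h t by simp
    then show "\<exists>y\<in>\<Omega>. dist y x < \<epsilon>" using d t by (intro bexI[of _ "x + t *\<^sub>R e"]) auto
  qed
  ultimately show "x \<in> frontier \<Omega>" using \<Omega> by (simp add: frontier_def interior_open)
qed

text \<open>\<open>inward_unit_normal\<close> constrains \<gamma> only through curves in the
  boundary and through the inward ray. Every vector orthogonal to the gradient of the height is the
  velocity of such a curve, so \<gamma> is parallel to this gradient, and the ray decides the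
  sign.\<close>

lemma inward_unit_normal_eq:
  assumes \<Omega>: "open \<Omega>" and g: "C_on 2 UNIV g" and e: "norm e = 1"
    and loc: "\<And>x. x \<in> ball x0 r \<Longrightarrow> x \<in> \<Omega> \<longleftrightarrow> 0 < height e g x" and x: "x \<in> ball x0 r" "x \<in> frontier \<Omega>"
    and \<gamma>: "inward_unit_normal \<Omega> \<gamma>"
  shows "height_grad e g x = norm (height_grad e g x) *\<^sub>R \<gamma> x"
proof -
  define \<nu> where "\<nu> = height_grad e g x"
  have g1: "C_on 1 UNIV g" by (rule C_on_mono[OF g]) simp
  have \<nu>1: "1 \<le> norm \<nu>" unfolding \<nu>_def by (rule height_grad_axis[OF e])
  have h0: "height e g x = 0" using height_frontier_iff[OF \<Omega> g1 e loc x(1)] x(2) by simp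
  obtain B where B: "0 \<le> B" "\<And>v w. v \<in> ball x0 r \<Longrightarrow> w \<in> ball x0 r \<Longrightarrow>
     \<bar>height e g w - height e g v - height_grad e g v \<bullet> (w - v)\<bar> \<le> B * (norm (w - v))\<^sup>2"
    using height_taylor[OF g e] by blast
  have \<gamma>1: "norm (\<gamma> x) = 1" and \<gamma>t: "\<And>w. w \<in> tangent_vectors (frontier \<Omega>) x \<Longrightarrow> \<gamma> x \<bullet> w = 0"
    and \<gamma>in: "\<forall>\<^sub>F t in at_right 0. x + t *\<^sub>R \<gamma> x \<in> \<Omega>"
    using \<gamma> x(2) by (auto simp: inward_unit_normal_def)
  have tan: "w \<in> tangent_vectors (frontier \<Omega>) x" if w: "\<nu> \<bullet> w = 0" for w
  proof -
    \<comment> \<open>The straight line is moved back to height 0 along e. The correction has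
      derivative 0, so the velocity is still w.\<close>
    define c where "c t = x + t *\<^sub>R w + (- height e g (x + t *\<^sub>R w)) *\<^sub>R e" for t
    have gd: "(g has_derivative (\<lambda>h. grad g (tang e x) \<bullet> h)) (at (tang e x))"
      by (rule C_on_has_derivative[OF g1 open_UNIV UNIV_I order_refl])
    have "((\<lambda>t. g (tang e x + t *\<^sub>R tang e w)) has_real_derivative grad g (tang e x) \<bullet> tang e w) (at 0)"
      by (rule line_has_derivative) (use gd in simp)
    moreover have "((\<lambda>t. (x + t *\<^sub>R w) \<bullet> e) has_real_derivative w \<bullet> e) (at 0)"
      unfolding has_field_derivative_def by (auto intro!: derivative_eq_intros simp: fun_eq_iff)
    ultimately have "((\<lambda>t. (x + t *\<^sub>R w) \<bullet> e - g (tang e x + t *\<^sub>R tang e w)) has_real_derivative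
        w \<bullet> e - grad g (tang e x) \<bullet> tang e w) (at 0)" by (intro DERIV_diff)
    moreover have "w \<bullet> e - grad g (tang e x) \<bullet> tang e w = 0"
      using w unfolding \<nu>_def height_grad_def inner_diff_left tang_inner_left by (simp add: inner_commute)
    ultimately have hd: "((\<lambda>t. height e g (x + t *\<^sub>R w)) has_real_derivative 0) (at 0)"
      unfolding height_def tang_add tang_scaleR by simp
    have cd: "(c has_vector_derivative w) (at 0)"
    proof -
      have "(c has_vector_derivative (0 + (0 *\<^sub>R 0 + 1 *\<^sub>R w)) + ((- height e g (x + 0 *\<^sub>R w)) *\<^sub>R 0 + (- 0) *\<^sub>R e)) (at 0)"
        unfolding c_def
        by (intro has_vector_derivative_add has_vector_derivative_scaleR has_vector_derivative_const DERIV_minus hd DERIV_ident)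
      then show ?thesis by simp
    qed
    have c0: "c 0 = x" by (simp add: c_def h0)
    have "\<forall>\<^sub>F t in nhds 0. c t \<in> ball x0 r"
    proof -
      have "isCont c 0" using cd has_vector_derivative_continuous by blast
      then have "(c \<longlongrightarrow> x) (nhds 0)" using c0 by (simp add: continuous_at tendsto_nhds_iff)
      then show ?thesis using topological_tendstoD[OF _ open_ball x(1)] by blast
    qed
    then have "\<forall>\<^sub>F t in nhds 0. c t \<in> frontier \<Omega>"
    proof eventually_elim
      case (elim t)
      have "height e g (c t) = 0" unfolding c_def height_add_axis[OF e] by simp
      then show ?case using height_frontier_iff[OF \<Omega> g1 e loc elim] by simp
    qed
    then show ?thesis unfolding tangent_vectors_def using c0 cd by blast
  qed
  have \<nu>\<nu>: "\<nu> \<bullet> \<nu> > 0" using \<nu>1 by (auto simp: inner_gt_zero_iff)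
  define a where "a = (\<gamma> x \<bullet> \<nu>) / (\<nu> \<bullet> \<nu>)"
  define w where "w = \<gamma> x - a *\<^sub>R \<nu>"
  have w\<nu>: "\<nu> \<bullet> w = 0" using \<nu>\<nu> unfolding w_def a_def inner_diff_right by (simp add: inner_commute)
  have "w \<bullet> w = \<gamma> x \<bullet> w - a * (\<nu> \<bullet> w)" unfolding w_def by (simp add: inner_diff_left)
  also have "\<dots> = 0" using \<gamma>t[OF tan[OF w\<nu>]] w\<nu> by simp
  finally have \<gamma>a: "\<gamma> x = a *\<^sub>R \<nu>" by (simp add: w_def)
  \<comment> \<open>For a < 0 the height along the inward ray would be at most - k t + B t^2, which
    is negative for small t.\<close>
  have "\<not> a \<le> 0"
  proof
    assume "a \<le> 0"
    moreover have "a \<noteq> 0" using \<gamma>a \<gamma>1 by auto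
    ultimately have a: "a < 0" by simp
    define k where "k = - a * (\<nu> \<bullet> \<nu>)"
    have k: "k > 0" using a \<nu>\<nu> by (simp add: k_def mult_neg_pos)
    have "\<forall>\<^sub>F t in at_right 0. t < k / (B + 1)"
      using k B(1) eventually_at_right_less by (intro eventually_at_rightI[of 0 "k / (B + 1)"]) auto
    moreover have "\<forall>\<^sub>F t in at_right 0. x + t *\<^sub>R \<gamma> x \<in> ball x0 r"
      using eventually_line_in_open[OF open_ball x(1), of "\<gamma> x"] by (simp add: eventually_nhds_conv_at eventually_at_split)
    moreover have "\<forall>\<^sub>F t in at_right (0::real). 0 < t" by (simp add: eventually_at_right_less)
    ultimately have "\<forall>\<^sub>F t in at_right (0::real). False" using \<gamma>in
    proof eventually_elim
      case (elim t)
      have "0 < height e g (x + t *\<^sub>R \<gamma> x)" using loc[OF elim(2)] elim(4) by simp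
      moreover have "\<bar>height e g (x + t *\<^sub>R \<gamma> x) - height e g x - \<nu> \<bullet> (t *\<^sub>R \<gamma> x)\<bar> \<le> B * t\<^sup>2"
        using B(2)[OF x(1) elim(2)] \<gamma>1 unfolding \<nu>_def by simp
      moreover have "\<nu> \<bullet> (t *\<^sub>R \<gamma> x) = - (k * t)" by (simp add: \<gamma>a k_def)
      ultimately have "k * t < B * t\<^sup>2" using h0 by linarith
      then have "k < B * t" using elim(3) by (simp add: power2_eq_square)
      moreover have "t * (B + 1) < k" using elim(1) B(1) by (simp add: pos_less_divide_eq)
      ultimately show False using elim(3) by (simp add: distrib_left mult.commute)
    qed
    then show False by (simp add: trivial_limit_at_right_real)
  qed
  then have "norm (\<gamma> x) = a * norm \<nu>" unfolding \<gamma>a by simp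
  then have "norm \<nu> * a = 1" using \<gamma>1 by (simp add: mult.commute)
  then show ?thesis unfolding \<nu>_def[symmetric] \<gamma>a by simp
qed

section \<open>Charts of the boundary and uniform touching balls\<close>

lemma C_boundaryE:
  assumes "C_boundary 3 \<Omega>" "x0 \<in> frontier \<Omega>"
  obtains r e g where "0 < r" "norm e = 1" "C_on 2 UNIV g"
    "\<And>x. x \<in> ball x0 r \<Longrightarrow> x \<in> \<Omega> \<longleftrightarrow> 0 < height e g x"
proof -
  obtain r e g where r: "r > 0" "norm e = 1" "C_on 3 UNIV g"
    and eq: "\<Omega> \<inter> ball x0 r = {x \<in> ball x0 r. x \<bullet> e > g (x - (x \<bullet> e) *\<^sub>R e)}"
    using bspec[OF assms(1)[unfolded C_boundary_def] assms(2)] by auto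
  have "x \<in> \<Omega> \<longleftrightarrow> 0 < height e g x" if "x \<in> ball x0 r" for x
  proof -
    have "x \<in> \<Omega> \<inter> ball x0 r \<longleftrightarrow> x \<in> ball x0 r \<and> x \<bullet> e > g (x - (x \<bullet> e) *\<^sub>R e)"
      unfolding eq by blast
    then show ?thesis using that by (simp add: height_def tang_def)
  qed
  moreover have "C_on 2 UNIV g" by (rule C_on_mono[OF r(3)]) simp
  ultimately show ?thesis using that r(1,2) by blast
qed

text \<open>A quantitative form of the smoothness of the boundary that avoids differentiating the
  distance function: it yields a Lipschitz normal, a one-sided bound for chords, and the value
  \<rho> of \<open>T\<close> on the boundary.\<close>

definition touching_balls :: "'a::euclidean_space set \<Rightarrow> ('a \<Rightarrow> 'a) \<Rightarrow> real \<Rightarrow> 'a \<Rightarrow> bool" where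
  "touching_balls \<Omega> \<gamma> \<rho> x \<longleftrightarrow>
     ball (x + \<rho> *\<^sub>R \<gamma> x) \<rho> \<subseteq> \<Omega> \<and> ball (x - \<rho> *\<^sub>R \<gamma> x) \<rho> \<inter> \<Omega> = {}"

lemma touching_balls_mono:
  assumes "touching_balls \<Omega> \<gamma> \<rho> x" "\<rho>' \<le> \<rho>" "norm (\<gamma> x) = 1"
  shows "touching_balls \<Omega> \<gamma> \<rho>' x"
proof -
  have "ball (x + \<rho>' *\<^sub>R v) \<rho>' \<subseteq> ball (x + \<rho> *\<^sub>R v) \<rho>" if "norm v = 1" for v
  proof
    fix y assume "y \<in> ball (x + \<rho>' *\<^sub>R v) \<rho>'"
    then have "norm (x + \<rho>' *\<^sub>R v - y) < \<rho>'" by (simp add: dist_norm)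
    moreover have "x + \<rho> *\<^sub>R v - y = (x + \<rho>' *\<^sub>R v - y) + (\<rho> - \<rho>') *\<^sub>R v" by (simp add: algebra_simps)
    then have "norm (x + \<rho> *\<^sub>R v - y) \<le> norm (x + \<rho>' *\<^sub>R v - y) + norm ((\<rho> - \<rho>') *\<^sub>R v)"
      using norm_triangle_ineq by metis
    moreover have "norm ((\<rho> - \<rho>') *\<^sub>R v) = \<rho> - \<rho>'" using assms(2) that by simp
    ultimately show "y \<in> ball (x + \<rho> *\<^sub>R v) \<rho>" by (simp add: dist_norm)
  qed
  from this[of "\<gamma> x"] this[of "- \<gamma> x"] show ?thesis
    using assms(1,3) unfolding touching_balls_def by auto
qed

lemma ball_on_normal:
  fixes x v y :: "'a::real_inner"
  assumes "y \<in> ball (x + \<rho> *\<^sub>R v) \<rho>" "norm v = 1" "0 < \<rho>"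
  shows "(norm (y - x))\<^sup>2 < 2 * \<rho> * (v \<bullet> (y - x))" "norm (y - x) < 2 * \<rho>"
proof -
  have "norm (y - x - \<rho> *\<^sub>R v) < \<rho>" using assms(1) by (simp add: dist_norm norm_minus_commute algebra_simps)
  then have "(norm (y - x - \<rho> *\<^sub>R v))\<^sup>2 < \<rho>\<^sup>2" by (intro power_strict_mono) auto
  moreover have "(norm (y - x - \<rho> *\<^sub>R v))\<^sup>2 = (norm (y - x))\<^sup>2 - 2 * \<rho> * (v \<bullet> (y - x)) + \<rho>\<^sup>2"
  proof -
    define d where "d = y - x"
    have vv: "v \<bullet> v = 1" using assms(2) by (simp add: dot_square_norm)
    have "(norm (d - \<rho> *\<^sub>R v))\<^sup>2 = d \<bullet> d - 2 * \<rho> * (v \<bullet> d) + \<rho>\<^sup>2"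
      unfolding power2_norm_eq_inner inner_diff_left inner_diff_right inner_scaleR_left inner_scaleR_right
        vv inner_commute[of d v] by (simp add: power2_eq_square right_diff_distrib)
    then show ?thesis unfolding d_def power2_norm_eq_inner .
  qed
  ultimately show 1: "(norm (y - x))\<^sup>2 < 2 * \<rho> * (v \<bullet> (y - x))" by linarith
  have "v \<bullet> (y - x) \<le> norm (y - x)" using norm_cauchy_schwarz[of v "y - x"] assms(2) by simp
  then have "2 * \<rho> * (v \<bullet> (y - x)) \<le> 2 * \<rho> * norm (y - x)" using assms(3) by simp
  then have "norm (y - x) * norm (y - x) < 2 * \<rho> * norm (y - x)" using 1 by (simp add: power2_eq_square)
  then show "norm (y - x) < 2 * \<rho>" by (rule mult_right_less_imp_less) simp
qed

text \<open>A point y of a touching ball satisfies |y - x|^2 < 2 \<rho> d, where d is the component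
  of y - x along the axis of the ball, so for small \<rho> the linear part of the height dominates
  the Taylor remainder. The radius is found before \<gamma> is given.\<close>

lemma touching_balls_local:
  assumes \<Omega>: "open \<Omega>" and C: "C_boundary 3 \<Omega>" and x0: "x0 \<in> frontier \<Omega>"
  shows "\<exists>r>0. \<exists>\<rho>>0. \<forall>\<gamma>. inward_unit_normal \<Omega> \<gamma> \<longrightarrow>
    (\<forall>x\<in>frontier \<Omega> \<inter> ball x0 r. touching_balls \<Omega> \<gamma> \<rho> x)"
proof -
  obtain r e g where r: "0 < r" and e: "norm e = 1" and g: "C_on 2 UNIV g"
    and loc: "\<And>x. x \<in> ball x0 r \<Longrightarrow> x \<in> \<Omega> \<longleftrightarrow> 0 < height e g x"
    using C_boundaryE[OF C x0] by blast
  obtain B where B: "0 \<le> B" "\<And>v w. v \<in> ball x0 r \<Longrightarrow> w \<in> ball x0 r \<Longrightarrow>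
     \<bar>height e g w - height e g v - height_grad e g v \<bullet> (w - v)\<bar> \<le> B * (norm (w - v))\<^sup>2"
    using height_taylor[OF g e] by blast
  \<comment> \<open>The first bound keeps the balls inside the chart, the second makes
    \<open>B * (2 * \<rho>)\<close> less than 1.\<close>
  define \<rho> where "\<rho> = min (r / 4) (1 / (2 * (B + 1)))"
  have \<rho>: "0 < \<rho>" using r B by (simp add: \<rho>_def)
  have \<rho>r: "2 * \<rho> \<le> r / 2" by (simp add: \<rho>_def min_def)
  have "\<rho> \<le> 1 / (2 * (B + 1))" by (simp add: \<rho>_def)
  then have \<rho>B: "\<rho> * (2 * (B + 1)) \<le> 1" using B(1) by (simp add: pos_le_divide_eq)
  have "touching_balls \<Omega> \<gamma> \<rho> x"
    if \<gamma>: "inward_unit_normal \<Omega> \<gamma>" and x: "x \<in> frontier \<Omega>" "x \<in> ball x0 (r / 2)" for \<gamma> x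
  proof -
    define \<nu> where "\<nu> = height_grad e g x"
    have xr: "x \<in> ball x0 r" using x(2) r by simp
    have \<gamma>1: "norm (\<gamma> x) = 1" using \<gamma> x(1) by (simp add: inward_unit_normal_def)
    have \<nu>1: "1 \<le> norm \<nu>" unfolding \<nu>_def by (rule height_grad_axis[OF e])
    have \<nu>: "\<nu> = norm \<nu> *\<^sub>R \<gamma> x"
      unfolding \<nu>_def by (rule inward_unit_normal_eq[OF \<Omega> g e loc xr x(1) \<gamma>])
    have h0: "height e g x = 0"
      using height_frontier_iff[OF \<Omega> C_on_mono[OF g] e loc xr] x(1) by simp
    \<comment> \<open>The sign \<sigma> treats the interior and the exterior ball together.\<close>
    have key: "y \<in> ball x0 r \<and> 0 < \<sigma> * height e g y"
      if y: "y \<in> ball (x + \<rho> *\<^sub>R (\<sigma> *\<^sub>R \<gamma> x)) \<rho>" and \<sigma>: "\<sigma> = 1 \<or> \<sigma> = -1" for y \<sigma>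
    proof -
      have "norm (\<sigma> *\<^sub>R \<gamma> x) = 1" using \<sigma> \<gamma>1 by auto
      note b = ball_on_normal[OF y this \<rho>]
      have "dist x0 y \<le> dist x0 x + dist x y" by (rule dist_triangle)
      also have "\<dots> < r / 2 + 2 * \<rho>" using b(2) x(2) by (simp add: dist_norm norm_minus_commute)
      finally have yr: "y \<in> ball x0 r" using \<rho>r by simp
      define d where "d = (\<sigma> *\<^sub>R \<gamma> x) \<bullet> (y - x)"
      have "0 \<le> (norm (y - x))\<^sup>2" by simp
      then have "0 < 2 * \<rho> * d" using b(1) unfolding d_def by linarith
      then have d0: "0 < d" using \<rho> by (simp add: zero_less_mult_iff)
      have "B * (norm (y - x))\<^sup>2 \<le> B * (2 * \<rho> * d)"
        using b(1) B(1) unfolding d_def by (intro mult_left_mono) auto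
      also have "\<dots> < (B + 1) * (2 * \<rho> * d)" using d0 \<rho> by (intro mult_strict_right_mono) auto
      also have "\<dots> = (\<rho> * (2 * (B + 1))) * d" by simp
      also have "\<dots> \<le> 1 * d" using \<rho>B d0 by (intro mult_right_mono) auto
      also have "\<dots> \<le> norm \<nu> * d" using \<nu>1 d0 by (intro mult_right_mono) auto
      also have "\<dots> = \<sigma> * (\<nu> \<bullet> (y - x))" unfolding d_def by (subst (2) \<nu>) simp
      finally have "B * (norm (y - x))\<^sup>2 < \<sigma> * (\<nu> \<bullet> (y - x))" .
      moreover have "\<bar>height e g y - \<nu> \<bullet> (y - x)\<bar> \<le> B * (norm (y - x))\<^sup>2"
        using B(2)[OF xr yr] h0 unfolding \<nu>_def by simp
      ultimately show ?thesis using \<sigma> yr by (auto simp: abs_le_iff)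
    qed
    show ?thesis
      unfolding touching_balls_def
    proof
      show "ball (x + \<rho> *\<^sub>R \<gamma> x) \<rho> \<subseteq> \<Omega>" using key[where \<sigma> = 1] loc by auto
      show "ball (x - \<rho> *\<^sub>R \<gamma> x) \<rho> \<inter> \<Omega> = {}" using key[where \<sigma> = "-1"] loc by fastforce
    qed
  qed
  then show ?thesis using r \<rho> by (intro exI[of _ "r / 2"] conjI exI[of _ \<rho>]) auto
qed

lemma touching_balls_uniform:
  fixes \<Omega> :: "'a::euclidean_space set"
  assumes \<Omega>: "open \<Omega>" "bounded \<Omega>" and C: "C_boundary 3 \<Omega>"
  shows "\<exists>\<rho>>0. \<forall>\<gamma>. inward_unit_normal \<Omega> \<gamma> \<longrightarrow> (\<forall>x\<in>frontier \<Omega>. touching_balls \<Omega> \<gamma> \<rho> x)"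
proof -
  obtain r \<rho> where r: "\<And>x0. x0 \<in> frontier \<Omega> \<Longrightarrow> 0 < r x0" and \<rho>: "\<And>x0. x0 \<in> frontier \<Omega> \<Longrightarrow> 0 < \<rho> x0"
    and tb: "\<And>x0 \<gamma> x. x0 \<in> frontier \<Omega> \<Longrightarrow> inward_unit_normal \<Omega> \<gamma> \<Longrightarrow>
      x \<in> frontier \<Omega> \<inter> ball x0 (r x0) \<Longrightarrow> touching_balls \<Omega> \<gamma> (\<rho> x0) x"
    using touching_balls_local[OF \<Omega>(1) C] by metis
  have "compact (frontier \<Omega>)" using \<Omega>(2) by (rule compact_frontier_bounded)
  then obtain F where F: "F \<subseteq> frontier \<Omega>" "finite F" "frontier \<Omega> \<subseteq> (\<Union>x0\<in>F. ball x0 (r x0))"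
    by (rule compactE_image[where C = "frontier \<Omega>" and f = "\<lambda>x0. ball x0 (r x0)"]) (use r in auto)
  \<comment> \<open>The inserted 1 keeps the minimum meaningful should the cover be empty.\<close>
  define \<rho>0 where "\<rho>0 = Min (insert 1 (\<rho> ` F))"
  have \<rho>0: "0 < \<rho>0" unfolding \<rho>0_def using F(1,2) \<rho> by (subst Min_gr_iff) auto
  have "touching_balls \<Omega> \<gamma> \<rho>0 x" if \<gamma>: "inward_unit_normal \<Omega> \<gamma>" and x: "x \<in> frontier \<Omega>" for \<gamma> x
  proof -
    obtain x0 where x0: "x0 \<in> F" "x \<in> ball x0 (r x0)" using F(3) x by blast
    have "\<rho>0 \<le> \<rho> x0" unfolding \<rho>0_def using F(2) x0(1) by (intro Min_le) auto
    moreover have "touching_balls \<Omega> \<gamma> (\<rho> x0) x" by (rule tb[OF _ \<gamma>]) (use x0 F(1) x in auto)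
    moreover have "norm (\<gamma> x) = 1" using \<gamma> x by (simp add: inward_unit_normal_def)
    ultimately show ?thesis by (metis touching_balls_mono)
  qed
  then show ?thesis using \<rho>0 by blast
qed

section \<open>Quasiconvexity of the domain\<close>

lemma grad_lip_mono: "grad_lip \<Lambda> \<Omega> x y \<Longrightarrow> \<Lambda> \<le> \<Lambda>' \<Longrightarrow> grad_lip \<Lambda>' \<Omega> x y"
  unfolding grad_lip_def by (meson mult_right_mono norm_ge_zero order_trans)

text \<open>Near the boundary two points at distance s are joined by going up along e by M s,
  across, and down again. On the way across the height falls by at most (1 + L) s, which is no more
  than the ascent.\<close>

lemma quasiconvex_local:
  fixes \<Omega> :: "'a::euclidean_space set"
  assumes \<Omega>: "open \<Omega>" and C: "C_boundary 3 \<Omega>" and x0: "x0 \<in> closure \<Omega>"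
  shows "\<exists>r>0. \<exists>\<Lambda>. \<forall>x\<in>\<Omega> \<inter> ball x0 r. \<forall>y\<in>\<Omega> \<inter> ball x0 r. grad_lip \<Lambda> \<Omega> x y"
proof (cases "x0 \<in> \<Omega>")
  case True
  then obtain r where r: "r > 0" "ball x0 r \<subseteq> \<Omega>" using \<Omega> open_contains_ball by blast
  have "grad_lip 1 \<Omega> x y" if "x \<in> ball x0 r" "y \<in> ball x0 r" for x y
    by (rule grad_lip_segment) (use that r(2) in \<open>meson closed_segment_subset convex_ball order_trans\<close>)
  then show ?thesis using r(1) by blast
next
  case False
  then have fr: "x0 \<in> frontier \<Omega>" using x0 \<Omega> by (simp add: frontier_def interior_open)
  obtain r e g where r: "0 < r" and e: "norm e = 1" and g: "C_on 2 UNIV g"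
    and loc: "\<And>x. x \<in> ball x0 r \<Longrightarrow> x \<in> \<Omega> \<longleftrightarrow> 0 < height e g x"
    using C_boundaryE[OF C fr] by blast
  have g1: "C_on 1 UNIV g" by (rule C_on_mono[OF g]) simp
  obtain L where L: "0 \<le> L" "\<And>v w. v \<in> cball (tang e x0) r \<Longrightarrow> w \<in> cball (tang e x0) r \<Longrightarrow> \<bar>g v - g w\<bar> \<le> L * norm (v - w)"
    using C1_lipschitz_on_cball[OF g1, of "tang e x0" r] by blast
  define M where "M = L + 2"
  \<comment> \<open>Leaves room in the chart for an ascent of up to
    \<open>2 * M * r'\<close>.\<close>
  define r' where "r' = r / (1 + 2 * M)"
  have M: "M \<ge> 2" using L by (simp add: M_def)
  have r': "0 < r'" using r M by (simp add: r'_def)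
  have "(1 + 2 * M) * r' = r" unfolding r'_def using M by simp
  then have r'r: "r' + 2 * M * r' = r" by (simp add: distrib_right)
  have hl: "height e g y \<ge> height e g x - (1 + L) * norm (y - x)" if "x \<in> ball x0 r" "y \<in> ball x0 r" for x y
  proof -
    have tb: "tang e v \<in> cball (tang e x0) r" if "v \<in> ball x0 r" for v
      using that norm_tang_le[OF e, of "x0 - v"] by (simp add: dist_norm tang_diff)
    have "\<bar>g (tang e y) - g (tang e x)\<bar> \<le> L * norm (tang e (y - x))"
      unfolding tang_diff by (rule L(2)[OF tb tb]) (use that in auto)
    also have "\<dots> \<le> L * norm (y - x)" by (intro mult_left_mono norm_tang_le e L(1))
    finally have 1: "\<bar>g (tang e y) - g (tang e x)\<bar> \<le> L * norm (y - x)" .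
    have 2: "\<bar>(y - x) \<bullet> e\<bar> \<le> norm (y - x)" using Cauchy_Schwarz_ineq2[of "y - x" e] e by simp
    have "height e g y - height e g x = (y - x) \<bullet> e - (g (tang e y) - g (tang e x))"
      unfolding height_def inner_diff_left by simp
    then show ?thesis using 1 2 by (simp add: distrib_right)
  qed
  have "grad_lip (2 * M + 1) \<Omega> x y" if xy: "x \<in> \<Omega> \<inter> ball x0 r'" "y \<in> \<Omega> \<inter> ball x0 r'" for x y
  proof -
    define s where "s = norm (x - y)"
    define x1 y1 where "x1 = x + (M * s) *\<^sub>R e" and "y1 = y + (M * s) *\<^sub>R e"
    have s0: "0 \<le> s" by (simp add: s_def)
    have "s < 2 * r'"
      using dist_triangle2[of x y x0] xy unfolding s_def by (auto simp: dist_norm norm_minus_commute)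
    then have Ms: "M * s \<le> 2 * M * r'" using M by simp
    have up: "v + t *\<^sub>R e \<in> ball x0 r" if v: "v \<in> ball x0 r'" and t: "0 \<le> t" "t \<le> M * s" for v t
    proof -
      have "dist x0 (v + t *\<^sub>R e) \<le> dist x0 v + dist v (v + t *\<^sub>R e)" by (rule dist_triangle)
      also have "dist v (v + t *\<^sub>R e) = t" using t e by (simp add: dist_norm)
      finally have "dist x0 (v + t *\<^sub>R e) \<le> dist x0 v + t" .
      moreover have "dist x0 v < r'" using v by simp
      ultimately have "dist x0 (v + t *\<^sub>R e) < r" using t(2) Ms r'r by linarith
      then show ?thesis by simp
    qed
    have vert: "closed_segment v (v + (M * s) *\<^sub>R e) \<subseteq> \<Omega>" if v: "v \<in> \<Omega> \<inter> ball x0 r'" for v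
    proof
      fix w assume "w \<in> closed_segment v (v + (M * s) *\<^sub>R e)"
      then obtain t where t: "0 \<le> t" "t \<le> 1" "w = v + (t * (M * s)) *\<^sub>R e"
        unfolding closed_segment_def by (auto simp: algebra_simps)
      have tM: "0 \<le> t * (M * s)" "t * (M * s) \<le> M * s" using t M s0 by (auto simp: mult_left_le_one_le)
      have vr: "v \<in> ball x0 r" using up[of v 0] v M s0 by simp
      have "0 < height e g v" using loc[OF vr] v by simp
      then have "0 < height e g w" unfolding t(3) height_add_axis[OF e] using tM by simp
      then show "w \<in> \<Omega>" using loc[OF up[of v "t * (M * s)"]] v tM t(3) by auto
    qed
    have hor: "closed_segment x1 y1 \<subseteq> \<Omega>"
    proof
      fix w assume w: "w \<in> closed_segment x1 y1"
      have Ms0: "0 \<le> M * s" using M s0 by simp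
      have x1: "x1 \<in> ball x0 r" and y1: "y1 \<in> ball x0 r"
        unfolding x1_def y1_def using up xy Ms0 by auto
      have wr: "w \<in> ball x0 r" using w x1 y1 by (meson closed_segment_subset convex_ball subsetD)
      have xr: "x \<in> ball x0 r" using up[of x 0] xy Ms0 by simp
      have hx: "0 < height e g x" using loc[OF xr] xy by simp
      have "norm (w - x1) \<le> norm (y1 - x1)" by (rule segment_bound(1)[OF w])
      also have "\<dots> = s" unfolding x1_def y1_def s_def by (simp add: norm_minus_commute)
      finally have "(1 + L) * norm (w - x1) \<le> (1 + L) * s" using L(1) by (intro mult_left_mono) auto
      also have "\<dots> \<le> M * s" unfolding M_def using s0 by (intro mult_right_mono) auto
      finally have "(1 + L) * norm (w - x1) \<le> M * s" .
      moreover have "height e g x1 = height e g x + M * s" unfolding x1_def by (rule height_add_axis[OF e])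
      ultimately have "0 < height e g w" using hl[OF x1 wr] hx by linarith
      then show "w \<in> \<Omega>" using loc[OF wr] by simp
    qed
    have g1: "grad_lip 1 \<Omega> x x1" unfolding x1_def by (rule grad_lip_segment[OF vert[OF xy(1)]])
    have g2: "grad_lip 1 \<Omega> y y1" unfolding y1_def by (rule grad_lip_segment[OF vert[OF xy(2)]])
    have g3: "grad_lip 1 \<Omega> x1 y1" by (rule grad_lip_segment[OF hor])
    have n: "norm (x - x1) = M * s" "norm (y - y1) = M * s" "norm (x1 - y1) = s"
      unfolding x1_def y1_def s_def using e M by (auto simp: abs_mult)
    show ?thesis
      unfolding grad_lip_def
    proof (intro allI impI)
      fix h :: "'a \<Rightarrow> real" and K :: real
      assume K: "0 \<le> K" and h: "\<forall>w\<in>\<Omega>. \<bar>h w\<bar> \<le> K \<and> (\<exists>h'. (h has_derivative h') (at w) \<and> (\<forall>v. \<bar>h' v\<bar> \<le> K * norm v))"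
      have "\<bar>h v - h w\<bar> \<le> 1 * K * norm (v - w)" if "grad_lip 1 \<Omega> v w" for v w
        using that[unfolded grad_lip_def, THEN spec, THEN spec, THEN mp, OF K, THEN mp, OF h] .
      from this[OF g1] this[OF g2] this[OF g3]
      have "\<bar>h x - h x1\<bar> \<le> 1 * K * (M * s)" "\<bar>h y - h y1\<bar> \<le> 1 * K * (M * s)" "\<bar>h x1 - h y1\<bar> \<le> 1 * K * s"
        unfolding n .
      then have "\<bar>h x - h y\<bar> \<le> K * (M * s) + K * (M * s) + K * s" by linarith
      also have "\<dots> = (2 * M + 1) * K * norm (x - y)" unfolding s_def by (simp add: algebra_simps)
      finally show "\<bar>h x - h y\<bar> \<le> (2 * M + 1) * K * norm (x - y)" .
    qed
  qed
  then show ?thesis using r' by blast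
qed

text \<open>Pairs closer than a Lebesgue number of the cover lie in a common chart. For distant
  pairs the bound on h itself, which \<open>grad_lip\<close> includes for this purpose, gives the
  constant \<open>2 / \<delta>\<close>.\<close>

lemma quasiconvex_uniform:
  fixes \<Omega> :: "'a::euclidean_space set"
  assumes \<Omega>: "open \<Omega>" "bounded \<Omega>" "\<Omega> \<noteq> {}" and C: "C_boundary 3 \<Omega>"
  shows "\<exists>\<Lambda>\<ge>1. \<forall>x\<in>\<Omega>. \<forall>y\<in>\<Omega>. grad_lip \<Lambda> \<Omega> x y"
proof -
  obtain r \<Lambda> where r: "\<And>x0. x0 \<in> closure \<Omega> \<Longrightarrow> 0 < r x0"
    and gl: "\<And>x0 x y. x0 \<in> closure \<Omega> \<Longrightarrow> x \<in> \<Omega> \<inter> ball x0 (r x0) \<Longrightarrow> y \<in> \<Omega> \<inter> ball x0 (r x0) \<Longrightarrow> grad_lip (\<Lambda> x0) \<Omega> x y"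
    using quasiconvex_local[OF \<Omega>(1) C] by metis
  have cpt: "compact (closure \<Omega>)" using \<Omega>(2) by (simp add: compact_closure)
  then obtain F where F: "F \<subseteq> closure \<Omega>" "finite F" "closure \<Omega> \<subseteq> (\<Union>x0\<in>F. ball x0 (r x0))"
    by (rule compactE_image[where C = "closure \<Omega>" and f = "\<lambda>x0. ball x0 (r x0)"]) (use r in auto)
  have "closure \<Omega> \<noteq> {}" using \<Omega>(3) by simp
  then have "(\<lambda>x0. ball x0 (r x0)) ` F \<noteq> {}" using F(3) by auto
  then obtain \<delta> where \<delta>: "0 < \<delta>" and leb: "\<And>T. T \<subseteq> closure \<Omega> \<Longrightarrow> diameter T < \<delta> \<Longrightarrow> \<exists>B\<in>(\<lambda>x0. ball x0 (r x0)) ` F. T \<subseteq> B"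
    using Lebesgue_number_lemma[OF cpt _ F(3)] by (metis (mono_tags, lifting) image_iff open_ball)
  define \<Lambda>0 where "\<Lambda>0 = Max (insert 1 (insert (2 / \<delta>) (\<Lambda> ` F)))"
  have fin: "finite (insert 1 (insert (2 / \<delta>) (\<Lambda> ` F)))" using F(2) by simp
  have \<Lambda>0: "1 \<le> \<Lambda>0" "2 / \<delta> \<le> \<Lambda>0" "\<And>x0. x0 \<in> F \<Longrightarrow> \<Lambda> x0 \<le> \<Lambda>0"
    unfolding \<Lambda>0_def by (intro Max_ge[OF fin]; simp)+
  have "grad_lip \<Lambda>0 \<Omega> x y" if xy: "x \<in> \<Omega>" "y \<in> \<Omega>" for x y
  proof (cases "norm (x - y) < \<delta>")
    case True
    have "diameter {x, y} \<le> norm (x - y)" by (rule diameter_le) (auto simp: norm_minus_commute)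
    then have "diameter {x, y} < \<delta>" using True by simp
    moreover have "{x, y} \<subseteq> closure \<Omega>" using xy closure_subset by auto
    ultimately obtain x0 where x0: "x0 \<in> F" "{x, y} \<subseteq> ball x0 (r x0)" using leb[of "{x, y}"] by auto
    have "grad_lip (\<Lambda> x0) \<Omega> x y" by (rule gl[of x0]) (use x0 F(1) xy in auto)
    then show ?thesis using \<Lambda>0(3)[OF x0(1)] by (rule grad_lip_mono)
  next
    case False
    show ?thesis
      unfolding grad_lip_def
    proof (intro allI impI)
      fix h :: "'a \<Rightarrow> real" and K :: real
      assume K: "0 \<le> K" and h: "\<forall>w\<in>\<Omega>. \<bar>h w\<bar> \<le> K \<and> (\<exists>h'. (h has_derivative h') (at w) \<and> (\<forall>v. \<bar>h' v\<bar> \<le> K * norm v))"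
      have "\<bar>h x - h y\<bar> \<le> \<bar>h x\<bar> + \<bar>h y\<bar>" by simp
      also have "\<dots> \<le> 2 * K" using conjunct1[OF bspec[OF h xy(1)]] conjunct1[OF bspec[OF h xy(2)]] by linarith
      also have "\<dots> = 2 / \<delta> * K * \<delta>" using \<delta> by simp
      also have "\<dots> \<le> \<Lambda>0 * K * norm (x - y)"
        using \<Lambda>0(1,2) K False \<delta> by (intro mult_mono mult_right_mono) auto
      finally show "\<bar>h x - h y\<bar> \<le> \<Lambda>0 * K * norm (x - y)" .
    qed
  qed
  then show ?thesis using \<Lambda>0(1) by blast
qed

section \<open>The boundary condition\<close>

text \<open>The left-hand side \<open>v powr (q - 1) * (Du \<bullet> \<gamma>)\<close> of the boundary condition for a gradient with normal
  component \<open>t\<close> and tangential part of norm \<open>a\<close>.\<close>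

definition oblique_fun :: "real \<Rightarrow> real \<Rightarrow> real \<Rightarrow> real" where
  "oblique_fun q a t = sqrt (1 + a\<^sup>2 + t\<^sup>2) powr (q - 1) * t"

lemma oblique_weight_mono:
  assumes "1 < q" "\<bar>t\<bar> \<le> \<bar>t'\<bar>"
  shows "sqrt (1 + a\<^sup>2 + t\<^sup>2) powr (q - 1) \<le> sqrt (1 + a\<^sup>2 + t'\<^sup>2) powr (q - 1)"
proof -
  have "t\<^sup>2 \<le> t'\<^sup>2" using assms(2) by (simp add: abs_le_square_iff)
  then show ?thesis using assms(1) by (intro powr_mono2) auto
qed

lemma oblique_weight_ge_1:
  assumes "1 < q"
  shows "1 \<le> sqrt (1 + a\<^sup>2 + t\<^sup>2) powr (q - 1)"
proof (rule ge_one_powr_ge_zero)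
  show "1 \<le> sqrt (1 + a\<^sup>2 + t\<^sup>2)" by simp
qed (use assms in simp)

text \<open>The weight in front of t is at least 1, even, and nondecreasing in the modulus of t. The
  expansion is uniform in a, so the inverse is 1-Lipschitz however large the tangential part
  is.\<close>

lemma oblique_fun_expanding:
  assumes q: "1 < q" and t: "t \<le> t'"
  shows "t' - t \<le> oblique_fun q a t' - oblique_fun q a t"
proof -
  let ?w = "\<lambda>t. sqrt (1 + a\<^sup>2 + t\<^sup>2) powr (q - 1)"
  have w1: "1 \<le> ?w t" "1 \<le> ?w t'" using oblique_weight_ge_1[OF q] by auto
  consider "0 \<le> t" | "t \<le> 0" "0 \<le> t'" | "t' \<le> 0" by linarith
  then show ?thesis
  proof cases
    case 1
    have "0 \<le> (?w t' - ?w t) * t' + (?w t - 1) * (t' - t)"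
      using oblique_weight_mono[OF q, of t t' a] w1 1 t by simp
    then show ?thesis unfolding oblique_fun_def by (simp add: algebra_simps)
  next
    case 2
    have "0 \<le> (?w t' - 1) * t' + (?w t - 1) * (- t)" using w1 2 by (intro add_nonneg_nonneg mult_nonneg_nonneg) auto
    then show ?thesis unfolding oblique_fun_def by (simp add: algebra_simps)
  next
    case 3
    have "0 \<le> (?w t - ?w t') * (- t) + (?w t' - 1) * (t' - t)"
      using oblique_weight_mono[OF q, of t' t a] w1 3 t by (intro add_nonneg_nonneg mult_nonneg_nonneg) auto
    then show ?thesis unfolding oblique_fun_def by (simp add: algebra_simps)
  qed
qed

lemma oblique_fun_0 [simp]: "oblique_fun q a 0 = 0"
  by (simp add: oblique_fun_def)

lemma oblique_fun_minus: "oblique_fun q a (- t) = - oblique_fun q a t"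
  by (simp add: oblique_fun_def)

lemma oblique_fun_surj:
  assumes q: "1 < q"
  shows "\<exists>t. oblique_fun q a t = c"
proof -
  have cont: "continuous_on {- \<bar>c\<bar>..\<bar>c\<bar>} (oblique_fun q a)"
    unfolding oblique_fun_def[abs_def]
    by (intro continuous_intros) (auto simp: add_pos_nonneg sum_power2_eq_zero_iff add_nonneg_eq_0_iff)
  have "\<bar>c\<bar> - 0 \<le> oblique_fun q a \<bar>c\<bar> - oblique_fun q a 0" by (rule oblique_fun_expanding[OF q]) simp
  moreover have "0 - (- \<bar>c\<bar>) \<le> oblique_fun q a 0 - oblique_fun q a (- \<bar>c\<bar>)" by (rule oblique_fun_expanding[OF q]) simp
  ultimately have "oblique_fun q a (- \<bar>c\<bar>) \<le> c" "c \<le> oblique_fun q a \<bar>c\<bar>" unfolding oblique_fun_0 by linarith+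
  from IVT'[OF this _ cont] show ?thesis by auto
qed

text \<open>The value chosen is the only one, because \<open>oblique_fun\<close> is strictly
  increasing in its last argument when \<open>1 < q\<close>.\<close>

definition oblique_inv :: "real \<Rightarrow> real \<Rightarrow> real \<Rightarrow> real" where
  "oblique_inv q a c = (SOME t. oblique_fun q a t = c)"

lemma oblique_inv:
  assumes "1 < q"
  shows "oblique_fun q a (oblique_inv q a c) = c"
  unfolding oblique_inv_def by (rule someI_ex[OF oblique_fun_surj[OF assms]])

lemma oblique_inv_lipschitz:
  assumes q: "1 < q"
  shows "\<bar>oblique_inv q a c - oblique_inv q a c'\<bar> \<le> \<bar>c - c'\<bar>"
  using oblique_fun_expanding[OF q, of "oblique_inv q a c" "oblique_inv q a c'" a]
    oblique_fun_expanding[OF q, of "oblique_inv q a c'" "oblique_inv q a c" a]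
  unfolding oblique_inv[OF q] by linarith

lemma oblique_inv_le:
  assumes q: "1 < q"
  shows "\<bar>oblique_inv q a c\<bar> \<le> \<bar>c\<bar>"
  using oblique_fun_expanding[OF q, of "oblique_inv q a c" 0 a]
    oblique_fun_expanding[OF q, of 0 "oblique_inv q a c" a]
  unfolding oblique_inv[OF q] oblique_fun_0 by linarith

lemma slope_tang: 
  assumes "norm \<gamma> = 1"
  shows "slope p = sqrt (1 + (norm (tang \<gamma> p))\<^sup>2 + (p \<bullet> \<gamma>)\<^sup>2)"
  unfolding slope_def norm_tang_sq[OF assms] by simp

text \<open>Boundary maxima force the gradient to lie below \<open>p\<close> in the direction of the normal, so that
  a strict inequality at \<open>p\<close> contradicts the boundary condition.\<close>

lemma oblique_shift:
  assumes q: "1 < q" and \<gamma>: "norm \<gamma> = 1" and l: "0 \<le> l"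
  shows "slope (p - l *\<^sub>R \<gamma>) powr (q - 1) * ((p - l *\<^sub>R \<gamma>) \<bullet> \<gamma>) \<le> slope p powr (q - 1) * (p \<bullet> \<gamma>)"
proof -
  have gg: "\<gamma> \<bullet> \<gamma> = 1" using \<gamma> by (simp add: dot_square_norm)
  have t: "tang \<gamma> (p - l *\<^sub>R \<gamma>) = tang \<gamma> p"
    unfolding tang_diff tang_scaleR tang_self[OF \<gamma>] by simp
  have i: "(p - l *\<^sub>R \<gamma>) \<bullet> \<gamma> = p \<bullet> \<gamma> - l" by (simp add: inner_diff_left gg)
  have "p \<bullet> \<gamma> - (p \<bullet> \<gamma> - l) \<le> oblique_fun q (norm (tang \<gamma> p)) (p \<bullet> \<gamma>)
      - oblique_fun q (norm (tang \<gamma> p)) (p \<bullet> \<gamma> - l)"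
    by (rule oblique_fun_expanding[OF q]) (use l in simp)
  then show ?thesis
    unfolding slope_tang[OF \<gamma>, of p] slope_tang[OF \<gamma>, of "p - l *\<^sub>R \<gamma>"] t i using l
    by (simp add: oblique_fun_def)
qed

section \<open>Strict violation of the boundary condition\<close>

lemma exp_minus_twice_le:
  fixes z :: real
  assumes "0 \<le> z" "z \<le> 1 / 2"
  shows "exp (- 2 * z) \<le> 1 - z"
proof -
  have "0 \<le> z * (1 - 2 * z)" using assms by simp
  then have "1 \<le> (1 + 2 * z) * (1 - z)" by (simp add: algebra_simps)
  also have "\<dots> \<le> exp (2 * z) * (1 - z)" using assms exp_ge_add_one_self[of "2 * z"] by (intro mult_right_mono) auto
  finally have "1 / exp (2 * z) \<le> 1 - z" by (simp add: divide_le_eq mult.commute)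
  then show ?thesis by (simp add: exp_minus inverse_eq_divide)
qed

lemma ln_one_plus_ge:
  fixes x :: real
  assumes "0 \<le> x"
  shows "x / (1 + x) \<le> ln (1 + x)"
proof -
  have "ln (1 / (1 + x)) \<le> 1 / (1 + x) - 1" by (rule ln_le_minus_one) (use assms in simp)
  moreover have "1 / (1 + x) - 1 = - (x / (1 + x))" using assms by (simp add: field_simps)
  ultimately show ?thesis using assms by (simp add: ln_div)
qed

text \<open>For \<theta> \<ge> 0 the danger is a slope larger than the one for which \<theta> was
  computed. The excess is at most a factor 1 + (C2 + C3) s, whereas a positive normal component is
  smaller than \<theta> by at least a factor exp (- \<tau> / L2); \<open>big\<close> says that the
  latter wins.\<close>

lemma oblique_strict_pos:
  fixes p e \<gamma> err :: "'a::euclidean_space"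
  assumes q: "1 < q" and \<gamma>: "norm \<gamma> = 1" and e: "norm e = 1" and s: "0 < s" and P1: "1 \<le> P"
    and A: "0 \<le> A" "A \<le> (3 + C2 * s) * P" and err: "norm err \<le> C3 * s"
    and p: "p = A *\<^sub>R e + \<sigma> *\<^sub>R \<gamma> + err"
    and C: "0 \<le> C2" "0 \<le> C3" and \<tau>: "0 < \<tau>" "p \<bullet> \<gamma> \<le> \<theta> - \<tau>"
    and L2: "0 < L2" "\<theta> \<le> L2" and big: "(q - 1) * (C2 + C3) * s < \<tau> / L2" and \<theta>: "0 \<le> \<theta>"
  shows "slope p powr (q - 1) * (p \<bullet> \<gamma>) < sqrt (1 + (3 * P)\<^sup>2 + \<theta>\<^sup>2) powr (q - 1) * \<theta>"
proof (cases "0 < p \<bullet> \<gamma>")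
  case False
  then show ?thesis
  proof (cases "\<theta> = 0")
    case True
    then have "p \<bullet> \<gamma> < 0" using \<tau> by simp
    moreover have "0 < slope p powr (q - 1)" by (simp only: powr_gt_zero slope_nonzero not_False_eq_True)
    ultimately have "slope p powr (q - 1) * (p \<bullet> \<gamma>) < 0" by (simp only: mult_pos_neg)
    then show ?thesis using True by simp
  next
    case False
    then have "0 < \<theta>" using \<theta> by simp
    moreover have "1 \<le> sqrt (1 + (3 * P)\<^sup>2 + \<theta>\<^sup>2) powr (q - 1)" by (rule oblique_weight_ge_1[OF q])
    ultimately have "0 < sqrt (1 + (3 * P)\<^sup>2 + \<theta>\<^sup>2) powr (q - 1) * \<theta>"
      by (intro mult_pos_pos) linarith+
    moreover have "slope p powr (q - 1) * (p \<bullet> \<gamma>) \<le> 0"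
      using \<open>\<not> 0 < p \<bullet> \<gamma>\<close> by (intro mult_nonneg_nonpos) auto
    ultimately show ?thesis by linarith
  qed
next
  case True
  define t where "t = p \<bullet> \<gamma>"
  \<comment> \<open>The slope at which \<theta> solves the boundary condition.\<close>
  define V0 where "V0 = sqrt (1 + (3 * P)\<^sup>2 + \<theta>\<^sup>2)"
  define C6 where "C6 = C2 + C3"
  have t: "0 < t" "t \<le> \<theta> - \<tau>" using True \<tau> by (auto simp: t_def)
  have \<theta>0: "0 < \<theta>" using t \<tau> by linarith
  have C6: "0 \<le> C6 * s" using C s by (simp add: C6_def)
  have V00: "0 < V0" unfolding V0_def by (simp add: add_pos_nonneg)
  have "tang \<gamma> p = tang \<gamma> (A *\<^sub>R e + err)"
    unfolding p tang_add tang_scaleR tang_self[OF \<gamma>] by simp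
  then have "norm (tang \<gamma> p) \<le> norm (A *\<^sub>R e + err)" using norm_tang_le[OF \<gamma>] by metis
  also have "\<dots> \<le> A + C3 * s" using norm_triangle_ineq[of "A *\<^sub>R e" err] err A(1) e by simp
  also have "\<dots> \<le> (3 + C2 * s) * P + C3 * s" using A by simp
  also have "\<dots> \<le> 3 * P * (1 + C6 * s)"
  proof -
    have c: "0 \<le> C2 * s" "0 \<le> C3 * s" using C s by auto
    have "0 \<le> P" using P1 by simp
    from mult_nonneg_nonneg[OF c(1) this] mult_left_mono[OF P1 c(2)] mult_nonneg_nonneg[OF c(2) this]
    show ?thesis by (simp add: C6_def algebra_simps)
  qed
  finally have tp: "norm (tang \<gamma> p) \<le> 3 * P * (1 + C6 * s)" .
  have "slope p \<le> V0 * (1 + C6 * s)"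
  proof (rule power2_le_imp_le)
    have "(slope p)\<^sup>2 = 1 + (norm (tang \<gamma> p))\<^sup>2 + t\<^sup>2"
      unfolding slope_tang[OF \<gamma>] t_def by (simp add: add_nonneg_nonneg)
    also have "\<dots> \<le> 1 * (1 + C6 * s)\<^sup>2 + (3 * P * (1 + C6 * s))\<^sup>2 + \<theta>\<^sup>2 * (1 + C6 * s)\<^sup>2"
    proof (intro add_mono)
      have 1: "1 \<le> (1 + C6 * s)\<^sup>2" using C6 by (simp add: one_le_power)
      then show "1 \<le> 1 * (1 + C6 * s)\<^sup>2" by simp
      show "(norm (tang \<gamma> p))\<^sup>2 \<le> (3 * P * (1 + C6 * s))\<^sup>2" using tp by (intro power_mono) auto
      have "t\<^sup>2 \<le> \<theta>\<^sup>2" using t \<tau> by (intro power_mono) auto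
      also have "\<theta>\<^sup>2 * 1 \<le> \<theta>\<^sup>2 * (1 + C6 * s)\<^sup>2" using 1 by (intro mult_left_mono) auto
      finally show "t\<^sup>2 \<le> \<theta>\<^sup>2 * (1 + C6 * s)\<^sup>2" by simp
    qed
    also have "\<dots> = (V0 * (1 + C6 * s))\<^sup>2"
      unfolding V0_def power_mult_distrib by (simp add: add_nonneg_nonneg algebra_simps)
    finally show "(slope p)\<^sup>2 \<le> (V0 * (1 + C6 * s))\<^sup>2" .
    show "0 \<le> V0 * (1 + C6 * s)" using V00 C6 by simp
  qed
  then have "slope p powr (q - 1) \<le> (V0 * (1 + C6 * s)) powr (q - 1)"
    using q by (intro powr_mono2) (auto simp: less_imp_le)
  also have "\<dots> = V0 powr (q - 1) * (1 + C6 * s) powr (q - 1)" using V00 C6 by (simp add: powr_mult)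
  also have "\<dots> \<le> V0 powr (q - 1) * exp ((q - 1) * C6 * s)"
  proof (rule mult_left_mono)
    have "(1 + C6 * s) powr (q - 1) \<le> exp (C6 * s) powr (q - 1)"
      using q C6 by (intro powr_mono2) (auto simp: exp_ge_add_one_self)
    then show "(1 + C6 * s) powr (q - 1) \<le> exp ((q - 1) * C6 * s)" by (simp add: powr_def mult_ac)
  qed simp
  finally have w: "slope p powr (q - 1) \<le> V0 powr (q - 1) * exp ((q - 1) * C6 * s)" .
  have tt: "t \<le> \<theta> * exp (- (\<tau> / \<theta>))"
  proof -
    have "\<theta> - \<tau> = \<theta> * (1 + (- (\<tau> / \<theta>)))" using \<theta>0 by (simp add: right_diff_distrib)
    also have "\<dots> \<le> \<theta> * exp (- (\<tau> / \<theta>))" using \<theta>0 by (intro mult_left_mono exp_ge_add_one_self) auto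
    finally show ?thesis using t by linarith
  qed
  have "slope p powr (q - 1) * t \<le> (V0 powr (q - 1) * exp ((q - 1) * C6 * s)) * (\<theta> * exp (- (\<tau> / \<theta>)))"
    by (rule mult_mono[OF w tt]) (use t in auto)
  also have "\<dots> = V0 powr (q - 1) * \<theta> * exp ((q - 1) * C6 * s - \<tau> / \<theta>)"
    by (simp add: exp_diff exp_minus divide_inverse mult_ac)
  also have "\<dots> < V0 powr (q - 1) * \<theta> * 1"
  proof (rule mult_strict_left_mono)
    have "\<tau> / L2 \<le> \<tau> / \<theta>" using \<tau> \<theta>0 L2 by (intro divide_left_mono) auto
    then show "exp ((q - 1) * C6 * s - \<tau> / \<theta>) < 1" using big by (simp add: C6_def)
    show "0 < V0 powr (q - 1) * \<theta>" using V00 \<theta>0 by simp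
  qed
  finally show ?thesis unfolding t_def V0_def by simp
qed

text \<open>For \<theta> < 0 the danger is a slope smaller than expected, as happens when s is large
  compared with \<delta>. Then \<tau> is bounded from below, and by \<open>big2\<close> the
  left-hand side is below - L2 outright. For small s / \<delta> the slope is at least
  \<open>V0 * exp (- 4 * x)\<close>, and \<open>big3\<close> wins because the bound on the boundary
  value forces - \<theta> to be at most L2 / m powr (q - 1).\<close>

lemma oblique_strict_neg:
  fixes p e \<gamma> err :: "'a::euclidean_space"
  assumes q: "1 < q" and \<gamma>: "norm \<gamma> = 1" and e: "norm e = 1" and s: "0 < s" "s \<le> 1" and \<delta>: "0 < \<delta>" and C: "0 < C"
    and P: "P = 1 / (C * \<delta>)" "1 \<le> P" and A: "0 \<le> A" "(3 - C2 * s) * (P / (1 + s / \<delta>)) \<le> A"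
    and m: "0 < m" "m \<le> P / (1 + s / \<delta>)" "C2 * s \<le> 1 / 2"
    and err: "norm err \<le> C3 * s" and \<rho>: "0 < \<rho>"
    and p: "p = A *\<^sub>R e + \<sigma> *\<^sub>R \<gamma> + err" and \<sigma>: "\<sigma> \<le> \<theta>" "- \<Sigma> \<le> \<sigma>" and e\<gamma>: "e \<bullet> \<gamma> \<le> s / (2 * \<rho>)"
    and Cs: "0 \<le> C2" "0 \<le> C3" and \<tau>: "\<tau> = ln (1 + s / \<delta>) / (8 * \<rho> * C)" "p \<bullet> \<gamma> \<le> \<theta> - \<tau>"
    and L2: "0 < L2" "- \<theta> * sqrt (1 + (3 * P)\<^sup>2 + \<theta>\<^sup>2) powr (q - 1) \<le> L2" and \<theta>: "\<theta> < 0"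
    and big1: "\<Sigma> + C3 \<le> m"
    and t0: "t0 = min (1 / 4) (1 / (4 * (q - 1)))"
    and big2: "8 * \<rho> * C * L2 < m powr (q - 1) * ln (1 + t0)"
    and big3: "128 * \<rho> * C * L2 * (q - 1) < m powr (q - 1)"
    and small: "\<delta> * (C2 + \<Sigma> / \<rho> + C3) \<le> 1"
  shows "slope p powr (q - 1) * (p \<bullet> \<gamma>) < sqrt (1 + (3 * P)\<^sup>2 + \<theta>\<^sup>2) powr (q - 1) * \<theta>"
proof -
  define x where "x = s / \<delta>"
  define V0 where "V0 = sqrt (1 + (3 * P)\<^sup>2 + \<theta>\<^sup>2)"
  define B where "B = P / (1 + x)"
  have x: "0 < x" "s = \<delta> * x" using s \<delta> by (simp_all add: x_def)
  have V01: "1 \<le> V0" unfolding V0_def by simp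
  have V0sq: "V0\<^sup>2 = 1 + (3 * P)\<^sup>2 + \<theta>\<^sup>2" unfolding V0_def by (simp add: add_nonneg_nonneg)
  have \<Sigma>0: "0 \<le> \<Sigma>" using \<sigma> \<theta> by linarith
  have lnx: "0 < ln (1 + x)" using x by simp
  have \<tau>0: "0 < \<tau>" unfolding \<tau>(1) x_def[symmetric] using lnx \<rho> C by simp
  \<comment> \<open>The bound 1/4 allows \<open>exp_minus_twice_le\<close> with
    \<open>2 * x\<close>; the other one keeps the exponent \<open>k\<close> at most 1.\<close>
  have t0: "0 < t0" "t0 \<le> 1 / 4" "4 * (q - 1) * t0 \<le> 1"
  proof -
    show "0 < t0" "t0 \<le> 1 / 4" using q unfolding t0 by auto
    have "t0 \<le> 1 / (4 * (q - 1))" unfolding t0 by simp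
    then show "4 * (q - 1) * t0 \<le> 1" using q by (simp add: pos_le_divide_eq mult.commute)
  qed
  have B: "m \<le> B" "(3 - C2 * s) * B \<le> A" using m A by (simp_all add: B_def x_def)
  have PB: "B \<le> P" unfolding B_def using x P(2) by (simp add: divide_le_eq)
  have mq: "0 < m powr (q - 1)" using m by simp
  show ?thesis
  proof (cases "t0 \<le> x")
    case True
    have "5 / 2 * B \<le> (3 - C2 * s) * B" using m(3) B m(1) by (intro mult_right_mono) auto
    then have A2: "5 / 2 * B \<le> A" using B by linarith
    have "norm (A *\<^sub>R e) \<le> norm p + norm (\<sigma> *\<^sub>R \<gamma>) + norm err"
    proof -
      have "A *\<^sub>R e = p - \<sigma> *\<^sub>R \<gamma> - err" unfolding p by simp
      then show ?thesis using norm_triangle_ineq4[of "p - \<sigma> *\<^sub>R \<gamma>" err] norm_triangle_ineq4[of p "\<sigma> *\<^sub>R \<gamma>"] by simp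
    qed
    moreover have "norm (\<sigma> *\<^sub>R \<gamma>) \<le> \<Sigma>" using \<sigma> \<theta> \<gamma> by simp
    moreover have "C3 * s \<le> C3 * 1" using s Cs by (intro mult_left_mono) auto
    ultimately have "m \<le> slope p"
      using A2 A(1) e err big1 B(1) m(1) norm_le_slope[of p] by simp
    then have "m powr (q - 1) \<le> slope p powr (q - 1)" using q m by (intro powr_mono2) auto
    moreover have "p \<bullet> \<gamma> \<le> - \<tau>" using \<tau>(2) \<theta> by linarith
    ultimately have "m powr (q - 1) * \<tau> \<le> slope p powr (q - 1) * - (p \<bullet> \<gamma>)"
      using \<tau>0 mq by (intro mult_mono) auto
    moreover have "L2 < m powr (q - 1) * \<tau>"
    proof -
      have "ln (1 + t0) \<le> ln (1 + x)" using True t0 by simp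
      then have "m powr (q - 1) * ln (1 + t0) \<le> m powr (q - 1) * ln (1 + x)" using mq by simp
      then have "L2 * (8 * \<rho> * C) < m powr (q - 1) * ln (1 + x)" using big2 by (simp add: mult_ac)
      then have "L2 < m powr (q - 1) * ln (1 + x) / (8 * \<rho> * C)" using \<rho> C by (simp add: pos_less_divide_eq)
      then show ?thesis unfolding \<tau>(1) x_def by simp
    qed
    moreover have "- L2 \<le> V0 powr (q - 1) * \<theta>" using L2 by (simp add: V0_def mult.commute)
    ultimately show ?thesis unfolding V0_def by linarith
  next
    case False
    then have x4: "x \<le> 1 / 4" "4 * (q - 1) * x \<le> 1"
    proof -
      show "x \<le> 1 / 4" using False t0 by linarith
      have "4 * (q - 1) * x \<le> 4 * (q - 1) * t0" using False q by (intro mult_left_mono) auto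
      then show "4 * (q - 1) * x \<le> 1" using t0 by linarith
    qed
    define z where "z = \<Sigma> * s / \<rho>"
    define y where "y = x + C2 * s"
    have sum: "C2 * s + z + C3 * s \<le> x"
    proof -
      have "\<delta> * (C2 + \<Sigma> / \<rho> + C3) * x \<le> 1 * x" using small x by (intro mult_right_mono) auto
      then show ?thesis unfolding z_def x(2) by (simp add: algebra_simps)
    qed
    have nn: "0 \<le> C2 * s" "0 \<le> z" "0 \<le> C3 * s" using Cs s \<Sigma>0 \<rho> by (auto simp: z_def)
    have y: "0 \<le> y" "y \<le> 1" "z \<le> 1" using nn sum x x4 by (auto simp: y_def)
    have A3: "3 * P * (1 - y) \<le> A"
    proof -
      have "P * (1 - x) \<le> B"
      proof -
        have "(1 - x) * (1 + x) \<le> 1" by (simp add: algebra_simps)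
        then have "1 - x \<le> 1 / (1 + x)" using x by (simp add: pos_le_divide_eq)
        then have "P * (1 - x) \<le> P * (1 / (1 + x))" using P(2) by (intro mult_left_mono) auto
        then show ?thesis by (simp add: B_def)
      qed
      moreover have "3 * (1 - C2 * s) \<le> 3 - C2 * s" using nn by simp
      ultimately have "(3 * (1 - C2 * s)) * (P * (1 - x)) \<le> (3 - C2 * s) * B"
        using m(3) x4 P(2) nn by (intro mult_mono) auto
      moreover have "0 \<le> C2 * s * x" using nn x by simp
      then have "1 - y \<le> (1 - C2 * s) * (1 - x)" unfolding y_def by (simp add: algebra_simps)
      then have "3 * P * (1 - y) \<le> 3 * P * ((1 - C2 * s) * (1 - x))" using P(2) by (intro mult_left_mono) auto
      ultimately show ?thesis using B(2) by (simp add: mult_ac)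
    qed
    \<comment> \<open>Because \<sigma> is negative, the one-sided bound on
      \<open>e \<bullet> \<gamma>\<close> suffices to keep the mixed term of the square above
      \<open>- (A * z)\<close>.\<close>
    have quad: "(V0 * ((1 - y) * (1 - z)))\<^sup>2 \<le> (slope (A *\<^sub>R e + \<sigma> *\<^sub>R \<gamma>))\<^sup>2"
    proof -
      have ee: "e \<bullet> e = 1" and gg: "\<gamma> \<bullet> \<gamma> = 1" using e \<gamma> by (auto simp: dot_square_norm)
      have exp: "(slope (A *\<^sub>R e + \<sigma> *\<^sub>R \<gamma>))\<^sup>2 = 1 + A\<^sup>2 + \<sigma>\<^sup>2 + 2 * A * (\<sigma> * (e \<bullet> \<gamma>))"
        unfolding slope_sq power2_norm_eq_inner inner_add_left inner_add_right inner_scaleR_left inner_scaleR_right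
          ee gg inner_commute[of \<gamma> e] by (simp add: power2_eq_square distrib_left)
      have "\<sigma> * (s / (2 * \<rho>)) \<le> \<sigma> * (e \<bullet> \<gamma>)" using e\<gamma> \<sigma> \<theta> by (intro mult_left_mono_neg) auto
      moreover have "- \<Sigma> * (s / (2 * \<rho>)) \<le> \<sigma> * (s / (2 * \<rho>))" using \<sigma> s \<rho> by (intro mult_right_mono) auto
      ultimately have "2 * A * (- \<Sigma> * (s / (2 * \<rho>))) \<le> 2 * A * (\<sigma> * (e \<bullet> \<gamma>))" using A by (intro mult_left_mono) auto
      then have 1: "- (A * z) \<le> 2 * A * (\<sigma> * (e \<bullet> \<gamma>))" by (simp add: z_def)
      have "\<theta>\<^sup>2 \<le> \<sigma>\<^sup>2" using \<sigma> \<theta> by (simp add: abs_le_square_iff[symmetric])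
      moreover have "A \<le> 1 + A\<^sup>2 + \<theta>\<^sup>2"
      proof -
        have "0 \<le> (A - 1)\<^sup>2 + A\<^sup>2 + 1 + 2 * \<theta>\<^sup>2" by (simp add: add_nonneg_nonneg)
        then show ?thesis by (simp add: power2_diff)
      qed
      then have "A * z \<le> (1 + A\<^sup>2 + \<theta>\<^sup>2) * z" using nn by (intro mult_right_mono) auto
      moreover have "(1 + A\<^sup>2 + \<theta>\<^sup>2) * (1 - z) = (1 + A\<^sup>2 + \<theta>\<^sup>2) - (1 + A\<^sup>2 + \<theta>\<^sup>2) * z"
        unfolding right_diff_distrib by simp
      ultimately have 2: "(1 + A\<^sup>2 + \<theta>\<^sup>2) * (1 - z) \<le> (slope (A *\<^sub>R e + \<sigma> *\<^sub>R \<gamma>))\<^sup>2"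
        unfolding exp using 1 by simp
      have "(V0 * (1 - y))\<^sup>2 \<le> 1 + A\<^sup>2 + \<theta>\<^sup>2"
      proof -
        have y1: "(1 - y)\<^sup>2 \<le> 1" using y by (intro power_le_one) auto
        have "(3 * P * (1 - y))\<^sup>2 \<le> A\<^sup>2" using A3 P(2) y by (intro power_mono) auto
        moreover have "\<theta>\<^sup>2 * (1 - y)\<^sup>2 \<le> \<theta>\<^sup>2 * 1" using y1 by (intro mult_left_mono) auto
        ultimately show ?thesis unfolding power_mult_distrib V0sq using y1 by (simp add: distrib_right)
      qed
      moreover have "(1 - z)\<^sup>2 \<le> 1 - z" unfolding power2_eq_square using y nn by (intro mult_left_le) auto
      ultimately have "(V0 * (1 - y))\<^sup>2 * (1 - z)\<^sup>2 \<le> (1 + A\<^sup>2 + \<theta>\<^sup>2) * (1 - z)" by (intro mult_mono) auto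
      then show ?thesis using 2 unfolding power_mult_distrib by (simp add: mult_ac)
    qed
    have "V0 * ((1 - y) * (1 - z)) \<le> slope (A *\<^sub>R e + \<sigma> *\<^sub>R \<gamma>)"
      by (rule power2_le_imp_le[OF quad]) (simp add: less_imp_le)
    moreover have "slope (A *\<^sub>R e + \<sigma> *\<^sub>R \<gamma>) \<le> slope p + C3 * s"
      using slope_diff[of "A *\<^sub>R e + \<sigma> *\<^sub>R \<gamma>" p] err unfolding p by (simp add: norm_minus_commute)
    moreover have "C3 * s \<le> V0 * (C3 * s)" using V01 nn by (simp add: mult_le_cancel_right1)
    moreover have "V0 * (1 - 2 * x) \<le> V0 * ((1 - y) * (1 - z) - C3 * s)"
    proof (rule mult_left_mono)
      have "0 \<le> y * z" using y nn by simp
      then have "1 - y - z \<le> (1 - y) * (1 - z)" by (simp add: algebra_simps)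
      then show "1 - 2 * x \<le> (1 - y) * (1 - z) - C3 * s" using sum unfolding y_def by linarith
    qed (use V01 in simp)
    ultimately have "V0 * (1 - 2 * x) \<le> slope p" by (simp add: right_diff_distrib)
    moreover have "V0 * exp (- 4 * x) \<le> V0 * (1 - 2 * x)"
      using exp_minus_twice_le[of "2 * x"] x x4 V01 by (intro mult_left_mono) auto
    ultimately have "V0 * exp (- 4 * x) \<le> slope p" by (rule order_trans[rotated])
    then have "(V0 * exp (- 4 * x)) powr (q - 1) \<le> slope p powr (q - 1)"
      using q V01 by (intro powr_mono2) auto
    then have w: "V0 powr (q - 1) * exp (- 4 * x) powr (q - 1) \<le> slope p powr (q - 1)"
      using V01 by (simp add: powr_mult)
    define k where "k = 4 * (q - 1) * x"
    have k: "0 < k" "k \<le> 1" using q x x4 by (simp_all add: k_def)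
    have ek: "exp (- 4 * x) powr (q - 1) = exp (- k)" by (simp add: powr_def k_def)
    have "exp k \<le> 1 + k + k\<^sup>2" using exp_bound[of k] k by simp
    also have "k\<^sup>2 \<le> k" using k by (simp add: power2_eq_square mult_left_le)
    finally have expk: "exp k \<le> 1 + 2 * k" by simp
    \<comment> \<open>The loss in the weight is linear in x and the gain \<tau> is at least linear
      in x; \<open>big3\<close> compares the coefficients.\<close>
    have "- \<theta> * (2 * k) < \<tau>"
    proof -
      have "m powr (q - 1) \<le> V0 powr (q - 1)"
      proof (rule powr_mono2)
        have "P \<le> V0"
        proof (rule power2_le_imp_le)
          show "P\<^sup>2 \<le> V0\<^sup>2" unfolding V0sq power_mult_distrib by simp
        qed (use V01 in simp)
        then show "m \<le> V0" using B PB by linarith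
      qed (use q m in auto)
      then have "- \<theta> * m powr (q - 1) \<le> - \<theta> * V0 powr (q - 1)" using \<theta> by (intro mult_left_mono) auto
      then have "- \<theta> * m powr (q - 1) \<le> L2" using L2 unfolding V0_def by linarith
      then have "- \<theta> \<le> L2 / m powr (q - 1)" using mq by (simp add: pos_le_divide_eq)
      then have "- \<theta> * (2 * k) \<le> L2 / m powr (q - 1) * (2 * k)" using k by (intro mult_right_mono) auto
      also have "\<dots> = (8 * (q - 1) * L2) / m powr (q - 1) * x" by (simp add: k_def)
      also have "\<dots> < 1 / (16 * \<rho> * C) * x"
      proof (rule mult_strict_right_mono)
        show "(8 * (q - 1) * L2) / m powr (q - 1) < 1 / (16 * \<rho> * C)"
          using big3 mq \<rho> C by (simp add: divide_less_eq pos_less_divide_eq mult_ac)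
      qed (use x in simp)
      also have "\<dots> \<le> \<tau>"
      proof -
        have "x / 2 \<le> x / (1 + x)" using x x4 by (intro divide_left_mono) auto
        also have "\<dots> \<le> ln (1 + x)" by (rule ln_one_plus_ge) (use x in simp)
        finally have "(x / 2) / (8 * \<rho> * C) \<le> ln (1 + x) / (8 * \<rho> * C)" using \<rho> C by (intro divide_right_mono) auto
        then show ?thesis unfolding \<tau>(1) x_def[symmetric] by simp
      qed
      finally show ?thesis .
    qed
    then have "- \<theta> * exp k < - \<theta> + \<tau>"
    proof -
      assume "- \<theta> * (2 * k) < \<tau>"
      moreover have "- \<theta> * exp k \<le> - \<theta> * (1 + 2 * k)" using expk \<theta> by (intro mult_left_mono) auto
      ultimately show ?thesis by (simp add: distrib_left)
    qed
    then have "- \<theta> * exp k * exp (- k) < (- \<theta> + \<tau>) * exp (- k)" by (intro mult_strict_right_mono) auto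
    then have "- \<theta> < (- \<theta> + \<tau>) * exp (- k)" by (simp add: mult.assoc flip: exp_add)
    then have "V0 powr (q - 1) * - \<theta> < V0 powr (q - 1) * ((- \<theta> + \<tau>) * exp (- k))"
      using V01 by (intro mult_strict_left_mono) auto
    also have "\<dots> = V0 powr (q - 1) * exp (- k) * (- \<theta> + \<tau>)" by simp
    also have "\<dots> \<le> slope p powr (q - 1) * (- (p \<bullet> \<gamma>))"
      using w \<tau>(2) \<tau>0 \<theta> unfolding ek by (intro mult_mono) auto
    finally show ?thesis unfolding V0_def by simp
  qed
qed

section \<open>Interior maxima of the global two-point function\<close>

text \<open>The solution of \<phi>'' = - C \<phi>'^2 with \<phi> 0 = 0 and initial slope 1 / (C
  \<delta>).\<close>

definition log_profile :: "real \<Rightarrow> real \<Rightarrow> real \<Rightarrow> real" where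
  "log_profile C \<delta> r = ln (1 + r / \<delta>) / C"

lemma log_profile_derivative:
  assumes "0 < C" "0 < \<delta>" "0 \<le> r"
  shows "(log_profile C \<delta> has_real_derivative 1 / (C * (r + \<delta>))) (at r)"
proof -
  have pos: "0 < 1 + r / \<delta>" using assms by (simp add: add_pos_nonneg)
  have "((\<lambda>r. ln (1 + r / \<delta>) / C) has_real_derivative (1 / (1 + r / \<delta>) * (1 / \<delta>)) / C) (at r)"
    using pos assms by (auto intro!: derivative_eq_intros)
  moreover have "(1 / (1 + r / \<delta>) * (1 / \<delta>)) / C = 1 / (C * (r + \<delta>))"
    using assms pos by (simp add: field_simps)
  ultimately show ?thesis unfolding log_profile_def[abs_def] by (rule DERIV_cong)
qed

lemma log_profile_second_derivative:
  assumes "0 < C" "0 < \<delta>" "0 \<le> r"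
  shows "((\<lambda>r. 1 / (C * (r + \<delta>))) has_real_derivative - (C * (1 / (C * (r + \<delta>)))\<^sup>2)) (at r)"
proof -
  have "C * (r + \<delta>) \<noteq> 0" using assms by simp
  then have "((\<lambda>r. 1 / (C * (r + \<delta>))) has_real_derivative - (C / (C * (r + \<delta>))\<^sup>2)) (at r)"
    by (auto intro!: derivative_eq_intros simp: power2_eq_square)
  then show ?thesis by (simp add: power_divide)
qed

lemma log_profile_bounds:
  assumes C: "0 < C" and \<delta>: "0 < \<delta>" and s: "0 \<le> s"
  shows "0 \<le> log_profile C \<delta> s" "s * (1 / (C * (s + \<delta>))) \<le> log_profile C \<delta> s" "log_profile C \<delta> s \<le> s / (C * \<delta>)"
proof -
  show "0 \<le> log_profile C \<delta> s" using assms by (simp add: log_profile_def)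
  have "(s / \<delta>) / (1 + s / \<delta>) / C \<le> ln (1 + s / \<delta>) / C"
    by (intro divide_right_mono ln_one_plus_ge) (use assms in auto)
  moreover have "(s / \<delta>) / (1 + s / \<delta>) / C = s * (1 / (C * (s + \<delta>)))"
  proof -
    have "1 + s / \<delta> = (s + \<delta>) / \<delta>" using \<delta> by (simp add: add_divide_distrib)
    then show ?thesis using \<delta> by simp
  qed
  ultimately show "s * (1 / (C * (s + \<delta>))) \<le> log_profile C \<delta> s" unfolding log_profile_def by linarith
  have "ln (1 + s / \<delta>) \<le> s / \<delta>" by (rule ln_add_one_self_le_self) (use assms in auto)
  then have "ln (1 + s / \<delta>) / C \<le> (s / \<delta>) / C" using C by (intro divide_right_mono) auto
  then show "log_profile C \<delta> s \<le> s / (C * \<delta>)" by (simp add: log_profile_def mult.commute)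
qed

text \<open>Cancels the factor 1 / s in the tangential cost, into which \<phi>^2 enters through the
  difference of the gradients. Up to \<delta> the profile is at most s / (C \<delta>); beyond
  \<delta> it is at most F, while s \<phi>'(s) is at least 1 / (2 C). The two remaining factors
  \<phi>' are bounded from below by m.\<close>

lemma log_profile_square_le:
  assumes C: "0 < C" and \<delta>: "0 < \<delta>" and s: "0 < s" and F: "log_profile C \<delta> s \<le> F"
    and m: "0 < m" "m \<le> 1 / (C * (s + \<delta>))" and big: "2 * F \<le> m\<^sup>2" "2 * C * F\<^sup>2 \<le> m\<^sup>2"
  shows "(log_profile C \<delta> s)\<^sup>2 \<le> s * (1 / (C * (s + \<delta>))) ^ 3"
proof -
  define \<phi> \<phi>1 where "\<phi> = log_profile C \<delta> s" and "\<phi>1 = 1 / (C * (s + \<delta>))"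
  have b: "0 \<le> \<phi>" "\<phi> \<le> s / (C * \<delta>)" "\<phi> \<le> F" using log_profile_bounds[OF C \<delta>, of s] s F by (auto simp: \<phi>_def)
  have m2: "m\<^sup>2 \<le> \<phi>1\<^sup>2" using m by (intro power_mono) (auto simp: \<phi>1_def)
  have \<phi>10: "0 < \<phi>1" using C \<delta> s by (simp add: \<phi>1_def)
  have cube: "s * \<phi>1 ^ 3 = \<phi>1\<^sup>2 * (s * \<phi>1)" by (simp add: power3_eq_cube power2_eq_square)
  show ?thesis
  proof (cases "s \<le> \<delta>")
    case True
    have "\<phi>\<^sup>2 \<le> F * (s / (C * \<delta>))" unfolding power2_eq_square using b by (intro mult_mono) auto
    also have "\<dots> \<le> (m\<^sup>2 / 2) * (s / (C * \<delta>))" using big s C \<delta> by (intro mult_right_mono) auto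
    also have "\<dots> = m\<^sup>2 * (s * (1 / (C * (\<delta> + \<delta>))))" by simp
    also have "\<dots> \<le> \<phi>1\<^sup>2 * (s * \<phi>1)"
      unfolding \<phi>1_def using True C \<delta> s m2[unfolded \<phi>1_def]
      by (intro mult_mono mult_left_mono divide_left_mono mult_pos_pos mult_nonneg_nonneg) auto
    finally show ?thesis unfolding cube[unfolded \<phi>1_def] \<phi>_def \<phi>1_def .
  next
    case False
    have "\<phi>\<^sup>2 \<le> F\<^sup>2" using b by (intro power_mono) auto
    also have "\<dots> \<le> m\<^sup>2 / (2 * C)" using big C by (simp add: pos_le_divide_eq mult_ac)
    also have "\<dots> = m\<^sup>2 * (s * (1 / (C * (s + s))))" using s by simp
    also have "\<dots> \<le> \<phi>1\<^sup>2 * (s * \<phi>1)"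
      unfolding \<phi>1_def using False C \<delta> s m2[unfolded \<phi>1_def]
      by (intro mult_mono mult_left_mono divide_left_mono mult_pos_pos mult_nonneg_nonneg) auto
    finally show ?thesis unfolding cube[unfolded \<phi>1_def] \<phi>_def \<phi>1_def .
  qed
qed

section \<open>Gradients close to a multiple of the axis\<close>

lemma axial_slope_eq_norm_Pair: "axial_slope e p = norm (1::real, p \<bullet> e)"
  unfolding axial_slope_def norm_Pair by simp

lemma axial_slope_diff:
  assumes "norm e = 1"
  shows "\<bar>axial_slope e p - axial_slope e q\<bar> \<le> norm (p - q)"
proof -
  have "\<bar>axial_slope e p - axial_slope e q\<bar> \<le> norm ((1::real, p \<bullet> e) - (1, q \<bullet> e))"
    unfolding axial_slope_eq_norm_Pair by (rule norm_triangle_ineq3)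
  also have "\<dots> = \<bar>(p - q) \<bullet> e\<bar>" unfolding diff_Pair norm_Pair inner_diff_left by simp
  also have "\<dots> \<le> norm (p - q)" using Cauchy_Schwarz_ineq2[of "p - q" e] assms by simp
  finally show ?thesis .
qed

lemma axial_slope_le_slope:
  assumes "norm e = 1"
  shows "axial_slope e p \<le> slope p"
proof (rule power2_le_imp_le)
  show "(axial_slope e p)\<^sup>2 \<le> (slope p)\<^sup>2" unfolding slope_axial_slope[OF assms] by simp
qed (simp add: less_imp_le)

text \<open>The deviation from \<open>A *\<^sub>R e\<close> is at most half of A, so that all the
  slopes are comparable to A.\<close>

lemma near_axis:
  fixes p e :: "'a::euclidean_space"
  assumes e: "norm e = 1" and A: "1 \<le> A" "2 * C0 \<le> A" and p: "norm (p - A *\<^sub>R e) \<le> C0"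
  shows "A / 2 \<le> axial_slope e p" "A / 2 \<le> slope p" "slope p \<le> 5 / 2 * A" "axial_slope e p \<le> 2 * A"
    "norm (tang e p) \<le> C0" "tcoef e p \<le> 2 / A\<^sup>2" "slope p \<le> 1 + A + C0"
proof -
  have ee: "e \<bullet> e = 1" using e by (simp add: dot_square_norm)
  have C0: "0 \<le> C0" by (rule order_trans[OF norm_ge_zero p])
  have "\<bar>(p - A *\<^sub>R e) \<bullet> e\<bar> \<le> C0" using Cauchy_Schwarz_ineq2[of "p - A *\<^sub>R e" e] e p by simp
  then have pe: "A - C0 \<le> p \<bullet> e" "p \<bullet> e \<le> A + C0" by (simp_all add: inner_diff_left ee abs_le_iff)
  show S: "A / 2 \<le> axial_slope e p" using inner_axial_le[of p e] pe A by linarith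
  show v: "A / 2 \<le> slope p" using S axial_slope_le_slope[OF e, of p] by linarith
  have "norm p \<le> norm (p - A *\<^sub>R e) + norm (A *\<^sub>R e)" using norm_triangle_ineq[of "p - A *\<^sub>R e" "A *\<^sub>R e"] by simp
  then have "norm p \<le> C0 + A" using p e A by simp
  then show "slope p \<le> 5 / 2 * A" "slope p \<le> 1 + A + C0" using slope_le[of p] A by linarith+
  show "axial_slope e p \<le> 2 * A"
  proof (rule power2_le_imp_le)
    have "(p \<bullet> e)\<^sup>2 \<le> (3 / 2 * A)\<^sup>2" using pe A C0 by (intro power_mono) auto
    moreover have "1 \<le> A\<^sup>2" using A by (simp add: one_le_power)
    ultimately show "(axial_slope e p)\<^sup>2 \<le> (2 * A)\<^sup>2"
      unfolding axial_slope_sq power_mult_distrib by (simp add: power_divide)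
  qed (use A in simp)
  have "tang e p = tang e (p - A *\<^sub>R e)" unfolding tang_diff tang_scaleR tang_self[OF e] by simp
  then show "norm (tang e p) \<le> C0" using norm_tang_le[OF e, of "p - A *\<^sub>R e"] p by simp
  have "A / 2 * (A / 2 + A / 2) \<le> slope p * (slope p + axial_slope e p)"
    using S v A by (intro mult_mono add_mono) auto
  then have "tcoef e p \<le> 1 / (A / 2 * (A / 2 + A / 2))"
    unfolding tcoef_def using A by (intro divide_left_mono mult_pos_pos) (auto simp: add_pos_pos)
  also have "\<dots> = 2 / A\<^sup>2" by (simp add: power2_eq_square)
  finally show "tcoef e p \<le> 2 / A\<^sup>2" .
qed

lemma tcoef_diff:
  fixes p q e :: "'a::euclidean_space"
  assumes e: "norm e = 1" and A: "1 \<le> A" "2 * C0 \<le> A"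
    and p: "norm (p - A *\<^sub>R e) \<le> C0" and q: "norm (q - A *\<^sub>R e) \<le> C0"
  shows "\<bar>tcoef e p - tcoef e q\<bar> \<le> 40 * norm (p - q) / A\<^sup>2"
proof -
  define vp vq Sp Sq where "vp = slope p" and "vq = slope q" and "Sp = axial_slope e p" and "Sq = axial_slope e q"
  define Dp Dq where "Dp = vp * (vp + Sp)" and "Dq = vq * (vq + Sq)"
  note P = near_axis[OF e A p] and Q = near_axis[OF e A q]
  have b: "A / 2 \<le> vp" "A / 2 \<le> Sp" "A / 2 \<le> vq" "A / 2 \<le> Sq" "vp \<le> 5 / 2 * A" "vq \<le> 5 / 2 * A" "Sp \<le> 2 * A"
    using P Q by (auto simp: vp_def vq_def Sp_def Sq_def)
  have d: "\<bar>vp - vq\<bar> \<le> norm (p - q)" "\<bar>Sp - Sq\<bar> \<le> norm (p - q)"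
    using slope_diff axial_slope_diff[OF e] by (auto simp: vp_def vq_def Sp_def Sq_def)
  have DD: "A\<^sup>2 / 2 \<le> Dp" "A\<^sup>2 / 2 \<le> Dq"
  proof -
    have "A / 2 * (A / 2 + A / 2) \<le> Dp" "A / 2 * (A / 2 + A / 2) \<le> Dq"
      unfolding Dp_def Dq_def using b A by (intro mult_mono add_mono; simp)+
    then show "A\<^sup>2 / 2 \<le> Dp" "A\<^sup>2 / 2 \<le> Dq" by (simp_all add: power2_eq_square)
  qed
  have A2: "0 < A\<^sup>2" using A by simp
  have Dpos: "0 < Dp" "0 < Dq" using DD A2 by linarith+
  have "Dq - Dp = (vq - vp) * (vp + Sp) + vq * ((vq - vp) + (Sq - Sp))" by (simp add: Dp_def Dq_def algebra_simps)
  then have "\<bar>Dq - Dp\<bar> \<le> \<bar>(vq - vp) * (vp + Sp)\<bar> + \<bar>vq * ((vq - vp) + (Sq - Sp))\<bar>" by linarith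
  also have "\<dots> \<le> norm (p - q) * (9 / 2 * A) + (5 / 2 * A) * (norm (p - q) + norm (p - q))"
    unfolding abs_mult using b A d by (intro add_mono mult_mono) (auto simp: abs_minus_commute)
  also have "\<dots> \<le> 10 * A * norm (p - q)" using A by (simp add: mult_ac)
  finally have DqDp: "\<bar>Dq - Dp\<bar> \<le> 10 * A * norm (p - q)" .
  have "tcoef e p - tcoef e q = 1 / Dp - 1 / Dq" by (simp add: tcoef_def Dp_def Dq_def vp_def vq_def Sp_def Sq_def)
  also have "\<dots> = (Dq - Dp) / (Dp * Dq)" using Dpos by (simp add: field_simps)
  finally have "\<bar>tcoef e p - tcoef e q\<bar> = \<bar>Dq - Dp\<bar> / (Dp * Dq)" using Dpos by (simp add: abs_mult)
  also have "\<dots> \<le> (10 * A * norm (p - q)) / (A\<^sup>2 / 2 * (A\<^sup>2 / 2))"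
    using DqDp DD A2 A Dpos by (intro frac_le mult_mono mult_pos_pos) auto
  also have "\<dots> = 40 * norm (p - q) / A\<^sup>2 * (1 / A)" using A by (simp add: power2_eq_square)
  also have "\<dots> \<le> 40 * norm (p - q) / A\<^sup>2 * 1" using A by (intro mult_left_mono) auto
  finally show ?thesis by simp
qed

text \<open>Unlike in the interior estimate, both tangential parts are present and need not shrink
  with s. Their difference does, and so the bound has to be Lipschitz in the gradient.\<close>

lemma tang_form_diff:
  fixes p q e b :: "'a::euclidean_space"
  assumes e: "norm e = 1" and A: "1 \<le> A" "2 * C0 \<le> A"
    and p: "norm (p - A *\<^sub>R e) \<le> C0" and q: "norm (q - A *\<^sub>R e) \<le> C0" and b: "norm b \<le> 1"
  shows "norm ((tcoef e p * (tang e p \<bullet> b)) *\<^sub>R tang e p - (tcoef e q * (tang e q \<bullet> b)) *\<^sub>R tang e q)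
    \<le> (4 * C0 + 40 * C0\<^sup>2) * norm (p - q) / A\<^sup>2"
proof -
  define P Q kp kq d where "P = tang e p" and "Q = tang e q" and "kp = tcoef e p" and "kq = tcoef e q" and "d = norm (p - q)"
  have C0: "0 \<le> C0" by (rule order_trans[OF norm_ge_zero p])
  have PQ: "norm P \<le> C0" "norm Q \<le> C0" using near_axis(5)[OF e A p] near_axis(5)[OF e A q] by (auto simp: P_def Q_def)
  have PQd: "norm (P - Q) \<le> d" unfolding P_def Q_def d_def tang_diff[symmetric] by (rule norm_tang_le[OF e])
  have kp: "0 \<le> kp" "kp \<le> 2 / A\<^sup>2" using near_axis(6)[OF e A p] tcoef_nonneg by (auto simp: kp_def)
  have kd: "\<bar>kp - kq\<bar> \<le> 40 * d / A\<^sup>2" using tcoef_diff[OF e A p q] by (simp add: kp_def kq_def d_def)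
  have ib: "\<bar>v \<bullet> b\<bar> \<le> norm v" for v
    using Cauchy_Schwarz_ineq2[of v b] mult_left_le[OF b norm_ge_zero, of v] by linarith
  have "(kp * (P \<bullet> b)) *\<^sub>R P - (kq * (Q \<bullet> b)) *\<^sub>R Q =
      (kp * (P \<bullet> b)) *\<^sub>R (P - Q) + (kp * ((P - Q) \<bullet> b)) *\<^sub>R Q + ((kp - kq) * (Q \<bullet> b)) *\<^sub>R Q"
    by (simp add: algebra_simps inner_diff_left)
  then have "norm ((kp * (P \<bullet> b)) *\<^sub>R P - (kq * (Q \<bullet> b)) *\<^sub>R Q)
     \<le> norm ((kp * (P \<bullet> b)) *\<^sub>R (P - Q)) + norm ((kp * ((P - Q) \<bullet> b)) *\<^sub>R Q) + norm (((kp - kq) * (Q \<bullet> b)) *\<^sub>R Q)"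
    using norm_triangle_ineq norm_triangle_le by (smt (verit))
  also have "\<dots> = kp * \<bar>P \<bullet> b\<bar> * norm (P - Q) + kp * \<bar>(P - Q) \<bullet> b\<bar> * norm Q + \<bar>kp - kq\<bar> * \<bar>Q \<bullet> b\<bar> * norm Q"
    using kp by (simp add: abs_mult)
  also have "\<dots> \<le> 2 / A\<^sup>2 * C0 * d + 2 / A\<^sup>2 * d * C0 + 40 * d / A\<^sup>2 * C0 * C0"
    using kp kd ib[of P] ib[of Q] ib[of "P - Q"] PQ PQd C0 by (intro add_mono mult_mono) (auto simp: d_def)
  also have "\<dots> = (4 * C0 + 40 * C0\<^sup>2) * d / A\<^sup>2" by (simp add: add_divide_distrib power2_eq_square algebra_simps)
  finally show ?thesis by (simp add: P_def Q_def kp_def kq_def d_def)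
qed

text \<open>Apart from the gain, all terms are bounded independently of s and \<delta>: s \<phi>'(s)
  is at most F, the gradients differ by a quantity of order \<phi> s + s, and
  \<open>log_profile_square_le\<close> cancels the 1 / s. So a large C excludes the maximum, once m
  is large in terms of it.\<close>

lemma global_interior_max:
  fixes u :: "'a::euclidean_space \<Rightarrow> real" and x y z c1 c2 b :: 'a
  assumes u: "C_on 2 \<Omega> u" "open \<Omega>" "x \<in> \<Omega>" "y \<in> \<Omega>" and mc: "mean_curvature_eq \<Omega> f u"
    and rhs: "rhs_conditions \<Omega> M0 L1 f" and M0: "0 < M0" and L1: "0 < L1" and lip: "grad_lip \<Lambda> \<Omega> x y" and \<Lambda>: "0 \<le> \<Lambda>"
    and uM: "\<bar>u x\<bar> \<le> M0" "\<bar>u y\<bar> \<le> M0" "u y \<le> u x"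
    and ne: "x \<noteq> y" and s: "s = norm (x - y)" "s \<le> 1"
    and max: "\<forall>\<^sub>F w in nhds (x, y). u (fst w) - u (snd w) - two_point_fun (log_profile C \<delta>) 1 \<kappa> c1 c2 b N z (fst w) (snd w)
        \<le> u x - u y - two_point_fun (log_profile C \<delta>) 1 \<kappa> c1 c2 b N z x y"
    and C: "0 < C" and \<delta>: "0 < \<delta>" and \<kappa>: "0 \<le> \<kappa>" and N: "0 \<le> N"
    and D: "norm (x - c1) \<le> D" "norm (y - c2) \<le> D" and b: "norm b \<le> B1" and xz: "norm (x - z) \<le> s"
    and F: "log_profile C \<delta> s \<le> F"
    and C0: "C0 = 2 * \<kappa> * F * D + B1 + 2 * N" and E1: "E1 = 1 + 2 * \<kappa> * D\<^sup>2"
    and m: "m \<le> 1 / (C * (s + \<delta>))" "1 \<le> m" "2 * C0 \<le> m" "2 * F \<le> m\<^sup>2" "2 * C * F\<^sup>2 \<le> m\<^sup>2"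
    and n: "n = real DIM('a)"
    and big: "4 * E1 * (L1 * (4 * \<kappa> * D * F + 2 * N) + \<Lambda> * L1 * (1 + C0 + E1 * F)
       + n * (4 * C0 + 40 * C0\<^sup>2)\<^sup>2 * (32 * \<kappa>\<^sup>2 * D\<^sup>2 + 8 * N\<^sup>2) + 4 * \<kappa> * D * (16 + 8 * n\<^sup>2 * C0)
       + 4 * n * \<kappa> * F + 2 * n * N) < C"
  shows False
proof -
  define \<phi> where "\<phi> = log_profile C \<delta>"
  define \<phi>1 where "\<phi>1 r = 1 / (C * (r + \<delta>))" for r
  define \<phi>2 where "\<phi>2 = - (C * (\<phi>1 s)\<^sup>2)"
  define e where "e = (x - y) /\<^sub>R s"
  define E where "E = 1 + \<kappa> * (norm (x - c1))\<^sup>2 + \<kappa> * (norm (y - c2))\<^sup>2"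
  define A where "A = E * \<phi>1 s"
  have s0: "s > 0" unfolding s using ne by simp
  have e1: "norm e = 1" unfolding e_def norm_scaleR s(1)[symmetric] using s0 by simp
  have D0: "0 \<le> D" by (rule order_trans[OF norm_ge_zero D(1)])
  have B0: "0 \<le> B1" by (rule order_trans[OF norm_ge_zero b])
  have \<phi>b: "0 \<le> \<phi> s" "s * \<phi>1 s \<le> \<phi> s" "\<phi> s \<le> F"
    using log_profile_bounds[OF C \<delta>, of s] s0 F by (auto simp: \<phi>_def \<phi>1_def)
  have F0: "0 \<le> F" using \<phi>b by linarith
  have C00: "0 \<le> C0" unfolding C0 using \<kappa> F0 D0 B0 N by simp
  have "m \<le> \<phi>1 s" unfolding \<phi>1_def by (rule m(1))
  then have \<phi>1m: "m \<le> \<phi>1 s" "0 < \<phi>1 s" "1 \<le> \<phi>1 s" using m(2) by linarith+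
  have \<phi>20: "\<phi>2 \<le> 0" unfolding \<phi>2_def using C by simp
  have d1: "\<forall>\<^sub>F r in nhds s. (\<phi> has_real_derivative \<phi>1 r) (at r)"
  proof -
    have "\<forall>\<^sub>F r in nhds s. r \<in> {0<..}" by (rule eventually_nhds_in_open) (use s0 in auto)
    then show ?thesis
      by eventually_elim (simp add: \<phi>_def \<phi>1_def log_profile_derivative[OF C \<delta>])
  qed
  have d2: "(\<phi>1 has_real_derivative \<phi>2) (at s)"
    unfolding \<phi>1_def[abs_def] \<phi>2_def using log_profile_second_derivative[OF C \<delta>] s0 by simp
  have x2: "(norm (x - c1))\<^sup>2 \<le> D\<^sup>2" "(norm (y - c2))\<^sup>2 \<le> D\<^sup>2" using D by (auto intro: power_mono)
  have E: "1 \<le> E" "E \<le> E1"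
  proof -
    show "1 \<le> E" unfolding E_def using \<kappa> by simp
    have "\<kappa> * (norm (x - c1))\<^sup>2 \<le> \<kappa> * D\<^sup>2" "\<kappa> * (norm (y - c2))\<^sup>2 \<le> \<kappa> * D\<^sup>2" using x2 \<kappa> by (auto intro: mult_left_mono)
    then show "E \<le> E1" unfolding E_def E1 by linarith
  qed
  have A: "\<phi>1 s \<le> A" using mult_right_mono[OF E(1), of "\<phi>1 s"] \<phi>1m by (simp add: A_def)
  have A1: "1 \<le> A" "2 * C0 \<le> A" "0 < A" using A \<phi>1m m by linarith+
  obtain Hx where Hx: "(grad u has_derivative Hx) (at x)"
    using C_on_grad_differentiable[OF u(1,2,3) order_refl] unfolding differentiable_def by blast
  obtain Hy where Hy: "(grad u has_derivative Hy) (at y)"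
    using C_on_grad_differentiable[OF u(1,2,4) order_refl] unfolding differentiable_def by blast
  note max' = max[folded \<phi>_def]
  note grads = two_point_max(1,2)[of \<Omega> u x y s e \<phi> \<phi>1 \<phi>2 1 \<kappa> c1 c2 b N z Hx Hy E, OF u ne s(1) e_def d1 d2 max' Hx Hy E_def]
  define p where "p = grad u x"
  define q where "q = grad u y"
  have p: "p - A *\<^sub>R e = (2 * \<kappa> * \<phi> s) *\<^sub>R (x - c1) + b + (2 * N) *\<^sub>R (x - z)"
    and q: "q - A *\<^sub>R e = - ((2 * \<kappa> * \<phi> s) *\<^sub>R (y - c2)) + b"
    using grads by (simp_all add: p_def q_def A_def)
  have k\<phi>: "0 \<le> 2 * \<kappa> * \<phi> s" using \<kappa> \<phi>b by simp
  have nx: "norm ((2 * \<kappa> * \<phi> s) *\<^sub>R (x - c1)) \<le> 2 * \<kappa> * \<phi> s * D"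
    and ny: "norm ((2 * \<kappa> * \<phi> s) *\<^sub>R (y - c2)) \<le> 2 * \<kappa> * \<phi> s * D"
    using D k\<phi> by (auto simp: abs_of_nonneg \<kappa> \<phi>b intro!: mult_left_mono)
  have nz: "norm ((2 * N) *\<^sub>R (x - z)) \<le> 2 * N * s" using xz N by (simp add: mult_left_mono)
  have \<phi>FD: "2 * \<kappa> * \<phi> s * D \<le> 2 * \<kappa> * F * D" using \<phi>b \<kappa> D0 by (intro mult_right_mono mult_left_mono) auto
  have NsN: "2 * N * s \<le> 2 * N" using N s by (simp add: mult_left_le)
  have pC: "norm (p - A *\<^sub>R e) \<le> C0"
    unfolding p C0 using nx nz b \<phi>FD NsN
      norm_triangle_ineq[of "(2 * \<kappa> * \<phi> s) *\<^sub>R (x - c1) + b" "(2 * N) *\<^sub>R (x - z)"]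
      norm_triangle_ineq[of "(2 * \<kappa> * \<phi> s) *\<^sub>R (x - c1)" b] by linarith
  have qC: "norm (q - A *\<^sub>R e) \<le> C0"
    unfolding q C0 using ny b \<phi>FD N
      norm_triangle_ineq[of "- ((2 * \<kappa> * \<phi> s) *\<^sub>R (y - c2))" b] unfolding norm_minus_cancel by linarith
  have pq: "norm (p - q) \<le> 4 * \<kappa> * D * \<phi> s + 2 * N * s"
  proof -
    have "p - q = (p - A *\<^sub>R e) - (q - A *\<^sub>R e)" by simp
    also have "\<dots> = ((2 * \<kappa> * \<phi> s) *\<^sub>R (x - c1) + (2 * \<kappa> * \<phi> s) *\<^sub>R (y - c2)) + (2 * N) *\<^sub>R (x - z)"
      unfolding p q by simp
    finally have "p - q = ((2 * \<kappa> * \<phi> s) *\<^sub>R (x - c1) + (2 * \<kappa> * \<phi> s) *\<^sub>R (y - c2)) + (2 * N) *\<^sub>R (x - z)" .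
    then have "norm (p - q) \<le> norm ((2 * \<kappa> * \<phi> s) *\<^sub>R (x - c1)) + norm ((2 * \<kappa> * \<phi> s) *\<^sub>R (y - c2)) + norm ((2 * N) *\<^sub>R (x - z))"
      using norm_triangle_ineq[of "(2 * \<kappa> * \<phi> s) *\<^sub>R (x - c1) + (2 * \<kappa> * \<phi> s) *\<^sub>R (y - c2)" "(2 * N) *\<^sub>R (x - z)"]
        norm_triangle_ineq[of "(2 * \<kappa> * \<phi> s) *\<^sub>R (x - c1)" "(2 * \<kappa> * \<phi> s) *\<^sub>R (y - c2)"] by simp
    moreover have "2 * \<kappa> * \<phi> s * D + 2 * \<kappa> * \<phi> s * D = 4 * \<kappa> * D * \<phi> s" by simp
    ultimately show ?thesis using nx ny nz by linarith
  qed
  have pq1: "norm (p - q) \<le> 4 * \<kappa> * D * F + 2 * N"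
    using pq NsN mult_left_mono[OF \<phi>b(3), of "4 * \<kappa> * D"] \<kappa> D0 by simp
  note P = near_axis[OF e1 A1(1,2) pC] and Q = near_axis[OF e1 A1(1,2) qC]
  define KZ where "KZ = 4 * C0 + 40 * C0\<^sup>2"
  define Z where "Z = KZ * norm (p - q) / A\<^sup>2"
  have Z: "norm ((tcoef e p * (tang e p \<bullet> b)) *\<^sub>R tang e p - (tcoef e q * (tang e q \<bullet> b)) *\<^sub>R tang e q) \<le> Z"
    if "b \<in> Basis" for b
    unfolding Z_def KZ_def by (rule tang_form_diff[OF e1 A1(1,2) pC qC]) (use that in simp)
  define a where "a = 1 / axial_slope e p + 1 / axial_slope e q"
  have ineq: "f (x, u x) * slope p - f (y, u y) * slope q \<le>
      E * \<phi>2 * a\<^sup>2 + n * (E * \<phi>1 s / s * Z\<^sup>2)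
      + 4 * \<kappa> * D * \<phi>1 s * (a\<^sup>2 + 2 * n\<^sup>2 * C0 * (1 / slope p + 1 / slope q))
      + 4 * n * \<kappa> * \<phi> s + 2 * n * N"
    unfolding a_def n
    by (rule two_point_inequality[of \<Omega> u x y f s e \<phi> \<phi>1 \<phi>2 1 \<kappa> c1 c2 b N z E D p q C0 Z,
          OF u mc ne s(1) e_def d1 d2 max' E_def \<kappa> N \<phi>b(1) _ \<phi>20 _ D p_def q_def P(5) Q(5) Z])
       (use \<phi>1m E in auto)
  have inv_le: "1 / r \<le> 2 / A" if "A / 2 \<le> r" for r :: real
  proof -
    have "1 / r \<le> 1 / (A / 2)" using that A1 by (intro divide_left_mono mult_pos_pos) auto
    then show ?thesis by simp
  qed
  have a: "0 \<le> a" "a \<le> 4 / A"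
    using inv_le[OF P(1)] inv_le[OF Q(1)] by (auto simp: a_def less_imp_le add_nonneg_nonneg)
  \<comment> \<open>The axial slopes are at most \<open>2 * A\<close> with
    \<open>A = E * \<phi>1 s\<close>, and so \<open>\<phi>1 s\<close> cancels against
    \<open>\<phi>2\<close>.\<close>
  have gain: "E * \<phi>2 * a\<^sup>2 \<le> - (C / (4 * E1))"
  proof -
    have "1 / (2 * A) \<le> 1 / axial_slope e q" using Q(4) A1 by (intro divide_left_mono mult_pos_pos) auto
    also have "\<dots> \<le> a" by (simp add: a_def less_imp_le)
    finally have "(1 / (2 * A))\<^sup>2 \<le> a\<^sup>2" using A1 by (intro power_mono) auto
    then have "E * \<phi>2 * a\<^sup>2 \<le> E * \<phi>2 * (1 / (2 * A))\<^sup>2"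
      using E \<phi>20 by (intro mult_left_mono_neg mult_nonneg_nonpos) auto
    also have "\<dots> = - (C / (4 * E))" unfolding A_def \<phi>2_def using E \<phi>1m by (simp add: power2_eq_square)
    also have "\<dots> \<le> - (C / (4 * E1))" using E C by (simp add: frac_le)
    finally show ?thesis .
  qed
  have cost: "E * \<phi>1 s / s * Z\<^sup>2 \<le> KZ\<^sup>2 * (32 * \<kappa>\<^sup>2 * D\<^sup>2 + 8 * N\<^sup>2)"
  proof -
    have "E * \<phi>1 s / s * Z\<^sup>2 = KZ\<^sup>2 * ((norm (p - q))\<^sup>2 / (s * A ^ 3))"
      unfolding Z_def A_def[symmetric] power_divide power_mult_distrib using A1 s0
      by (simp add: power2_eq_square power3_eq_cube)
    also have "\<dots> \<le> KZ\<^sup>2 * (((32 * \<kappa>\<^sup>2 * D\<^sup>2 + 8 * N\<^sup>2) * (s * (\<phi>1 s) ^ 3)) / (s * (\<phi>1 s) ^ 3))"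
    proof (rule mult_left_mono[OF frac_le])
      have "(norm (p - q))\<^sup>2 \<le> (4 * \<kappa> * D * \<phi> s + 2 * N * s)\<^sup>2" using pq by (intro power_mono) auto
      also have "\<dots> \<le> 2 * (4 * \<kappa> * D * \<phi> s)\<^sup>2 + 2 * (2 * N * s)\<^sup>2"
        using sum_squares_bound[of "4 * \<kappa> * D * \<phi> s" "2 * N * s"] unfolding power2_sum by linarith
      also have "\<dots> = 32 * \<kappa>\<^sup>2 * D\<^sup>2 * (\<phi> s)\<^sup>2 + 8 * N\<^sup>2 * s\<^sup>2" by (simp add: power_mult_distrib)
      also have "\<dots> \<le> 32 * \<kappa>\<^sup>2 * D\<^sup>2 * (s * (\<phi>1 s) ^ 3) + 8 * N\<^sup>2 * (s * (\<phi>1 s) ^ 3)"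
      proof (intro add_mono mult_left_mono)
        show "(\<phi> s)\<^sup>2 \<le> s * (\<phi>1 s) ^ 3"
          unfolding \<phi>_def \<phi>1_def by (rule log_profile_square_le[OF C \<delta> s0 F]) (use m in auto)
        have "1 \<le> (\<phi>1 s) ^ 3" using \<phi>1m by (simp add: one_le_power)
        then show "s\<^sup>2 \<le> s * (\<phi>1 s) ^ 3" unfolding power2_eq_square using s s0 by (intro mult_left_mono) auto
      qed auto
      finally show "(norm (p - q))\<^sup>2 \<le> (32 * \<kappa>\<^sup>2 * D\<^sup>2 + 8 * N\<^sup>2) * (s * (\<phi>1 s) ^ 3)" by (simp add: distrib_right)
      show "s * (\<phi>1 s) ^ 3 \<le> s * A ^ 3" using A \<phi>1m s0 by (intro mult_left_mono power_mono) auto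
    qed (use s0 \<phi>1m in auto)
    also have "\<dots> = KZ\<^sup>2 * (32 * \<kappa>\<^sup>2 * D\<^sup>2 + 8 * N\<^sup>2)" using s0 \<phi>1m by simp
    finally show ?thesis .
  qed
  have cross: "4 * \<kappa> * D * \<phi>1 s * (a\<^sup>2 + 2 * n\<^sup>2 * C0 * (1 / slope p + 1 / slope q)) \<le> 4 * \<kappa> * D * (16 + 8 * n\<^sup>2 * C0)"
  proof -
    have "a\<^sup>2 \<le> (4 / A)\<^sup>2" using a by (intro power_mono) auto
    also have "\<dots> = 16 / A * (1 / A)" by (simp add: power2_eq_square)
    also have "\<dots> \<le> 16 / A * 1" using A1 by (intro mult_left_mono) auto
    finally have a2: "a\<^sup>2 \<le> 16 / A" by simp
    have "1 / slope p + 1 / slope q \<le> 4 / A" using inv_le[OF P(2)] inv_le[OF Q(2)] by simp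
    then have "2 * n\<^sup>2 * C0 * (1 / slope p + 1 / slope q) \<le> 2 * n\<^sup>2 * C0 * (4 / A)" using C00 by (intro mult_left_mono) auto
    then have "a\<^sup>2 + 2 * n\<^sup>2 * C0 * (1 / slope p + 1 / slope q) \<le> (16 + 8 * n\<^sup>2 * C0) / A"
      using a2 by (simp add: add_divide_distrib)
    then have "\<phi>1 s * (a\<^sup>2 + 2 * n\<^sup>2 * C0 * (1 / slope p + 1 / slope q)) \<le> A * ((16 + 8 * n\<^sup>2 * C0) / A)"
      using A \<phi>1m A1 C00 by (intro mult_mono) (auto intro!: add_nonneg_nonneg mult_nonneg_nonneg simp: less_imp_le)
    also have "\<dots> = 16 + 8 * n\<^sup>2 * C0" using A1 by simp
    finally have "4 * \<kappa> * D * (\<phi>1 s * (a\<^sup>2 + 2 * n\<^sup>2 * C0 * (1 / slope p + 1 / slope q))) \<le> 4 * \<kappa> * D * (16 + 8 * n\<^sup>2 * C0)"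
      using \<kappa> D0 by (intro mult_left_mono) auto
    then show ?thesis by (simp only: mult.assoc)
  qed
  have n0: "0 \<le> n" by (simp add: n)
  have kphi: "4 * n * \<kappa> * \<phi> s \<le> 4 * n * \<kappa> * F" using \<phi>b n0 \<kappa> by (intro mult_left_mono) auto
  have lhs: "- (L1 * (4 * \<kappa> * D * F + 2 * N) + \<Lambda> * L1 * (1 + C0 + E1 * F)) \<le> f (x, u x) * slope p - f (y, u y) * slope q"
  proof -
    have "- (L1 * (4 * \<kappa> * D * F + 2 * N) + (\<Lambda> * L1 * norm (x - y)) * slope q) \<le> f (x, u x) * slope p - f (y, u y) * slope q"
      by (intro rhs_slope_difference rhs_bound[OF rhs u(3) uM(1)] rhs_difference[OF rhs u(2,3,4) M0 L1 lip uM]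
          order_trans[OF slope_diff pq1])
    moreover have "(\<Lambda> * L1) * (norm (x - y) * slope q) \<le> (\<Lambda> * L1) * (1 + C0 + E1 * F)"
    proof (rule mult_left_mono)
      \<comment> \<open>The slope is large but occurs only with the factor s, and
        \<open>s * A\<close> is at most \<open>E1 * F\<close>.\<close>
      have "s * slope q \<le> s * (1 + A + C0)" using Q(7) s0 by (intro mult_left_mono) auto
      also have "\<dots> = s * (1 + C0) + E * (s * \<phi>1 s)" unfolding A_def by (simp add: algebra_simps)
      also have "\<dots> \<le> 1 * (1 + C0) + E1 * F"
        using s s0 C00 E \<phi>b \<phi>1m by (intro add_mono mult_mono) auto
      finally show "norm (x - y) * slope q \<le> 1 + C0 + E1 * F" unfolding s(1) by simp
    qed (use \<Lambda> L1 in simp)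
    ultimately show ?thesis by (simp add: mult.assoc)
  qed
  have "n * (E * \<phi>1 s / s * Z\<^sup>2) \<le> n * (KZ\<^sup>2 * (32 * \<kappa>\<^sup>2 * D\<^sup>2 + 8 * N\<^sup>2))" by (rule mult_left_mono[OF cost n0])
  then have "C / (4 * E1) \<le> L1 * (4 * \<kappa> * D * F + 2 * N) + \<Lambda> * L1 * (1 + C0 + E1 * F)
       + n * KZ\<^sup>2 * (32 * \<kappa>\<^sup>2 * D\<^sup>2 + 8 * N\<^sup>2) + 4 * \<kappa> * D * (16 + 8 * n\<^sup>2 * C0)
       + 4 * n * \<kappa> * F + 2 * n * N"
    using lhs ineq gain cross kphi unfolding mult.assoc[of n "KZ\<^sup>2"] by linarith
  moreover have "0 < 4 * E1" using E by linarith
  ultimately have "C \<le> (L1 * (4 * \<kappa> * D * F + 2 * N) + \<Lambda> * L1 * (1 + C0 + E1 * F)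
       + n * KZ\<^sup>2 * (32 * \<kappa>\<^sup>2 * D\<^sup>2 + 8 * N\<^sup>2) + 4 * \<kappa> * D * (16 + 8 * n\<^sup>2 * C0)
       + 4 * n * \<kappa> * F + 2 * n * N) * (4 * E1)" by (simp only: pos_divide_le_eq)
  then show False using big unfolding KZ_def by (simp only: mult.commute[of _ "4 * E1"])
qed

section \<open>Choice of the constants\<close>

text \<open>\<open>m\<close> bounds the slope of the profile from below on \<open>[0, s0]\<close>, and \<open>\<delta>\<close> is so small that the
  profile exceeds \<open>F\<close>, a bound for the differences of \<open>u\<close>, at \<open>s0\<close>. The first condition
  on \<open>C\<close> excludes interior maxima; the lower bounds for \<open>m\<close> exclude boundary maxima.\<close>

locale profile_constants =
  fixes q \<rho> \<Lambda> D M0 L1 L2 n Lb B1 C m \<delta> s0 F \<kappa> C0 E1 C2 S t0 :: real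
  assumes q: "1 < q" and \<rho>: "0 < \<rho>" and \<Lambda>: "0 \<le> \<Lambda>" and D: "0 \<le> D" and M0: "0 < M0" and L1: "0 < L1" and L2: "0 < L2"
    and n: "0 \<le> n" and Lb: "0 < Lb" and B1: "0 \<le> B1"
    and F: "F = 2 * M0 + B1" and \<kappa>: "\<kappa> = 1 / \<rho>\<^sup>2" and C0: "C0 = 2 * \<kappa> * F * D + B1 + 2 * Lb"
    and E1: "E1 = 1 + 2 * \<kappa> * D\<^sup>2" and C2: "C2 = 2 * D / \<rho>\<^sup>2" and S: "S = L2 + 2 * F / \<rho>"
    and t0: "t0 = min (1 / 4) (1 / (4 * (q - 1)))"
    and C_big: "4 * E1 * (L1 * (4 * \<kappa> * D * F + 2 * Lb) + \<Lambda> * L1 * (1 + C0 + E1 * F)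
       + n * (4 * C0 + 40 * C0\<^sup>2)\<^sup>2 * (32 * \<kappa>\<^sup>2 * D\<^sup>2 + 8 * Lb\<^sup>2) + 4 * \<kappa> * D * (16 + 8 * n\<^sup>2 * C0)
       + 4 * n * \<kappa> * F + 2 * n * Lb) < C"
    and C1: "1 \<le> C"
    and m: "1 \<le> m" "2 * C0 \<le> m" "2 * F \<le> m" "2 * C * F\<^sup>2 \<le> m" "8 * \<rho> * (3 * Lb) \<le> m"
      "8 * \<rho> * L2 * (q - 1) * (C2 + 3 * Lb) < m" "S + 3 * Lb \<le> m" "C2 + S / \<rho> + 3 * Lb \<le> m"
    and mq: "8 * \<rho> * C * L2 < m powr (q - 1) * ln (1 + t0)" "128 * \<rho> * C * L2 * (q - 1) < m powr (q - 1)"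
    and s0: "s0 = 1 / (2 * C * m)" and \<delta>: "\<delta> = s0 * exp (- (C * F))"

text \<open>The choice is not circular: \<open>C_big\<close> involves neither m nor \<delta>, the
  conditions on m involve C but not \<delta>, and \<open>s0\<close> and \<delta> are then
  explicit.\<close>

lemma profile_constants_exist:
  fixes q \<rho> \<Lambda> D M0 L1 L2 n Lb B1 :: real
  assumes "1 < q" "0 < \<rho>" "0 \<le> \<Lambda>" "0 \<le> D" "0 < M0" "0 < L1" "0 < L2" "0 \<le> n" "0 < Lb" "0 \<le> B1"
  shows "\<exists>C m \<delta> s0 F \<kappa> C0 E1 C2 S t0. profile_constants q \<rho> \<Lambda> D M0 L1 L2 n Lb B1 C m \<delta> s0 F \<kappa> C0 E1 C2 S t0"
proof -
  define F where "F = 2 * M0 + B1"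
  define \<kappa> where "\<kappa> = 1 / \<rho>\<^sup>2"
  define C0 where "C0 = 2 * \<kappa> * F * D + B1 + 2 * Lb"
  define E1 where "E1 = 1 + 2 * \<kappa> * D\<^sup>2"
  define C2 where "C2 = 2 * D / \<rho>\<^sup>2"
  define S where "S = L2 + 2 * F / \<rho>"
  define t0 where "t0 = min (1 / 4) (1 / (4 * (q - 1)))"
  define K where "K = 4 * E1 * (L1 * (4 * \<kappa> * D * F + 2 * Lb) + \<Lambda> * L1 * (1 + C0 + E1 * F)
       + n * (4 * C0 + 40 * C0\<^sup>2)\<^sup>2 * (32 * \<kappa>\<^sup>2 * D\<^sup>2 + 8 * Lb\<^sup>2) + 4 * \<kappa> * D * (16 + 8 * n\<^sup>2 * C0)
       + 4 * n * \<kappa> * F + 2 * n * Lb)"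
  define C where "C = 1 + \<bar>K\<bar>"
  have C: "1 \<le> C" "K < C" by (simp_all add: C_def)
  have t0: "0 < t0" using assms by (simp add: t0_def)
  then have lt0: "0 < ln (1 + t0)" by simp
  \<comment> \<open>A single number above both lower bounds required of
    \<open>m powr (q - 1)\<close>; its root is one of the members of X.\<close>
  define J where "J = 8 * \<rho> * C * L2 / ln (1 + t0) + 128 * \<rho> * C * L2 * (q - 1)"
  have J1: "0 < 8 * \<rho> * C * L2 / ln (1 + t0)" "0 < 128 * \<rho> * C * L2 * (q - 1)" using assms C lt0 by simp_all
  define X where "X = {1, 2 * C0, 2 * F, 2 * C * F\<^sup>2, 8 * \<rho> * (3 * Lb), 8 * \<rho> * L2 * (q - 1) * (C2 + 3 * Lb),
     S + 3 * Lb, C2 + S / \<rho> + 3 * Lb, J powr (1 / (q - 1))}"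
  define m where "m = Max X + 1"
  have X: "r < m" if "r \<in> X" for r
  proof -
    have "r \<le> Max X" by (rule Max_ge[OF _ that]) (simp add: X_def)
    then show ?thesis by (simp add: m_def)
  qed
  have m: "1 \<le> m" "2 * C0 \<le> m" "2 * F \<le> m" "2 * C * F\<^sup>2 \<le> m" "8 * \<rho> * (3 * Lb) \<le> m"
      "8 * \<rho> * L2 * (q - 1) * (C2 + 3 * Lb) < m" "S + 3 * Lb \<le> m" "C2 + S / \<rho> + 3 * Lb \<le> m"
      "J powr (1 / (q - 1)) < m"
    by (intro X less_imp_le[OF X]; simp only: X_def insert_iff simp_thms)+
  have "J = (J powr (1 / (q - 1))) powr (q - 1)" using J1 assms by (simp add: J_def powr_powr)
  also have "\<dots> < m powr (q - 1)" using m(9) assms by (intro powr_less_mono2) auto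
  finally have Jm: "J < m powr (q - 1)" .
  then have "8 * \<rho> * C * L2 / ln (1 + t0) < m powr (q - 1)" "128 * \<rho> * C * L2 * (q - 1) < m powr (q - 1)"
    using J1 unfolding J_def by linarith+
  then have mq: "8 * \<rho> * C * L2 < m powr (q - 1) * ln (1 + t0)" "128 * \<rho> * C * L2 * (q - 1) < m powr (q - 1)"
    using lt0 by (simp_all only: pos_divide_less_eq)
  have "profile_constants q \<rho> \<Lambda> D M0 L1 L2 n Lb B1 C m (1 / (2 * C * m) * exp (- (C * F))) (1 / (2 * C * m)) F \<kappa> C0 E1 C2 S t0"
    unfolding profile_constants_def
    using assms F_def \<kappa>_def C0_def E1_def C2_def S_def t0_def C K_def m mq by simp
  then show ?thesis by blast
qed

section \<open>Consequences of the choice of constants\<close>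

context profile_constants
begin

text \<open>The slope of the profile at 0.\<close>

definition P :: real where "P = 1 / (C * \<delta>)"

abbreviation \<phi> :: "real \<Rightarrow> real" where "\<phi> \<equiv> log_profile C \<delta>"

definition \<phi>1 :: "real \<Rightarrow> real" where "\<phi>1 s = 1 / (C * (s + \<delta>))"

lemma F_nonneg: "0 \<le> F"
  using F M0 B1 by simp

lemma s0_bounds: "0 < s0" "s0 \<le> 1" "C2 * s0 \<le> 1 / 2" "s0 * m \<le> 1 / 2"
proof -
  have Cm: "0 < C * m" "1 * m \<le> C * m" using C1 m by (auto intro: mult_right_mono mult_pos_pos)
  show "0 < s0" using Cm by (simp add: s0)
  have "s0 * m = 1 / (2 * C)" using m by (simp add: s0)
  also have "\<dots> \<le> 1 / 2" using C1 by simp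
  finally show sm: "s0 * m \<le> 1 / 2" .
  have "s0 * 1 \<le> s0 * m" using \<open>0 < s0\<close> m by (intro mult_left_mono) auto
  then show "s0 \<le> 1" using sm by simp
  have "0 \<le> S" using L2 F_nonneg \<rho> by (simp add: S)
  then have "0 \<le> S / \<rho>" using \<rho> by simp
  then have "C2 \<le> m" using m Lb by linarith
  then have "C2 * s0 \<le> m * s0" using \<open>0 < s0\<close> by (intro mult_right_mono) auto
  then show "C2 * s0 \<le> 1 / 2" using sm by (simp add: mult.commute)
qed

lemma \<delta>_bounds: "0 < \<delta>" "\<delta> \<le> s0" "\<delta> * (C2 + S / \<rho> + 3 * Lb) \<le> 1"
proof -
  show d: "0 < \<delta>" unfolding \<delta> using s0_bounds by simp
  have "exp (- (C * F)) \<le> 1" using C1 F_nonneg by simp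
  then show le: "\<delta> \<le> s0" unfolding \<delta> using s0_bounds by (intro mult_left_le) auto
  have "\<delta> * (C2 + S / \<rho> + 3 * Lb) \<le> \<delta> * m" using d m by (intro mult_left_mono) auto
  also have "\<dots> \<le> s0 * m" using le m by (intro mult_right_mono) auto
  finally show "\<delta> * (C2 + S / \<rho> + 3 * Lb) \<le> 1" using s0_bounds by linarith
qed

lemma C_pos: "0 < C"
  using C1 by simp

lemma m_le_\<phi>1:
  assumes "0 \<le> s" "s \<le> s0"
  shows "m \<le> \<phi>1 s"
proof -
  have "C * (s + \<delta>) \<le> C * (s0 + s0)" using assms \<delta>_bounds C_pos by (intro mult_left_mono) auto
  then have "1 / (C * (s0 + s0)) \<le> \<phi>1 s" unfolding \<phi>1_def
    using assms \<delta>_bounds C_pos s0_bounds by (intro divide_left_mono mult_pos_pos) auto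
  moreover have "1 / (C * (s0 + s0)) = m" using C_pos m by (simp add: s0)
  ultimately show ?thesis by simp
qed

lemma P_alt: "0 \<le> s \<Longrightarrow> \<phi>1 s = P / (1 + s / \<delta>)"
  using \<delta>_bounds C_pos by (simp add: \<phi>1_def P_def field_simps)

lemma P_ge: "m \<le> P" "1 \<le> P"
  using m_le_\<phi>1[of 0] s0_bounds m by (auto simp: \<phi>1_def P_def)

lemma \<phi>1_le_P: "0 \<le> s \<Longrightarrow> \<phi>1 s \<le> P"
  unfolding P_def \<phi>1_def using \<delta>_bounds C_pos by (intro divide_left_mono mult_pos_pos) auto

lemma profile_reaches: "F \<le> \<phi> s0"
proof -
  have "s0 \<noteq> 0" using s0_bounds(1) by simp
  then have eq: "exp (C * F) = s0 / \<delta>" unfolding \<delta> exp_minus by (simp add: inverse_eq_divide)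
  have "C * F = ln (s0 / \<delta>)" unfolding eq[symmetric] by (rule ln_exp[symmetric])
  also have "\<dots> \<le> ln (1 + s0 / \<delta>)"
    using divide_pos_pos[OF s0_bounds(1) \<delta>_bounds(1)] by simp
  finally show ?thesis unfolding log_profile_def using C_pos by (simp add: pos_le_divide_eq mult.commute)
qed

text \<open>A balance of normal components in units of
  \<open>\<tau> = \<phi> s / (8 * \<rho>)\<close>: the term with \<open>T\<close> contributes - 16,
  the axis at most 14 because \<open>E \<le> 7 / 2\<close> and
  \<open>e \<bullet> \<gamma> \<le> s / (2 * \<rho>)\<close>, and the error at most 1. The net - 1
  is the margin that the two strict inequalities require.\<close>

lemma boundary_strict:
  fixes p e \<gamma> err :: "'a::euclidean_space"
  assumes \<gamma>: "norm \<gamma> = 1" and e: "norm e = 1" and s: "0 < s" "s \<le> s0" and \<phi>F: "\<phi> s \<le> F"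
    and E: "\<bar>E - 3\<bar> \<le> C2 * s" and e\<gamma>: "e \<bullet> \<gamma> \<le> s / (2 * \<rho>)" and err: "norm err \<le> 3 * Lb * s"
    and \<theta>: "\<bar>\<theta>\<bar> \<le> L2" "\<bar>oblique_fun q (3 * P) \<theta>\<bar> \<le> L2"
    and p: "p = (E * \<phi>1 s) *\<^sub>R e + (\<theta> - 2 * \<phi> s / \<rho>) *\<^sub>R \<gamma> + err"
  shows "slope p powr (q - 1) * (p \<bullet> \<gamma>) < oblique_fun q (3 * P) \<theta>"
proof -
  define A \<sigma> \<tau> where "A = E * \<phi>1 s" and "\<sigma> = \<theta> - 2 * \<phi> s / \<rho>" and "\<tau> = \<phi> s / (8 * \<rho>)"
  have gg: "\<gamma> \<bullet> \<gamma> = 1" using \<gamma> by (simp add: dot_square_norm)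
  have s': "0 \<le> s" "s \<le> 1" using s s0_bounds by auto
  have C20: "0 \<le> C2" unfolding C2 using D by simp
  have C2s: "C2 * s \<le> 1 / 2" using mult_left_mono[OF s(2) C20] s0_bounds by linarith
  note lb = log_profile_bounds[OF C_pos \<delta>_bounds(1) s'(1)]
  have m\<phi>: "m \<le> \<phi>1 s" using m_le_\<phi>1 s by simp
  have s\<phi>1: "s * \<phi>1 s \<le> \<phi> s" using lb unfolding \<phi>1_def by simp
  have sm: "s * m \<le> \<phi> s" using mult_left_mono[OF m\<phi> s'(1)] s\<phi>1 by linarith
  have E': "3 - C2 * s \<le> E" "E \<le> 3 + C2 * s" "5 / 2 \<le> E" "E \<le> 7 / 2" using E C2s by (auto simp: abs_le_iff)
  have \<phi>1pos: "0 < \<phi>1 s" using m\<phi> m by linarith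
  have A0: "0 \<le> A" unfolding A_def using E' \<phi>1pos by simp
  have \<phi>pos: "0 < \<phi> s" using sm s m by (smt (verit) mult_pos_pos)
  have \<tau>pos: "0 < \<tau>" unfolding \<tau>_def using \<phi>pos \<rho> by simp
  have upper: "p \<bullet> \<gamma> \<le> \<theta> - \<tau>"
  proof -
    have "A * (e \<bullet> \<gamma>) \<le> A * (s / (2 * \<rho>))" using e\<gamma> A0 by (rule mult_left_mono)
    also have "\<dots> = (E * (s * \<phi>1 s)) / (2 * \<rho>)" by (simp add: A_def)
    also have "\<dots> \<le> (7 / 2 * \<phi> s) / (2 * \<rho>)"
      using E' s\<phi>1 \<rho> \<phi>1pos s' by (intro divide_right_mono mult_mono) auto
    also have "\<dots> = 14 * \<tau>" by (simp add: \<tau>_def)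
    finally have 1: "A * (e \<bullet> \<gamma>) \<le> 14 * \<tau>" .
    have "(8 * \<rho> * (3 * Lb)) * s \<le> m * s" using m s' by (intro mult_right_mono) auto
    then have "3 * Lb * s * (8 * \<rho>) \<le> \<phi> s" using sm by (simp add: mult_ac)
    then have 2: "3 * Lb * s \<le> \<tau>" unfolding \<tau>_def using \<rho> by (simp add: pos_le_divide_eq)
    have "\<bar>err \<bullet> \<gamma>\<bar> \<le> norm err" using Cauchy_Schwarz_ineq2[of err \<gamma>] \<gamma> by simp
    then have 3: "err \<bullet> \<gamma> \<le> \<tau>" using err 2 by linarith
    have "p \<bullet> \<gamma> = A * (e \<bullet> \<gamma>) + \<theta> - 16 * \<tau> + err \<bullet> \<gamma>"
      unfolding p A_def[symmetric] inner_add_left inner_scaleR_left gg \<tau>_def by simp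
    then show ?thesis using 1 3 by linarith
  qed
  have p': "p = A *\<^sub>R e + \<sigma> *\<^sub>R \<gamma> + err" unfolding p A_def \<sigma>_def ..
  show ?thesis
  proof (cases "0 \<le> \<theta>")
    case True
    have "slope p powr (q - 1) * (p \<bullet> \<gamma>) < sqrt (1 + (3 * P)\<^sup>2 + \<theta>\<^sup>2) powr (q - 1) * \<theta>"
    proof (rule oblique_strict_pos[OF q \<gamma> e s(1) P_ge(2) A0 _ err p' C20 _ \<tau>pos upper L2 _ _ True])
      show "A \<le> (3 + C2 * s) * P" unfolding A_def using E' \<phi>1_le_P[OF s'(1)] \<phi>1pos by (intro mult_mono) auto
      have "(8 * \<rho> * L2 * (q - 1) * (C2 + 3 * Lb)) * s < m * s" using m s by (intro mult_strict_right_mono) auto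
      moreover have "(8 * \<rho> * L2 * (q - 1) * (C2 + 3 * Lb)) * s = ((q - 1) * (C2 + 3 * Lb) * s) * (8 * \<rho> * L2)"
        by (simp only: mult_ac)
      moreover have "m * s = s * m" by (rule mult.commute)
      ultimately have "((q - 1) * (C2 + 3 * Lb) * s) * (8 * \<rho> * L2) < \<phi> s" using sm by linarith
      then have "(q - 1) * (C2 + 3 * Lb) * s < \<phi> s / (8 * \<rho> * L2)" using \<rho> L2 by (simp add: pos_less_divide_eq)
      then show "(q - 1) * (C2 + 3 * Lb) * s < \<tau> / L2" by (simp add: \<tau>_def)
    qed (use Lb \<theta> in auto)
    then show ?thesis by (simp add: oblique_fun_def)
  next
    case False
    have "slope p powr (q - 1) * (p \<bullet> \<gamma>) < sqrt (1 + (3 * P)\<^sup>2 + \<theta>\<^sup>2) powr (q - 1) * \<theta>"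
    proof (rule oblique_strict_neg[OF q \<gamma> e s(1) s'(2) \<delta>_bounds(1) C_pos P_def P_ge(2) A0 _ _ _ C2s err \<rho> p' _ _ e\<gamma> C20 _ _ upper L2 _ _ m(7) t0 mq \<delta>_bounds(3)])
      show "(3 - C2 * s) * (P / (1 + s / \<delta>)) \<le> A"
        unfolding A_def P_alt[OF s'(1), symmetric] using E' \<phi>1pos by (intro mult_right_mono) auto
      show "m \<le> P / (1 + s / \<delta>)" using m\<phi> unfolding P_alt[OF s'(1)] .
      show "\<sigma> \<le> \<theta>" unfolding \<sigma>_def using \<phi>pos \<rho> by simp
      have "2 * \<phi> s / \<rho> \<le> 2 * F / \<rho>" using \<phi>F \<rho> by (intro divide_right_mono) auto
      then show "- S \<le> \<sigma>" unfolding \<sigma>_def S using \<theta> by linarith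
      show "\<tau> = ln (1 + s / \<delta>) / (8 * \<rho> * C)" by (simp add: \<tau>_def log_profile_def)
      show "- \<theta> * sqrt (1 + (3 * P)\<^sup>2 + \<theta>\<^sup>2) powr (q - 1) \<le> L2"
        using \<theta>(2) unfolding oblique_fun_def by (simp add: mult.commute abs_le_iff)
    qed (use Lb m False in auto)
    then show ?thesis by (simp add: oblique_fun_def)
  qed
qed

end

section \<open>First derivatives up to the boundary\<close>

text \<open>\<open>grad_cl\<close> is a limit within S; the extensions of the partial derivatives
  show that it exists at every point of the closure.\<close>

lemma grad_cl_extension:
  fixes u :: "'a::euclidean_space \<Rightarrow> real"
  assumes C: "C_closure k S u" "1 \<le> k" and S: "open S"
  shows "continuous_on (closure S) (grad_cl S u)" "\<And>x. x \<in> S \<Longrightarrow> grad_cl S u x = grad u x"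
proof -
  have Con: "C_on k S u" using C by (simp add: C_closure_def)
  show int: "grad_cl S u x = grad u x" if "x \<in> S" for x
    by (rule grad_cl_interior[OF Con C(2) S that])
  have "\<exists>g. continuous_on (closure S) g \<and> (\<forall>x\<in>S. g x = partial_derivs [b] u x)" if "b \<in> Basis" for b
  proof -
    have "[b] \<in> lists Basis" "length [b] \<le> k" using that C(2) by auto
    then show ?thesis using C(1) unfolding C_closure_def by blast
  qed
  then obtain g where g: "\<And>b. b \<in> Basis \<Longrightarrow> continuous_on (closure S) (g b)"
    "\<And>b x. b \<in> Basis \<Longrightarrow> x \<in> S \<Longrightarrow> g b x = partial_derivs [b] u x" by metis
  define G where "G x = (\<Sum>b\<in>Basis. g b x *\<^sub>R b)" for x
  have G: "continuous_on (closure S) G" unfolding G_def by (intro continuous_intros g(1))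
  have GS: "G x = grad u x" if "x \<in> S" for x
    unfolding G_def grad_partial by (intro sum.cong refl) (simp only: g(2)[OF _ that])
  have "grad_cl S u x = G x" if x: "x \<in> closure S" for x
  proof (cases "x \<in> S")
    case True
    then show ?thesis using int GS by simp
  next
    case False
    then have "x islimpt S" using x by (simp add: closure_def)
    then have nt: "at x within S \<noteq> bot" by (simp add: trivial_limit_within)
    have "(G \<longlongrightarrow> G x) (at x within closure S)" using G x by (simp add: continuous_on_def)
    then have "(G \<longlongrightarrow> G x) (at x within S)" by (rule tendsto_within_subset) (rule closure_subset)
    moreover have "\<forall>\<^sub>F y in at x within S. G y = grad u y"
      unfolding eventually_at_filter by (intro always_eventually allI impI) (rule GS)
    ultimately have "(grad u \<longlongrightarrow> G x) (at x within S)" by (rule Lim_transform_eventually)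
    then show ?thesis unfolding grad_cl_def using nt by (intro tendsto_Lim)
  qed
  then show "continuous_on (closure S) (grad_cl S u)" using G continuous_on_cong[OF refl, of "closure S" "grad_cl S u" G] by simp
qed

text \<open>u may fail to be differentiable at x, as its values outside S are arbitrary. The mean
  value theorem on the inward ray and the continuity of \<open>grad_cl\<close> take the place of a
  derivative. The factor \<sigma> serves for u at x and for - u at y.\<close>

lemma boundary_derivative_le:
  fixes u :: "'a::euclidean_space \<Rightarrow> real" and \<Psi> :: "real \<Rightarrow> real" and \<sigma> :: real
  assumes C: "C_closure k S u" "1 \<le> k" and S: "open S" and x: "x \<in> closure S" and t1: "0 < t1"
    and ray: "\<And>t. 0 < t \<Longrightarrow> t < t1 \<Longrightarrow> x + t *\<^sub>R \<xi> \<in> S"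
    and \<Psi>: "(\<Psi> has_real_derivative d) (at 0)"
    and max: "\<And>t. 0 < t \<Longrightarrow> t < t1 \<Longrightarrow> \<sigma> * u (x + t *\<^sub>R \<xi>) - \<Psi> t \<le> \<sigma> * u x - \<Psi> 0"
  shows "\<sigma> * (grad_cl S u x \<bullet> \<xi>) \<le> d"
proof (rule ccontr)
  assume "\<not> \<sigma> * (grad_cl S u x \<bullet> \<xi>) \<le> d"
  then have gt: "d < \<sigma> * (grad_cl S u x \<bullet> \<xi>)" by simp
  define c where "c = (d + \<sigma> * (grad_cl S u x \<bullet> \<xi>)) / 2"
  have c: "d < c" "c < \<sigma> * (grad_cl S u x \<bullet> \<xi>)" using gt by (simp_all add: c_def)
  have Con: "C_on k S u" and cu: "continuous_on (closure S) u" using C by (simp_all add: C_closure_def)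
  have cl: "x + t *\<^sub>R \<xi> \<in> closure S" if "0 \<le> t" "t < t1" for t
    using ray[of t] x that closure_subset by (cases "t = 0") auto
  have cont: "continuous_on {0..<t1} (\<lambda>t. \<sigma> * (grad_cl S u (x + t *\<^sub>R \<xi>) \<bullet> \<xi>))"
    by (intro continuous_intros continuous_on_compose2[OF grad_cl_extension(1)[OF C S]]) (use cl in auto)
  have "((\<lambda>t. \<sigma> * (grad_cl S u (x + t *\<^sub>R \<xi>) \<bullet> \<xi>)) \<longlongrightarrow> \<sigma> * (grad_cl S u (x + 0 *\<^sub>R \<xi>) \<bullet> \<xi>)) (at 0 within {0..<t1})"
    by - (rule bspec[OF cont[unfolded continuous_on_def]], use t1 in simp)
  then have "\<forall>\<^sub>F t in at 0 within {0..<t1}. c < \<sigma> * (grad_cl S u (x + t *\<^sub>R \<xi>) \<bullet> \<xi>)"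
    by (rule order_tendstoD) (use c in simp)
  then obtain t2 where t2: "t2 > 0" "\<And>t. 0 < t \<Longrightarrow> t < t1 \<Longrightarrow> t < t2 \<Longrightarrow> c < \<sigma> * (grad_cl S u (x + t *\<^sub>R \<xi>) \<bullet> \<xi>)"
    unfolding eventually_at by (auto simp: dist_real_def)
  have "((\<lambda>t. c * t - \<Psi> t) has_real_derivative c - d) (at 0)"
    by (auto intro!: derivative_eq_intros \<Psi>)
  then have "\<exists>t3>0. \<forall>h>0. h < t3 \<longrightarrow> c * 0 - \<Psi> 0 < c * (0 + h) - \<Psi> (0 + h)"
    by (rule DERIV_pos_inc_right) (use c in simp)
  then obtain t3 where t3: "t3 > 0" and t3': "\<And>t. 0 < t \<Longrightarrow> t < t3 \<Longrightarrow> c * 0 - \<Psi> 0 < c * (0 + t) - \<Psi> (0 + t)" by blast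
  define t where "t = Min {t1, t2, t3} / 2"
  have t: "0 < t" "t < t1" "t < t2" "t < t3" using t1 t2(1) t3 by (auto simp: t_def min_def)
  have der: "((\<lambda>t. u (x + t *\<^sub>R \<xi>)) has_real_derivative grad u (x + z *\<^sub>R \<xi>) \<bullet> \<xi>) (at z)"
    if "0 < z" "z < t" for z
    by (rule line_has_derivative[OF C_on_has_derivative[OF Con S ray C(2)]]) (use that t in auto)
  have "\<exists>l z. 0 < z \<and> z < t \<and> ((\<lambda>t. u (x + t *\<^sub>R \<xi>)) has_real_derivative l) (at z)
      \<and> u (x + t *\<^sub>R \<xi>) - u (x + 0 *\<^sub>R \<xi>) = (t - 0) * l"
  proof (rule MVT[OF t(1)])
    show "continuous_on {0..t} (\<lambda>t. u (x + t *\<^sub>R \<xi>))"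
      by (intro continuous_on_compose2[OF cu] continuous_intros) (use cl t in auto)
    show "(\<lambda>t. u (x + t *\<^sub>R \<xi>)) differentiable at z" if "0 < z" "z < t" for z
      using der[OF that] real_differentiable_def by blast
  qed
  then obtain l z where z: "0 < z" "z < t" and dl: "((\<lambda>t. u (x + t *\<^sub>R \<xi>)) has_real_derivative l) (at z)"
    and eq: "u (x + t *\<^sub>R \<xi>) - u x = t * l" by auto
  have "l = grad u (x + z *\<^sub>R \<xi>) \<bullet> \<xi>" by (rule DERIV_unique[OF dl der[OF z]])
  also have "\<dots> = grad_cl S u (x + z *\<^sub>R \<xi>) \<bullet> \<xi>"
    using grad_cl_extension(2)[OF C S ray[of z]] z t by simp
  finally have "c < \<sigma> * l" using t2(2)[of z] z t by simp
  then have "c * t < t * (\<sigma> * l)" using t by (simp add: mult.commute)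
  moreover have "t * (\<sigma> * l) = \<sigma> * u (x + t *\<^sub>R \<xi>) - \<sigma> * u x"
    using eq by (simp add: right_diff_distrib[symmetric] mult.left_commute)
  moreover have "\<sigma> * u (x + t *\<^sub>R \<xi>) - \<sigma> * u x \<le> \<Psi> t - \<Psi> 0" using max[OF t(1,2)] by simp
  ultimately show False using t3'[OF t(1,4)] by simp
qed

text \<open>What a maximum at a boundary point leaves of the first-order condition when only
  directions into the domain can be tested.\<close>

lemma outward_direction:
  fixes d \<gamma> :: "'a::real_inner"
  assumes \<gamma>: "norm \<gamma> = 1" and d: "\<And>\<xi>. 0 < \<xi> \<bullet> \<gamma> \<Longrightarrow> d \<bullet> \<xi> \<le> 0"
  obtains l where "0 \<le> l" "d = - l *\<^sub>R \<gamma>"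
proof -
  have gg: "\<gamma> \<bullet> \<gamma> = 1" using \<gamma> by (simp add: dot_square_norm)
  define w where "w = tang \<gamma> d"
  have wg: "w \<bullet> \<gamma> = 0" unfolding w_def using inner_tang[OF \<gamma>, of d] by (simp add: inner_commute)
  have dw: "d \<bullet> w = w \<bullet> w"
  proof -
    have "d = w + (d \<bullet> \<gamma>) *\<^sub>R \<gamma>" by (simp add: w_def tang_def)
    then have "d \<bullet> w = w \<bullet> w + (d \<bullet> \<gamma>) * (\<gamma> \<bullet> w)" by (metis inner_add_left inner_scaleR_left)
    then show ?thesis using wg by (simp add: inner_commute)
  qed
  have "w \<bullet> w \<le> 0"
  proof (rule ccontr)
    assume "\<not> w \<bullet> w \<le> 0"
    then have pos: "0 < w \<bullet> w" by linarith
    \<comment> \<open>The vector w is only a limit of admissible directions; this tilt makes it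
      admissible and is small enough not to spoil the sign.\<close>
    define r where "r = (w \<bullet> w) / (2 * (1 + \<bar>d \<bullet> \<gamma>\<bar>))"
    have r: "0 < r" using pos by (simp add: r_def add_pos_nonneg)
    have "d \<bullet> (w + r *\<^sub>R \<gamma>) \<le> 0" by (rule d) (simp add: inner_add_left wg gg r)
    then have "w \<bullet> w + r * (d \<bullet> \<gamma>) \<le> 0" by (simp add: inner_add_right dw)
    moreover have "r * (- \<bar>d \<bullet> \<gamma>\<bar>) \<le> r * (d \<bullet> \<gamma>)" using r by (intro mult_left_mono) auto
    moreover have "r * (2 * (1 + \<bar>d \<bullet> \<gamma>\<bar>)) = w \<bullet> w" unfolding r_def by (simp add: add_nonneg_eq_0_iff)
    ultimately have "r * (2 + \<bar>d \<bullet> \<gamma>\<bar>) \<le> 0" by (simp add: algebra_simps)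
    moreover have "0 < r * (2 + \<bar>d \<bullet> \<gamma>\<bar>)" using r by (intro mult_pos_pos) auto
    ultimately show False by simp
  qed
  then have "w \<bullet> w = 0" using inner_ge_zero[of w] by linarith
  then have "w = 0" by simp
  then have deq: "d = - (- (d \<bullet> \<gamma>)) *\<^sub>R \<gamma>" by (simp add: w_def tang_def)
  have "d \<bullet> \<gamma> \<le> 0" by (rule d) (simp add: gg)
  then show ?thesis using that[of "- (d \<bullet> \<gamma>)"] deq by simp
qed

section \<open>Consequences of the touching balls\<close>

lemma mcshane_extension:
  fixes h :: "'a::metric_space \<Rightarrow> real"
  assumes S: "S \<noteq> {}" and L: "0 \<le> L" and lip: "\<And>x y. x \<in> S \<Longrightarrow> y \<in> S \<Longrightarrow> h x - h y \<le> L * dist x y"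
  obtains k where "\<And>x. x \<in> S \<Longrightarrow> k x = h x" "\<And>x y. \<bar>k x - k y\<bar> \<le> L * dist x y"
proof -
  obtain s where s: "s \<in> S" using S by blast
  define k where "k x = (INF z\<in>S. h z + L * dist x z)" for x
  have bdd: "bdd_below ((\<lambda>z. h z + L * dist x z) ` S)" for x
  proof (rule bdd_belowI2)
    fix z assume z: "z \<in> S"
    have "L * dist s z \<le> L * (dist x s + dist x z)" using L dist_triangle3[of s z x] by (intro mult_left_mono) auto
    then show "h s - L * dist x s \<le> h z + L * dist x z" using lip[OF s z] by (simp add: distrib_left)
  qed
  have le: "k x \<le> h z + L * dist x z" if "z \<in> S" for x z
    unfolding k_def by (rule cINF_lower[OF bdd that])
  have ge: "r \<le> k x" if "\<And>z. z \<in> S \<Longrightarrow> r \<le> h z + L * dist x z" for r x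
    unfolding k_def by (rule cINF_greatest[OF S that])
  have 1: "k x = h x" if x: "x \<in> S" for x
  proof (rule order_antisym)
    show "k x \<le> h x" using le[OF x, of x] by simp
    show "h x \<le> k x" by (rule ge) (use lip[OF x] in \<open>simp add: algebra_simps\<close>)
  qed
  have 2: "k x - L * dist x y \<le> k y" for x y
  proof (rule ge)
    fix z assume z: "z \<in> S"
    have "L * dist x z \<le> L * (dist x y + dist y z)" using L by (intro mult_left_mono dist_triangle) auto
    then show "k x - L * dist x y \<le> h z + L * dist y z" using le[OF z, of x] by (simp add: distrib_left)
  qed
  have "\<bar>k x - k y\<bar> \<le> L * dist x y" for x y using 2[of x y] 2[of y x] by (simp add: dist_commute abs_le_iff)
  then show ?thesis using that 1 by blast
qed

text \<open>Extending each coordinate separately costs the dimension as a factor, the n in the lower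
  bound for \<open>Lb\<close>.\<close>

lemma vector_lipschitz_extension:
  fixes b :: "'a::metric_space \<Rightarrow> 'b::euclidean_space"
  assumes S: "S \<noteq> {}" and L: "0 \<le> L" and lip: "\<And>x y. x \<in> S \<Longrightarrow> y \<in> S \<Longrightarrow> norm (b x - b y) \<le> L * dist x y"
  obtains c where "\<And>x. x \<in> S \<Longrightarrow> c x = b x" "\<And>x y. norm (c x - c y) \<le> (real DIM('b) * L) * dist x y"
proof -
  have "\<exists>k. (\<forall>x\<in>S. k x = b x \<bullet> i) \<and> (\<forall>x y. \<bar>k x - k y\<bar> \<le> L * dist x y)" if i: "i \<in> Basis" for i
  proof -
    have l: "b x \<bullet> i - b y \<bullet> i \<le> L * dist x y" if "x \<in> S" "y \<in> S" for x y
    proof -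
      have "b x \<bullet> i - b y \<bullet> i = (b x - b y) \<bullet> i" by (rule inner_diff_left[symmetric])
      also have "\<dots> \<le> norm (b x - b y)" using Basis_le_norm[OF i, of "b x - b y"] by simp
      finally show ?thesis using lip[OF that] by linarith
    qed
    show ?thesis using mcshane_extension[OF S L l] by metis
  qed
  then obtain k where k: "\<And>i x. i \<in> Basis \<Longrightarrow> x \<in> S \<Longrightarrow> k i x = b x \<bullet> i"
    "\<And>i x y. i \<in> Basis \<Longrightarrow> \<bar>k i x - k i y\<bar> \<le> L * dist x y" by metis
  define c where "c x = (\<Sum>i\<in>Basis. k i x *\<^sub>R i)" for x
  have "c x = b x" if "x \<in> S" for x
    unfolding c_def by (simp add: k(1)[OF _ that] euclidean_representation)
  moreover have "norm (c x - c y) \<le> (real DIM('b) * L) * dist x y" for x y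
  proof -
    have "c x - c y = (\<Sum>i\<in>Basis. (k i x - k i y) *\<^sub>R i)"
      unfolding c_def by (simp add: sum_subtractf scaleR_left_diff_distrib)
    also have "norm \<dots> \<le> (\<Sum>i\<in>Basis. norm ((k i x - k i y) *\<^sub>R i))" by (rule norm_sum)
    also have "\<dots> \<le> (\<Sum>i\<in>(Basis::'b set). L * dist x y)" by (intro sum_mono) (use k(2) in simp)
    finally show ?thesis by simp
  qed
  ultimately show ?thesis using that by blast
qed

section \<open>Normals, chords and centres of inner balls\<close>

lemma disjoint_balls_distance:
  fixes a c :: "'a::euclidean_space"
  assumes "ball a r \<inter> ball c r = {}" "0 < r"
  shows "2 * r \<le> norm (a - c)"
proof (rule ccontr)
  assume "\<not> 2 * r \<le> norm (a - c)"
  then have "norm (a - c) < 2 * r" by simp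
  then have "midpoint a c \<in> ball a r \<inter> ball c r"
    by (simp add: dist_midpoint) (simp add: dist_norm)
  then show False using assms(1) by blast
qed

text \<open>The inner ball at one point and the outer ball at the other are disjoint, so their
  centres are at least 2 \<rho> apart. Squared and added for both orders, this gives the bound by
  the parallelogram law.\<close>

lemma touching_balls_normal_lipschitz:
  fixes \<gamma> :: "'a::euclidean_space \<Rightarrow> 'a"
  assumes x: "touching_balls \<Omega> \<gamma> \<rho> x" "norm (\<gamma> x) = 1" and y: "touching_balls \<Omega> \<gamma> \<rho> y" "norm (\<gamma> y) = 1" and \<rho>: "0 < \<rho>"
  shows "norm (\<gamma> x - \<gamma> y) \<le> norm (x - y) / \<rho>"
proof -
  define d g where "d = x - y" and "g = \<gamma> x + \<gamma> y"
  have "2 * \<rho> \<le> norm ((x + \<rho> *\<^sub>R \<gamma> x) - (y - \<rho> *\<^sub>R \<gamma> y))" "2 * \<rho> \<le> norm ((y + \<rho> *\<^sub>R \<gamma> y) - (x - \<rho> *\<^sub>R \<gamma> x))"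
    by (intro disjoint_balls_distance \<rho>; use x(1) y(1) in \<open>unfold touching_balls_def, blast\<close>)+
  moreover have "(x + \<rho> *\<^sub>R \<gamma> x) - (y - \<rho> *\<^sub>R \<gamma> y) = \<rho> *\<^sub>R g + d" "(y + \<rho> *\<^sub>R \<gamma> y) - (x - \<rho> *\<^sub>R \<gamma> x) = \<rho> *\<^sub>R g - d"
    by (simp_all add: d_def g_def scaleR_add_right)
  ultimately have "2 * \<rho> \<le> norm (\<rho> *\<^sub>R g + d)" "2 * \<rho> \<le> norm (\<rho> *\<^sub>R g - d)" by simp_all
  then have "(2 * \<rho>)\<^sup>2 \<le> (norm (\<rho> *\<^sub>R g + d))\<^sup>2" "(2 * \<rho>)\<^sup>2 \<le> (norm (\<rho> *\<^sub>R g - d))\<^sup>2"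
    by (intro power_mono; use \<rho> in simp)+
  moreover have "(norm (\<rho> *\<^sub>R g + d))\<^sup>2 + (norm (\<rho> *\<^sub>R g - d))\<^sup>2 = 2 * (\<rho>\<^sup>2 * (norm g)\<^sup>2) + 2 * (norm d)\<^sup>2"
    unfolding power2_norm_eq_inner inner_add_left inner_add_right inner_diff_left inner_diff_right
    by (simp add: power2_eq_square)
  ultimately have 1: "4 * \<rho>\<^sup>2 \<le> \<rho>\<^sup>2 * (norm g)\<^sup>2 + (norm d)\<^sup>2" by (simp add: power_mult_distrib)
  have "\<gamma> x \<bullet> \<gamma> x = 1" "\<gamma> y \<bullet> \<gamma> y = 1" using x y by (auto simp: dot_square_norm)
  then have "(norm (\<gamma> x - \<gamma> y))\<^sup>2 = 4 - (norm g)\<^sup>2"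
    unfolding g_def power2_norm_eq_inner inner_add_left inner_add_right inner_diff_left inner_diff_right
    by (simp add: inner_commute)
  then have "\<rho>\<^sup>2 * (norm (\<gamma> x - \<gamma> y))\<^sup>2 \<le> (norm d)\<^sup>2" using 1 by (simp add: right_diff_distrib)
  then have "(\<rho> * norm (\<gamma> x - \<gamma> y))\<^sup>2 \<le> (norm d)\<^sup>2" by (simp add: power_mult_distrib)
  then have "\<rho> * norm (\<gamma> x - \<gamma> y) \<le> norm d" by (rule power2_le_imp_le) simp
  then show ?thesis unfolding d_def using \<rho> by (simp add: pos_le_divide_eq mult.commute)
qed

text \<open>The point y is not in the outer ball at x. Divided by norm (x - y), this is the bound on
  \<open>e \<bullet> \<gamma>\<close> required by \<open>boundary_strict\<close>.\<close>

lemma touching_balls_exterior: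
  fixes \<gamma> :: "'a::euclidean_space \<Rightarrow> 'a"
  assumes x: "touching_balls \<Omega> \<gamma> \<rho> x" "norm (\<gamma> x) = 1" and \<rho>: "0 < \<rho>" and y: "y \<in> closure \<Omega>"
  shows "(x - y) \<bullet> \<gamma> x \<le> (norm (x - y))\<^sup>2 / (2 * \<rho>)"
proof -
  have "ball (x - \<rho> *\<^sub>R \<gamma> x) \<rho> \<inter> closure \<Omega> = {}"
    using x(1) open_Int_closure_eq_empty[OF open_ball] unfolding touching_balls_def by blast
  then have "\<rho> \<le> norm ((x - y) - \<rho> *\<^sub>R \<gamma> x)" using y by (force simp: dist_norm algebra_simps)
  then have "\<rho>\<^sup>2 \<le> (norm ((x - y) - \<rho> *\<^sub>R \<gamma> x))\<^sup>2" using \<rho> by (intro power_mono) auto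
  moreover have "(norm ((x - y) - \<rho> *\<^sub>R \<gamma> x))\<^sup>2 = (norm (x - y))\<^sup>2 - 2 * \<rho> * ((x - y) \<bullet> \<gamma> x) + \<rho>\<^sup>2"
  proof -
    define d where "d = x - y"
    have gg: "\<gamma> x \<bullet> \<gamma> x = 1" using x by (simp add: dot_square_norm)
    have "(norm (d - \<rho> *\<^sub>R \<gamma> x))\<^sup>2 = (norm d)\<^sup>2 - 2 * \<rho> * (d \<bullet> \<gamma> x) + \<rho>\<^sup>2"
      unfolding power2_norm_eq_inner inner_diff_left inner_diff_right inner_scaleR_left inner_scaleR_right
        gg inner_commute[of "\<gamma> x" d] by (simp add: power2_eq_square right_diff_distrib)
    then show ?thesis unfolding d_def .
  qed
  ultimately have "((x - y) \<bullet> \<gamma> x) * (2 * \<rho>) \<le> (norm (x - y))\<^sup>2" by (simp add: mult_ac)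
  then show ?thesis using \<rho> by (simp only: pos_le_divide_eq mult_pos_pos zero_less_numeral)
qed

lemma touching_balls_ray:
  fixes \<gamma> :: "'a::euclidean_space \<Rightarrow> 'a"
  assumes x: "touching_balls \<Omega> \<gamma> \<rho> x" "norm (\<gamma> x) = 1" and \<rho>: "0 < \<rho>" and \<xi>: "0 < \<xi> \<bullet> \<gamma> x"
  obtains t1 where "0 < t1" "\<And>t. 0 < t \<Longrightarrow> t < t1 \<Longrightarrow> x + t *\<^sub>R \<xi> \<in> \<Omega>"
proof -
  define t1 where "t1 = 2 * \<rho> * (\<xi> \<bullet> \<gamma> x) / (1 + \<xi> \<bullet> \<xi>)"
  have p: "0 < 1 + \<xi> \<bullet> \<xi>" by (simp add: add_pos_nonneg)
  have t1: "0 < t1" using \<rho> \<xi> p by (simp add: t1_def)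
  have "x + t *\<^sub>R \<xi> \<in> \<Omega>" if t: "0 < t" "t < t1" for t
  proof -
    have gg: "\<gamma> x \<bullet> \<gamma> x = 1" using x by (simp add: dot_square_norm)
    have "t * (1 + \<xi> \<bullet> \<xi>) < 2 * \<rho> * (\<xi> \<bullet> \<gamma> x)" using t(2) p unfolding t1_def by (simp only: pos_less_divide_eq)
    then have "t * (t * (1 + \<xi> \<bullet> \<xi>)) < t * (2 * \<rho> * (\<xi> \<bullet> \<gamma> x))" using t by (intro mult_strict_left_mono)
    moreover have "t * (t * (1 + \<xi> \<bullet> \<xi>)) = t * t + t * (t * (\<xi> \<bullet> \<xi>))" by (simp only: distrib_left mult_1_right)
    moreover have "t * (2 * \<rho> * (\<xi> \<bullet> \<gamma> x)) = 2 * \<rho> * (t * (\<xi> \<bullet> \<gamma> x))" by (simp only: mult_ac)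
    moreover have "0 < t * t" using t by simp
    ultimately have 1: "t * (t * (\<xi> \<bullet> \<xi>)) < 2 * \<rho> * (t * (\<xi> \<bullet> \<gamma> x))" by linarith
    have "(norm (\<rho> *\<^sub>R \<gamma> x - t *\<^sub>R \<xi>))\<^sup>2 = \<rho>\<^sup>2 - 2 * \<rho> * (t * (\<xi> \<bullet> \<gamma> x)) + t * (t * (\<xi> \<bullet> \<xi>))"
      unfolding power2_norm_eq_inner inner_diff_left inner_diff_right inner_scaleR_left inner_scaleR_right
        gg inner_commute[of "\<gamma> x" \<xi>] by (simp add: power2_eq_square right_diff_distrib)
    then have "(norm (\<rho> *\<^sub>R \<gamma> x - t *\<^sub>R \<xi>))\<^sup>2 < \<rho>\<^sup>2" using 1 by linarith
    then have "norm (\<rho> *\<^sub>R \<gamma> x - t *\<^sub>R \<xi>) < \<rho>" by (rule power_less_imp_less_base) (use \<rho> in simp)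
    then have "x + t *\<^sub>R \<xi> \<in> ball (x + \<rho> *\<^sub>R \<gamma> x) \<rho>" by (simp add: dist_norm)
    then show ?thesis using x(1) unfolding touching_balls_def by blast
  qed
  then show ?thesis using that t1 by blast
qed

text \<open>Near the boundary the distance to this set plays the role of \<rho> minus the boundary
  distance; everywhere else the distance to a nearest point is still a convenient upper bound for
  it.\<close>

definition inner_centres :: "'a::euclidean_space set \<Rightarrow> real \<Rightarrow> 'a set" where
  "inner_centres \<Omega> \<rho> = {c. ball c \<rho> \<subseteq> \<Omega>}"

lemma inner_centres_closed: "closed (inner_centres \<Omega> \<rho>)"
proof -
  have "inner_centres \<Omega> \<rho> = (\<Inter>y\<in>- \<Omega>. {c. \<rho> \<le> dist c y})" unfolding inner_centres_def by (force simp: not_le)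
  then show ?thesis by (simp only:) (intro closed_INT ballI closed_Collect_le continuous_intros)
qed

text \<open>As x is outside \<open>\<Omega>\<close>, it is at least \<rho> away from every centre,
  and the touching ball attains this distance.\<close>

lemma inner_centres_boundary:
  assumes x: "touching_balls \<Omega> \<gamma> \<rho> x" "norm (\<gamma> x) = 1" and \<rho>: "0 < \<rho>" and fr: "x \<in> frontier \<Omega>" and \<Omega>: "open \<Omega>"
  shows "x + \<rho> *\<^sub>R \<gamma> x \<in> inner_centres \<Omega> \<rho>" "infdist x (inner_centres \<Omega> \<rho>) = \<rho>"
proof -
  show c: "x + \<rho> *\<^sub>R \<gamma> x \<in> inner_centres \<Omega> \<rho>" using x(1) by (simp add: inner_centres_def touching_balls_def)
  have "x \<notin> \<Omega>" using fr \<Omega> by (simp add: frontier_def interior_open)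
  then have "\<rho> \<le> dist x a" if "a \<in> inner_centres \<Omega> \<rho>" for a
    using that unfolding inner_centres_def by (force simp: dist_commute not_le)
  then have "\<rho> \<le> infdist x (inner_centres \<Omega> \<rho>)"
    unfolding infdist_def using c by (auto intro!: cINF_greatest)
  moreover have "infdist x (inner_centres \<Omega> \<rho>) \<le> dist x (x + \<rho> *\<^sub>R \<gamma> x)" by (rule infdist_le[OF c])
  moreover have "dist x (x + \<rho> *\<^sub>R \<gamma> x) = \<rho>" using x \<rho> by (simp add: dist_norm)
  ultimately show "infdist x (inner_centres \<Omega> \<rho>) = \<rho>" by linarith
qed

section \<open>Bounds for the boundary datum\<close>

lemma C1_norm_bounds:
  assumes C: "C_closure 1 S \<psi>" and S: "open S" "bounded S" and le: "C1_norm S \<psi> \<le> L2" and x: "x \<in> closure S"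
  shows "\<bar>\<psi> x\<bar> \<le> L2" "norm (grad_cl S \<psi> x) \<le> L2"
proof -
  have cpt: "compact (closure S)" using S by (simp add: compact_closure)
  have "continuous_on (closure S) \<psi>" using C by (simp add: C_closure_def)
  then have "compact ((\<lambda>x. \<bar>\<psi> x\<bar>) ` closure S)" by (intro compact_continuous_image[OF _ cpt] continuous_intros)
  then have b1: "bdd_above ((\<lambda>x. \<bar>\<psi> x\<bar>) ` closure S)" by (simp add: bounded_imp_bdd_above compact_imp_bounded)
  have "compact ((\<lambda>x. norm (grad_cl S \<psi> x)) ` closure S)"
    by (intro compact_continuous_image[OF _ cpt] continuous_intros grad_cl_extension(1)[OF C _ S(1)]) simp
  then have b2: "bdd_above ((\<lambda>x. norm (grad_cl S \<psi> x)) ` closure S)" by (simp add: bounded_imp_bdd_above compact_imp_bounded)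
  have "\<bar>\<psi> x\<bar> \<le> (SUP x\<in>closure S. \<bar>\<psi> x\<bar>)" by (rule cSUP_upper[OF x b1])
  moreover have "norm (grad_cl S \<psi> x) \<le> (SUP x\<in>closure S. norm (grad_cl S \<psi> x))" by (rule cSUP_upper[OF x b2])
  moreover have "0 \<le> \<bar>\<psi> x\<bar>" "0 \<le> norm (grad_cl S \<psi> x)" by simp_all
  moreover have "(SUP x\<in>closure S. \<bar>\<psi> x\<bar>) + (SUP x\<in>closure S. norm (grad_cl S \<psi> x)) \<le> L2"
    using le unfolding C1_norm_def .
  ultimately show "\<bar>\<psi> x\<bar> \<le> L2" "norm (grad_cl S \<psi> x) \<le> L2" by linarith+
qed

lemma lipschitz_on_closure:
  fixes \<psi> :: "'a::euclidean_space \<Rightarrow> real"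
  assumes cont: "continuous_on (closure S) \<psi>" and lip: "\<And>x y. x \<in> S \<Longrightarrow> y \<in> S \<Longrightarrow> \<bar>\<psi> x - \<psi> y\<bar> \<le> L * norm (x - y)"
    and xy: "x \<in> closure S" "y \<in> closure S"
  shows "\<bar>\<psi> x - \<psi> y\<bar> \<le> L * norm (x - y)"
proof -
  let ?F = "\<lambda>w. \<bar>\<psi> (fst w) - \<psi> (snd w)\<bar> - L * norm (fst w - snd w)"
  have "?F (x, y) \<le> 0"
  proof (rule continuous_le_on_closure[where S = "S \<times> S" and f = ?F])
    show "continuous_on (closure (S \<times> S)) ?F"
      unfolding closure_Times
    proof (intro continuous_on_diff continuous_on_mult continuous_on_norm continuous_on_const continuous_on_rabs)
      show "continuous_on (closure S \<times> closure S) (\<lambda>w. \<psi> (fst w))"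
        by (rule continuous_on_compose2[OF cont continuous_on_fst[OF continuous_on_id]]) auto
      show "continuous_on (closure S \<times> closure S) (\<lambda>w. \<psi> (snd w))"
        by (rule continuous_on_compose2[OF cont continuous_on_snd[OF continuous_on_id]]) auto
    qed (rule continuous_on_fst[OF continuous_on_id] continuous_on_snd[OF continuous_on_id])+
  qed (use xy lip in \<open>auto simp: closure_Times\<close>)
  then show ?thesis by simp
qed

lemma C1_function_lipschitz:
  assumes C: "C_closure 1 S \<psi>" and S: "open S" "bounded S" and le: "C1_norm S \<psi> \<le> L2"
    and qc: "\<And>x y. x \<in> S \<Longrightarrow> y \<in> S \<Longrightarrow> grad_lip \<Lambda> S x y" and xy: "x \<in> closure S" "y \<in> closure S"
  shows "\<bar>\<psi> x - \<psi> y\<bar> \<le> (\<Lambda> * L2) * norm (x - y)"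
proof (rule lipschitz_on_closure[OF _ _ xy])
  note b = C1_norm_bounds[OF C S le]
  have Con: "C_on 1 S \<psi>" using C by (simp add: C_closure_def)
  show "continuous_on (closure S) \<psi>" using C by (simp add: C_closure_def)
  show "\<bar>\<psi> x - \<psi> y\<bar> \<le> (\<Lambda> * L2) * norm (x - y)" if "x \<in> S" "y \<in> S" for x y
  proof (rule grad_lipD[OF qc[OF that], where h' = "\<lambda>w v. grad \<psi> w \<bullet> v"])
    have "0 \<le> \<bar>\<psi> x\<bar>" by simp
    then show "0 \<le> L2" using b(1)[of x] that closure_subset by force
    fix w assume w: "w \<in> S"
    then have wc: "w \<in> closure S" using closure_subset by blast
    show "\<bar>\<psi> w\<bar> \<le> L2" by (rule b(1)[OF wc])
    show "(\<psi> has_derivative (\<lambda>v. grad \<psi> w \<bullet> v)) (at w)" by (rule C_on_has_derivative[OF Con S(1) w order_refl])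
    fix v :: 'a
    have "norm (grad \<psi> w) \<le> L2" using b(2)[OF wc] grad_cl_extension(2)[OF C order_refl S(1) w] by simp
    then have "norm (grad \<psi> w) * norm v \<le> L2 * norm v" by (rule mult_right_mono) simp
    then show "\<bar>grad \<psi> w \<bullet> v\<bar> \<le> L2 * norm v" by (rule order_trans[OF Cauchy_Schwarz_ineq2])
  qed
qed

section \<open>The global gradient estimate\<close>

text \<open>In the bound \<open>E1\<close> stands for the factor with \<open>T\<close>,
  \<open>P\<close> for the slope of the profile at 0 and \<open>B1\<close> for the size of b. The
  geometry of the domain enters through \<open>tb\<close>, \<open>qc\<close> and \<open>diam\<close>
  only.\<close>

lemma (in profile_constants) global_gradient_bound:
  fixes \<Omega> :: "'a::euclidean_space set" and u \<psi> :: "'a \<Rightarrow> real" and \<gamma> :: "'a \<Rightarrow> 'a"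
  assumes \<Omega>: "open \<Omega>" "bounded \<Omega>" "frontier \<Omega> \<noteq> {}"
    and tb: "\<And>x. x \<in> frontier \<Omega> \<Longrightarrow> touching_balls \<Omega> \<gamma> \<rho> x" and \<gamma>1: "\<And>x. x \<in> frontier \<Omega> \<Longrightarrow> norm (\<gamma> x) = 1"
    and qc: "\<And>x y. x \<in> \<Omega> \<Longrightarrow> y \<in> \<Omega> \<Longrightarrow> grad_lip \<Lambda> \<Omega> x y"
    and diam: "\<And>x y. x \<in> closure \<Omega> \<Longrightarrow> y \<in> closure \<Omega> \<Longrightarrow> norm (x - y) \<le> D"
    and dim: "n = real DIM('a)" and Lb_ge: "n * (\<Lambda> * L2 + L2 / \<rho>) \<le> Lb" and B1_ge: "L2 + Lb * D \<le> B1"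
    and u: "C_closure 2 \<Omega> u" and mc: "mean_curvature_eq \<Omega> f u" and bc: "oblique_bc q \<Omega> \<gamma> \<psi> u"
    and uM: "\<And>x. x \<in> closure \<Omega> \<Longrightarrow> \<bar>u x\<bar> \<le> M0" and rhs: "rhs_conditions \<Omega> M0 L1 f"
    and \<psi>: "C_closure 1 \<Omega> \<psi>" "C1_norm \<Omega> \<psi> \<le> L2"
    and x0: "x0 \<in> closure \<Omega>"
  shows "norm (grad_cl \<Omega> u x0) \<le> E1 * P + B1"
proof -
  have Cu: "C_on 2 \<Omega> u" and cu: "continuous_on (closure \<Omega>) u" using u by (simp_all add: C_closure_def)
  have fr_cl: "x \<in> closure \<Omega>" if "x \<in> frontier \<Omega>" for x using that by (simp add: frontier_def)
  have cl_cases: "x \<in> \<Omega> \<or> x \<in> frontier \<Omega>" if "x \<in> closure \<Omega>" for x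
    using that \<Omega>(1) by (auto simp: frontier_def interior_open)
  \<comment> \<open>The normal component that solves the boundary condition when the tangential part
    has norm \<open>3 * P\<close>, the size expected at a boundary maximum for s small compared with
    \<delta>.\<close>
  define \<theta> where "\<theta> z = oblique_inv q (3 * P) (- \<psi> z)" for z
  have \<psi>le: "\<bar>\<psi> z\<bar> \<le> L2" if "z \<in> closure \<Omega>" for z by (rule C1_norm_bounds[OF \<psi>(1) \<Omega>(1,2) \<psi>(2) that])
  have of\<theta>: "oblique_fun q (3 * P) (\<theta> z) = - \<psi> z" for z unfolding \<theta>_def by (rule oblique_inv[OF q])
  have \<theta>le: "\<bar>\<theta> z\<bar> \<le> L2" if "z \<in> closure \<Omega>" for z
    using oblique_inv_le[OF q, of "3 * P" "- \<psi> z"] \<psi>le[OF that] unfolding \<theta>_def by simp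
  have \<theta>lip: "\<bar>\<theta> z - \<theta> w\<bar> \<le> (\<Lambda> * L2) * norm (z - w)" if "z \<in> closure \<Omega>" "w \<in> closure \<Omega>" for z w
    using oblique_inv_lipschitz[OF q, of "3 * P" "- \<psi> z" "- \<psi> w"]
      C1_function_lipschitz[OF \<psi>(1) \<Omega>(1,2) \<psi>(2) qc that] unfolding \<theta>_def by simp
  \<comment> \<open>The Lipschitz constant is free of \<open>P\<close>, because
    \<open>oblique_inv\<close> is 1-Lipschitz for every tangential size.\<close>
  obtain b where b: "\<And>z. z \<in> frontier \<Omega> \<Longrightarrow> b z = \<theta> z *\<^sub>R \<gamma> z"
    and blip0: "\<And>z w. norm (b z - b w) \<le> (real DIM('a) * (\<Lambda> * L2 + L2 / \<rho>)) * dist z w"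
  proof (rule vector_lipschitz_extension[OF \<Omega>(3), of "\<Lambda> * L2 + L2 / \<rho>" "\<lambda>z. \<theta> z *\<^sub>R \<gamma> z"])
    show "0 \<le> \<Lambda> * L2 + L2 / \<rho>" using \<Lambda> L2 \<rho> by simp
    fix z w assume zw: "z \<in> frontier \<Omega>" "w \<in> frontier \<Omega>"
    have "\<theta> z *\<^sub>R \<gamma> z - \<theta> w *\<^sub>R \<gamma> w = (\<theta> z - \<theta> w) *\<^sub>R \<gamma> z + \<theta> w *\<^sub>R (\<gamma> z - \<gamma> w)" by (simp add: algebra_simps)
    then have "norm (\<theta> z *\<^sub>R \<gamma> z - \<theta> w *\<^sub>R \<gamma> w) \<le> norm ((\<theta> z - \<theta> w) *\<^sub>R \<gamma> z) + norm (\<theta> w *\<^sub>R (\<gamma> z - \<gamma> w))"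
      using norm_triangle_ineq by metis
    also have "\<dots> = \<bar>\<theta> z - \<theta> w\<bar> + \<bar>\<theta> w\<bar> * norm (\<gamma> z - \<gamma> w)" using \<gamma>1[OF zw(1)] by simp
    also have "\<dots> \<le> (\<Lambda> * L2) * norm (z - w) + L2 * (norm (z - w) / \<rho>)"
      using \<theta>lip[OF fr_cl fr_cl, OF zw] \<theta>le[OF fr_cl[OF zw(2)]]
        touching_balls_normal_lipschitz[OF tb[OF zw(1)] \<gamma>1[OF zw(1)] tb[OF zw(2)] \<gamma>1[OF zw(2)] \<rho>]
      by (intro add_mono mult_mono) auto
    also have "\<dots> = (\<Lambda> * L2 + L2 / \<rho>) * dist z w" by (simp add: dist_norm distrib_right)
    finally show "norm (\<theta> z *\<^sub>R \<gamma> z - \<theta> w *\<^sub>R \<gamma> w) \<le> (\<Lambda> * L2 + L2 / \<rho>) * dist z w" .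
  qed blast
  have blip: "norm (b z - b w) \<le> Lb * norm (z - w)" for z w
    using order_trans[OF blip0[of z w] mult_right_mono[OF Lb_ge[unfolded dim], of "dist z w"]] by (simp add: dist_norm)
  have ble: "norm (b z) \<le> B1" if z: "z \<in> closure \<Omega>" for z
  proof -
    obtain w where w: "w \<in> frontier \<Omega>" using \<Omega>(3) by blast
    have "norm (b w) \<le> L2" unfolding b[OF w] using \<gamma>1[OF w] \<theta>le[OF fr_cl[OF w]] by simp
    moreover have "norm (b z) \<le> norm (b w) + norm (b z - b w)" using norm_triangle_ineq[of "b w" "b z - b w"] by simp
    moreover have "Lb * norm (z - w) \<le> Lb * D" using diam[OF z fr_cl[OF w]] Lb by (intro mult_left_mono) auto
    ultimately show ?thesis using blip[of z w] B1_ge by linarith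
  qed
  have cb: "continuous_on (closure \<Omega>) b"
  proof (rule lipschitz_on_continuous_on)
    show "Lb-lipschitz_on (closure \<Omega>) b" using blip Lb by (intro lipschitz_onI) (auto simp: dist_norm)
  qed
  define I where "I = inner_centres \<Omega> \<rho>"
  have Icl: "closed I" unfolding I_def by (rule inner_centres_closed)
  have In: "I \<noteq> {}"
  proof -
    obtain w where w: "w \<in> frontier \<Omega>" using \<Omega>(3) by blast
    show ?thesis unfolding I_def using inner_centres_boundary(1)[OF tb[OF w] \<gamma>1[OF w] \<rho> w \<Omega>(1)] by blast
  qed
  have I\<Omega>: "c \<in> closure \<Omega>" if "c \<in> I" for c
    using that \<rho> closure_subset unfolding I_def inner_centres_def by (metis centre_in_ball mem_Collect_eq subsetD)
  define T where "T x = infdist x I" for x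
  have T0: "0 \<le> T x" for x unfolding T_def by (rule infdist_nonneg)
  have Tle: "T x \<le> norm (x - c)" if "c \<in> I" for x c unfolding T_def dist_norm[symmetric] by (rule infdist_le[OF that])
  have Tlip: "\<bar>T x - T y\<bar> \<le> norm (x - y)" for x y
    using infdist_triangle_abs[of x I y] unfolding T_def by (simp add: dist_norm)
  \<comment> \<open>At a boundary point the centre on the normal is selected, so that the term with
    \<open>T\<close> acts exactly in the normal direction.\<close>
  have centre: "\<exists>c\<in>I. T x = norm (x - c) \<and> norm (x - c) \<le> D \<and> (x \<in> frontier \<Omega> \<longrightarrow> c = x + \<rho> *\<^sub>R \<gamma> x \<and> T x = \<rho>)"
    if x: "x \<in> closure \<Omega>" for x
  proof (cases "x \<in> frontier \<Omega>")
    case True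
    note ib = inner_centres_boundary[OF tb[OF True] \<gamma>1[OF True] \<rho> True \<Omega>(1), folded I_def]
    have "norm (x - (x + \<rho> *\<^sub>R \<gamma> x)) = \<rho>" using \<gamma>1[OF True] \<rho> by simp
    then show ?thesis using ib diam[OF x I\<Omega>[OF ib(1)]] unfolding T_def by (intro bexI[OF _ ib(1)]) simp
  next
    case False
    obtain c where "c \<in> I" "infdist x I = dist x c" using infdist_attains_inf[OF Icl In, of x] by blast
    then show ?thesis using False diam[OF x I\<Omega>] unfolding T_def dist_norm by blast
  qed
  have TD: "T x \<le> D" if "x \<in> closure \<Omega>" for x using centre[OF that] by auto
  have \<kappa>0: "0 < \<kappa>" "\<kappa> * \<rho>\<^sup>2 = 1" using \<rho> by (simp_all add: \<kappa>)
  define W where "W x y z = u x - u y - \<phi> (norm (x - y)) * (1 + \<kappa> * (T x)\<^sup>2 + \<kappa> * (T y)\<^sup>2)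
      - b z \<bullet> (x - y) - Lb * (norm (x - z))\<^sup>2" for x y z
  \<comment> \<open>No relation between z and x is imposed; it comes out of the maximum.\<close>
  define K where "K = {w. fst w \<in> closure \<Omega> \<and> fst (snd w) \<in> closure \<Omega> \<and> snd (snd w) \<in> closure \<Omega> \<and> norm (fst w - fst (snd w)) \<le> s0}"
  have \<phi>pos: "0 \<le> \<phi> s" if "0 \<le> s" for s by (rule log_profile_bounds(1)[OF C_pos \<delta>_bounds(1) that])
  have c\<phi>: "continuous_on {0..} \<phi>"
  proof (rule continuous_at_imp_continuous_on, rule ballI)
    fix r :: real assume "r \<in> {0..}"
    then show "isCont \<phi> r" using log_profile_derivative[OF C_pos \<delta>_bounds(1), of r] by (auto intro: DERIV_isCont)
  qed
  have W_le: "W x y z \<le> 0" if inK: "(x, y, z) \<in> K" for x y z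
  proof (rule ccontr)
    assume neg: "\<not> W x y z \<le> 0"
    have cK: "compact K"
    proof -
      have cc: "compact (closure \<Omega>)" using \<Omega>(2) by (simp add: compact_closure)
      have "K = (closure \<Omega> \<times> closure \<Omega> \<times> closure \<Omega>) \<inter> {w. norm (fst w - fst (snd w)) \<le> s0}"
        unfolding K_def by auto
      moreover have "closed {w :: 'a \<times> 'a \<times> 'a. norm (fst w - fst (snd w)) \<le> s0}"
        by (intro closed_Collect_le continuous_intros)
      ultimately show ?thesis using cc by (simp only: compact_Int_closed compact_Times)
    qed
    have cW: "continuous_on K (\<lambda>w. W (fst w) (fst (snd w)) (snd (snd w)))"
    proof -
      have c1: "continuous_on K (\<lambda>w. fst w)" "continuous_on K (\<lambda>w. fst (snd w))" "continuous_on K (\<lambda>w. snd (snd w))"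
        by (intro continuous_intros)+
      have cT: "continuous_on UNIV T" unfolding T_def[abs_def] by (intro continuous_intros)
      have 1: "continuous_on K (\<lambda>w. u (fst w))" "continuous_on K (\<lambda>w. u (fst (snd w)))" "continuous_on K (\<lambda>w. b (snd (snd w)))"
        by (rule continuous_on_compose2[OF cu c1(1)] continuous_on_compose2[OF cu c1(2)] continuous_on_compose2[OF cb c1(3)], force simp: K_def)+
      have 2: "continuous_on K (\<lambda>w. T (fst w))" "continuous_on K (\<lambda>w. T (fst (snd w)))"
        by (rule continuous_on_compose2[OF cT c1(1)] continuous_on_compose2[OF cT c1(2)], simp)+
      have 3: "continuous_on K (\<lambda>w. \<phi> (norm (fst w - fst (snd w))))"
        by (rule continuous_on_compose2[OF c\<phi>]) (intro continuous_intros c1, auto)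
      show ?thesis unfolding W_def
        by (intro continuous_on_diff continuous_on_mult continuous_on_add continuous_on_power continuous_on_inner
            continuous_on_const continuous_on_norm 1 2 3 c1)
    qed
    obtain w where wK: "w \<in> K" and wmax: "\<And>w'. w' \<in> K \<Longrightarrow> W (fst w') (fst (snd w')) (snd (snd w')) \<le> W (fst w) (fst (snd w)) (snd (snd w))"
      using continuous_attains_sup[OF cK _ cW] inK by blast
    obtain x y z where w: "w = (x, y, z)" by (cases w) auto
    have cl: "x \<in> closure \<Omega>" "y \<in> closure \<Omega>" "z \<in> closure \<Omega>" and xys0: "norm (x - y) \<le> s0" using wK by (auto simp: K_def w)
    have max: "W x' y' z' \<le> W x y z" if "x' \<in> closure \<Omega>" "y' \<in> closure \<Omega>" "z' \<in> closure \<Omega>" "norm (x' - y') \<le> s0" for x' y' z'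
      using wmax[of "(x', y', z')"] that by (simp add: K_def w)
    have pos: "0 < W x y z" using wmax[OF inK] neg by (simp add: w)
    define s e where "s = norm (x - y)" and "e = (x - y) /\<^sub>R s"
    have ne: "x \<noteq> y"
    proof
      assume "x = y"
      then have "W x y z = - (Lb * (norm (x - z))\<^sup>2)" by (simp add: W_def log_profile_def)
      moreover have "0 \<le> Lb * (norm (x - z))\<^sup>2" using Lb by simp
      ultimately show False using pos by linarith
    qed
    then have s: "0 < s" unfolding s_def by simp
    have ss0: "s \<le> s0" using xys0 by (simp add: s_def)
    have s1: "s \<le> 1" using ss0 s0_bounds by linarith
    obtain c1 where c1: "c1 \<in> I" "T x = norm (x - c1)" "norm (x - c1) \<le> D" "x \<in> frontier \<Omega> \<Longrightarrow> c1 = x + \<rho> *\<^sub>R \<gamma> x" "x \<in> frontier \<Omega> \<Longrightarrow> T x = \<rho>"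
      using centre[OF cl(1)] by blast
    obtain c2 where c2: "c2 \<in> I" "T y = norm (y - c2)" "norm (y - c2) \<le> D" "y \<in> frontier \<Omega> \<Longrightarrow> c2 = y + \<rho> *\<^sub>R \<gamma> y" "y \<in> frontier \<Omega> \<Longrightarrow> T y = \<rho>"
      using centre[OF cl(2)] by blast
    define E where "E = 1 + \<kappa> * (norm (x - c1))\<^sup>2 + \<kappa> * (norm (y - c2))\<^sup>2"
    have E1': "1 \<le> E" unfolding E_def using \<kappa>0 by simp
    have \<phi>0: "0 \<le> \<phi> s" by (rule \<phi>pos) (use s in simp)
    have bxy: "\<bar>b z \<bullet> (x - y)\<bar> \<le> B1 * s"
      unfolding s_def by (rule order_trans[OF Cauchy_Schwarz_ineq2 mult_right_mono[OF ble[OF cl(3)]]]) simp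
    have "0 \<le> Lb * (norm (x - z))\<^sup>2" using Lb by simp
    then have Wb: "\<phi> s * E + b z \<bullet> (x - y) < u x - u y"
      using pos unfolding W_def E_def s_def[symmetric] c1(2) c2(2) by linarith
    have \<phi>E: "\<phi> s \<le> \<phi> s * E" using mult_left_mono[OF E1' \<phi>0] by simp
    have B1s: "B1 * s \<le> B1" using B1 s1 by (simp add: mult_left_le)
    have \<phi>F: "\<phi> s < F" unfolding F using Wb \<phi>E bxy B1s uM[OF cl(1)] uM[OF cl(2)] by linarith
    \<comment> \<open>At distance \<open>s0\<close> the profile would already be at least F.\<close>
    have slt: "s < s0" using ss0 \<phi>F profile_reaches by (cases "s = s0") auto
    have m\<phi>: "m \<le> \<phi>1 s" using m_le_\<phi>1 s ss0 by simp
    have sm: "s * m \<le> \<phi> s"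
      using mult_left_mono[OF m\<phi>, of s] log_profile_bounds(2)[OF C_pos \<delta>_bounds(1), of s] s unfolding \<phi>1_def by simp
    have B1m: "B1 \<le> m"
    proof -
      have "0 \<le> 2 * \<kappa> * F * D" using \<kappa>0 F_nonneg D by simp
      then have "B1 \<le> C0" using Lb unfolding C0 by linarith
      then show ?thesis using m(2) B1 by linarith
    qed
    have "B1 * s \<le> s * m" using mult_left_mono[OF B1m, of s] s by (simp add: mult.commute)
    then have uxy: "u y \<le> u x" using Wb \<phi>E bxy sm by linarith
    \<comment> \<open>Replacing z by x removes the penalty and costs only the variation of
      b.\<close>
    have xz: "norm (x - z) \<le> s"
    proof -
      have "W x y x \<le> W x y z" by (rule max[OF cl(1,2,1) xys0])
      then have "Lb * (norm (x - z))\<^sup>2 \<le> b x \<bullet> (x - y) - b z \<bullet> (x - y)" by (simp add: W_def)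
      also have "\<dots> = (b x - b z) \<bullet> (x - y)" by (simp add: inner_diff_left)
      also have "\<dots> \<le> norm (b x - b z) * norm (x - y)" by (rule norm_cauchy_schwarz)
      also have "\<dots> \<le> (Lb * norm (x - z)) * s" unfolding s_def by (intro mult_right_mono blip) simp
      finally have "Lb * (norm (x - z) * norm (x - z)) \<le> Lb * (norm (x - z) * s)" by (simp add: power2_eq_square mult.assoc)
      then have "norm (x - z) * norm (x - z) \<le> norm (x - z) * s" using Lb by simp
      then show ?thesis using s by (cases "x = z") auto
    qed
    \<comment> \<open>Because \<open>T\<close> is at most the distance to a fixed centre and \<phi>
      is nonnegative, \<open>\<Phi>\<close> only subtracts more, with equality at (x, y); so the
      maximum survives with smooth data.\<close>
    define \<Phi> where "\<Phi> = two_point_fun \<phi> 1 \<kappa> c1 c2 (b z) Lb z"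
    have frozen: "u x' - u y' - \<Phi> x' y' \<le> u x - u y - \<Phi> x y"
      if x': "x' \<in> closure \<Omega>" and y': "y' \<in> closure \<Omega>" and d: "norm (x' - y') \<le> s0" for x' y'
    proof -
      have "(T x')\<^sup>2 \<le> (norm (x' - c1))\<^sup>2" "(T y')\<^sup>2 \<le> (norm (y' - c2))\<^sup>2"
        by (intro power_mono Tle c1(1) c2(1) T0)+
      then have "\<kappa> * (T x')\<^sup>2 \<le> \<kappa> * (norm (x' - c1))\<^sup>2" "\<kappa> * (T y')\<^sup>2 \<le> \<kappa> * (norm (y' - c2))\<^sup>2"
        using \<kappa>0 by (auto intro: mult_left_mono)
      then have "\<phi> (norm (x' - y')) * (1 + \<kappa> * (T x')\<^sup>2 + \<kappa> * (T y')\<^sup>2)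
          \<le> \<phi> (norm (x' - y')) * (1 + \<kappa> * (norm (x' - c1))\<^sup>2 + \<kappa> * (norm (y' - c2))\<^sup>2)"
        by (intro mult_left_mono \<phi>pos) auto
      then show ?thesis using max[OF x' y' cl(3) d]
        unfolding W_def \<Phi>_def two_point_fun_def c1(2) c2(2) by linarith
    qed
    have d\<phi>: "(\<phi> has_real_derivative \<phi>1 r) (at r)" if "0 \<le> r" for r
      unfolding \<phi>1_def by (rule log_profile_derivative[OF C_pos \<delta>_bounds(1) that])
    have line: "((\<lambda>t. \<Phi> (x + t *\<^sub>R \<xi>) (y + t *\<^sub>R \<eta>)) has_real_derivative
        ((E * \<phi>1 s) *\<^sub>R e + (2 * \<kappa> * \<phi> s) *\<^sub>R (x - c1) + b z + (2 * Lb) *\<^sub>R (x - z)) \<bullet> \<xi>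
        - ((E * \<phi>1 s) *\<^sub>R e - (2 * \<kappa> * \<phi> s) *\<^sub>R (y - c2) + b z) \<bullet> \<eta>) (at 0)" for \<xi> \<eta>
    proof -
      have "((\<lambda>t. \<Phi> (x + t *\<^sub>R \<xi>) (y + t *\<^sub>R \<eta>)) has_real_derivative
         \<phi>1 (norm (x - y + 0 *\<^sub>R (\<xi> - \<eta>)))
         * (((x - y + 0 *\<^sub>R (\<xi> - \<eta>)) \<bullet> (\<xi> - \<eta>)) / norm (x - y + 0 *\<^sub>R (\<xi> - \<eta>)))
         * (1 + \<kappa> * (norm (x + 0 *\<^sub>R \<xi> - c1))\<^sup>2 + \<kappa> * (norm (y + 0 *\<^sub>R \<eta> - c2))\<^sup>2)
         + \<phi> (norm (x - y + 0 *\<^sub>R (\<xi> - \<eta>))) * (2 * \<kappa> * ((x + 0 *\<^sub>R \<xi> - c1) \<bullet> \<xi> + (y + 0 *\<^sub>R \<eta> - c2) \<bullet> \<eta>))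
         + b z \<bullet> (\<xi> - \<eta>) + 2 * Lb * ((x + 0 *\<^sub>R \<xi> - z) \<bullet> \<xi>)) (at 0)"
        unfolding \<Phi>_def by (rule two_point_line_derivative) (use ne d\<phi> in simp_all)
      moreover have de: "((x - y) \<bullet> (\<xi> - \<eta>)) / s = e \<bullet> (\<xi> - \<eta>)" by (simp add: e_def divide_inverse)
      ultimately show ?thesis
        unfolding scaleR_zero_left add_0_right s_def[symmetric] E_def[symmetric] de
        by (elim DERIV_cong) (simp add: inner_diff_left inner_diff_right inner_add_left algebra_simps)
    qed
    have Tdiff: "\<bar>(T x)\<^sup>2 - (T y)\<^sup>2\<bar> \<le> 2 * D * s"
    proof -
      have "(T x)\<^sup>2 - (T y)\<^sup>2 = (T x - T y) * (T x + T y)" by (simp add: power2_eq_square algebra_simps)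
      moreover have "\<bar>(T x - T y) * (T x + T y)\<bar> \<le> s * (D + D)"
        unfolding abs_mult s_def using Tlip[of x y] T0[of x] T0[of y] TD[OF cl(1)] TD[OF cl(2)]
        by (intro mult_mono) auto
      ultimately show ?thesis by (simp add: mult_ac)
    qed
    \<comment> \<open>At the boundary point the term with \<open>T\<close> equals \<kappa> \<rho>^2
      = 1; the other one differs from it by a multiple of s, since \<open>T\<close> is Lipschitz and
      bounded by D.\<close>
    have E3: "\<bar>E - 3\<bar> \<le> C2 * s" if "x \<in> frontier \<Omega> \<or> y \<in> frontier \<Omega>"
    proof -
      have "T x = \<rho> \<or> T y = \<rho>" using that c1(5) c2(5) by blast
      then have "E - 3 = \<kappa> * ((T y)\<^sup>2 - (T x)\<^sup>2) \<or> E - 3 = \<kappa> * ((T x)\<^sup>2 - (T y)\<^sup>2)"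
        unfolding E_def c1(2)[symmetric] c2(2)[symmetric] using \<kappa>0(2) by (auto simp: right_diff_distrib)
      then have "\<bar>E - 3\<bar> = \<kappa> * \<bar>(T x)\<^sup>2 - (T y)\<^sup>2\<bar>" using \<kappa>0(1) by (auto simp: abs_mult abs_minus_commute)
      also have "\<dots> \<le> \<kappa> * (2 * D * s)" using Tdiff \<kappa>0 by (intro mult_left_mono) auto
      finally show ?thesis unfolding C2 \<kappa> by simp
    qed
    have e1: "norm e = 1" unfolding e_def norm_scaleR s_def[symmetric] using s by simp
    have near: "\<forall>\<^sub>F w in nhds (x, y). norm (fst w - snd w) < s0"
    proof -
      have "open {w :: 'a \<times> 'a. norm (fst w - snd w) < s0}" by (intro open_Collect_less continuous_intros)
      moreover have "(x, y) \<in> {w. norm (fst w - snd w) < s0}" using slt by (simp add: s_def)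
      ultimately have "\<forall>\<^sub>F w in nhds (x, y). w \<in> {w. norm (fst w - snd w) < s0}" by (rule eventually_nhds_in_open)
      then show ?thesis by simp
    qed
    have kr: "(2 * \<kappa> * \<phi> s) *\<^sub>R (- (\<rho> *\<^sub>R v)) = - (2 * \<phi> s / \<rho>) *\<^sub>R v" for v :: 'a
      unfolding \<kappa> using \<rho> by (simp add: power2_eq_square)
    \<comment> \<open>Test rays respect the constraint of \<open>K\<close> for a short time, because
      s is strictly below \<open>s0\<close>.\<close>
    have short: "norm (v + t *\<^sub>R \<xi>) \<le> s0" if "norm v = s" "0 < t" "t < (s0 - s) / (1 + norm \<xi>)" for v \<xi> :: 'a and t
    proof -
      have "t * (1 + norm \<xi>) < s0 - s" using that(3) by (simp add: pos_less_divide_eq add_pos_nonneg)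
      then have "t * norm \<xi> \<le> s0 - s" using that(2) by (simp add: distrib_left)
      then show ?thesis using norm_triangle_ineq[of v "t *\<^sub>R \<xi>"] that by simp
    qed
    have gap: "0 < (s0 - s) / (1 + norm \<xi>)" for \<xi> :: 'a using slt by (simp add: add_pos_nonneg)
    \<comment> \<open>If both points lie on the boundary, either of the first two cases applies, as
      each of them moves one point only.\<close>
    consider "x \<in> frontier \<Omega>" | "y \<in> frontier \<Omega>" | "x \<in> \<Omega>" "y \<in> \<Omega>" using cl_cases cl by blast
    then show False
    proof cases
      case 1
      define G where "G = grad_cl \<Omega> u x"
      define p where "p = (E * \<phi>1 s) *\<^sub>R e + (2 * \<kappa> * \<phi> s) *\<^sub>R (x - c1) + b z + (2 * Lb) *\<^sub>R (x - z)"
      have "(G - p) \<bullet> \<xi> \<le> 0" if \<xi>: "0 < \<xi> \<bullet> \<gamma> x" for \<xi>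
      proof -
        obtain t1 where t1: "0 < t1" "\<And>t. 0 < t \<Longrightarrow> t < t1 \<Longrightarrow> x + t *\<^sub>R \<xi> \<in> \<Omega>"
          using touching_balls_ray[OF tb[OF 1] \<gamma>1[OF 1] \<rho> \<xi>] by blast
        have "1 * (grad_cl \<Omega> u x \<bullet> \<xi>) \<le> p \<bullet> \<xi>"
        proof (rule boundary_derivative_le[where ?t1.0 = "min t1 ((s0 - s) / (1 + norm \<xi>))" and \<Psi> = "\<lambda>t. \<Phi> (x + t *\<^sub>R \<xi>) y", OF u _ \<Omega>(1) cl(1)])
          show "0 < min t1 ((s0 - s) / (1 + norm \<xi>))" using t1 gap by simp
          show "((\<lambda>t. \<Phi> (x + t *\<^sub>R \<xi>) y) has_real_derivative p \<bullet> \<xi>) (at 0)"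
            using line[of \<xi> 0] unfolding p_def by simp
          fix t assume t: "0 < t" "t < min t1 ((s0 - s) / (1 + norm \<xi>))"
          then show in\<Omega>: "x + t *\<^sub>R \<xi> \<in> \<Omega>" using t1 by simp
          have "norm (x - y + t *\<^sub>R \<xi>) \<le> s0" by (rule short) (use t in \<open>simp_all add: s_def\<close>)
          moreover have "x + t *\<^sub>R \<xi> - y = x - y + t *\<^sub>R \<xi>" by simp
          ultimately have "norm (x + t *\<^sub>R \<xi> - y) \<le> s0" by (simp only:)
          from frozen[OF subsetD[OF closure_subset in\<Omega>] cl(2) this]
          show "1 * u (x + t *\<^sub>R \<xi>) - \<Phi> (x + t *\<^sub>R \<xi>) y \<le> 1 * u x - \<Phi> (x + 0 *\<^sub>R \<xi>) y" by simp
        qed simp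
        then show ?thesis by (simp add: G_def inner_diff_left)
      qed
      then obtain l where l: "0 \<le> l" "G - p = - l *\<^sub>R \<gamma> x" using outward_direction[OF \<gamma>1[OF 1]] by blast
      \<comment> \<open>The true gradient lies below p in the direction of the normal, as
        \<open>oblique_shift\<close> requires.\<close>
      have G: "G = p - l *\<^sub>R \<gamma> x" using l(2) by (simp add: algebra_simps)
      have "slope G powr (q - 1) * (G \<bullet> \<gamma> x) = - \<psi> x"
        using bc 1 unfolding oblique_bc_def G_def by (simp add: eq_neg_iff_add_eq_0)
      moreover have "slope G powr (q - 1) * (G \<bullet> \<gamma> x) \<le> slope p powr (q - 1) * (p \<bullet> \<gamma> x)"
        unfolding G by (rule oblique_shift[OF q \<gamma>1[OF 1] l(1)])
      moreover have "slope p powr (q - 1) * (p \<bullet> \<gamma> x) < oblique_fun q (3 * P) (\<theta> x)"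
      proof (rule boundary_strict[OF \<gamma>1[OF 1] e1 s ss0 less_imp_le[OF \<phi>F] E3])
        show "x \<in> frontier \<Omega> \<or> y \<in> frontier \<Omega>" using 1 by simp
        have "(x - y) \<bullet> \<gamma> x \<le> s\<^sup>2 / (2 * \<rho>)" unfolding s_def by (rule touching_balls_exterior[OF tb[OF 1] \<gamma>1[OF 1] \<rho> cl(2)])
        then have "((x - y) \<bullet> \<gamma> x) / s \<le> (s\<^sup>2 / (2 * \<rho>)) / s" using s by (intro divide_right_mono) auto
        moreover have "(s\<^sup>2 / (2 * \<rho>)) / s = s / (2 * \<rho>)" using s by (simp add: power2_eq_square)
        moreover have "e \<bullet> \<gamma> x = ((x - y) \<bullet> \<gamma> x) / s" unfolding e_def inner_scaleR_left by (simp add: divide_inverse)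
        ultimately show "e \<bullet> \<gamma> x \<le> s / (2 * \<rho>)" by (simp only:)
        show "norm ((b z - b x) + (2 * Lb) *\<^sub>R (x - z)) \<le> 3 * Lb * s"
        proof -
          have "norm ((2 * Lb) *\<^sub>R (x - z)) = 2 * (Lb * norm (x - z))" using Lb by simp
          moreover have "Lb * norm (x - z) \<le> Lb * s" using xz Lb by simp
          ultimately show ?thesis
            using norm_triangle_ineq[of "b z - b x" "(2 * Lb) *\<^sub>R (x - z)"] blip[of z x]
            unfolding norm_minus_commute[of z x] by linarith
        qed
        show "\<bar>\<theta> x\<bar> \<le> L2" by (rule \<theta>le[OF cl(1)])
        show "\<bar>oblique_fun q (3 * P) (\<theta> x)\<bar> \<le> L2" using \<psi>le[OF cl(1)] by (simp add: of\<theta>)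
        have "x - c1 = - (\<rho> *\<^sub>R \<gamma> x)" using c1(4)[OF 1] by simp
        then show "p = (E * \<phi>1 s) *\<^sub>R e + (\<theta> x - 2 * \<phi> s / \<rho>) *\<^sub>R \<gamma> x + ((b z - b x) + (2 * Lb) *\<^sub>R (x - z))"
          unfolding p_def by (simp only: kr b[OF 1]) (simp add: scaleR_left_diff_distrib)
      qed
      ultimately show False using of\<theta> by simp
    next
      case 2
      define G where "G = grad_cl \<Omega> u y"
      \<comment> \<open>The argument of the previous case for - u at y: the axis and \<theta> change
        sign, and so does the boundary value, because \<open>oblique_fun\<close> is odd.\<close>
      define p where "p = - ((E * \<phi>1 s) *\<^sub>R e - (2 * \<kappa> * \<phi> s) *\<^sub>R (y - c2) + b z)"
      have "(- G - p) \<bullet> \<xi> \<le> 0" if \<xi>: "0 < \<xi> \<bullet> \<gamma> y" for \<xi>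
      proof -
        obtain t1 where t1: "0 < t1" "\<And>t. 0 < t \<Longrightarrow> t < t1 \<Longrightarrow> y + t *\<^sub>R \<xi> \<in> \<Omega>"
          using touching_balls_ray[OF tb[OF 2] \<gamma>1[OF 2] \<rho> \<xi>] by blast
        have "(-1) * (grad_cl \<Omega> u y \<bullet> \<xi>) \<le> p \<bullet> \<xi>"
        proof (rule boundary_derivative_le[where ?t1.0 = "min t1 ((s0 - s) / (1 + norm \<xi>))" and \<Psi> = "\<lambda>t. \<Phi> x (y + t *\<^sub>R \<xi>)", OF u _ \<Omega>(1) cl(2)])
          show "0 < min t1 ((s0 - s) / (1 + norm \<xi>))" using t1 gap by simp
          show "((\<lambda>t. \<Phi> x (y + t *\<^sub>R \<xi>)) has_real_derivative p \<bullet> \<xi>) (at 0)"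
            using line[of 0 \<xi>] unfolding p_def by (simp add: inner_diff_left inner_add_left)
          fix t assume t: "0 < t" "t < min t1 ((s0 - s) / (1 + norm \<xi>))"
          then show in\<Omega>: "y + t *\<^sub>R \<xi> \<in> \<Omega>" using t1 by simp
          have "norm (y - x + t *\<^sub>R \<xi>) \<le> s0" by (rule short) (use t in \<open>simp_all add: s_def norm_minus_commute\<close>)
          moreover have "norm (x - (y + t *\<^sub>R \<xi>)) = norm (y - x + t *\<^sub>R \<xi>)"
            by (metis add_diff_eq diff_add_eq norm_minus_commute)
          ultimately have "norm (x - (y + t *\<^sub>R \<xi>)) \<le> s0" by (simp only:)
          from frozen[OF cl(1) subsetD[OF closure_subset in\<Omega>] this]
          show "(-1) * u (y + t *\<^sub>R \<xi>) - \<Phi> x (y + t *\<^sub>R \<xi>) \<le> (-1) * u y - \<Phi> x (y + 0 *\<^sub>R \<xi>)" by simp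
        qed simp
        then show ?thesis by (simp add: G_def inner_diff_left)
      qed
      then obtain l where l: "0 \<le> l" "- G - p = - l *\<^sub>R \<gamma> y" using outward_direction[OF \<gamma>1[OF 2]] by blast
      have G: "- G = p - l *\<^sub>R \<gamma> y" using l(2) by (simp add: algebra_simps)
      have "slope G powr (q - 1) * (G \<bullet> \<gamma> y) = - \<psi> y"
        using bc 2 unfolding oblique_bc_def G_def by (simp add: eq_neg_iff_add_eq_0)
      then have "slope (- G) powr (q - 1) * (- G \<bullet> \<gamma> y) = \<psi> y" by simp
      moreover have "slope (- G) powr (q - 1) * (- G \<bullet> \<gamma> y) \<le> slope p powr (q - 1) * (p \<bullet> \<gamma> y)"
        unfolding G by (rule oblique_shift[OF q \<gamma>1[OF 2] l(1)])
      moreover have "slope p powr (q - 1) * (p \<bullet> \<gamma> y) < oblique_fun q (3 * P) (- \<theta> y)"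
      proof (rule boundary_strict[OF \<gamma>1[OF 2] _ s ss0 less_imp_le[OF \<phi>F] E3, of "- e"])
        show "norm (- e) = 1" using e1 by simp
        show "x \<in> frontier \<Omega> \<or> y \<in> frontier \<Omega>" using 2 by simp
        have "(y - x) \<bullet> \<gamma> y \<le> (norm (y - x))\<^sup>2 / (2 * \<rho>)" by (rule touching_balls_exterior[OF tb[OF 2] \<gamma>1[OF 2] \<rho> cl(1)])
        then have "(y - x) \<bullet> \<gamma> y \<le> s\<^sup>2 / (2 * \<rho>)" by (simp add: s_def norm_minus_commute)
        then have "((y - x) \<bullet> \<gamma> y) / s \<le> (s\<^sup>2 / (2 * \<rho>)) / s" using s by (intro divide_right_mono) auto
        moreover have "(s\<^sup>2 / (2 * \<rho>)) / s = s / (2 * \<rho>)" using s by (simp add: power2_eq_square)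
        moreover have "- e = (y - x) /\<^sub>R s"
          unfolding e_def by (simp add: scaleR_minus_right[symmetric] del: scaleR_minus_right)
        then have "- e \<bullet> \<gamma> y = ((y - x) \<bullet> \<gamma> y) / s" by (simp only: inner_scaleR_left divide_inverse mult.commute)
        ultimately show "- e \<bullet> \<gamma> y \<le> s / (2 * \<rho>)" by (simp only:)
        show "norm (b y - b z) \<le> 3 * Lb * s"
        proof -
          have "norm (y - z) \<le> norm (x - y) + norm (x - z)"
            using norm_triangle_ineq[of "y - x" "x - z"] by (simp add: norm_minus_commute)
          then have "norm (y - z) \<le> 3 * s" using xz s unfolding s_def by linarith
          then have "Lb * norm (y - z) \<le> Lb * (3 * s)" using Lb by (intro mult_left_mono) auto
          then show ?thesis using blip[of y z] by simp
        qed
        show "\<bar>- \<theta> y\<bar> \<le> L2" using \<theta>le[OF cl(2)] by simp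
        show "\<bar>oblique_fun q (3 * P) (- \<theta> y)\<bar> \<le> L2" using \<psi>le[OF cl(2)] by (simp add: oblique_fun_minus of\<theta>)
        have "y - c2 = - (\<rho> *\<^sub>R \<gamma> y)" using c2(4)[OF 2] by simp
        then show "p = (E * \<phi>1 s) *\<^sub>R (- e) + (- \<theta> y - 2 * \<phi> s / \<rho>) *\<^sub>R \<gamma> y + (b y - b z)"
          unfolding p_def by (simp only: kr b[OF 2]) (simp add: scaleR_left_diff_distrib)
      qed
      ultimately show False using of\<theta> by (simp add: oblique_fun_minus)
    next
      case 3
      have "\<forall>\<^sub>F w in nhds (x, y). w \<in> \<Omega> \<times> \<Omega>"
        by (rule eventually_nhds_in_open) (use \<Omega>(1) 3 in \<open>auto intro: open_Times\<close>)
      with near have lmax: "\<forall>\<^sub>F w in nhds (x, y). u (fst w) - u (snd w) - two_point_fun \<phi> 1 \<kappa> c1 c2 (b z) Lb z (fst w) (snd w)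
          \<le> u x - u y - two_point_fun \<phi> 1 \<kappa> c1 c2 (b z) Lb z x y"
      proof eventually_elim
        case (elim w)
        then have "fst w \<in> closure \<Omega>" "snd w \<in> closure \<Omega>" using closure_subset[of \<Omega>] by auto
        then show ?case using frozen[of "fst w" "snd w"] elim unfolding \<Phi>_def by simp
      qed
      show False
      proof (rule global_interior_max[OF Cu \<Omega>(1) 3 mc rhs M0 L1 qc[OF 3] \<Lambda> uM[OF cl(1)] uM[OF cl(2)] uxy ne s_def s1 lmax
            C_pos \<delta>_bounds(1) less_imp_le[OF \<kappa>0(1)] less_imp_le[OF Lb] c1(3) c2(3) ble[OF cl(3)] xz less_imp_le[OF \<phi>F] C0 E1 _ m(1,2) _ _ dim C_big])
        show "m \<le> 1 / (C * (s + \<delta>))" using m\<phi> by (simp add: \<phi>1_def)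
        have mm: "m \<le> m\<^sup>2" using m(1) by (intro self_le_power) simp_all
        show "2 * F \<le> m\<^sup>2" "2 * C * F\<^sup>2 \<le> m\<^sup>2" using m(3,4) mm by linarith+
      qed
    qed
  qed
  have E1P: "0 \<le> E1 * P + B1" using \<kappa>0 P_ge B1 unfolding E1 by simp
  have int: "norm (grad u x) \<le> E1 * P + B1" if x: "x \<in> \<Omega>" for x
  proof -
    have xc: "x \<in> closure \<Omega>" using x closure_subset by blast
    obtain r where r: "0 < r" "cball x r \<subseteq> \<Omega>" using \<Omega>(1) x open_contains_cball by blast
    show ?thesis
    proof (rule gradient_bound_from_difference[OF C_on_has_derivative[OF Cu \<Omega>(1) x], where r = "min r s0"])
      fix y assume y: "norm (x - y) \<le> min r s0"
      have yc: "y \<in> closure \<Omega>" using y r(2) closure_subset[of \<Omega>] by (auto simp: dist_norm subset_iff)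
      \<comment> \<open>For z = x the penalty vanishes, and b contributes no more than its
        norm.\<close>
      have "W x y x \<le> 0" by (rule W_le) (use xc yc y in \<open>simp add: K_def\<close>)
      then have 1: "u x - u y \<le> \<phi> (norm (x - y)) * (1 + \<kappa> * (T x)\<^sup>2 + \<kappa> * (T y)\<^sup>2) + b x \<bullet> (x - y)" by (simp add: W_def)
      have "\<phi> (norm (x - y)) \<le> P * norm (x - y)"
        using log_profile_bounds(3)[OF C_pos \<delta>_bounds(1), of "norm (x - y)"] by (simp add: P_def)
      moreover have "1 + \<kappa> * (T x)\<^sup>2 + \<kappa> * (T y)\<^sup>2 \<le> E1"
      proof -
        have "(T x)\<^sup>2 \<le> D\<^sup>2" "(T y)\<^sup>2 \<le> D\<^sup>2" by (intro power_mono TD xc yc T0)+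
        then have "\<kappa> * (T x)\<^sup>2 \<le> \<kappa> * D\<^sup>2" "\<kappa> * (T y)\<^sup>2 \<le> \<kappa> * D\<^sup>2" using \<kappa>0 by (auto intro: mult_left_mono)
        then show ?thesis unfolding E1 by linarith
      qed
      ultimately have 2: "\<phi> (norm (x - y)) * (1 + \<kappa> * (T x)\<^sup>2 + \<kappa> * (T y)\<^sup>2) \<le> (P * norm (x - y)) * E1"
        using \<kappa>0 P_ge by (intro mult_mono) (auto intro!: add_nonneg_nonneg)
      have 3: "b x \<bullet> (x - y) \<le> B1 * norm (x - y)"
        by (rule order_trans[OF norm_cauchy_schwarz mult_right_mono[OF ble[OF xc]]]) simp
      have "(P * norm (x - y)) * E1 + B1 * norm (x - y) = (E1 * P + B1) * norm (x - y)" by (simp add: algebra_simps)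
      then show "u x - u y \<le> (E1 * P + B1) * norm (x - y)" using 1 2 3 by linarith
    qed (use r s0_bounds E1P in auto)
  qed
  show ?thesis
  proof (rule continuous_le_on_closure[where S = \<Omega> and f = "\<lambda>x. norm (grad_cl \<Omega> u x)"])
    show "continuous_on (closure \<Omega>) (\<lambda>x. norm (grad_cl \<Omega> u x))"
      by (intro continuous_on_norm grad_cl_extension(1)[OF u _ \<Omega>(1)]) simp
    show "norm (grad_cl \<Omega> u x) \<le> E1 * P + B1" if "x \<in> \<Omega>" for x
      using int[OF that] grad_cl_extension(2)[OF u _ \<Omega>(1) that] by simp
  qed (rule x0)
qed

theorem theorem1p1:
  assumes dim: "CARD('n::finite) \<ge> 2"
  shows "\<exists>M1 :: real \<Rightarrow> real \<Rightarrow> real \<Rightarrow> real.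
    interior_gradient_bound TYPE('n) M1 \<and>
    (\<forall>q>1. \<forall>\<Omega> :: (real ^ 'n) set. \<forall>M0>0. \<forall>L1>0. \<forall>L2>0.
      bounded_domain \<Omega> \<and> C_boundary 3 \<Omega> \<longrightarrow>
      (\<forall>\<epsilon>>0. \<exists>\<mu>0. 0 < \<mu>0 \<and> \<mu>0 < \<epsilon> \<and> (\<exists>M2>0.
        \<forall>\<gamma> f \<psi> u.
          inward_unit_normal \<Omega> \<gamma> \<and>
          C_closure 2 \<Omega> u \<and> C_on 3 \<Omega> u \<and>
          mean_curvature_eq \<Omega> f u \<and> oblique_bc q \<Omega> \<gamma> \<psi> u \<and>
          (\<forall>x\<in>closure \<Omega>. \<bar>u x\<bar> \<le> M0) \<and>
          rhs_conditions \<Omega> M0 L1 f \<and>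
          C_closure 1 \<Omega> \<psi> \<and> C1_norm \<Omega> \<psi> \<le> L2
          \<longrightarrow> (\<forall>x\<in>closure (boundary_strip \<Omega> \<mu>0).
                norm (grad_cl \<Omega> u x) \<le> max (M1 \<mu>0 M0 L1) M2))))"
proof -
  obtain M1 where M1: "interior_gradient_bound TYPE('n) M1" using interior_gradient_bound_exists by blast
  \<comment> \<open>The constant is found before \<gamma>, f, \<psi> and u are given, and it bounds
    the gradient on the whole closure.\<close>
  have main: "\<exists>M2>0. \<forall>\<gamma> f \<psi> u. inward_unit_normal \<Omega> \<gamma> \<and> C_closure 2 \<Omega> u \<and> C_on 3 \<Omega> u \<and>
          mean_curvature_eq \<Omega> f u \<and> oblique_bc q \<Omega> \<gamma> \<psi> u \<and> (\<forall>x\<in>closure \<Omega>. \<bar>u x\<bar> \<le> M0) \<and>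
          rhs_conditions \<Omega> M0 L1 f \<and> C_closure 1 \<Omega> \<psi> \<and> C1_norm \<Omega> \<psi> \<le> L2
          \<longrightarrow> (\<forall>x\<in>closure \<Omega>. norm (grad_cl \<Omega> u x) \<le> M2)"
    if q: "1 < q" and M0: "0 < M0" and L1: "0 < L1" and L2: "0 < L2" and \<Omega>: "bounded_domain \<Omega>" "C_boundary 3 \<Omega>"
    for q M0 L1 L2 :: real and \<Omega> :: "(real ^ 'n) set"
  proof -
    have o: "open \<Omega>" and bd: "bounded \<Omega>" and ne: "\<Omega> \<noteq> {}" using \<Omega>(1) by (simp_all add: bounded_domain_def)
    have fr: "frontier \<Omega> \<noteq> {}" using ne bd by (auto simp: frontier_eq_empty)
    obtain \<rho> where \<rho>: "0 < \<rho>" and tb: "\<And>\<gamma> x. inward_unit_normal \<Omega> \<gamma> \<Longrightarrow> x \<in> frontier \<Omega> \<Longrightarrow> touching_balls \<Omega> \<gamma> \<rho> x"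
      using touching_balls_uniform[OF o bd \<Omega>(2)] by blast
    obtain \<Lambda> where \<Lambda>: "1 \<le> \<Lambda>" and qc: "\<And>x y. x \<in> \<Omega> \<Longrightarrow> y \<in> \<Omega> \<Longrightarrow> grad_lip \<Lambda> \<Omega> x y"
      using quasiconvex_uniform[OF o bd ne \<Omega>(2)] by blast
    define D where "D = diameter (closure \<Omega>)"
    have diam: "norm (x - y) \<le> D" if "x \<in> closure \<Omega>" "y \<in> closure \<Omega>" for x y
      using diameter_bounded_bound[OF bounded_closure[OF bd] that] by (simp add: D_def dist_norm)
    have D0: "0 \<le> D" unfolding D_def using bd by (intro diameter_ge_0) (rule bounded_closure)
    define n where "n = real DIM(real ^ 'n)"
    have n0: "0 \<le> n" by (simp add: n_def)
    define Lb where "Lb = n * (\<Lambda> * L2 + L2 / \<rho>) + 1"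
    have "0 \<le> n * (\<Lambda> * L2 + L2 / \<rho>)" using n0 \<Lambda> L2 \<rho> by (intro mult_nonneg_nonneg add_nonneg_nonneg) auto
    then have Lb_pos: "0 < Lb" and Lb_ge: "n * (\<Lambda> * L2 + L2 / \<rho>) \<le> Lb" by (simp_all add: Lb_def)
    define B1 where "B1 = L2 + Lb * D"
    have B1: "0 \<le> B1" using L2 Lb_pos D0 by (simp add: B1_def)
    have "0 \<le> \<Lambda>" using \<Lambda> by simp
    from profile_constants_exist[OF q \<rho> this D0 M0 L1 L2 n0 Lb_pos B1]
    obtain C m \<delta> s0 F \<kappa> C0 E1 C2 S t0 where
      pc: "profile_constants q \<rho> \<Lambda> D M0 L1 L2 n Lb B1 C m \<delta> s0 F \<kappa> C0 E1 C2 S t0" by blast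
    interpret profile_constants q \<rho> \<Lambda> D M0 L1 L2 n Lb B1 C m \<delta> s0 F \<kappa> C0 E1 C2 S t0 by (rule pc)
    have bound: "norm (grad_cl \<Omega> u x) \<le> E1 * P + B1"
      if "inward_unit_normal \<Omega> \<gamma>" "C_closure 2 \<Omega> u" "mean_curvature_eq \<Omega> f u" "oblique_bc q \<Omega> \<gamma> \<psi> u"
        "\<And>x. x \<in> closure \<Omega> \<Longrightarrow> \<bar>u x\<bar> \<le> M0" "rhs_conditions \<Omega> M0 L1 f" "C_closure 1 \<Omega> \<psi>" "C1_norm \<Omega> \<psi> \<le> L2" "x \<in> closure \<Omega>"
      for \<gamma> f \<psi> u x
      by (rule global_gradient_bound[OF o bd fr tb[OF that(1)] _ qc diam n_def Lb_ge _ that(2-9)])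
         (use that(1) in \<open>auto simp: inward_unit_normal_def B1_def\<close>)
    show ?thesis
    proof (intro exI[of _ "\<bar>E1 * P + B1\<bar> + 1"] conjI allI impI ballI)
      fix \<gamma> f \<psi> u x
      assume h: "inward_unit_normal \<Omega> \<gamma> \<and> C_closure 2 \<Omega> u \<and> C_on 3 \<Omega> u \<and>
          mean_curvature_eq \<Omega> f u \<and> oblique_bc q \<Omega> \<gamma> \<psi> u \<and> (\<forall>x\<in>closure \<Omega>. \<bar>u x\<bar> \<le> M0) \<and>
          rhs_conditions \<Omega> M0 L1 f \<and> C_closure 1 \<Omega> \<psi> \<and> C1_norm \<Omega> \<psi> \<le> L2" and x: "x \<in> closure \<Omega>"
      have "norm (grad_cl \<Omega> u x) \<le> E1 * P + B1"
        by (rule bound[of \<gamma> u f \<psi>]) (use h x in simp_all)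
      then show "norm (grad_cl \<Omega> u x) \<le> \<bar>E1 * P + B1\<bar> + 1" by linarith
    qed linarith
  qed
  have strip: "closure (boundary_strip \<Omega> \<mu>) \<subseteq> closure \<Omega>" for \<Omega> :: "(real ^ 'n) set" and \<mu>
    by (rule closure_mono) (auto simp: boundary_strip_def)
  show ?thesis
  proof (intro exI[of _ M1] conjI M1 allI impI)
    fix q M0 L1 L2 \<epsilon> :: real and \<Omega> :: "(real ^ 'n) set"
    assume a: "1 < q" "0 < M0" "0 < L1" "0 < L2" "bounded_domain \<Omega> \<and> C_boundary 3 \<Omega>" "0 < \<epsilon>"
    obtain M2 where "0 < M2" and M2: "\<forall>\<gamma> f \<psi> u. inward_unit_normal \<Omega> \<gamma> \<and> C_closure 2 \<Omega> u \<and> C_on 3 \<Omega> u \<and>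
          mean_curvature_eq \<Omega> f u \<and> oblique_bc q \<Omega> \<gamma> \<psi> u \<and> (\<forall>x\<in>closure \<Omega>. \<bar>u x\<bar> \<le> M0) \<and>
          rhs_conditions \<Omega> M0 L1 f \<and> C_closure 1 \<Omega> \<psi> \<and> C1_norm \<Omega> \<psi> \<le> L2
          \<longrightarrow> (\<forall>x\<in>closure \<Omega>. norm (grad_cl \<Omega> u x) \<le> M2)"
      using main[OF a(1-4) conjunct1[OF a(5)] conjunct2[OF a(5)]] by (elim exE conjE)
    show "\<exists>\<mu>0. 0 < \<mu>0 \<and> \<mu>0 < \<epsilon> \<and> (\<exists>M2>0.
        \<forall>\<gamma> f \<psi> u.
          inward_unit_normal \<Omega> \<gamma> \<and>
          C_closure 2 \<Omega> u \<and> C_on 3 \<Omega> u \<and>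
          mean_curvature_eq \<Omega> f u \<and> oblique_bc q \<Omega> \<gamma> \<psi> u \<and>
          (\<forall>x\<in>closure \<Omega>. \<bar>u x\<bar> \<le> M0) \<and>
          rhs_conditions \<Omega> M0 L1 f \<and>
          C_closure 1 \<Omega> \<psi> \<and> C1_norm \<Omega> \<psi> \<le> L2
          \<longrightarrow> (\<forall>x\<in>closure (boundary_strip \<Omega> \<mu>0).
                norm (grad_cl \<Omega> u x) \<le> max (M1 \<mu>0 M0 L1) M2))"
    \<comment> \<open>Since \<open>M2\<close> bounds the gradient on the whole closure, half of
      \<epsilon> can serve as the width of the strip.\<close>
    proof (rule exI[of _ "\<epsilon> / 2"], intro exI[of _ M2] conjI allI impI ballI)
      fix \<gamma> f \<psi> u x
      assume h: "inward_unit_normal \<Omega> \<gamma> \<and> C_closure 2 \<Omega> u \<and> C_on 3 \<Omega> u \<and>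
          mean_curvature_eq \<Omega> f u \<and> oblique_bc q \<Omega> \<gamma> \<psi> u \<and> (\<forall>x\<in>closure \<Omega>. \<bar>u x\<bar> \<le> M0) \<and>
          rhs_conditions \<Omega> M0 L1 f \<and> C_closure 1 \<Omega> \<psi> \<and> C1_norm \<Omega> \<psi> \<le> L2"
        and x: "x \<in> closure (boundary_strip \<Omega> (\<epsilon> / 2))"
      have "norm (grad_cl \<Omega> u x) \<le> M2" by (rule bspec[OF mp[OF M2[THEN spec, THEN spec, THEN spec, THEN spec] h]]) (use x strip in blast)
      then show "norm (grad_cl \<Omega> u x) \<le> max (M1 (\<epsilon> / 2) M0 L1) M2" by simp
    qed (use a \<open>0 < M2\<close> in auto)
  qed
qed

end
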